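(* Let $(X,d,\mu,\mathcal{E},\mathcal{F})$ be an MMD space such that $\mu$ is a doubling measure on $(X,d)$, and suppose that it satisfies the sub-Gaussian heat kernel estimates $\mathrm{HKE}(\Psi)$ for some scale function $\Psi:[0,\infty)\to[0,\infty)$. Then the martingale dimension of $(X,d,\mu,\mathcal{E},\mathcal{F})$ is finite.
   Context: An MMD space (metric measure Dirichlet space) $(X,d,\mu,\mathcal{E},\mathcal{F})$ consists of a complete, locally compact, separable metric space $(X,d)$, a Radon measure $\mu$ on $X$ with full support, and a strongly local, regular symmetric Dirichlet form $(\mathcal{E},\mathcal{F})$ on $L^2(X,\mu)$. That is: $\mathcal{F}$ is a dense linear subspace of $L^2(X,\mu)$; $\mathcal{E}:\mathcal{F}\times\mathcal{F}\to\mathbb{R}$ is a nonnegative definite symmetric bilinear form; it is closed ($\mathcal{F}$ is a Hilbert space under $\mathcal{E}_1=\mathcal{E}+\langle\cdot,\cdot\rangle_{L^2(\mu)}$) and Markovian ($f^+\wedge 1\in\mathcal{F}$ and $\mathcal{E}(f^+\wedge 1,f^+\wedge1)\le\mathcal{E}(f,f)$). Regular: $\mathcal{F}\cap C_c(X)$ is dense in $(\mathcal{F},\mathcal{E}_1)$ and in $(C_c(X),\|\cdot\|_{\sup})$, where $C_c(X)$ is the space of continuous compactly supported real functions. Strongly local: $\mathcal{E}(f,g)=0$ whenever $f,g\in\mathcal{F}$ have compact supports and $\mathrm{supp}_\mu[f-a\mathbf{1}_X]\cap\mathrm{supp}_\mu[g]=\emptyset$ for some $a\in\mathbb{R}$,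 where $\mathrm{supp}_\mu[f]$ is the support of the measure $|f|\,d\mu$. Doubling: there is $C\in(1,\infty)$ with $\mu(B(x,2r))\le C\mu(B(x,r))$ for all $x\in X$, $r>0$ ($B(x,r)$ open balls). Energy measure: for $f\in\mathcal{F}\cap L^\infty(X,\mu)$, $\Gamma(f,f)$ is the unique Borel measure with $\int_X g\,d\Gamma(f,f)=\mathcal{E}(f,fg)-\frac12\mathcal{E}(f^2,g)$ for all $g\in\mathcal{F}\cap C_c(X)$; for general $f\in\mathcal{F}$, $\Gamma(f,f)(A)=\lim_{k\to\infty}\Gamma((-k)\vee(f\wedge k),(-k)\vee(f\wedge k))(A)$; $\Gamma(f,g)$ is defined by polarization. A $\sigma$-finite Borel measure $\nu$ is a minimal energy-dominant measure if (i) $\Gamma(f,f)\ll\nu$ for every $f\in\mathcal{F}$, and (ii) any $\sigma$-finite Borel $\nu'$ satisfying (i) in place of $\nu$ satisfies $\nu\ll\nu'$ (such a $\nu$ exists). For $f=(f_1,\dots,f_n)\in\mathcal{F}^n$ put $\gamma_\nu(f)=\big[\frac{d\Gamma(f_i,f_j)}{d\nu}\big]_{1\le i,j\le n}$. Martingale dimension: the smallest $K\in\mathbb{N}\cup\{0,\infty\}$ such that for every $n\in\mathbb{N}$ and $f\in\mathcal{F}^n$, the $\nu$-essential supremum of $\mathrm{rank}(\gamma_\nu(f))$ is at most $K$ (independent of the choice of $\nu$). Scale function: a homeomorphism $\Psi:[0,\infty)\to[0,\infty)$ for which there are constants $1<\beta_1<\beta_2$ and $C>1$ with $C^{-1}(R/r)^{\beta_1}\le\Psi(R)/\Psi(r)\le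 C(R/r)^{\beta_2}$ for all $0<r\le R$. Put $\Phi(s)=\sup_{r>0}\big(\frac sr-\frac1{\Psi(r)}\big)$. Heat kernel: let $(P_t)_{t>0}$ be the strongly continuous contraction semigroup of symmetric operators on $L^2(X,\mu)$ associated with $(\mathcal{E},\mathcal{F})$ (so $\mathcal{F}=\{f\in L^2:\lim_{t\downarrow0}\frac1t\langle f-P_tf,f\rangle<\infty\}$ and $\mathcal{E}(f,f)=\lim_{t\downarrow0}\frac1t\langle f-P_tf,f\rangle$). A heat kernel is a family $\{p_t\}_{t>0}$ of nonnegative Borel functions on $X\times X$ such that for all $t>0$, $f\in L^2(X,\mu)$: $P_tf(x)=\int_Xp_t(x,y)f(y)\,d\mu(y)$ for $\mu$-a.e. $x$. $\mathrm{HKE}(\Psi)$: there exist $C_1,c_1,c_2,c_3,\delta\in(0,\infty)$ and a heat kernel $\{p_t\}_{t>0}$ such that for any $t>0$, $$p_t(x,y)\le\frac{C_1}{\mu(B(x,\Psi^{-1}(t)))}\exp\Big(-c_1t\,\Phi\big(c_2\tfrac{d(x,y)}t\big)\Big)\quad\text{for }\mu\text{-a.e. }x,y\in X,$$ $$p_t(x,y)\ge\frac{c_3}{\mu(B(x,\Psi^{-1}(t)))}\quad\text{for }\mu\text{-a.e. }x,y\in X\text{ with }d(x,y)\le\delta\Psi^{-1}(t).$$ *)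

theory Defs
  imports "HOL-Probability.Probability" "Jordan_Normal_Form.DL_Rank"
begin

text \<open>
  The metric space \<open>(X,d)\<close> is a type of class \<^class>\<open>polish_space\<close> with its own distance
  \<^const>\<open>dist\<close>: the class provides completeness of the metric and second countability, which for
  metric spaces is separability.

  Elements of \<open>L\<^sup>2(X,\<mu>)\<close> are represented by Borel functions. The domain \<open>F\<close> of a form is
  a set of such functions closed under \<open>\<mu>\<close>-a.e. equality, and the form \<open>E\<close> is required to
  depend on its arguments in \<open>F\<close> only up to \<open>\<mu>\<close>-a.e. equality. Values of \<open>E\<close> outside
  \<open>F \<times> F\<close> are irrelevant.
\<close>

definition radon_measure :: "'a::topological_space measure \<Rightarrow> bool" where
  "radon_measure \<mu> \<longleftrightarrow>
     sets \<mu> = sets borel \<and>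
     (\<forall>K. compact K \<longrightarrow> emeasure \<mu> K < \<infinity>) \<and>
     (\<forall>A\<in>sets borel. emeasure \<mu> A = (SUP K\<in>{K. compact K \<and> K \<subseteq> A}. emeasure \<mu> K))"

definition full_support :: "'a::topological_space measure \<Rightarrow> bool" where
  "full_support \<mu> \<longleftrightarrow> (\<forall>U. open U \<longrightarrow> U \<noteq> {} \<longrightarrow> emeasure \<mu> U > 0)"

definition measure_support :: "'a::topological_space measure \<Rightarrow> 'a set" where
  "measure_support \<nu> = - \<Union>{U. open U \<and> emeasure \<nu> U = 0}"

definition fun_support :: "'a::topological_space measure \<Rightarrow> ('a \<Rightarrow> real) \<Rightarrow> 'a set" where
  "fun_support \<mu> f = measure_support (density \<mu> (\<lambda>x. ennreal \<bar>f x\<bar>))"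

definition L2 :: "'a measure \<Rightarrow> ('a \<Rightarrow> real) set" where
  "L2 \<mu> = {f \<in> borel_measurable \<mu>. integrable \<mu> (\<lambda>x. (f x)\<^sup>2)}"

definition L2_inner :: "'a measure \<Rightarrow> ('a \<Rightarrow> real) \<Rightarrow> ('a \<Rightarrow> real) \<Rightarrow> real" where
  "L2_inner \<mu> f g = (\<integral>x. f x * g x \<partial>\<mu>)"

definition ess_bounded :: "'a measure \<Rightarrow> ('a \<Rightarrow> real) \<Rightarrow> bool" where
  "ess_bounded \<mu> f \<longleftrightarrow> f \<in> borel_measurable \<mu> \<and> (\<exists>C. AE x in \<mu>. \<bar>f x\<bar> \<le> C)"

definition Cc :: "('a::topological_space \<Rightarrow> real) set" where
  "Cc = {f. continuous_on UNIV f \<and> compact (closure {x. f x \<noteq> 0})}"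

type_synonym 'a form = "('a \<Rightarrow> real) \<Rightarrow> ('a \<Rightarrow> real) \<Rightarrow> real"

definition E1 :: "'a measure \<Rightarrow> 'a form \<Rightarrow> 'a form" where
  "E1 \<mu> E f g = E f g + L2_inner \<mu> f g"

locale dirichlet_form =
  fixes \<mu> :: "'a measure"
    and E :: "'a form"
    and F :: "('a \<Rightarrow> real) set"
  assumes domain_L2: "F \<subseteq> L2 \<mu>"
    and domain_AE: "f \<in> F \<Longrightarrow> g \<in> borel_measurable \<mu> \<Longrightarrow> (AE x in \<mu>. f x = g x) \<Longrightarrow> g \<in> F"
    and domain_zero: "(\<lambda>x. 0) \<in> F"
    and domain_add: "f \<in> F \<Longrightarrow> g \<in> F \<Longrightarrow> (\<lambda>x. f x + g x) \<in> F"
    and domain_scale: "f \<in> F \<Longrightarrow> (\<lambda>x. c * f x) \<in> F"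
    and domain_dense:
      "f \<in> L2 \<mu> \<Longrightarrow> e > 0 \<Longrightarrow> \<exists>g\<in>F. L2_inner \<mu> (\<lambda>x. f x - g x) (\<lambda>x. f x - g x) < e"
    and form_AE: "f \<in> F \<Longrightarrow> g \<in> F \<Longrightarrow> h \<in> F \<Longrightarrow> (AE x in \<mu>. f x = g x) \<Longrightarrow> E f h = E g h"
    and form_sym: "f \<in> F \<Longrightarrow> g \<in> F \<Longrightarrow> E f g = E g f"
    and form_add: "f \<in> F \<Longrightarrow> g \<in> F \<Longrightarrow> h \<in> F \<Longrightarrow> E (\<lambda>x. f x + g x) h = E f h + E g h"
    and form_scale: "f \<in> F \<Longrightarrow> h \<in> F \<Longrightarrow> E (\<lambda>x. c * f x) h = c * E f h"
    and form_nonneg: "f \<in> F \<Longrightarrow> E f f \<ge> 0"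
    and closed_form:
      "(\<And>n. u n \<in> F) \<Longrightarrow>
       (\<And>e. e > 0 \<Longrightarrow> \<exists>N. \<forall>m\<ge>N. \<forall>n\<ge>N.
          E1 \<mu> E (\<lambda>x. u m x - u n x) (\<lambda>x. u m x - u n x) < e) \<Longrightarrow>
       \<exists>f\<in>F. (\<lambda>n::nat. E1 \<mu> E (\<lambda>x. u n x - f x) (\<lambda>x. u n x - f x)) \<longlonglongrightarrow> 0"
    and markovian_domain: "f \<in> F \<Longrightarrow> (\<lambda>x. min (max (f x) 0) 1) \<in> F"
    and markovian:
      "f \<in> F \<Longrightarrow> E (\<lambda>x. min (max (f x) 0) 1) (\<lambda>x. min (max (f x) 0) 1) \<le> E f f"

definition regular_form ::
  "'a::topological_space measure \<Rightarrow> 'a form \<Rightarrow> ('a \<Rightarrow> real) set \<Rightarrow> bool" where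
  "regular_form \<mu> E F \<longleftrightarrow>
     (\<forall>f\<in>F. \<forall>e>0. \<exists>g\<in>F \<inter> Cc. E1 \<mu> E (\<lambda>x. f x - g x) (\<lambda>x. f x - g x) < e) \<and>
     (\<forall>f\<in>Cc. \<forall>e>0. \<exists>g\<in>F \<inter> Cc. \<forall>x. \<bar>f x - g x\<bar> < e)"

definition strongly_local ::
  "'a::topological_space measure \<Rightarrow> 'a form \<Rightarrow> ('a \<Rightarrow> real) set \<Rightarrow> bool" where
  "strongly_local \<mu> E F \<longleftrightarrow>
     (\<forall>f\<in>F. \<forall>g\<in>F. compact (fun_support \<mu> f) \<longrightarrow> compact (fun_support \<mu> g) \<longrightarrow>
        (\<exists>a. fun_support \<mu> (\<lambda>x. f x - a) \<inter> fun_support \<mu> g = {}) \<longrightarrow> E f g = 0)"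

locale MMD_space = dirichlet_form \<mu> E F
  for \<mu> :: "'a::polish_space measure"
    and E :: "'a form"
    and F :: "('a \<Rightarrow> real) set" +
  assumes locally_compact: "locally_compact_space (euclidean :: 'a topology)"
    and radon: "radon_measure \<mu>"
    and full_support: "full_support \<mu>"
    and regular: "regular_form \<mu> E F"
    and strongly_local: "strongly_local \<mu> E F"

definition doubling_measure :: "'a::metric_space measure \<Rightarrow> bool" where
  "doubling_measure \<mu> \<longleftrightarrow>
     (\<exists>C>1. \<forall>x. \<forall>r>0. emeasure \<mu> (ball x (2 * r)) \<le> ennreal C * emeasure \<mu> (ball x r))"


section \<open>Energy measures and martingale dimension\<close>

definition energy_measure_bounded ::
  "'a::topological_space form \<Rightarrow> ('a \<Rightarrow> real) set \<Rightarrow> ('a \<Rightarrow> real) \<Rightarrow> 'a measure" where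
  "energy_measure_bounded E F f =
     (THE \<nu>. sets \<nu> = sets borel \<and>
        (\<forall>g\<in>F \<inter> Cc. integrable \<nu> g \<and>
           (\<integral>x. g x \<partial>\<nu>) = E f (\<lambda>x. f x * g x) - 1 / 2 * E (\<lambda>x. (f x)\<^sup>2) g))"

definition truncate :: "nat \<Rightarrow> ('a \<Rightarrow> real) \<Rightarrow> 'a \<Rightarrow> real" where
  "truncate k f = (\<lambda>x. max (- real k) (min (f x) (real k)))"

text \<open>
  For \<open>f \<in> F \<inter> L\<^sup>\<infinity>\<close> the truncations are eventually a.e. equal to \<open>f\<close>, so the limit
  below is then \<open>energy_measure_bounded E F f\<close>.
\<close>

definition energy_measure ::
  "'a::topological_space form \<Rightarrow> ('a \<Rightarrow> real) set \<Rightarrow> ('a \<Rightarrow> real) \<Rightarrow> 'a measure" where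
  "energy_measure E F f =
     measure_of UNIV (sets borel)
       (\<lambda>A. lim (\<lambda>k. emeasure (energy_measure_bounded E F (truncate k f)) A))"

text \<open>The signed measure \<open>\<Gamma>(f,g)\<close>, as a real-valued set function.\<close>

definition mutual_energy_measure ::
  "'a::topological_space form \<Rightarrow> ('a \<Rightarrow> real) set \<Rightarrow> ('a \<Rightarrow> real) \<Rightarrow> ('a \<Rightarrow> real) \<Rightarrow> 'a set \<Rightarrow> real"
where
  "mutual_energy_measure E F f g A =
     (measure (energy_measure E F (\<lambda>x. f x + g x)) A
      - measure (energy_measure E F (\<lambda>x. f x - g x)) A) / 4"

definition energy_dominant ::
  "'a::topological_space form \<Rightarrow> ('a \<Rightarrow> real) set \<Rightarrow> 'a measure \<Rightarrow> bool" where
  "energy_dominant E F \<nu> \<longleftrightarrow>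
     sets \<nu> = sets borel \<and> sigma_finite_measure \<nu> \<and>
     (\<forall>f\<in>F. absolutely_continuous \<nu> (energy_measure E F f))"

definition minimal_energy_dominant ::
  "'a::topological_space form \<Rightarrow> ('a \<Rightarrow> real) set \<Rightarrow> 'a measure \<Rightarrow> bool" where
  "minimal_energy_dominant E F \<nu> \<longleftrightarrow>
     energy_dominant E F \<nu> \<and>
     (\<forall>\<nu>'. energy_dominant E F \<nu>' \<longrightarrow> absolutely_continuous \<nu>' \<nu>)"

text \<open>
  The library's \<^const>\<open>RN_deriv\<close> covers only nonnegative measures, so the density of the signed
  measure \<open>\<Gamma>(f,g)\<close> is a version chosen by its defining property, which determines it
  \<open>\<nu>\<close>-a.e.
\<close>

definition energy_density ::
  "'a::topological_space form \<Rightarrow> ('a \<Rightarrow> real) set \<Rightarrow> 'a measure \<Rightarrow>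
   ('a \<Rightarrow> real) \<Rightarrow> ('a \<Rightarrow> real) \<Rightarrow> 'a \<Rightarrow> real" where
  "energy_density E F \<nu> f g =
     (SOME h. h \<in> borel_measurable borel \<and> integrable \<nu> h \<and>
        (\<forall>A\<in>sets borel. mutual_energy_measure E F f g A = (LINT x:A|\<nu>. h x)))"

definition energy_matrix ::
  "'a::topological_space form \<Rightarrow> ('a \<Rightarrow> real) set \<Rightarrow> 'a measure \<Rightarrow>
   nat \<Rightarrow> (nat \<Rightarrow> 'a \<Rightarrow> real) \<Rightarrow> 'a \<Rightarrow> real mat" where
  "energy_matrix E F \<nu> n f x = Matrix.mat n n (\<lambda>(i, j). energy_density E F \<nu> (f i) (f j) x)"

definition martingale_dimension ::
  "'a::topological_space form \<Rightarrow> ('a \<Rightarrow> real) set \<Rightarrow> 'a measure \<Rightarrow> enat" where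
  "martingale_dimension E F \<nu> =
     (LEAST K. \<forall>n. \<forall>f :: nat \<Rightarrow> 'a \<Rightarrow> real. (\<forall>i<n. f i \<in> F) \<longrightarrow>
        esssup \<nu> (\<lambda>x. of_nat (vec_space.rank n (energy_matrix E F \<nu> n f x)) :: ennreal)
          \<le> ennreal_of_enat K)"


section \<open>Heat kernel estimates\<close>

text \<open>
  For \<open>t > 0\<close>, \<open>P t\<close> acts on \<^term>\<open>L2 \<mu>\<close> and all identities hold \<open>\<mu>\<close>-a.e.;
  linearity and contractivity make \<open>P t\<close> well defined on a.e.-classes.
\<close>

definition associated_semigroup ::
  "'a measure \<Rightarrow> 'a form \<Rightarrow> ('a \<Rightarrow> real) set \<Rightarrow> (real \<Rightarrow> ('a \<Rightarrow> real) \<Rightarrow> 'a \<Rightarrow> real) \<Rightarrow> bool" where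
  "associated_semigroup \<mu> E F P \<longleftrightarrow>
     (\<forall>t>0. \<forall>f\<in>L2 \<mu>. P t f \<in> L2 \<mu>) \<and>
     (\<forall>t>0. \<forall>f\<in>L2 \<mu>. \<forall>g\<in>L2 \<mu>. \<forall>a b.
        AE x in \<mu>. P t (\<lambda>y. a * f y + b * g y) x = a * P t f x + b * P t g x) \<and>
     (\<forall>t>0. \<forall>f\<in>L2 \<mu>. L2_inner \<mu> (P t f) (P t f) \<le> L2_inner \<mu> f f) \<and>
     (\<forall>t>0. \<forall>f\<in>L2 \<mu>. \<forall>g\<in>L2 \<mu>. L2_inner \<mu> (P t f) g = L2_inner \<mu> f (P t g)) \<and>
     (\<forall>s>0. \<forall>t>0. \<forall>f\<in>L2 \<mu>. AE x in \<mu>. P (s + t) f x = P s (P t f) x) \<and>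
     (\<forall>f\<in>L2 \<mu>.
        ((\<lambda>t. L2_inner \<mu> (\<lambda>x. P t f x - f x) (\<lambda>x. P t f x - f x)) \<longlongrightarrow> 0) (at_right 0)) \<and>
     F = {f \<in> L2 \<mu>. \<exists>l::real.
        ((\<lambda>t. 1 / t * L2_inner \<mu> (\<lambda>x. f x - P t f x) f) \<longlongrightarrow> l) (at_right 0)} \<and>
     (\<forall>f\<in>F. ((\<lambda>t. 1 / t * L2_inner \<mu> (\<lambda>x. f x - P t f x) f) \<longlongrightarrow> E f f) (at_right 0))"

definition heat_kernel ::
  "'a::polish_space measure \<Rightarrow> 'a form \<Rightarrow> ('a \<Rightarrow> real) set \<Rightarrow> (real \<Rightarrow> 'a \<Rightarrow> 'a \<Rightarrow> real) \<Rightarrow> bool"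
where
  "heat_kernel \<mu> E F p \<longleftrightarrow>
     (\<forall>t>0. (\<lambda>(x, y). p t x y) \<in> borel_measurable borel) \<and>
     (\<forall>t>0. \<forall>x y. p t x y \<ge> 0) \<and>
     (\<exists>P. associated_semigroup \<mu> E F P \<and>
        (\<forall>t>0. \<forall>f\<in>L2 \<mu>. AE x in \<mu>.
           integrable \<mu> (\<lambda>y. p t x y * f y) \<and> P t f x = (\<integral>y. p t x y * f y \<partial>\<mu>)))"

definition scale_function :: "(real \<Rightarrow> real) \<Rightarrow> bool" where
  "scale_function \<Psi> \<longleftrightarrow>
     (\<exists>\<Psi>'. homeomorphism {0..} {0..} \<Psi> \<Psi>') \<and>
     (\<exists>\<beta>\<^sub>1 \<beta>\<^sub>2 C. 1 < \<beta>\<^sub>1 \<and> \<beta>\<^sub>1 < \<beta>\<^sub>2 \<and> 1 < C \<and>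
        (\<forall>r R. 0 < r \<and> r \<le> R \<longrightarrow>
           inverse C * (R / r) powr \<beta>\<^sub>1 \<le> \<Psi> R / \<Psi> r \<and> \<Psi> R / \<Psi> r \<le> C * (R / r) powr \<beta>\<^sub>2))"

abbreviation scale_inv :: "(real \<Rightarrow> real) \<Rightarrow> real \<Rightarrow> real" where
  "scale_inv \<Psi> \<equiv> inv_into {0..} \<Psi>"

text \<open>
  For a scale function, \<open>\<beta>\<^sub>1 > 1\<close> makes the set below bounded above for every \<open>s \<ge> 0\<close>,
  so the real supremum is the intended one.
\<close>

definition scale_conjugate :: "(real \<Rightarrow> real) \<Rightarrow> real \<Rightarrow> real" where
  "scale_conjugate \<Psi> s = (SUP r\<in>{0<..}. s / r - 1 / \<Psi> r)"

definition HKE ::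
  "'a::polish_space measure \<Rightarrow> 'a form \<Rightarrow> ('a \<Rightarrow> real) set \<Rightarrow> (real \<Rightarrow> real) \<Rightarrow> bool" where
  "HKE \<mu> E F \<Psi> \<longleftrightarrow>
     (\<exists>C\<^sub>1>0. \<exists>c\<^sub>1>0. \<exists>c\<^sub>2>0. \<exists>c\<^sub>3>0. \<exists>\<delta>>0. \<exists>p. heat_kernel \<mu> E F p \<and>
        (\<forall>t>0.
           (AE x in \<mu>. AE y in \<mu>.
              p t x y \<le> C\<^sub>1 / measure \<mu> (ball x (scale_inv \<Psi> t))
                          * exp (- c\<^sub>1 * t * scale_conjugate \<Psi> (c\<^sub>2 * (dist x y / t)))) \<and>
           (AE x in \<mu>. AE y in \<mu>. dist x y \<le> \<delta> * scale_inv \<Psi> t \<longrightarrow>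
              p t x y \<ge> c\<^sub>3 / measure \<mu> (ball x (scale_inv \<Psi> t)))))"

end

theory Submission
  imports Defs "HOL-Real_Asymp.Real_Asymp"
begin

text \<open>
 For \<open>u\<close> in the range of the semigroup, the heat kernel bounds give a Poincare inequality on
 balls (through the Neumann version of the semigroup on a ball) and a Caccioppoli inequality whose
 cutoff functions are time averages of the heat flow started from indicators of balls. Given many
 functions, on every small ball some unit linear combination has mean zero on all balls of a much
 smaller, but comparable, radius; how many functions are needed depends only on the doubling
 constant and the required gain. The two inequalities then make the energy of this combination on
 the ball a small fraction of the total energy around it. If the rank of the energy matrix exceeded
 this number on a set of positive measure, a rational change of basis would make the matrix nearly
 the identity on a smaller such set, so that every unit combination would carry almost the same
 energy there; summing over a cover by balls is a contradiction.
\<close>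

text \<open>The energy measures may be singular to \<open>mu\<close>, so neither gradient bounds nor
  Lipschitz cutoffs are available. Everything is therefore run through the finite differences
  \<open>sform h f f / h\<close> and the densities \<open>edens h f\<close>, which are genuine
  functions and converge to \<open>E\<close> and, vaguely, to the energy measures. Spectral calculus
  is replaced by log-convexity of sequences of iterates. The Caccioppoli inequality carries an
  error: \<open>Ps r / 2\<close> times the squared \<open>L2\<close> norm of the generator applied
  to the function. This is why functions are first moved into the range of the semigroup, where that
  norm is finite; the error then disappears as \<open>r\<close> tends to 0. Heat-flow cutoffs have
  exponentially decaying tails instead of compact support, hence the dyadic annuli and one further
  mean-zero condition on a larger ball. Constants are chosen in the order: the annulus index
  \<open>k0\<close> (discarding tails), the ratio \<open>ep\<close> of the two radii (the Poincare
  gain), then the number of mean-zero conditions, so that this number depends on neither the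
  functions nor the final radius \<open>r\<close>.\<close>

abbreviation LIMSEQ_ascii (infixr "---->" 60) where "X ----> L == X \<longlonglongrightarrow> L"

abbreviation (input) ind :: "'a set => 'a => real" where "ind == indicat_real"

section \<open>Discriminants and log-convex sequences\<close>

lemma quadratic_nonneg_discriminant:
 fixes a b c :: real
 assumes "!!s. a+2 * b * s + c * s^2>=0"
 shows "b^2<=a * c"
proof -
 have a:"a>=0" using assms[of 0] by simp
 have c:"c>=0"
 proof (rule ccontr)
  assume "\<not> c>=0"
  then have c:"c<0" by simp
  \<comment> \<open>For negative \<open>c\<close> this makes \<open>c * s\<close> smaller than
    \<open>- (|a| + 2 |b|)\<close>, so the quadratic term beats the other two; the added 1 gives
    \<open>s >= 1\<close>.\<close>
  define s where "s=(1 + (abs a) + 2 * (abs b))/(- c)+1"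
  have s1:"s>=1" using c by (simp add:s_def divide_nonneg_neg)
  have cs:"c * s < - ((abs a) + 2 * (abs b))" using c by (simp add:s_def field_simps)
  have "2 * b * s<=2 * (abs b) * s" using s1 by (intro mult_right_mono) auto
  moreover have "a<=(abs a) * s" using s1 mult_left_mono[of 1 s "(abs a)"] by simp
  moreover have "c * s^2 < - ((abs a) + 2 * (abs b)) * s" using mult_strict_right_mono[OF cs, of s] s1 by (simp add:power2_eq_square mult.assoc)
  ultimately have "a+2 * b * s + c * s^2<0" by (simp add:algebra_simps)
  then show False using assms[of s] by simp
 qed
 show ?thesis
 proof (cases "c=0")
  case True
  have "b=0"
  proof (rule ccontr)
   assume "b~=0"
   then have "a+2 * b * (- (a+1)/(2 * b)) = - 1" by (simp add:field_simps)
   then show False using assms[of "- (a+1)/(2 * b)"] True by simp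
  qed
  then show ?thesis using True by simp
 next
  case False
  have "a+2 * b * (- b/c) + c * (- b/c)^2>=0" by (rule assms)
  then have "a - b\<^sup>2/c>=0" using False by (simp add:field_simps power2_eq_square)
  then show ?thesis using False c by (simp add:field_simps)
 qed
qed

text \<open>If \<open>b k\<close> exceeded \<open>b 0\<close>, the ratio
  \<open>q = b k / b 0 > 1\<close> would at least be squared at each doubling of the index, and
  \<open>b (2 ^ j * k)\<close> would outgrow \<open>M\<close>. This stands in for the spectral
  theorem: it shows that powers of a symmetric contraction do not increase a nonnegative form that
  commutes with it.\<close>

lemma log_convex_bounded:
 fixes b :: "nat=>real"
 assumes nonneg:"!!k. b k>=0" and bounded:"!!k. b k<=M"
  and conv:"!!k. (b k)^2<=b 0 * b (2 * k)"
 shows "b k<=b 0"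
proof (cases "b 0=0")
 case True
 then show ?thesis using conv[of k] by simp
next
 case False
 then have b0:"b 0>0" using nonneg[of 0] by simp
 show ?thesis
 proof (rule ccontr)
  assume "\<not> ?thesis"
  then have q:"b k/b 0>1" using b0 by simp
  define q where "q=b k/b 0"
  have grow:"b (2 ^ j * k)/b 0>=q^(2 ^ j)" for j
  proof (induction j)
   case (Suc j)
   have "q^(2 ^ Suc j)=(q^(2 ^ j))^2" by (simp add:power_mult[symmetric] mult.commute)
   also have "...<=(b (2 ^ j * k)/b 0)^2" using Suc q by (intro power_mono) (auto simp:q_def)
   also have "...<=b (2*(2 ^ j * k))/b 0" using conv[of "2 ^ j * k"] b0 by (simp add:power_divide field_simps power2_eq_square)
   finally show ?case by (simp add:mult.assoc)
  qed (simp add:q_def)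
  obtain n where n:"q ^ n>M/b 0" using real_arch_pow[of q "M/b 0"] q by (auto simp:q_def)
  have "q ^ n<=q^(2 ^ n)" using q by (intro power_increasing) (auto simp:q_def less_imp_le)
  then have "b (2 ^ n * k)/b 0>M/b 0" using grow[of n] n by linarith
  then show False using bounded[of "2 ^ n * k"] b0 by (simp add:divide_less_cancel)
 qed
qed

subsection \<open>The space of square integrable functions\<close>

lemma L2_measurable:"f:L2 mu==>f:borel_measurable mu" by (simp add:L2_def)

lemma L2_integrable_square:"f:L2 mu==>integrable mu (%x. (f x)^2)" by (simp add:L2_def)

lemma L2_integrable_mult:
 assumes "f:L2 mu" "g:L2 mu"
 shows "integrable mu (%x. f x * g x)"
proof (rule Bochner_Integration.integrable_bound)
 show "integrable mu (%x. (f x)^2+(g x)^2)" using assms by (auto simp:L2_def)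
 show "(%x. f x * g x):borel_measurable mu" using assms[THEN L2_measurable] by measurable
 show "AE x in mu. norm (f x * g x)<=norm ((f x)^2+(g x)^2)"
 proof (rule AE_I2)
  fix x
  have "2 * \<bar>f x * g x\<bar><=(f x)^2+(g x)^2" using sum_squares_bound[of "\<bar>f x\<bar>" "\<bar>g x\<bar>"] by (simp add:abs_mult)
  then have "\<bar>f x * g x\<bar><=(f x)^2+(g x)^2" by linarith
  then show "norm (f x * g x)<=norm ((f x)^2+(g x)^2)" by simp
 qed
qed

lemma L2_lin:
 assumes "f:L2 mu" "g:L2 mu"
 shows "(%x. a * f x + b * g x):L2 mu"
proof -
 have "integrable mu (%x. a^2*(f x)^2+(2 * a * b)*(f x * g x) + b^2*(g x)^2)" using assms L2_integrable_mult[OF assms] by (auto simp:L2_def)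
 then have "integrable mu (%x. (a * f x + b * g x)^2)" by (simp add:power2_eq_square algebra_simps)
 then show ?thesis using assms by (auto simp:L2_def)
qed

lemma L2_add:"f:L2 mu==>g:L2 mu==>(%x. f x + g x):L2 mu"
 and L2_diff:"f:L2 mu==>g:L2 mu==>(%x. f x - g x):L2 mu"
 and L2_cmult:"f:L2 mu==>(%x. a * f x):L2 mu"
 using L2_lin[of f mu g 1 1] L2_lin[of f mu g 1 "-1"] L2_lin[of f mu f a 0] by simp_all

lemma L2_bound:
 assumes "f:borel_measurable mu" "g:L2 mu" "AE x in mu. \<bar>f x\<bar><=\<bar>g x\<bar>"
 shows "f:L2 mu"
proof -
 have "integrable mu (%x. (f x)^2)"
 proof (rule Bochner_Integration.integrable_bound[OF L2_integrable_square[OF assms(2)]])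
  show "AE x in mu. norm ((f x)^2)<=norm ((g x)^2)" using assms(3) by eventually_elim (simp add:abs_le_square_iff)
 qed (use assms in measurable)
 then show ?thesis using assms by (simp add:L2_def)
qed

lemma L2_mult_bounded:
 assumes "f:L2 mu" "g:borel_measurable mu" "AE x in mu. \<bar>g x\<bar><=C"
 shows "(%x. f x * g x):L2 mu"
proof (rule L2_bound[OF _ L2_cmult[OF assms(1), of C]])
 show "(%x. f x * g x):borel_measurable mu" using L2_measurable[OF assms(1)] assms(2) by measurable
 show "AE x in mu. \<bar>f x * g x\<bar><=\<bar>C * f x\<bar>" using assms(3)
 proof eventually_elim
  case (elim x)
  then have "\<bar>g x\<bar><=(abs C)" by linarith
  then show ?case by (simp add:abs_mult mult.commute[of "(abs C)"] mult_left_mono)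
 qed
qed

lemma L2_inner_commute:"L2_inner mu f g=L2_inner mu g f" by (simp add:L2_inner_def mult.commute)

lemma L2_inner_cong_AE:
 assumes "AE x in mu. f x=f' x" "AE x in mu. g x=g' x"
  "f:borel_measurable mu" "f':borel_measurable mu" "g:borel_measurable mu" "g':borel_measurable mu"
 shows "L2_inner mu f g=L2_inner mu f' g'" unfolding L2_inner_def by (rule integral_cong_AE) (use assms in \<open>auto elim: eventually_elim2\<close>)

lemma L2_inner_lin_left:
 assumes "f:L2 mu" "g:L2 mu" "k:L2 mu"
 shows "L2_inner mu (%x. a * f x + b * g x) k=a * L2_inner mu f k + b * L2_inner mu g k"
proof -
 have "L2_inner mu (%x. a * f x + b * g x) k=(\<integral>x. a * (f x * k x) + b * (g x * k x) \<partial>mu)" by (simp add:L2_inner_def algebra_simps)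
 also have "...=a * L2_inner mu f k + b * L2_inner mu g k"
  using L2_integrable_mult[OF assms(1,3)] L2_integrable_mult[OF assms(2,3)] by (simp add:L2_inner_def)
 finally show ?thesis .
qed

lemma L2_inner_add_left:
 "f:L2 mu==>g:L2 mu==>k:L2 mu ==>
  L2_inner mu (%x. f x + g x) k=L2_inner mu f k + L2_inner mu g k"
 and L2_inner_diff_left:
 "f:L2 mu==>g:L2 mu==>k:L2 mu ==>
  L2_inner mu (%x. f x - g x) k=L2_inner mu f k - L2_inner mu g k"
 and L2_inner_cmult_left:"L2_inner mu (%x. a * f x) k=a * L2_inner mu f k"
 using L2_inner_lin_left[of f mu g k 1 1] L2_inner_lin_left[of f mu g k 1 "-1"] by (simp_all add: L2_inner_def mult.assoc)

lemma L2_inner_add_right: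
 "f:L2 mu==>g:L2 mu==>k:L2 mu ==>
  L2_inner mu k (%x. f x + g x)=L2_inner mu k f + L2_inner mu k g"
 and L2_inner_diff_right:
 "f:L2 mu==>g:L2 mu==>k:L2 mu ==>
  L2_inner mu k (%x. f x - g x)=L2_inner mu k f - L2_inner mu k g"
 and L2_inner_cmult_right:"L2_inner mu k (%x. a * f x)=a * L2_inner mu k f"
 using L2_inner_add_left[of f mu g k] L2_inner_diff_left[of f mu g k] L2_inner_cmult_left[of mu a f k] by (simp_all add: L2_inner_commute[of mu k])

lemma L2_inner_self_nonneg:"L2_inner mu f f>=0" by (simp add:L2_inner_def)

lemma L2_Cauchy_Schwarz:
 assumes "f:L2 mu" "g:L2 mu"
 shows "(L2_inner mu f g)^2<=L2_inner mu f f * L2_inner mu g g"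
proof (rule quadratic_nonneg_discriminant)
 fix s
 have "0<=L2_inner mu (%x. 1 * f x + s * g x) (%x. 1 * f x + s * g x)" by (rule L2_inner_self_nonneg)
 also have "...=L2_inner mu f f+2 * L2_inner mu f g * s + L2_inner mu g g * s^2"
  using assms by (simp add:L2_lin[where a=1, simplified] L2_inner_lin_left[where a=1, simplified]
   L2_inner_add_right L2_inner_cmult_right L2_cmult L2_add L2_inner_commute[of _ g f]
   algebra_simps power2_eq_square)
 finally show "0<=L2_inner mu f f+2 * L2_inner mu f g * s + L2_inner mu g g * s^2" .
qed

definition L2_norm :: "'a measure=>('a=>real)=>real" where
 "L2_norm mu f=sqrt (L2_inner mu f f)"

lemma L2_norm_nonneg:"L2_norm mu f>=0" by (simp add:L2_norm_def L2_inner_self_nonneg)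

lemma L2_norm_square:"(L2_norm mu f)^2=L2_inner mu f f" by (simp add:L2_norm_def L2_inner_self_nonneg)

lemma L2_inner_bound:
 assumes "f:L2 mu" "g:L2 mu"
 shows "\<bar>L2_inner mu f g\<bar><=L2_norm mu f * L2_norm mu g"
proof -
 have "\<bar>L2_inner mu f g\<bar>=sqrt ((L2_inner mu f g)^2)" by simp
 also have "...<=sqrt (L2_inner mu f f * L2_inner mu g g)" using L2_Cauchy_Schwarz[OF assms] by (rule real_sqrt_le_mono)
 finally show ?thesis by (simp add:L2_norm_def real_sqrt_mult)
qed

lemma L2_norm_triangle:
 assumes "f:L2 mu" "g:L2 mu"
 shows "L2_norm mu (%x. f x + g x)<=L2_norm mu f + L2_norm mu g"
proof (rule power2_le_imp_le)
 have "(L2_norm mu (%x. f x + g x))^2=L2_inner mu f f+2 * L2_inner mu f g + L2_inner mu g g"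
  using assms by (simp add:L2_norm_square L2_inner_add_left L2_inner_add_right L2_add L2_inner_commute[of _ g f])
 also have "...<=(L2_norm mu f + L2_norm mu g)^2" using L2_inner_bound[OF assms] by (simp add:power2_sum L2_norm_square abs_le_iff)
 finally show "(L2_norm mu (%x. f x + g x))^2<=(L2_norm mu f + L2_norm mu g)^2" .
qed (simp add:L2_norm_nonneg)

lemma L2_norm_minus_commute:"L2_norm mu (%x. f x - g x)=L2_norm mu (%x. g x - f x)"
 by (simp add:L2_norm_def L2_inner_def power2_commute flip: power2_eq_square)

lemma L2_norm_mono:
 assumes "f:borel_measurable mu" "g:L2 mu" "AE x in mu. \<bar>f x\<bar><=\<bar>g x\<bar>"
 shows "L2_norm mu f<=L2_norm mu g"
proof -
 have "f:L2 mu" by (rule L2_bound[OF assms])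
 have "L2_inner mu f f<=L2_inner mu g g" unfolding L2_inner_def
 proof (rule integral_mono_AE)
  show "AE x in mu. f x * f x<=g x * g x" using assms(3) by eventually_elim (simp add:abs_le_square_iff flip: power2_eq_square)
 qed (use \<open>f \<in> L2 mu\<close> assms in \<open>auto intro: L2_integrable_mult\<close>)
 then show ?thesis by (simp add:L2_norm_def)
qed

lemma L2_inner_zero_AE:
 assumes "f:L2 mu" "L2_inner mu f f=0"
 shows "AE x in mu. f x=0"
proof -
 have "AE x in mu. (f x)^2=0" using integral_nonneg_eq_0_iff_AE[of mu "%x. (f x)^2"] assms by (auto simp:L2_inner_def L2_def power2_eq_square)
 then show ?thesis by simp
qed


subsection \<open>The form as a limit of the semigroup forms\<close>

locale semigroup_form = dirichlet_form mu E F for mu :: "'a measure" and E F +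
 fixes P :: "real=>('a=>real) => 'a=>real"
 assumes assoc:"associated_semigroup mu E F P"
begin

abbreviation "ip==L2_inner mu"
abbreviation "nrm==L2_norm mu"

lemma F_L2:"f:F==>f:L2 mu" using domain_L2 by auto

lemma F_lin:"f:F==>g:F==>(%x. a * f x + b * g x):F" by (intro domain_add domain_scale)

lemma F_diff:"f:F==>g:F==>(%x. f x - g x):F" using F_lin[of f g 1 "-1"] by simp

lemma P_L2:"t>0==>f:L2 mu==>P t f:L2 mu" using assoc by (simp add:associated_semigroup_def)

lemma P_measurable:"t>0==>f:L2 mu==>P t f:borel_measurable mu" using P_L2 L2_measurable by blast

lemma P_lin_AE:"t>0==>f:L2 mu==>g:L2 mu ==>
  AE x in mu. P t (%y. a * f y + b * g y) x=a * P t f x + b * P t g x"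
 using assoc by (simp add:associated_semigroup_def)

lemma P_diff_AE:"t>0==>f:L2 mu==>g:L2 mu ==>
  AE x in mu. P t (%y. f y - g y) x=P t f x - P t g x"
 using P_lin_AE[of t f g 1 "-1"] by simp

lemma P_contr_ip:"t>0==>f:L2 mu==>ip (P t f) (P t f)<=ip f f" using assoc unfolding associated_semigroup_def by blast

lemma P_contr:"t>0==>f:L2 mu==>nrm (P t f)<=nrm f" using P_contr_ip by (simp add:L2_norm_def)

lemma P_sym:"t>0==>f:L2 mu==>g:L2 mu==>ip (P t f) g=ip f (P t g)" using assoc unfolding associated_semigroup_def by blast

lemma P_semigroup_AE:"s>0==>t>0==>f:L2 mu==>AE x in mu. P (s + t) f x=P s (P t f) x" using assoc by (simp add:associated_semigroup_def)

lemma P_strongly_continuous:"f:L2 mu==>((%t. nrm (%x. P t f x - f x)) \<longlongrightarrow> 0) (at_right 0)"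
proof -
 assume "f:L2 mu"
 then have "((%t. ip (%x. P t f x - f x) (%x. P t f x - f x)) \<longlongrightarrow> 0) (at_right 0)"
  using assoc by (simp add:associated_semigroup_def)
 from tendsto_real_sqrt[OF this] show ?thesis by (simp add:L2_norm_def)
qed

lemma F_eq:"F={f:L2 mu. EX l. ((%t. 1/t * ip (%x. f x - P t f x) f) \<longlongrightarrow> l) (at_right 0)}"
 using assoc by (simp add:associated_semigroup_def)

lemma E_limit:"f:F==>((%t. 1/t * ip (%x. f x - P t f x) f) \<longlongrightarrow> E f f) (at_right 0)"
 using assoc unfolding associated_semigroup_def by blast

text \<open>The difference has norm zero, and contractivity transports this through
  \<open>P t\<close>.\<close>

lemma P_cong_AE:
 assumes t:"t>0" and f:"f:L2 mu" and g:"g:L2 mu" and eq:"AE x in mu. f x=g x"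
 shows "AE x in mu. P t f x=P t g x"
proof -
 have d:"(%x. f x - g x):L2 mu" by (rule L2_diff[OF f g])
 have "ip (%x. f x - g x) (%x. f x - g x)=ip (%x. 0) (%x. 0)" using eq d[THEN L2_measurable] by (intro L2_inner_cong_AE) auto
 then have "ip (%x. f x - g x) (%x. f x - g x)=0" by (simp add:L2_inner_def)
 then have "ip (P t (%x. f x - g x)) (P t (%x. f x - g x))=0" using P_contr_ip[OF t d] L2_inner_self_nonneg by (metis order_antisym)
 from L2_inner_zero_AE[OF P_L2[OF t d] this] P_diff_AE[OF t f g]
 show ?thesis by eventually_elim simp
qed

lemma P_commute_AE:
 assumes "s>0" "t>0" "f:L2 mu"
 shows "AE x in mu. P s (P t f) x=P t (P s f) x"
proof -
 have "AE x in mu. P (t + s) f x=P s (P t f) x" using P_semigroup_AE[OF assms] by (simp add:add.commute)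
 with P_semigroup_AE[OF assms(2,1,3)] show ?thesis by eventually_elim simp
qed

text \<open>\<open>sform h f f / h\<close> is the usual approximating form of a Dirichlet form:
  finite on all of \<open>L2 mu\<close> and, on \<open>F\<close>, below \<open>E f f\<close> with
  limit \<open>E f f\<close> as \<open>h\<close> tends to 0.\<close>

definition sform :: "real=>('a=>real)=>('a=>real)=>real" where
 "sform h f g=ip f g - ip (P h f) g"

lemma sform_eq:"h>0==>f:L2 mu==>g:L2 mu==>sform h f g=ip (%x. f x - P h f x) g" by (simp add:sform_def L2_inner_diff_left P_L2)

lemma sform_sym:"h>0==>f:L2 mu==>g:L2 mu==>sform h f g=sform h g f" using P_sym[of h f g] by (simp add:sform_def L2_inner_commute)

lemma sform_lin_right:
 assumes "h>0" "f:L2 mu" "g:L2 mu" "k:L2 mu"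
 shows "sform h k (%x. a * f x + b * g x)=a * sform h k f + b * sform h k g"
 using assms by (simp add:sform_def L2_inner_add_right L2_inner_cmult_right L2_cmult P_L2 algebra_simps)

lemma sform_lin_left:
 assumes "h>0" "f:L2 mu" "g:L2 mu" "k:L2 mu"
 shows "sform h (%x. a * f x + b * g x) k=a * sform h f k + b * sform h g k" using assms by (simp add:sform_sym[of h _ k] L2_lin sform_lin_right)

lemma sform_nonneg:
 assumes "h>0" "f:L2 mu" shows "sform h f f>=0"
proof -
 have "ip (P h f) f<=nrm (P h f) * nrm f" using L2_inner_bound[OF P_L2[OF assms] assms(2)] by linarith
 also have "...<=nrm f * nrm f" using P_contr[OF assms] by (intro mult_right_mono L2_norm_nonneg)
 also have "...=ip f f" using L2_norm_square[of mu f] by (simp add:power2_eq_square)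
 finally show ?thesis by (simp add:sform_def)
qed

lemma sform_cong_AE:
 assumes "h>0" "f:L2 mu" "f':L2 mu" "AE x in mu. f x=f' x"
  "g:L2 mu" "g':L2 mu" "AE x in mu. g x=g' x"
 shows "sform h f g=sform h f' g'"
proof -
 have "ip (P h f) g=ip (P h f') g'" using assms P_cong_AE[OF assms(1-4)] by (intro L2_inner_cong_AE) (auto intro: L2_measurable P_measurable)
 moreover have "ip f g=ip f' g'" using assms by (intro L2_inner_cong_AE) (auto intro: L2_measurable)
 ultimately show ?thesis by (simp add:sform_def)
qed

lemma sform_expand:
 assumes "h>0" "f:L2 mu" "g:L2 mu"
 shows "sform h (%x. a * f x + b * g x) (%x. a * f x + b * g x)
  = a^2 * sform h f f+2 * a * b * sform h f g + b^2 * sform h g g"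
 using assms by (simp add:sform_lin_left sform_lin_right L2_lin sform_sym[of h g f] algebra_simps power2_eq_square)

lemma sform_Cauchy_Schwarz:
 assumes "h>0" "f:L2 mu" "g:L2 mu"
 shows "(sform h f g)^2<=sform h f f * sform h g g"
proof (rule quadratic_nonneg_discriminant)
 fix s
 have "0<=sform h (%x. 1 * f x + s * g x) (%x. 1 * f x + s * g x)" using assms by (intro sform_nonneg L2_lin)
 also have "...=sform h f f+2 * sform h f g * s + sform h g g * s^2" unfolding sform_expand[OF assms] by (simp add:algebra_simps)
 finally show "0<=sform h f f+2 * sform h f g * s + sform h g g * s^2" .
qed

lemma sform_bound:
 assumes "h>0" "f:L2 mu" "g:L2 mu"
 shows "\<bar>sform h f g\<bar><=2 * nrm f * nrm g"
proof -
 have "\<bar>ip (P h f) g\<bar><=nrm (P h f) * nrm g" by (rule L2_inner_bound[OF P_L2[OF assms(1,2)] assms(3)])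
 also have "...<=nrm f * nrm g" using P_contr[OF assms(1,2)] by (intro mult_right_mono L2_norm_nonneg)
 finally show ?thesis using L2_inner_bound[OF assms(2,3)] by (simp add:sform_def)
qed

lemma sform_P_sym:
 assumes "h>0" "t>0" "f:L2 mu" "g:L2 mu"
 shows "sform h (P t f) g=sform h f (P t g)"
proof -
 have "ip (P h (P t f)) g=ip (P t (P h f)) g" using assms by (intro L2_inner_cong_AE P_commute_AE) (auto intro: P_L2 L2_measurable)
 then show ?thesis using assms by (simp add:sform_def P_sym P_L2)
qed

lemma sform_semigroup:
 assumes "h>0" "s>0" "t>0" "f:L2 mu" "g:L2 mu"
 shows "sform h (P (s + t) f) g=sform h (P s (P t f)) g" using assms by (intro sform_cong_AE P_semigroup_AE) (auto intro: P_L2)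

text \<open>Put \<open>b k = sform h (P (k t) f) (P (k t) f)\<close>. Symmetry and the semigroup law
  give \<open>b k = sform h f (P (2 k t) f)\<close>, so Cauchy-Schwarz reads
  \<open>(b k)^2 <= b 0 * b (2 k)\<close>, and contractivity bounds \<open>b\<close>;
  \<open>log_convex_bounded\<close> concludes.\<close>

lemma sform_P_le:
 assumes h:"h>0" and t:"t>0" and f:"f:L2 mu"
 shows "sform h (P t f) (P t f)<=sform h f f"
proof -
 \<comment> \<open>Index 0 is treated separately because nothing is assumed about
   \<open>P 0\<close>.\<close>
 define b where "b k=(if k=0 then sform h f f else sform h (P (real k * t) f) (P (real k * t) f))" for k :: nat
 have b_alt:"b k=sform h f (P (real (2 * k) * t) f)" if "k>0" for k
 proof -
  have k:"real k * t>0" using that t by simp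
  have "b k=sform h f (P (real k * t) (P (real k * t) f))" using that k h f by (simp add:b_def sform_P_sym P_L2)
  also have "...=sform h (P (real k * t) (P (real k * t) f)) f" using h f k by (intro sform_sym) (auto intro: P_L2)
  also have "...=sform h (P (real k * t + real k * t) f) f" using sform_semigroup[OF h k k f f] by simp
  also have "...=sform h f (P (real (2 * k) * t) f)" using h f k t that by (subst sform_sym) (auto intro: P_L2 simp:algebra_simps)
  finally show ?thesis .
 qed
 have "b 1<=b 0"
 proof (rule log_convex_bounded)
  fix k
  have L:"(if k=0 then f else P (real k * t) f):L2 mu" for k :: nat using f t by (auto intro: P_L2)
  show "b k>=0" unfolding b_def using f t h by (auto intro!: sform_nonneg P_L2)
  have N:"nrm (P (real k * t) f)<=nrm f" if "k>0" for k :: nat using P_contr[OF _ f, of "real k * t"] t that by simp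
  show "b k<=2 * nrm f * nrm f"
  proof (cases "k=0")
   case True then show ?thesis using sform_bound[OF h f f] by (simp add:b_def)
  next
   case False
   have "b k<=2 * nrm (P (real k * t) f) * nrm (P (real k * t) f)"
   using sform_bound[OF h P_L2[OF _ f] P_L2[OF _ f], of "real k * t" "real k * t"] False t by (simp add:b_def)
   also have "...<=2 * nrm f * nrm f" using N[of k] False by (intro mult_mono) (auto simp:L2_norm_nonneg)
   finally show ?thesis .
  qed
  show "(b k)^2<=b 0 * b (2 * k)"
  proof (cases "k=0")
   case False
   then have "real (2 * k) * t>0" using t by simp
   from sform_Cauchy_Schwarz[OF h f P_L2[OF this f]] False show ?thesis unfolding b_alt[OF False[unfolded neq0_conv]] by (simp add:b_def)
  qed (simp add:power2_eq_square)
 qed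
 then show ?thesis by (simp add:b_def)
qed

text \<open>The increments \<open>P (n h) f - P ((n+1) h) f\<close>, paired with \<open>f\<close>,
  are the values \<open>sform h (P (n h) f) f\<close>, each at most \<open>sform h f f\<close> by
  Cauchy-Schwarz and \<open>sform_P_le\<close>.\<close>

lemma sform_mult_le:
 assumes h:"h>0" and f:"f:L2 mu"
 shows "sform (real (Suc n) * h) f f<=real (Suc n) * sform h f f"
proof (induction n)
 case (Suc n)
 have nh:"real (Suc n) * h>0" using h by simp
 let ?f = "P (real (Suc n) * h) f"
 have fL:"?f:L2 mu" by (rule P_L2[OF nh f])
 have "ip (P (real (Suc (Suc n)) * h) f) f=ip (P h ?f) f"
 proof (rule L2_inner_cong_AE)
  show "AE x in mu. P (real (Suc (Suc n)) * h) f x=P h ?f x" using P_semigroup_AE[OF h nh f] by (simp add:algebra_simps)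
 qed (use f h nh fL in \<open>auto intro!: P_L2 L2_measurable\<close>)
 then have "sform (real (Suc (Suc n)) * h) f f=sform (real (Suc n) * h) f f + sform h ?f f" by (simp add:sform_def)
 also have "sform h ?f f<=sform h f f"
 proof -
  have "(sform h ?f f)^2<=sform h ?f ?f * sform h f f" by (rule sform_Cauchy_Schwarz[OF h fL f])
  also have "...<=(sform h f f)^2" unfolding power2_eq_square using sform_P_le[OF h nh f] sform_nonneg[OF h f] by (intro mult_right_mono)
  finally show ?thesis using sform_nonneg[OF h f] by (rule power2_le_imp_le)
 qed
 finally show ?case using Suc by (simp add:algebra_simps)
qed simp

lemma sform_limit:"f:F==>((%h. sform h f f/h) \<longlongrightarrow> E f f) (at_right 0)"
proof (rule Lim_transform_eventually[OF E_limit])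
 assume f:"f:F"
 show "\<forall>\<^sub>F h in at_right 0. 1/h * ip (%x. f x - P h f x) f=sform h f f/h"
  using eventually_at_right_less[of 0] by eventually_elim (use f in \<open>simp add:sform_eq F_L2\<close>)
qed auto

text \<open>By \<open>sform_mult_le\<close> the quotients at \<open>h / n\<close> are at least the
  quotient at \<open>h\<close>, and they tend to \<open>E f f\<close>.\<close>

lemma sform_div_le:
 assumes h:"h>0" and f:"f:F"
 shows "sform h f f/h<=E f f"
proof (rule tendsto_lowerbound)
 have "filterlim (%n. h/real (Suc n)) (at_right 0) sequentially" using h by real_asymp
 from filterlim_compose[OF sform_limit[OF f] this]
 show "(%n. sform (h/real (Suc n)) f f/(h/real (Suc n))) ----> E f f" .
 show "\<forall>\<^sub>F n in sequentially. sform h f f/h<=sform (h/real (Suc n)) f f/(h/real (Suc n))"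
 proof (rule always_eventually, rule allI)
  fix n
  have "sform h f f<=real (Suc n) * sform (h/real (Suc n)) f f" using sform_mult_le[of "h/real (Suc n)" f n] h f by (simp add:F_L2)
  then have "sform h f f/h<=real (Suc n) * sform (h/real (Suc n)) f f/h" using h by (intro divide_right_mono) auto
  then show "sform h f f/h<=sform (h/real (Suc n)) f f/(h/real (Suc n))" by (simp add:mult.commute)
 qed
qed simp

section \<open>Strong continuity and membership in the form domain\<close>

lemma P_modulus:
 assumes "f:L2 mu" "s>0" "h>0"
 shows "nrm (%x. P (s + h) f x - P s f x)<=nrm (%x. P h f x - f x)"
proof -
 have d:"(%x. P h f x - f x):L2 mu" using assms by (intro L2_diff P_L2)
 have "nrm (%x. P (s + h) f x - P s f x)<=nrm (P s (%x. P h f x - f x))"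
 proof (rule L2_norm_mono)
  show "AE x in mu. \<bar>P (s + h) f x - P s f x\<bar><=\<bar>P s (%x. P h f x - f x) x\<bar>"
   using P_semigroup_AE[OF assms(2,3,1)] P_diff_AE[OF assms(2) P_L2[OF assms(3,1)] assms(1)] by eventually_elim simp
 qed (use assms d in \<open>auto intro!: P_L2 L2_measurable L2_diff\<close>)
 also have "...<=nrm (%x. P h f x - f x)" by (rule P_contr[OF assms(2) d])
 finally show ?thesis .
qed

lemma P_modulus_abs:
 assumes "f:L2 mu" "s>0" "t>0" "s~=t"
 shows "nrm (%x. P t f x - P s f x)<=nrm (%x. P \<bar>t - s\<bar> f x - f x)"
proof (cases "s<t")
 case True
 then show ?thesis using P_modulus[OF assms(1,2), of "t - s"] by simp
next
 case False
 then have "t<s" using assms by simp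
 then show ?thesis using P_modulus[OF assms(1,3), of "s - t"] by (simp add:L2_norm_minus_commute[of mu "P t f"])
qed

text \<open>\<open>F\<close> is given by existence of a limit and not by boundedness, so the bound
  has to be upgraded to convergence. As in Fekete's lemma, subadditivity
  (\<open>sform_mult_le\<close>) together with strong continuity makes the quotients converge to
  their supremum \<open>S\<close>.\<close>

lemma sform_membership:
 assumes f:"f:L2 mu" and bound:"!!h. h>0==>sform h f f/h<=C"
 shows "f:F" "E f f<=C"
proof -
 define S where "S=(SUP h\<in>{0<..}. sform h f f/h)"
 have bdd:"bdd_above ((%h. sform h f f/h) ` {0<..})" using bound by (auto intro!: bdd_aboveI[of _ C])
 have le:"sform h f f/h<=S" if "h>0" for h unfolding S_def using that bdd by (intro cSUP_upper) auto
 have lim:"((%h. sform h f f/h) \<longlongrightarrow> S) (at_right 0)"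
 proof (rule order_tendstoI)
  fix a assume "a<S"
  then obtain h0 where h0:"h0>0" "a<sform h0 f f/h0" unfolding S_def using less_cSUP_iff[OF _ bdd] by auto
  \<comment> \<open>\<open>n h * h\<close> is the largest multiple of \<open>h\<close> not exceeding
    \<open>h0\<close>; it tends to \<open>h0\<close>, where the quotient already exceeds
    \<open>a\<close>.\<close>
  define n where "n h=nat \<lfloor>h0/h\<rfloor>" for h
  have n1:"\<forall>\<^sub>F h in at_right 0. h>0&h<h0" using eventually_at_right_less eventually_at_right_real[OF h0(1)]
   by (auto simp:eventually_conj_iff elim: eventually_mono)
  have nlim:"((%h. real (n h) * h) \<longlongrightarrow> h0) (at_right 0)"
  proof (rule real_tendsto_sandwich[of "%h. h0 - h" _ _ "%h. h0"])
   show "\<forall>\<^sub>F h in at_right 0. h0 - h<=real (n h) * h" using n1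
   proof eventually_elim
   case (elim h)
   then have "real (n h)>=h0/h-1" by (simp add:n_def)
   then show ?case using elim by (simp add:field_simps)
   qed
   show "\<forall>\<^sub>F h in at_right 0. real (n h) * h<=h0" using n1
   proof eventually_elim
   case (elim h)
   then have "real (n h)<=h0/h" by (simp add:n_def)
   then show ?case using elim by (simp add:field_simps)
   qed
  qed (auto intro!: tendsto_eq_intros)
  have ev:"\<forall>\<^sub>F h in at_right 0. a * (real (n h) * h)<sform (real (n h) * h) f f"
  proof -
   define b where "b=sform h0 f f - a * h0"
   have b:"b>0" using h0 by (simp add:b_def field_simps)
   \<comment> \<open>The modulus of continuity gets multiplied by \<open>nrm f\<close>, which may
     vanish; hence the added 1.\<close>
   define e where "e=b/(2*(nrm f+1))"
   have e:"e>0" using b by (simp add:e_def L2_norm_nonneg add_nonneg_pos)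
   have "\<forall>\<^sub>F t in at_right 0. dist (nrm (%x. P t f x - f x)) 0<e" using P_strongly_continuous[OF f] e by (rule tendstoD)
   then obtain dl where dl:"dl>0" "!!t. 0<t==>t<dl==>nrm (%x. P t f x - f x)<e"
   unfolding eventually_at_right_field by (auto simp:dist_real_def L2_norm_nonneg)
   have "\<forall>\<^sub>F h in at_right 0. dist (real (n h) * h) h0<dl" using nlim dl(1) by (rule tendstoD)
   moreover have "((%h. a * (real (n h) * h)) \<longlongrightarrow> a * h0) (at_right 0)" by (intro tendsto_intros nlim)
   then have "\<forall>\<^sub>F h in at_right 0. a * (real (n h) * h)<a * h0 + b/2" using b by (intro order_tendstoD(2)) auto
   moreover have "\<forall>\<^sub>F h in at_right 0. real (n h) * h>0" using order_tendstoD(1)[OF nlim h0(1)] .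
   ultimately show ?thesis
   proof eventually_elim
   case (elim h)
   let ?t = "real (n h) * h"
   have "\<bar>sform ?t f f - sform h0 f f\<bar><=b/2"
   proof (cases "?t=h0")
   case False
   have "\<bar>sform ?t f f - sform h0 f f\<bar>=\<bar>ip (%x. P ?t f x - P h0 f x) f\<bar>"
   using elim h0 f by (simp add:sform_def L2_inner_diff_left P_L2)
   also have "...<=nrm (%x. P ?t f x - P h0 f x) * nrm f" using elim h0 f by (intro L2_inner_bound L2_diff P_L2)
   also have "...<=nrm (%x. P \<bar>?t - h0\<bar> f x - f x) * nrm f"
   using elim h0 f False by (intro mult_right_mono P_modulus_abs L2_norm_nonneg) auto
   also have "...<=e * nrm f" using elim False by (intro mult_right_mono L2_norm_nonneg less_imp_le dl(2)) (auto simp:dist_real_def)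
   also have "...<=e * (nrm f+1)" using e by simp
   also have "...=b/2" using L2_norm_nonneg[of mu f] by (simp add:e_def field_simps)
   finally show ?thesis .
   qed (use b in simp)
   then have "sform h0 f f - b/2<=sform ?t f f" by linarith
   moreover have "a * ?t<a * h0 + b/2" using elim by blast
   moreover have "a * h0 + b/2=sform h0 f f - b/2" by (simp add:b_def field_simps)
   ultimately show ?case by (metis order_less_le_trans)
   qed
  qed
  show "\<forall>\<^sub>F h in at_right 0. a<sform h f f/h" using n1 ev
  proof eventually_elim
   case (elim h)
   have n0:"n h>0" using elim by (simp add:n_def)
   then obtain m where m:"n h=Suc m" using gr0_conv_Suc by auto
   have "a * (real (n h) * h)<real (n h) * sform h f f" using elim sform_mult_le[OF _ f, of h m] unfolding m by linarith
   then have "real (n h)*(a * h)<real (n h) * sform h f f" by (simp add:algebra_simps)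
   then have "a * h<sform h f f" using n0 by simp
   then show ?case using elim by (simp add:field_simps)
  qed
 next
  fix a assume a:"S<a"
  show "\<forall>\<^sub>F h in at_right 0. sform h f f/h<a" using eventually_at_right_less[of 0] by eventually_elim (use le a in force)
 qed
 have lim': "((%t. 1/t * ip (%x. f x - P t f x) f) \<longlongrightarrow> S) (at_right 0)"
 proof (rule Lim_transform_eventually[OF lim])
  show "\<forall>\<^sub>F h in at_right 0. sform h f f/h=1/h * ip (%x. f x - P h f x) f"
   using eventually_at_right_less[of 0] by eventually_elim (use f in \<open>simp add:sform_eq\<close>)
 qed
 then show fF:"f:F" using f F_eq by blast
 have "E f f=S" using tendsto_unique[OF _ E_limit[OF fF] lim'] by simp
 also have "S<=C" unfolding S_def using bound by (intro cSUP_least) auto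
 finally show "E f f<=C" .
qed

text \<open>For fixed \<open>h\<close> the form \<open>sform h\<close> is bounded on
  \<open>L2 mu\<close>, hence continuous under \<open>L2\<close> convergence alone.\<close>

lemma sform_L2_limit:
 assumes h:"h>0" and u:"!!n. u n:L2 mu" and f:"f:L2 mu"
  and lim:"(%n. nrm (%x. u n x - f x)) ----> 0"
 shows "(%n. sform h (u n) (u n)) ----> sform h f f"
proof -
 let ?d = "%n x. u n x - f x"
 have eq:"sform h (u n) (u n)=sform h f f+2 * sform h f (?d n) + sform h (?d n) (?d n)" for n
  using sform_expand[OF h f L2_diff[OF u[of n] f], of 1 1] by simp
 have b1:"\<bar>sform h f (?d n)\<bar><=2 * nrm f * nrm (?d n)" for n by (rule sform_bound[OF h f L2_diff[OF u f]])
 have b2:"\<bar>sform h (?d n) (?d n)\<bar><=2 * nrm (?d n) * nrm (?d n)" for n by (rule sform_bound[OF h L2_diff[OF u f] L2_diff[OF u f]])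
 have c1:"(%n. 2 * nrm f * nrm (?d n)) ----> 0" using tendsto_mult_left[OF lim, of "2 * nrm f"] by simp
 have c2:"(%n. 2 * nrm (?d n) * nrm (?d n)) ----> 0" using tendsto_mult[OF tendsto_mult_left[OF lim, of 2] lim] by simp
 have "(%n. sform h f (?d n)) ----> 0" by (rule Lim_null_comparison[OF always_eventually c1]) (use b1 in simp)
 moreover have "(%n. sform h (?d n) (?d n)) ----> 0" by (rule Lim_null_comparison[OF always_eventually c2]) (use b2 in simp)
 ultimately have "(%n. sform h f f+2 * sform h f (?d n) + sform h (?d n) (?d n)) ----> sform h f f+2*0+0" by (intro tendsto_intros)
 then show ?thesis by (simp add:eq)
qed

lemma E_lin_left:
 "f:F==>g:F==>k:F==>E (%x. a * f x + b * g x) k=a * E f k + b * E g k"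
 by (simp add:form_add form_scale domain_scale)

lemma E_lin_right:
 "f:F==>g:F==>k:F==>E k (%x. a * f x + b * g x)=a * E k f + b * E k g"
 by (simp add:form_sym[of k] F_lin E_lin_left)

lemma E_expand:
 assumes "f:F" "g:F"
 shows "E (%x. a * f x + b * g x) (%x. a * f x + b * g x)=a^2 * E f f+2 * a * b * E f g + b^2 * E g g"
 using assms by (simp add:E_lin_left E_lin_right F_lin form_sym[of g f] algebra_simps power2_eq_square)

lemma sform_limit_polar:
 assumes f:"f:F" and g:"g:F"
 shows "((%h. sform h f g/h) \<longlongrightarrow> E f g) (at_right 0)"
proof -
 let ?s = "%x. 1 * f x+1 * g x" and ?d = "%x. 1 * f x+(- 1) * g x"
 have "((%h. (sform h ?s ?s/h - sform h ?d ?d/h)/4) \<longlongrightarrow> (E ?s ?s - E ?d ?d)/4) (at_right 0)"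
  by (intro tendsto_intros sform_limit F_lin f g) auto
 moreover have "(E ?s ?s - E ?d ?d)/4=E f g" unfolding E_expand[OF f g] by simp
 moreover have "\<forall>\<^sub>F h in at_right 0. (sform h ?s ?s/h - sform h ?d ?d/h)/4=sform h f g/h" using eventually_at_right_less[of 0]
 proof eventually_elim
  case (elim h)
  show ?case unfolding sform_expand[OF elim F_L2[OF f] F_L2[OF g]] by (simp add:add_divide_distrib diff_divide_distrib)
 qed
 ultimately show ?thesis by (auto intro: Lim_transform_eventually)
qed

text \<open>Parallelogram law: the energy of \<open>u n - f\<close> is
  \<open>2 E (u n) (u n) + 2 E f f\<close> minus the energy of \<open>u n + f\<close>, and the
  latter is asymptotically at least \<open>4 E f f\<close> by lower semicontinuity, tested with
  \<open>sform h\<close> at one fixed \<open>h\<close>. It upgrades \<open>L2\<close> convergence of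
  truncations and of \<open>Q t f\<close> to convergence in energy.\<close>

lemma E_strong_limit:
 assumes u:"!!n. u n:F" and f:"f:F"
  and lim:"(%n. nrm (%x. u n x - f x)) ----> 0"
  and bound:"!!n. E (u n) (u n)<=E f f"
 shows "(%n. E (%x. u n x - f x) (%x. u n x - f x)) ----> 0"
proof (rule LIMSEQ_I)
 fix e :: real assume e:"e>0"
 let ?m = "%n x. 1 * u n x+1 * f x"
 have mF:"?m n:F" for n using u f by (intro F_lin)
 obtain h where h:"h>0" "4 * E f f - e/2<sform h (%x. 2 * f x) (%x. 2 * f x)/h"
 proof -
  have "((%h. sform h (%x. 2 * f x) (%x. 2 * f x)/h) \<longlongrightarrow> E (%x. 2 * f x) (%x. 2 * f x)) (at_right 0)"
   using f by (intro sform_limit domain_scale)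
  moreover have "E (%x. 2 * f x) (%x. 2 * f x)=4 * E f f" using E_expand[OF f f, of 2 0] by simp
  ultimately have "\<forall>\<^sub>F h in at_right 0. 4 * E f f - e/2<sform h (%x. 2 * f x) (%x. 2 * f x)/h" using e by (intro order_tendstoD(1)) auto
  then have "\<forall>\<^sub>F h in at_right 0. 4 * E f f - e/2<sform h (%x. 2 * f x) (%x. 2 * f x)/h&h>0"
   using eventually_at_right_less[of 0] by eventually_elim simp
  from eventually_happens'[OF _ this] show ?thesis using that by auto
 qed
 have "(%n. sform h (?m n) (?m n)) ----> sform h (%x. 2 * f x) (%x. 2 * f x)"
 proof (rule sform_L2_limit[OF h(1) F_L2[OF mF]])
  show "(%n. nrm (%x. 1 * u n x+1 * f x-2 * f x)) ----> 0" using lim by simp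
 qed (use f in \<open>auto intro: L2_cmult F_L2\<close>)
 then have "(%n. sform h (?m n) (?m n)/h) ----> sform h (%x. 2 * f x) (%x. 2 * f x)/h" by (intro tendsto_intros) (use h in auto)
 from order_tendstoD(1)[OF this h(2)]
 have "\<forall>\<^sub>F n in sequentially. 4 * E f f - e/2<sform h (?m n) (?m n)/h" .
 then obtain N where N:"!!n. n>=N==>4 * E f f - e/2<sform h (?m n) (?m n)/h" by (auto simp:eventually_sequentially)
 show "EX N. ALL n>=N. norm (E (%x. u n x - f x) (%x. u n x - f x)-0)<e"
 proof (intro exI allI impI)
  fix n assume n:"n>=N"
  have m:"E (?m n) (?m n)>4 * E f f - e/2" using N[OF n] sform_div_le[OF h(1) mF[of n]] by linarith
  have "E (%x. u n x - f x) (%x. u n x - f x)=2 * E (u n) (u n)+2 * E f f - E (?m n) (?m n)"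
   using E_expand[OF u[of n] f, of 1 1] E_expand[OF u[of n] f, of 1 "-1"] by simp
  also have "...<e" using m bound[of n] e by linarith
  finally show "norm (E (%x. u n x - f x) (%x. u n x - f x)-0)<e" using form_nonneg[OF F_diff[OF u[of n] f]] by simp
 qed
qed

text \<open>The approximating forms do not increase along the semigroup, and
  \<open>sform_membership\<close> carries this over to \<open>E\<close>.\<close>

lemma P_E_le:
 assumes "t>0" "f:F"
 shows "P t f:F" "E (P t f) (P t f)<=E f f"
proof -
 have "sform h (P t f) (P t f)/h<=E f f" if h:"h>0" for h
 proof -
  have "sform h (P t f) (P t f)/h<=sform h f f/h" using sform_P_le[OF h assms(1) F_L2[OF assms(2)]] h by (intro divide_right_mono) auto
  then show ?thesis using sform_div_le[OF h assms(2)] by linarith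
 qed
 from sform_membership[OF P_L2[OF assms(1) F_L2[OF assms(2)]] this]
 show "P t f:F" "E (P t f) (P t f)<=E f f" by auto
qed

text \<open>The analyticity estimate for a symmetric semigroup, by two telescoping sums instead of
  spectral calculus: along the iterates \<open>x n\<close> of \<open>P h\<close> the decreasing
  quantities \<open>g n\<close> sum to at most the squared norm of \<open>f\<close>, and the
  decreasing \<open>D n\<close> are at most \<open>g n - g (n+1)\<close>. Hence
  \<open>N * g N\<close> is at most that squared norm and \<open>N * D (2 N) <= g N\<close>.\<close>

lemma generator_bound:
 assumes h:"h>0" and t:"t>=4 * h" and f:"f:L2 mu"
 defines "v==P t f"
 shows "nrm (%x. v x - P h v x)<=8 * h/t * nrm f"
proof -
 define x where "x n=((P h) ^^ n) f" for n
 have x0:"x 0=f" and xS:"x (Suc n)=P h (x n)" for n by (simp_all add: x_def)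
 have xL:"x n:L2 mu" for n by (induction n) (simp_all add: x0 xS f P_L2[OF h])
 have h2:"h/2>0" using h by simp
 \<comment> \<open>Moving half a step to each side exhibits the mixed term as a diagonal value of
   the form, hence as nonnegative.\<close>
 have half:"sform h (x n) (x (Suc n))=sform h (P (h/2) (x n)) (P (h/2) (x n))" for n
 proof -
  have "sform h (P (h/2) (x n)) (P (h/2) (x n))=sform h (x n) (P (h/2) (P (h/2) (x n)))" by (rule sform_P_sym[OF h h2 xL P_L2[OF h2 xL]])
  also have "...=sform h (P (h/2) (P (h/2) (x n))) (x n)" by (intro sform_sym h xL P_L2 h2)
  also have "...=sform h (P h (x n)) (x n)" using sform_semigroup[OF h h2 h2 xL xL, of n n] by simp
  also have "...=sform h (x n) (x (Suc n))" unfolding xS by (intro sform_sym h xL P_L2)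
  finally show ?thesis by simp
 qed
 define g where "g n=sform h (x n) (x n)" for n
 have g0:"g n>=0" for n unfolding g_def by (rule sform_nonneg[OF h xL])
 have half0:"sform h (x n) (x (Suc n))>=0" for n unfolding half by (intro sform_nonneg h P_L2 h2 xL)
 have half1:"sform h (x n) (x (Suc n))>=g (Suc n)" for n
 proof -
  have "g (Suc n)=sform h (P (h/2) (P (h/2) (x n))) (P (h/2) (P (h/2) (x n)))" unfolding g_def xS using P_semigroup_AE[OF h2 h2 xL[of n]]
   by (intro sform_cong_AE h P_L2 xL h2) auto
  also have "...<=sform h (x n) (x (Suc n))" unfolding half by (intro sform_P_le h h2 P_L2 xL)
  finally show ?thesis .
 qed
 have gdec:"g (Suc n)<=g n" for n unfolding g_def xS by (rule sform_P_le[OF h h xL])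
 have gd:"g j<=g i" if "i<=j" for i j using that gdec by (rule lift_Suc_antimono_le[rotated])
 have d:"x n=x n&ip (%y. x n y - x (Suc n) y) (%y. x n y - x (Suc n) y)=sform h (x n) (x n) - sform h (x n) (x (Suc n))" for n
  unfolding sform_def xS[symmetric] using xL[of n] xL[of "Suc n"] by (simp add:L2_inner_diff_left L2_inner_diff_right L2_diff)
 have d1:"ip (%y. x n y - x (Suc n) y) (%y. x n y - x (Suc n) y)<=g n - g (Suc n)" for n using d[of n] half1[of n] by (simp add:g_def)
 have tele:"g n<=ip (x n) (x n) - ip (x (Suc n)) (x (Suc n))" for n
 proof -
  have "ip (x n) (x n) - ip (x (Suc n)) (x (Suc n))=sform h (x n) (x n) + sform h (x n) (x (Suc n))"
   unfolding sform_def xS[symmetric] by (simp add:L2_inner_commute)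
  then show ?thesis using half0[of n] by (simp add:g_def)
 qed
 have sumg:"(\<Sum>n<N. g n)<=ip f f - ip (x N) (x N)" for N
 proof (induction N)
  case (Suc N)
  then show ?case using tele[of N] by simp
 qed (simp add:x0)
 have gN:"real N * g N<=ip f f" for N
 proof -
  have "real N * g N=(\<Sum>n<N. g N)" by simp
  also have "...<=(\<Sum>n<N. g n)" by (intro sum_mono gd) auto
  also have "...<=ip f f" using sumg[of N] L2_inner_self_nonneg[of mu "x N"] by linarith
  finally show ?thesis .
 qed
 define D where "D n=ip (%y. x n y - x (Suc n) y) (%y. x n y - x (Suc n) y)" for n
 have contr:"nrm (%y. k y - P h k y)>=nrm (%y. P s k y - P h (P s k) y)"
  if k:"k:L2 mu" and s:"s>0" for k s
 proof -
  have "nrm (%y. P s k y - P h (P s k) y)<=nrm (P s (%y. k y - P h k y))"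
  proof (rule L2_norm_mono)
   show "AE y in mu. \<bar>P s k y - P h (P s k) y\<bar><=\<bar>P s (%y. k y - P h k y) y\<bar>"
   using P_commute_AE[OF h s k] P_diff_AE[OF s k P_L2[OF h k]] by eventually_elim simp
  qed (use s h k in \<open>auto intro!: P_L2 L2_measurable L2_diff\<close>)
  also have "...<=nrm (%y. k y - P h k y)" using s h k by (intro P_contr L2_diff P_L2)
  finally show ?thesis .
 qed
 have Ddec:"D (Suc n)<=D n" for n using contr[OF xL[of n] h] by (simp add:D_def L2_norm_def xS[symmetric])
 have Dd:"D j<=D i" if "i<=j" for i j using that Ddec by (rule lift_Suc_antimono_le[rotated])
 have DN:"real N * D (N + N)<=g N" for N
 proof -
  have tl:"(\<Sum>n<m. D (N + n))<=g N - g (N + m)" for m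
  proof (induction m)
   case (Suc m)
   then show ?case using d1[of "N + m"] by (simp add:D_def)
  qed simp
  have "real N * D (N + N)=(\<Sum>n<N. D (N + N))" by simp
  also have "...<=(\<Sum>n<N. D (N + n))" by (intro sum_mono Dd) auto
  also have "...<=g N" using tl[of N] g0[of "N + N"] by linarith
  finally show ?thesis .
 qed
 \<comment> \<open>\<open>2 N\<close> steps of length \<open>h\<close> stay below \<open>t\<close>,
   while \<open>N >= t / (8 h)\<close>; the hypothesis \<open>t >= 4 h\<close> gives
   \<open>N >= 1\<close>.\<close>
 define N where "N=nat \<lfloor>t/(4 * h)\<rfloor>"
 have N1:"N>=1" using h t by (simp add:N_def le_nat_iff field_simps)
 have "real N<=t/(4 * h)" using h t by (simp add:N_def)
 then have Nt:"real (N + N) * h<t" using h t by (simp add:field_simps)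
 have "real N>t/(4 * h)-1" using h t by (simp add:N_def)
 then have "2 * real N>=t/(4 * h)" using N1 by linarith
 then have N8:"real N>=t/(8 * h)" using h by (simp add:field_simps)
 have t0:"t>0" using h t by linarith
 have "real N * (real N * D (N + N))<=ip f f" using DN[of N] gN[of N] by (meson mult_left_mono of_nat_0_le_iff order_trans)
 then have "(nrm (%y. x (N+N) y - P h (x (N+N)) y) * real N)^2<=(nrm f)^2" unfolding power_mult_distrib L2_norm_square
  by (simp add:D_def xS[symmetric] power2_eq_square mult.commute mult.left_commute)
 then have DN2:"nrm (%y. x (N+N) y - P h (x (N+N)) y) * real N<=nrm f" by (rule power2_le_imp_le) (rule L2_norm_nonneg)
 have xP:"AE y in mu. x (Suc n) y=P (real (Suc n) * h) f y" for n
 proof (induction n)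
  case (Suc n)
  have "AE y in mu. P h (x (Suc n)) y=P h (P (real (Suc n) * h) f) y" using h by (intro P_cong_AE xL Suc P_L2 f) auto
  moreover have "AE y in mu. P (h + real (Suc n) * h) f y=P h (P (real (Suc n) * h) f) y" using h by (intro P_semigroup_AE f) auto
  ultimately show ?case unfolding xS[of "Suc n"] by eventually_elim (simp add:algebra_simps)
 qed (simp add:x0 xS)
 \<comment> \<open>The remaining time, during which the norm of \<open>x - P h x\<close> does not
   grow by \<open>contr\<close>.\<close>
 define s where "s=t - real (N + N) * h"
 have s:"s>0" using Nt by (simp add:s_def)
 have vs:"AE y in mu. v y=P s (x (N + N)) y"
 proof -
  obtain m where m:"N + N=Suc m" using N1 by (cases "N + N") auto
  have "AE y in mu. P (s + real (Suc m) * h) f y=P s (P (real (Suc m) * h) f) y" using h by (intro P_semigroup_AE f s) auto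
  moreover have "AE y in mu. P s (x (Suc m)) y=P s (P (real (Suc m) * h) f) y" using h by (intro P_cong_AE xL xP P_L2 f s) auto
  moreover have "s + real (Suc m) * h=t" by (simp add:s_def m)
  ultimately show ?thesis unfolding v_def m by (auto elim: eventually_elim2)
 qed
 have vL:"v:L2 mu" unfolding v_def by (rule P_L2[OF t0 f])
 have "nrm (%y. v y - P h v y)<=nrm (%y. P s (x (N+N)) y - P h (P s (x (N+N))) y)"
 proof (rule L2_norm_mono)
  show "AE y in mu. \<bar>v y - P h v y\<bar><=\<bar>P s (x (N+N)) y - P h (P s (x (N+N))) y\<bar>"
   using vs P_cong_AE[OF h vL P_L2[OF s xL] vs] by eventually_elim simp
 qed (use s h vL xL in \<open>auto intro!: P_L2 L2_measurable L2_diff\<close>)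
 also have "...<=nrm (%y. x (N+N) y - P h (x (N+N)) y)" by (rule contr[OF xL s])
 also have "...<=nrm f/real N" using DN2 N1 by (simp add:field_simps)
 also have "...<=nrm f/(t/(8 * h))" using N8 h t0 N1 by (intro divide_left_mono L2_norm_nonneg) auto
 also have "...=8 * h/t * nrm f" by simp
 finally show ?thesis .
qed

end

subsection \<open>The sub-Markov property\<close>

text \<open>The upper right Dini derivative is nonpositive, so the largest \<open>t\<close> with
  \<open>w t <= w a + e * (t - a)\<close> cannot be smaller than \<open>b\<close>; then
  \<open>e\<close> is made small.\<close>

lemma nonincreasing_of_Dini:
 fixes w :: "real=>real"
 assumes ab:"a<=b" and cont:"continuous_on {a..b} w"
  and dini:"!!t e. a<=t==>t<b==>e>0==>\<forall>\<^sub>F h in at_right 0. w (t + h)<=w t + e * h"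
 shows "w b<=w a"
proof (rule field_le_epsilon)
 fix e' :: real assume e': "e'>0"
 define e where "e=e'/(b - a+1)"
 have e:"e>0" using e' ab by (simp add:e_def)
 define S where "S={t\<in>{a..b}. w t - e * (t - a)<=w a}"
 have "closed S" unfolding S_def by (intro continuous_on_closed_Collect_le continuous_intros cont)
 have aS:"a:S" using ab by (simp add:S_def)
 have bdd:"bdd_above S" by (auto simp:S_def intro: bdd_aboveI[of _ b])
 define c where "c=Sup S"
 have cS:"c:S" unfolding c_def using closed_contains_Sup[OF _ bdd \<open>closed S\<close>] aS by auto
 have "c=b"
 proof (rule ccontr)
  assume "c~=b"
  then have c:"a<=c" "c<b" using cS by (auto simp:S_def)
  have "\<forall>\<^sub>F h in at_right 0. w (c + h)<=w c + e * h&h>0&h<b - c"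
   using dini[OF c e] eventually_at_right_less[of 0] eventually_at_right_real[of 0 "b - c"] c
   by (auto simp:eventually_conj_iff elim: eventually_mono)
  from eventually_happens'[OF _ this] obtain h where h:"w (c + h)<=w c + e * h" "h>0" "h<b - c" by auto
  have "c + h:S" using h c cS by (auto simp:S_def algebra_simps)
  then have "c + h<=c" unfolding c_def using bdd by (intro cSup_upper) auto
  then show False using h by simp
 qed
 then have "w b<=w a + e * (b - a)" using cS by (simp add:S_def)
 also have "e * (b - a)<=e'"
 proof -
  have "e * (b - a)<=e * (b - a+1)" using e by simp
  also have "...=e'" using ab by (simp add:e_def)
  finally show ?thesis .
 qed
 finally show "w b<=w a + e'" by simp
qed

locale kernel_form = semigroup_form mu E F P + sigma_finite_measure mu
 for mu :: "'a measure" and E F P +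
 fixes p :: "real => 'a => 'a=>real"
 assumes space_UNIV:"space mu=UNIV"
  and p_measurable:"t>0==>(%(x,y). p t x y):borel_measurable (mu \<Otimes>\<^sub>M mu)"
  and p_nonneg:"t>0==>p t x y>=0"
  and p_kernel:"t>0==>f:L2 mu==>AE x in mu.
   integrable mu (%y. p t x y * f y)&P t f x=(\<integral>y. p t x y * f y \<partial>mu)"
begin

definition unit_cut :: "('a=>real) => 'a=>real" where
 "unit_cut f x=min (max (f x) 0) 1"

lemma unit_cut_F:"f:F==>unit_cut f:F" using markovian_domain[of f] by (simp add:unit_cut_def[abs_def])

lemma unit_cut_E:"f:F==>E (unit_cut f) (unit_cut f)<=E f f" using markovian[of f] by (simp add:unit_cut_def[abs_def])

lemma P_nonneg_AE:
 assumes "t>0" "f:L2 mu" "AE x in mu. f x>=0"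
 shows "AE x in mu. P t f x>=0" using p_kernel[OF assms(1,2)]
proof eventually_elim
 case (elim x)
 have "(\<integral>y. p t x y * f y \<partial>mu)>=0" using assms(3) p_nonneg[OF assms(1)] by (intro integral_nonneg_AE) (auto elim!: eventually_mono)
 then show ?case using elim by simp
qed

text \<open>Write \<open>w = unit_cut v\<close> and \<open>g = v - w\<close>. For
  \<open>v >= 0\<close> the cut of \<open>w + s g\<close> is again \<open>w\<close> for every
  \<open>s >= 0\<close>, so the Markov property gives \<open>E w w <= E (w + s g) (w + s g)\<close>;
  the derivative at \<open>s = 0\<close> yields \<open>E w g >= 0\<close>. Adding
  \<open>E g g\<close> gives the claim.\<close>

lemma E_excess_nonneg:
 assumes v:"v:F" and v0:"AE x in mu. v x>=0"
 shows "E v (%x. v x - unit_cut v x)>=0"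
proof -
 let ?w = "unit_cut v" and ?g = "%x. v x - unit_cut v x"
 have wF:"?w:F" and gF:"?g:F" using v by (auto intro: unit_cut_F F_diff)
 have key:"0<=2 * E ?w ?g * s + E ?g ?g * s^2" if s:"s>=0" for s
 proof -
  let ?k = "%x. 1 * ?w x + s * ?g x"
  have kF:"?k:F" using wF gF by (rule F_lin)
  have eq:"AE x in mu. unit_cut ?k x=?w x" using v0
  proof eventually_elim
   case (elim x)
   show ?case
   proof (cases "v x<=1")
   case True then show ?thesis using elim by (simp add:unit_cut_def)
   next
   case False
   then have "s * (v x-1)>=0" using s by simp
   then show ?thesis using False by (simp add:unit_cut_def)
   qed
  qed
  have ukF:"unit_cut ?k:F" by (rule unit_cut_F[OF kF])
  have "E ?w ?w=E (unit_cut ?k) (unit_cut ?k)" using form_AE[OF ukF wF wF eq] form_AE[OF ukF wF ukF eq] form_sym[OF wF ukF] by simp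
  also have "...<=E ?k ?k" by (rule unit_cut_E[OF kF])
  also have "...=E ?w ?w+2 * E ?w ?g * s + E ?g ?g * s^2" unfolding E_expand[OF wF gF] by (simp add:algebra_simps)
  finally show ?thesis by simp
 qed
 have "E ?w ?g>=0"
 proof (rule ccontr)
  assume "\<not> ?thesis"
  then have neg:"E ?w ?g<0" by simp
  define s where "s = - E ?w ?g/(E ?g ?g+1)"
  have gg:"E ?g ?g>=0" by (rule form_nonneg[OF gF])
  have s:"s>0" using neg gg by (simp add:s_def divide_neg_pos)
  have "0<=s * (2 * E ?w ?g + E ?g ?g * s)" using key[of s] s by (simp add:power2_eq_square algebra_simps)
  then have "0<=2 * E ?w ?g + E ?g ?g * s" using s by (simp add:zero_le_mult_iff)
  moreover have "E ?g ?g * s<=(E ?g ?g+1) * s" using s by simp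
  moreover have "(E ?g ?g+1) * s = - E ?w ?g" using gg by (simp add:s_def)
  ultimately show False using neg by linarith
 qed
 moreover have "E (%x. 1 * ?w x+1 * ?g x) ?g=1 * E ?w ?g+1 * E ?g ?g" by (rule E_lin_left[OF wF gF gF])
 ultimately show ?thesis using form_nonneg[OF gF] by simp
qed

lemma excess_lipschitz:"\<bar>(x - min (max x 0) 1)-(y - min (max y 0) 1)\<bar><=\<bar>x - y :: real\<bar>" by linarith

text \<open>For the excess \<open>g t\<close> of \<open>P t f\<close> over 1, the squared norm has
  formal derivative \<open>- 2 E (P t f) (g t) <= 0\<close> by \<open>E_excess_nonneg\<close>, and
  it starts from 0. The derivative is replaced by a Dini estimate with error
  \<open>h * B * \<omega> h\<close>, where \<open>generator_bound\<close> supplies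
  \<open>B\<close>.\<close>

lemma P_le_one_F:
 assumes f:"f:F" and f01:"AE x in mu. 0<=f x&f x<=1" and t:"t>0"
 shows "AE x in mu. P t f x<=1"
proof -
 define g where "g t x=P t f x - unit_cut (P t f) x" for t x
 have vF:"P t f:F" if "t>0" for t using P_E_le(1)[OF that f] .
 have gF:"g t:F" if "t>0" for t using F_diff[OF vF[OF that] unit_cut_F[OF vF[OF that]]] by (simp add:g_def[abs_def])
 have v0:"AE x in mu. P t f x>=0" if "t>0" for t using P_nonneg_AE[OF that F_L2[OF f]] f01 by auto
 define \<omega> where "\<omega> h=nrm (%x. P h f x - f x)" for h
 have \<omega>0:"(\<omega> \<longlongrightarrow> 0) (at_right 0)" unfolding \<omega>_def by (rule P_strongly_continuous[OF F_L2[OF f]])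
 have lip:"nrm (%x. g s x - g t x)<=\<omega> \<bar>s - t\<bar>" if "s>0" "t>0" "s~=t" for s t
 proof -
  have "nrm (%x. g s x - g t x)<=nrm (%x. P s f x - P t f x)"
  proof (rule L2_norm_mono)
   show "AE x in mu. \<bar>g s x - g t x\<bar><=\<bar>P s f x - P t f x\<bar>" by (rule AE_I2) (unfold g_def unit_cut_def, rule excess_lipschitz)
  qed (use gF vF that in \<open>auto intro!: F_diff L2_measurable intro: F_L2\<close>)
  also have "...<=\<omega> \<bar>s - t\<bar>" unfolding \<omega>_def using that by (intro P_modulus_abs F_L2 f) auto
  finally show ?thesis .
 qed
 define W where "W t=ip (g t) (g t)" for t
 have W:"W t=(nrm (g t))^2" for t by (simp add:W_def L2_norm_square)
 have cont:"continuous_on {a..b} (%t. nrm (g t))" if a:"a>0" for a b unfolding continuous_on_iff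
 proof (intro ballI allI impI)
  fix t e :: real assume t:"t:{a..b}" and e:"e>0"
  then have "\<forall>\<^sub>F h in at_right 0. \<omega> h<e" using \<omega>0 by (intro order_tendstoD)
  then obtain dl where dl:"dl>0" "!!h. 0<h==>h<dl==>\<omega> h<e" unfolding eventually_at_right_field by auto
  show "EX d>0. ALL s:{a..b}. dist s t<d-->dist (nrm (g s)) (nrm (g t))<e"
  proof (intro exI conjI ballI impI)
   fix s assume s:"s:{a..b}" "dist s t<dl"
   show "dist (nrm (g s)) (nrm (g t))<e"
   proof (cases "s=t")
   case False
   have s0:"s>0" "t>0" using s t a by auto
   have L:"g s:L2 mu" "g t:L2 mu" using s0 by (auto intro: gF F_L2)
   have "nrm (g s)<=nrm (%x. g s x - g t x) + nrm (g t)" using L2_norm_triangle[OF L2_diff[OF L] L(2)] by simp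
   moreover have "nrm (g t)<=nrm (%x. g s x - g t x) + nrm (g s)"
   using L2_norm_triangle[OF L2_diff[OF L(2,1)] L(1)] by (simp add:L2_norm_minus_commute[of mu "g t"])
   moreover have "nrm (%x. g s x - g t x)<e" using lip[OF s0 False] dl(2)[of "\<bar>s - t\<bar>"] s False by (simp add:dist_real_def)
   ultimately show ?thesis by (simp add:dist_real_def abs_less_iff)
   qed (use e in simp)
  qed (fact dl(1))
 qed
 have dini:"\<forall>\<^sub>F h in at_right 0. W (t + h)<=W t + e * h" if t:"t>0" and e:"e>0" for t e
 proof -
  let ?v = "P t f"
  define B where "B=8/t * nrm f"
  have B0:"B>=0" using t by (simp add:B_def L2_norm_nonneg)
  have lim1:"((%h. sform h ?v (g t)/h) \<longlongrightarrow> E ?v (g t)) (at_right 0)" by (rule sform_limit_polar[OF vF[OF t] gF[OF t]])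
  have "E ?v (g t)>=0" using E_excess_nonneg[OF vF[OF t] v0[OF t]] by (simp add:g_def[abs_def])
  then have ev1:"\<forall>\<^sub>F h in at_right 0. sform h ?v (g t)/h > - (e/4)" using lim1 e by (intro order_tendstoD(1)) auto
  have "((%h. B * \<omega> h) \<longlongrightarrow> B * 0) (at_right 0)" by (intro tendsto_intros \<omega>0)
  then have ev2:"\<forall>\<^sub>F h in at_right 0. B * \<omega> h<e/4" using e by (intro order_tendstoD(2)) auto
  have ev3:"\<forall>\<^sub>F h in at_right 0. h>0&h<t/4" using eventually_at_right_less[of 0] eventually_at_right_real[of 0 "t/4"] t
   by (auto simp:eventually_conj_iff elim: eventually_mono)
  show ?thesis using ev1 ev2 ev3
  proof eventually_elim
   case (elim h)
   then have h:"h>0" "t>=4 * h" and th:"t + h>0" using t by auto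
   have L:"g (t + h):L2 mu" "g t:L2 mu" "?v:L2 mu" "P (t + h) f:L2 mu" using th t by (auto intro: gF vF F_L2)
   \<comment> \<open>Pointwise \<open>b^2 - a^2 <= 2 (b - a) b\<close> for the new excess
     \<open>b\<close> and the old \<open>a\<close>; where \<open>b > 0\<close>, the increment of the
     excess is at most that of \<open>P t f\<close>.\<close>
   have "W (t + h) - W t<=2 * ip (%x. P (t + h) f x - P t f x) (g (t + h))"
   proof -
   have "W (t + h) - W t=(\<integral>x. (g (t + h) x)^2-(g t x)\<^sup>2 \<partial>mu)" using L unfolding W_def L2_inner_def
   by (subst Bochner_Integration.integral_diff) (auto simp:L2_def power2_eq_square)
   also have "...<=(\<integral>x. 2*((P (t + h) f x - P t f x) * g (t + h) x) \<partial>mu)"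
   proof (rule integral_mono_AE)
   show "integrable mu (%x. (g (t + h) x)^2-(g t x)\<^sup>2)" using L by (auto simp:L2_def)
   show "integrable mu (%x. 2*((P (t + h) f x - P t f x) * g (t + h) x))" using L by (auto intro!: L2_integrable_mult L2_diff)
   show "AE x in mu. (g (t + h) x)^2-(g t x)\<^sup>2<=2*((P (t + h) f x - P t f x) * g (t + h) x)" using v0[OF th] v0[OF t]
   proof eventually_elim
   case (elim x)
   let ?b = "g (t + h) x" and ?a = "g t x"
   have b0:"?b>=0" using elim by (simp add:g_def unit_cut_def)
   have "(?b - ?a) * ?b<=(P (t + h) f x - P t f x) * ?b"
   proof (cases "?b=0")
   case False
   then have "?b - ?a<=P (t + h) f x - P t f x" using elim unfolding g_def unit_cut_def by linarith
   then show ?thesis using b0 by (rule mult_right_mono)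
   qed simp
   moreover have "?b^2 - ?a^2<=2*((?b - ?a) * ?b)" using zero_le_power2[of "?b - ?a"] by (simp add:power2_eq_square algebra_simps)
   ultimately show ?case by linarith
   qed
   qed
   finally show ?thesis by (simp add:L2_inner_def)
   qed
   also have "ip (%x. P (t + h) f x - P t f x) (g (t + h)) = - sform h ?v (g (t + h))"
   proof -
   have "AE x in mu. P (t + h) f x=P h ?v x" using P_semigroup_AE[OF h(1) t F_L2[OF f]] by (simp add:add.commute)
   then have "ip (P (t + h) f) (g (t + h))=ip (P h ?v) (g (t + h))" using L h by (intro L2_inner_cong_AE) (auto intro: L2_measurable P_L2)
   then show ?thesis using L by (simp add:sform_def L2_inner_diff_left)
   qed
   also have "- sform h ?v (g (t + h)) = - sform h ?v (g t) - sform h ?v (%x. g (t + h) x - g t x)"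
   using sform_lin_right[OF h(1) L(1,2,3), of 1 "-1"] by simp
   finally have fin:"W (t + h) - W t<=2*(- sform h ?v (g t) - sform h ?v (%x. g (t + h) x - g t x))" .
   \<comment> \<open>Replacing \<open>g (t + h)\<close> by \<open>g t\<close> in the form costs
     \<open>o(h)\<close>: the first argument contributes \<open>O(h)\<close> and the difference of
     the excesses tends to 0.\<close>
   have "- sform h ?v (%x. g (t + h) x - g t x)<=h * (B * \<omega> h)"
   proof -
   have "\<bar>sform h ?v (%x. g (t + h) x - g t x)\<bar><=nrm (%x. ?v x - P h ?v x) * nrm (%x. g (t + h) x - g t x)"
   using L h by (subst sform_eq) (auto intro!: L2_inner_bound L2_diff P_L2)
   also have "...<=(8 * h/t * nrm f) * \<omega> h" using generator_bound[OF h F_L2[OF f]] lip[OF th t] h t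
   by (intro mult_mono) (auto simp:L2_norm_nonneg)
   finally show ?thesis by (simp add:B_def mult_ac)
   qed
   have arith:"W'<=e'" if "W'<=2*(a - b)" "- b<=c" "2*(a + c)<=e'" for W' a b c e' :: real using that by argo
   have "W (t + h) - W t<=e * h"
   proof (rule arith[OF fin])
   show "- sform h ?v (%x. g (t + h) x - g t x)<=h * (B * \<omega> h)" by fact
   have c1:"- (e/4) * h<sform h ?v (g t)" using elim(1) h(1) by (simp add:pos_less_divide_eq)
   have c2:"h * (B * \<omega> h)<=h * (e/4)" using elim h by (intro mult_left_mono) auto
   have comb:"2*(- a + c)<=e * h" if "- (e/4) * h<a" "c<=h * (e/4)" for a c using that by (simp add:algebra_simps)
   show "2*(- sform h ?v (g t) + h * (B * \<omega> h))<=e * h" by (rule comb[OF c1 c2])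
   qed
   then show ?case by simp
  qed
 qed
 have mono:"nrm (g t)<=nrm (g a)" if "a>0" "a<=t" for a
 proof -
  have Weq:"W=(%t. (nrm (g t))^2)" using W by auto
  have "W t<=W a"
  proof (rule nonincreasing_of_Dini[where w = W and a = a and b = t])
   show "continuous_on {a..t} W" unfolding Weq using cont[OF that(1)] by (intro continuous_on_power)
   show "\<forall>\<^sub>F h in at_right 0. W (s + h)<=W s + e * h" if "a<=s" "s<t" "e>0" for s e using dini[of s e] that \<open>a > 0\<close> by simp
  qed (fact that(2))
  then show ?thesis unfolding W using L2_norm_nonneg by (rule power2_le_imp_le)
 qed
 have ga:"nrm (g a)<=\<omega> a" if a:"a>0" for a unfolding \<omega>_def
 proof (rule L2_norm_mono)
  show "AE x in mu. \<bar>g a x\<bar><=\<bar>P a f x - f x\<bar>" using f01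
  proof eventually_elim
   case (elim x)
   then show ?case using excess_lipschitz[of "P a f x" "f x"] by (simp add:g_def unit_cut_def)
  qed
 qed (use a f in \<open>auto intro!: L2_measurable gF L2_diff P_L2 intro: F_L2\<close>)
 have "nrm (g t)<=0"
 proof (rule tendsto_lowerbound[OF \<omega>0])
  show "\<forall>\<^sub>F a in at_right 0. nrm (g t)<=\<omega> a" using eventually_at_right_less[of 0] eventually_at_right_real[OF t]
  proof eventually_elim
   case (elim a)
   then show ?case using mono[of a] ga[of a] by simp
  qed
 qed simp
 then have "ip (g t) (g t)=0" using W[of t] L2_norm_nonneg[of mu "g t"] by (simp add:W_def)
 from L2_inner_zero_AE[OF F_L2[OF gF[OF t]] this] show ?thesis by eventually_elim (simp add:g_def unit_cut_def min_def split: if_splits)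
qed

text \<open>Approximates \<open>f\<close> in \<open>L2\<close> by cut elements of \<open>F\<close>,
  to which \<open>P_le_one_F\<close> applies. Thus \<open>P t f\<close> lies within
  \<open>1/(n+1)\<close> of a function with values in the unit interval, for every \<open>n\<close>,
  and its excess over that interval has norm zero.\<close>

lemma P_le_one:
 assumes f:"f:L2 mu" and f01:"!!x. 0<=f x&f x<=1" and t:"t>0"
 shows "AE x in mu. P t f x<=1"
proof -
 have "EX g:F. ip (%x. f x - g x) (%x. f x - g x)<(1/real (Suc n))^2" for n by (rule domain_dense[OF f]) simp
 then obtain g where g:"!!n. g n:F" "!!n. ip (%x. f x - g n x) (%x. f x - g n x)<(1/real (Suc n))^2" by metis
 let ?g = "%n. unit_cut (g n)" and ?v = "P t f"
 have gF:"?g n:F" for n by (rule unit_cut_F[OF g(1)])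
 have near:"nrm (%x. f x - ?g n x)<=1/real (Suc n)" for n
 proof -
  have "nrm (%x. f x - ?g n x)<=nrm (%x. f x - g n x)"
  proof (intro L2_norm_mono AE_I2)
   fix x show "\<bar>f x - ?g n x\<bar><=\<bar>f x - g n x\<bar>" using f01[of x] unfolding unit_cut_def by linarith
  qed (use f g gF in \<open>auto intro!: L2_measurable L2_diff intro: F_L2\<close>)
  also have "...<=1/real (Suc n)" unfolding L2_norm_def using g(2)[of n] by (intro real_le_lsqrt) (auto simp:less_imp_le)
  finally show ?thesis .
 qed
 let ?k = "%x. ?v x - unit_cut ?v x"
 have vL:"?v:L2 mu" by (rule P_L2[OF t f])
 have kL:"?k:L2 mu" by (rule L2_bound[OF _ vL]) (use vL[THEN L2_measurable] in \<open>auto simp:unit_cut_def\<close>)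
 have k:"nrm ?k<=1/real (Suc n)" for n
 proof -
  have "nrm ?k<=nrm (P t (%x. f x - ?g n x))"
  proof (rule L2_norm_mono)
   have "AE x in mu. P t (?g n) x<=1" by (rule P_le_one_F[OF gF[of n] _ t]) (simp add:unit_cut_def)
   moreover have "AE x in mu. 0<=P t (?g n) x" by (rule P_nonneg_AE[OF t F_L2[OF gF]]) (simp add:unit_cut_def)
   ultimately show "AE x in mu. \<bar>?k x\<bar><=\<bar>P t (%x. f x - ?g n x) x\<bar>" using P_diff_AE[OF t f F_L2[OF gF[of n]]]
   proof eventually_elim
   case (elim x)
   have "unit_cut (P t f) x<=P t f x | P t f x<0" unfolding unit_cut_def by linarith
   moreover have "\<bar>y - min (max y 0) 1\<bar><=\<bar>y - z\<bar>" if "0<=z" "z<=1" for y z :: real using that by linarith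
   ultimately show ?case using elim by (simp add:unit_cut_def)
   qed
  qed (use f gF kL t in \<open>auto intro!: L2_measurable P_L2 L2_diff intro: F_L2\<close>)
  also have "...<=nrm (%x. f x - ?g n x)" by (intro P_contr L2_diff f F_L2[OF gF] t)
  finally show ?thesis using near[of n] by linarith
 qed
 have "nrm ?k<=0" by (rule LIMSEQ_le_const[OF LIMSEQ_Suc[OF lim_1_over_n]]) (use k in auto)
 then have "nrm ?k=0" using L2_norm_nonneg[of mu ?k] by simp
 then have "ip ?k ?k=0" using L2_norm_square[of mu ?k] by simp
 from L2_inner_zero_AE[OF kL this] show ?thesis by eventually_elim (simp add:unit_cut_def min_def split: if_splits)
qed

subsection \<open>The kernel operators on bounded functions\<close>

definition kmass :: "real => 'a=>ennreal" where
 "kmass t x=(\<integral>\<^sup>+y. ennreal (p t x y) \<partial>mu)"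

text \<open>Discarding the null set where the kernel has mass above 1 makes all identities between the
 operators \<open>Q t\<close> below hold pointwise.\<close>

definition q :: "real => 'a => 'a=>real" where
 "q t x y=(if kmass t x<=1 then p t x y else 0)"

definition Q :: "real=>('a=>real) => 'a=>real" where
 "Q t f x=(\<integral>y. q t x y * f y \<partial>mu)"

text \<open>Bounded everywhere rather than almost everywhere: the operators \<open>Q t\<close> are
  integrals against honest kernels, so linearity and order hold at every point.\<close>

definition bdf :: "('a=>real) set" where
 "bdf={f:borel_measurable mu. EX C. ALL x. \<bar>f x\<bar><=C}"

lemma kmass_measurable [measurable]:"t>0==>kmass t:borel_measurable mu" unfolding kmass_def[abs_def] using p_measurable[of t] by measurable

text \<open>Indicators of an increasing exhaustion by sets of finite measure lie in
  \<open>L2\<close>, where \<open>P_le_one\<close> bounds the kernel integrals by 1; monotone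
  convergence does the rest.\<close>

lemma kmass_le_one: assumes t:"t>0" shows "AE x in mu. kmass t x<=1"
proof -
 obtain A :: "nat => 'a set" where A:"range A \<subseteq> sets mu" "(\<Union>i. A i)=space mu"
  "!!i. emeasure mu (A i)~=\<infinity>" "incseq A" using sigma_finite_incseq by metis
 have AL:"ind (A i):L2 mu" for i
 proof -
  have eq:"(%x. (ind (A i) x)^2)=ind (A i)" by (auto simp:indicator_def)
  show ?thesis unfolding L2_def using A by (auto simp:eq less_top intro!: integrable_real_indicator)
 qed
 have meas:"A i:sets mu" for i using A by auto
 have "AE x in mu. ALL i. integrable mu (%y. p t x y * ind (A i) y)&(\<integral>y. p t x y * ind (A i) y \<partial>mu)<=1"
 proof (subst AE_all_countable, rule allI)
  fix i
  from p_kernel[OF t AL[of i]] P_le_one[OF AL[of i] _ t]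
  show "AE x in mu. integrable mu (%y. p t x y * ind (A i) y)&(\<integral>y. p t x y * ind (A i) y \<partial>mu)<=1"
   by (auto elim: eventually_elim2 simp:indicator_def)
 qed
 then show ?thesis
 proof eventually_elim
  case (elim x)
  have pm:"(%y. p t x y):borel_measurable mu" using measurable_compose[OF measurable_Pair1' p_measurable[OF t], of x] by (simp add:space_UNIV)
  have "kmass t x=(\<integral>\<^sup>+y. (SUP i. ennreal (p t x y) * indicator (A i) y) \<partial>mu)"
  proof (unfold kmass_def, rule nn_integral_cong)
   fix y assume "y:space mu"
   then obtain i where i:"y:A i" using A(2) by blast
   show "ennreal (p t x y)=(SUP i. ennreal (p t x y) * indicator (A i) y)" by (intro antisym SUP_upper2[of i] SUP_least) (auto simp:i indicator_def)
  qed
  also have "...=(SUP i. \<integral>\<^sup>+y. ennreal (p t x y) * indicator (A i) y \<partial>mu)" using A(4) meas pm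
   by (intro nn_integral_monotone_convergence_SUP) (auto simp:incseq_def le_fun_def indicator_def subset_eq)
  also have "...<=1"
  proof (rule SUP_least)
   fix i
   have "(\<integral>\<^sup>+y. ennreal (p t x y) * indicator (A i) y \<partial>mu)=(\<integral>\<^sup>+y. ennreal (p t x y * ind (A i) y) \<partial>mu)"
   by (intro nn_integral_cong) (auto simp:indicator_def)
   also have "...=ennreal (\<integral>y. p t x y * ind (A i) y \<partial>mu)" using elim p_nonneg[OF t] by (intro nn_integral_eq_integral) auto
   also have "...<=1" using elim by (simp add:ennreal_le_1)
   finally show "(\<integral>\<^sup>+y. ennreal (p t x y) * indicator (A i) y \<partial>mu)<=1" .
  qed
  finally show ?case .
 qed
qed

lemma q_nonneg:"t>0==>q t x y>=0" by (simp add:q_def p_nonneg)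

lemma q_measurable2 [measurable]:"t>0==>(%(x,y). q t x y):borel_measurable (mu \<Otimes>\<^sub>M mu)" unfolding q_def[abs_def] split_beta
 using p_measurable[of t, unfolded split_beta] by measurable

lemma q_measurable [measurable]:"t>0==>(%y. q t x y):borel_measurable mu"
 using measurable_compose[OF measurable_Pair1' q_measurable2, of x t] by (simp add:space_UNIV)

lemma q_mass:"t>0==>(\<integral>\<^sup>+y. ennreal (q t x y) \<partial>mu)<=1" by (cases "kmass t x<=1") (auto simp:q_def kmass_def[symmetric])

lemma q_integrable1:"t>0==>integrable mu (q t x)"
proof (rule integrableI_bounded)
 assume t:"t>0"
 have "(\<integral>\<^sup>+y. ennreal (norm (q t x y)) \<partial>mu)=(\<integral>\<^sup>+y. ennreal (q t x y) \<partial>mu)"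
  using q_nonneg[OF t] by (intro nn_integral_cong) simp
 also have "...<\<infinity>" using q_mass[OF t, of x] by (simp add:order_le_less_trans)
 finally show "(\<integral>\<^sup>+y. ennreal (norm (q t x y)) \<partial>mu)<\<infinity>" .
qed simp

lemma bdf_measurable:"f:bdf==>f:borel_measurable mu" by (simp add:bdf_def)

lemma bdd_funE:
 assumes "f:bdf" obtains C where "C>=0" "!!x. \<bar>f x\<bar><=C"
proof -
 obtain C where C:"!!x. \<bar>f x\<bar><=C" using assms by (auto simp:bdf_def)
 have "C>=0" using C[of undefined] by linarith
 then show thesis using C that by blast
qed

lemma bdd_funI:"f:borel_measurable mu==>(!!x. \<bar>f x\<bar><=C)==>f:bdf" by (auto simp:bdf_def)

lemma bdf_const:"(%x. c):bdf" by (rule bdd_funI[of _ "(abs c)"]) auto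

lemma bdf_lin: assumes "f:bdf" "g:bdf" shows "(%x. a * f x + b * g x):bdf"
proof -
 obtain C D where C:"!!x. \<bar>f x\<bar><=C" and D:"!!x. \<bar>g x\<bar><=D" using assms by (auto simp:bdf_def)
 show ?thesis
 proof (rule bdd_funI)
  fix x
  have "\<bar>a * f x + b * g x\<bar><=(abs a) * \<bar>f x\<bar> + (abs b) * \<bar>g x\<bar>"
   using abs_triangle_ineq[of "a * f x" "b * g x"] by (simp add:abs_mult)
  also have "...<=(abs a) * C + (abs b) * D" using C D by (intro add_mono mult_left_mono) auto
  finally show "\<bar>a * f x + b * g x\<bar><=(abs a) * C + (abs b) * D" .
 qed (use assms[THEN bdf_measurable] in measurable)
qed

lemma bdf_add:"f:bdf==>g:bdf==>(%x. f x + g x):bdf"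
 and bdf_diff:"f:bdf==>g:bdf==>(%x. f x - g x):bdf"
 and bdf_cmult:"f:bdf==>(%x. a * f x):bdf"
 using bdf_lin[of f g 1 1] bdf_lin[of f g 1 "-1"] bdf_lin[of f f a 0] by simp_all

lemma bdf_mult: assumes "f:bdf" "g:bdf" shows "(%x. f x * g x):bdf"
proof -
 obtain C D where C:"C>=0" "!!x. \<bar>f x\<bar><=C" and D:"D>=0" "!!x. \<bar>g x\<bar><=D" using assms by (metis bdd_funE)
 show ?thesis by (rule bdd_funI[of _ "C * D"])
   (use C D assms[THEN bdf_measurable] in \<open>auto simp:abs_mult intro!: mult_mono\<close>)
qed

lemma bdf_power2:"f:bdf==>(%x. (f x)^2):bdf" using bdf_mult[of f f] by (simp add:power2_eq_square)

lemma bdf_indicator:"A:sets mu==>ind A:bdf" by (rule bdd_funI[of _ 1]) (auto simp:indicator_def)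

lemma q_integrable: assumes t:"t>0" and f:"f:bdf" shows "integrable mu (%y. q t x y * f y)"
proof -
 obtain C where C:"!!x. \<bar>f x\<bar><=C" using f by (auto simp:bdf_def)
 have [measurable]:"f:borel_measurable mu" by (rule bdf_measurable[OF f])
 show ?thesis
 proof (rule Bochner_Integration.integrable_bound[of _ "%y. C * q t x y"])
  show "AE y in mu. norm (q t x y * f y)<=norm (C * q t x y)"
  proof (rule AE_I2)
   fix y
   have "\<bar>f y\<bar><=(abs C)" using C[of y] by linarith
   then show "norm (q t x y * f y)<=norm (C * q t x y)" by (simp add:abs_mult mult.commute[of "(abs C)"] mult_left_mono)
  qed
 qed (use t in \<open>auto intro: q_integrable1\<close>)
qed

lemma Q_lin:
 assumes "t>0" "f:bdf" "g:bdf"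
 shows "Q t (%y. a * f y + b * g y) x=a * Q t f x + b * Q t g x"
proof -
 have "Q t (%y. a * f y + b * g y) x=(\<integral>y. a * (q t x y * f y) + b * (q t x y * g y) \<partial>mu)"
  unfolding Q_def by (simp add:algebra_simps)
 also have "...=a * Q t f x + b * Q t g x" using q_integrable[OF assms(1,2)] q_integrable[OF assms(1,3)] by (simp add:Q_def)
 finally show ?thesis .
qed

lemma Q_add:"t>0==>f:bdf==>g:bdf==>Q t (%y. f y + g y) x=Q t f x + Q t g x"
 and Q_diff:"t>0==>f:bdf==>g:bdf==>Q t (%y. f y - g y) x=Q t f x - Q t g x"
 and Q_cmult:"Q t (%y. a * f y) x=a * Q t f x"
 using Q_lin[of t f g 1 1 x] Q_lin[of t f g 1 "-1" x] by (simp_all add: Q_def mult.left_commute)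

lemma Q_mono_AE:
 assumes "t>0" "f:bdf" "g:bdf" "AE y in mu. f y<=g y"
 shows "Q t f x<=Q t g x" unfolding Q_def
proof (intro integral_mono_AE q_integrable)
 show "AE y in mu. q t x y * f y<=q t x y * g y" using assms(4) by eventually_elim (use q_nonneg assms(1) in \<open>simp add:mult_left_mono\<close>)
qed (use assms in auto)

lemma Q_mono:"t>0==>f:bdf==>g:bdf==>(!!y. f y<=g y)==>Q t f x<=Q t g x" by (rule Q_mono_AE) auto

lemma Q_nonneg:"t>0==>(!!y. f y>=0)==>Q t f x>=0" unfolding Q_def by (intro Bochner_Integration.integral_nonneg) (auto simp:q_nonneg)

lemma Q_one: assumes "t>0" shows "Q t (%y. 1) x<=1"
proof -
 have "ennreal (Q t (%y. 1) x)=(\<integral>\<^sup>+y. ennreal (q t x y) \<partial>mu)"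
  using q_integrable1[OF assms] q_nonneg[OF assms] by (simp add:Q_def nn_integral_eq_integral)
 then show ?thesis using q_mass[OF assms, of x] by (metis ennreal_le_1)
qed

lemma Q_le_const: assumes "t>0" "f:bdf" "!!y. f y<=C" "C>=0" shows "Q t f x<=C"
proof -
 have "Q t f x<=Q t (%y. C * 1) x" using assms bdf_const[of C] by (intro Q_mono) auto
 also have "...<=C" using Q_one[OF assms(1), of x] assms(4) unfolding Q_cmult by (simp add:mult_left_le)
 finally show ?thesis .
qed

lemma Q_abs_le: assumes "t>0" "f:bdf" "!!y. \<bar>f y\<bar><=C" shows "\<bar>Q t f x\<bar><=C"
proof -
 have C:"C>=0" using assms(3)[of undefined] by linarith
 have "Q t f x<=C" using assms C by (intro Q_le_const) (auto simp:abs_le_iff)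
 moreover have "Q t (%y. - 1 * f y) x<=C" using assms C bdf_cmult[of f "-1"] by (intro Q_le_const) (auto simp:abs_le_iff)
 ultimately show ?thesis unfolding Q_cmult by (simp add:abs_le_iff)
qed

lemma Q_measurable:"t>0==>f:borel_measurable mu==>Q t f:borel_measurable mu"
proof -
 assume t:"t>0" and [measurable]:"f:borel_measurable mu"
 show ?thesis unfolding Q_def[abs_def] using q_measurable2[OF t] by measurable
qed

lemma Q_bdd:"t>0==>f:bdf==>Q t f:bdf"
proof -
 assume t:"t>0" and f:"f:bdf"
 obtain C where C:"!!x. \<bar>f x\<bar><=C" using bdd_funE[OF f] by metis
 show ?thesis by (rule bdd_funI[OF Q_measurable[OF t bdf_measurable[OF f]] Q_abs_le[OF t f C]])
qed

lemma Q_P: assumes "t>0" "f:L2 mu" shows "AE x in mu. Q t f x=P t f x"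
 using p_kernel[OF assms] kmass_le_one[OF assms(1)] by eventually_elim (simp add:Q_def q_def)


lemma Q_P_bdd_inner:
 assumes "t>0" "f:L2 mu" "g:L2 mu"
 shows "ip (Q t f) g=ip (P t f) g" using assms by (intro L2_inner_cong_AE Q_P Q_measurable P_measurable L2_measurable) auto

lemma Q_L2:"t>0==>f:L2 mu==>Q t f:L2 mu"
proof (rule L2_bound[OF Q_measurable P_L2])
 assume "t>0" "f:L2 mu"
 from Q_P[OF this] show "AE x in mu. \<bar>Q t f x\<bar><=\<bar>P t f x\<bar>" by eventually_elim simp
qed (auto intro: L2_measurable)

lemma Q_semigroup_AE:
 assumes "s>0" "t>0" "f:L2 mu" "f:bdf"
 shows "AE x in mu. Q (s + t) f x=Q s (Q t f) x"
proof -
 have "AE x in mu. P s (Q t f) x=P s (P t f) x" using assms by (intro P_cong_AE Q_L2 P_L2 Q_P) auto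
 with Q_P[of "s + t" f] Q_P[OF assms(1) Q_L2[OF assms(2,3)]] P_semigroup_AE[OF assms(1,2,3)]
 show ?thesis using assms by (auto elim: eventually_elim2)
qed

text \<open>Indicators of sets of finite measure exhaust the space, so symmetry on \<open>L\<^sup>2\<close> passes to all
 nonnegative measurable functions by monotone convergence.\<close>

definition NQ :: "real=>('a=>ennreal) => 'a=>ennreal" where
 "NQ t f x=(\<integral>\<^sup>+y. ennreal (q t x y) * f y \<partial>mu)"

lemma NQ_measurable:"t>0==>f:borel_measurable mu==>NQ t f:borel_measurable mu"
proof -
 assume t:"t>0" and [measurable]:"f:borel_measurable mu"
 show ?thesis unfolding NQ_def[abs_def] using q_measurable2[OF t] by measurable
qed

lemma NQ_eq_Q:
 assumes t:"t>0" and f:"f:bdf" and f0:"!!x. f x>=0"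
 shows "NQ t (%y. ennreal (f y)) x=ennreal (Q t f x)"
proof -
 have "NQ t (%y. ennreal (f y)) x=(\<integral>\<^sup>+y. ennreal (q t x y * f y) \<partial>mu)"
  unfolding NQ_def by (intro nn_integral_cong) (simp add:ennreal_mult f0 q_nonneg[OF t])
 also have "...=ennreal (Q t f x)" unfolding Q_def using q_integrable[OF t f] f0 q_nonneg[OF t] by (intro nn_integral_eq_integral) auto
 finally show ?thesis .
qed

lemma NQ_sup:
 assumes t:"t>0" and f:"!!n. f n:borel_measurable mu" and inc:"incseq f"
 shows "NQ t (SUP n. f n) x=(SUP n. NQ t (f n) x)"
proof -
 have "NQ t (SUP n. f n) x=(\<integral>\<^sup>+y. (SUP n. ennreal (q t x y) * f n y) \<partial>mu)"
  unfolding NQ_def by (intro nn_integral_cong) (simp add:SUP_mult_left_ennreal image_comp)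
 also have "...=(SUP n. NQ t (f n) x)" unfolding NQ_def using inc f q_measurable[OF t]
  by (intro nn_integral_monotone_convergence_SUP) (auto simp:incseq_def le_fun_def mult_left_mono)
 finally show ?thesis .
qed

lemma NQ_sym_sets:
 assumes t:"t>0" and A:"A:sets mu" and B:"B:sets mu"
 shows "(\<integral>\<^sup>+x. indicator B x * NQ t (indicator A) x \<partial>mu)=(\<integral>\<^sup>+x. indicator A x * NQ t (indicator B) x \<partial>mu)"
proof -
 obtain S :: "nat => 'a set" where S:"range S \<subseteq> sets mu" "(\<Union>i. S i)=space mu"
  "!!i. emeasure mu (S i)~=\<infinity>" "incseq S" using sigma_finite_incseq by metis
 have Sm:"S i:sets mu" for i using S by auto
 define L where "L A B=(\<integral>\<^sup>+x. indicator B x * NQ t (indicator A) x \<partial>mu)" for A B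
 have fin:"L (A Int S n) (B Int S n)=L (B Int S n) (A Int S n)" for n
 proof -
  have ind:"ind (C Int S n):L2 mu" "ind (C Int S n):bdf" if "C:sets mu" for C
  proof -
   have eq:"(%x. (ind (C Int S n) x)^2)=ind (C Int S n)" by (auto simp:indicator_def)
   have "emeasure mu (C Int S n)<=emeasure mu (S n)" using that Sm by (intro emeasure_mono) auto
   then have "emeasure mu (C Int S n)<\<infinity>" using neq_top_trans[of "emeasure mu (S n)"] S(3)[of n] by (simp add:less_top[symmetric])
   then show "ind (C Int S n):L2 mu" unfolding L2_def using that Sm[of n] by (auto simp:eq intro!: integrable_real_indicator)
   show "ind (C Int S n):bdf" using that Sm[of n] by (intro bdf_indicator) auto
  qed
  have "L (C Int S n) (D Int S n)=ennreal (ip (P t (ind (C Int S n))) (ind (D Int S n)))"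
   if C:"C:sets mu" and D:"D:sets mu" for C D
  proof -
   let ?c = "ind (C Int S n)" and ?d = "ind (D Int S n)"
   have e:"(%x. ennreal (?c x))=indicator (C Int S n)" by (auto simp:indicator_def)
   have "L (C Int S n) (D Int S n)=(\<integral>\<^sup>+x. ennreal (Q t ?c x * ?d x) \<partial>mu)" unfolding L_def
   proof (rule nn_integral_cong)
   fix x
   have "NQ t (indicator (C Int S n)) x=ennreal (Q t ?c x)" using NQ_eq_Q[OF t ind(2)[OF C], of x] by (simp add:e)
   then show "indicator (D Int S n) x * NQ t (indicator (C Int S n)) x=ennreal (Q t ?c x * ?d x)" by (auto simp:indicator_def)
   qed
   also have "...=ennreal (\<integral>x. Q t ?c x * ?d x \<partial>mu)"
   proof (rule nn_integral_eq_integral)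
   show "integrable mu (%x. Q t ?c x * ?d x)" by (intro L2_integrable_mult Q_L2 t ind C D)
   show "AE x in mu. 0<=Q t ?c x * ?d x" by (auto intro!: mult_nonneg_nonneg Q_nonneg t)
   qed
   also have "(\<integral>x. Q t ?c x * ?d x \<partial>mu)=ip (P t ?c) ?d"
   using Q_P_bdd_inner[OF t ind(1)[OF C] ind(1)[OF D]] by (simp add:L2_inner_def)
   finally show ?thesis .
  qed
  then show ?thesis using A B P_sym[OF t ind(1)[OF A] ind(1)[OF B]] by (simp add:L2_inner_commute)
 qed
 have sup:"L C D=(SUP n. L (C Int S n) (D Int S n))" if C:"C:sets mu" and D:"D:sets mu" for C D
 proof -
  have incC:"incseq (%n. indicator (C Int S n) :: 'a=>ennreal)" for C using S(4) by (auto simp:incseq_def le_fun_def indicator_def)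
  have supC:"(SUP n. indicator (C Int S n))=(indicator C :: 'a=>ennreal)" for C
  proof
   fix x
   obtain i where "x:S i" using S(2) space_UNIV by blast
   then show "(SUP n. indicator (C Int S n)) x=(indicator C x :: ennreal)"
   unfolding SUP_apply by (intro antisym SUP_upper2[of i] SUP_least) (auto simp:indicator_def)
  qed
  have mC:"(indicator (C Int S n) :: 'a=>ennreal):borel_measurable mu" if "C:sets mu" for C n using that Sm[of n] by auto
  have inc2:"incseq (%n x. indicator (D Int S n) x * NQ t (indicator (C Int S n)) x)"
  proof (rule incseq_SucI, rule le_funI)
   fix n x
   have "NQ t (indicator (C Int S n)) x<=NQ t (indicator (C Int S (Suc n))) x" unfolding NQ_def using incseq_SucD[OF incC[of C], of n]
   by (intro nn_integral_mono mult_left_mono) (auto simp:le_fun_def)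
   then show "indicator (D Int S n) x * NQ t (indicator (C Int S n)) x
   <= indicator (D Int S (Suc n)) x * NQ t (indicator (C Int S (Suc n))) x"
   using incseq_SucD[OF incC[of D], of n] by (intro mult_mono) (auto simp:le_fun_def)
  qed
  have "L C D=(\<integral>\<^sup>+x. (SUP n. indicator (D Int S n) x * NQ t (indicator (C Int S n)) x) \<partial>mu)" unfolding L_def
  proof (rule nn_integral_cong)
   fix x
   have "NQ t (indicator C) x=(SUP n. NQ t (indicator (C Int S n)) x)" using NQ_sup[OF t mC[OF C] incC, of x] by (simp add:supC)
   moreover obtain i where i:"x:S i" using S(2) space_UNIV by blast
   have "indicator D x * (SUP n. NQ t (indicator (C Int S n)) x)=(SUP n. indicator (D Int S n) x * NQ t (indicator (C Int S n)) x)"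
   proof (rule antisym)
   show "indicator D x * (SUP n. NQ t (indicator (C Int S n)) x)<=(SUP n. indicator (D Int S n) x * NQ t (indicator (C Int S n)) x)"
   unfolding SUP_mult_left_ennreal
   proof (rule SUP_least)
   fix n
   have le1:"indicator D x<=(indicator (D Int S (max n i)) x :: ennreal)" using i incseqD[OF S(4), of i "max n i"] by (auto simp:indicator_def)
   have le2:"NQ t (indicator (C Int S n)) x<=NQ t (indicator (C Int S (max n i))) x" unfolding NQ_def using incseqD[OF incC[of C], of n "max n i"]
   by (intro nn_integral_mono mult_left_mono) (auto simp:le_fun_def)
   show "indicator D x * NQ t (indicator (C Int S n)) x<=(SUP n. indicator (D Int S n) x * NQ t (indicator (C Int S n)) x)"
   by (rule SUP_upper2[of "max n i"]) (auto intro: mult_mono le1 le2)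
   qed
   show "(SUP n. indicator (D Int S n) x * NQ t (indicator (C Int S n)) x)<=indicator D x * (SUP n. NQ t (indicator (C Int S n)) x)"
   by (rule SUP_least, rule mult_mono) (auto simp:indicator_def intro: SUP_upper)
   qed
   ultimately show "indicator D x * NQ t (indicator C) x=(SUP n. indicator (D Int S n) x * NQ t (indicator (C Int S n)) x)" by simp
  qed
  also have "...=(SUP n. L (C Int S n) (D Int S n))" unfolding L_def using inc2 NQ_measurable[OF t mC[OF C]] D Sm
   by (intro nn_integral_monotone_convergence_SUP) auto
  finally show ?thesis .
 qed
 show ?thesis using sup[OF A B] sup[OF B A] fin by (simp add:L_def)
qed

text \<open>Induction over \<open>f\<close>, with an induction over \<open>g\<close> nested in the
  case of an indicator.\<close>

lemma NQ_sym:
 assumes t:"t>0" and f:"f:borel_measurable mu" and g:"g:borel_measurable mu"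
 shows "(\<integral>\<^sup>+x. g x * NQ t f x \<partial>mu)=(\<integral>\<^sup>+x. f x * NQ t g x \<partial>mu)" using f
proof (induction f rule: borel_measurable_induct)
 case (cong f f')
 have "NQ t f'=NQ t f" using cong space_UNIV by (intro ext) (auto simp:NQ_def intro!: nn_integral_cong)
 moreover have "(\<integral>\<^sup>+x. f x * NQ t g x \<partial>mu)=(\<integral>\<^sup>+x. f' x * NQ t g x \<partial>mu)"
  using cong by (intro nn_integral_cong) auto
 ultimately show ?case using cong by simp
next
 case (set A)
 show ?case using g
 proof (induction g rule: borel_measurable_induct)
  case (cong f f')
  have "NQ t f'=NQ t f" using cong space_UNIV by (intro ext) (auto simp:NQ_def intro!: nn_integral_cong)
  moreover have "(\<integral>\<^sup>+x. f x * NQ t (indicator A) x \<partial>mu)=(\<integral>\<^sup>+x. f' x * NQ t (indicator A) x \<partial>mu)"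
   using cong by (intro nn_integral_cong) auto
  ultimately show ?case using cong by simp
 next
  case (set B)
  then show ?case using NQ_sym_sets[OF t \<open>A \<in> sets mu\<close>] by simp
 next
  case (mult u c)
  have e:"NQ t (%x. c * u x) x=c * NQ t u x" for x
   unfolding NQ_def using mult q_measurable[OF t] by (subst nn_integral_cmult[symmetric]) (auto simp:mult_ac)
  have "(\<integral>\<^sup>+x. (c * u x) * NQ t (indicator A) x \<partial>mu)=c * (\<integral>\<^sup>+x. u x * NQ t (indicator A) x \<partial>mu)"
   using mult NQ_measurable[OF t, of "indicator A"] set by (subst nn_integral_cmult[symmetric]) (auto simp:mult_ac)
  also have "...=c * (\<integral>\<^sup>+x. indicator A x * NQ t u x \<partial>mu)" using mult by simp
  also have "...=(\<integral>\<^sup>+x. indicator A x * NQ t (%x. c * u x) x \<partial>mu)"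
   using mult NQ_measurable[OF t, of u] set by (subst nn_integral_cmult[symmetric]) (auto simp:mult_ac e)
  finally show ?case .
 next
  case (add u v)
  have e:"NQ t (%x. v x + u x) x=NQ t v x + NQ t u x" for x
   unfolding NQ_def using add q_measurable[OF t] by (subst nn_integral_add[symmetric]) (auto simp:distrib_left)
  have "(\<integral>\<^sup>+x. (v x + u x) * NQ t (indicator A) x \<partial>mu)=(\<integral>\<^sup>+x. v x * NQ t (indicator A) x \<partial>mu)+(\<integral>\<^sup>+x. u x * NQ t (indicator A) x \<partial>mu)"
   using add NQ_measurable[OF t, of "indicator A"] set by (subst nn_integral_add[symmetric]) (auto simp:distrib_right)
  also have "...=(\<integral>\<^sup>+x. indicator A x * NQ t v x \<partial>mu)+(\<integral>\<^sup>+x. indicator A x * NQ t u x \<partial>mu)" using add by simp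
  also have "...=(\<integral>\<^sup>+x. indicator A x * NQ t (%x. v x + u x) x \<partial>mu)"
   using add NQ_measurable[OF t, of u] NQ_measurable[OF t, of v] set by (subst nn_integral_add[symmetric]) (auto simp:distrib_left e)
  finally show ?case .
 next
  case (seq U)
  have "(\<integral>\<^sup>+x. (SUP i. U i) x * NQ t (indicator A) x \<partial>mu)=(\<integral>\<^sup>+x. (SUP i. U i x * NQ t (indicator A) x) \<partial>mu)"
   by (intro nn_integral_cong) (simp add:SUP_mult_right_ennreal image_comp)
  also have "...=(SUP i. \<integral>\<^sup>+x. U i x * NQ t (indicator A) x \<partial>mu)" using seq NQ_measurable[OF t, of "indicator A"] set
   by (intro nn_integral_monotone_convergence_SUP) (auto simp:incseq_def le_fun_def mult_right_mono)
  also have "...=(SUP i. \<integral>\<^sup>+x. indicator A x * NQ t (U i) x \<partial>mu)" using seq by simp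
  also have "...=(\<integral>\<^sup>+x. (SUP i. indicator A x * NQ t (U i) x) \<partial>mu)"
  proof (rule nn_integral_monotone_convergence_SUP[symmetric])
   show "incseq (%i x. indicator A x * NQ t (U i) x)" using seq by (auto simp:incseq_def le_fun_def NQ_def intro!: mult_left_mono nn_integral_mono)
  qed (use seq NQ_measurable[OF t, of "U _"] set in auto)
  also have "...=(\<integral>\<^sup>+x. indicator A x * NQ t (SUP i. U i) x \<partial>mu)"
   using seq by (intro nn_integral_cong) (simp add:NQ_sup[OF t] SUP_mult_left_ennreal)
  finally show ?case .
 qed
next
 case (mult u c)
 have e:"NQ t (%x. c * u x) x=c * NQ t u x" for x
  unfolding NQ_def using mult q_measurable[OF t] by (subst nn_integral_cmult[symmetric]) (auto simp:mult_ac)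
 have "(\<integral>\<^sup>+x. g x * NQ t (%x. c * u x) x \<partial>mu)=c * (\<integral>\<^sup>+x. g x * NQ t u x \<partial>mu)"
  using mult NQ_measurable[OF t, of u] g by (subst nn_integral_cmult[symmetric]) (auto simp:mult_ac e)
 also have "...=c * (\<integral>\<^sup>+x. u x * NQ t g x \<partial>mu)" using mult by simp
 also have "...=(\<integral>\<^sup>+x. (c * u x) * NQ t g x \<partial>mu)"
  using mult NQ_measurable[OF t g] by (subst nn_integral_cmult[symmetric]) (auto simp:mult_ac)
 finally show ?case .
next
 case (add u v)
 have e:"NQ t (%x. v x + u x) x=NQ t v x + NQ t u x" for x
  unfolding NQ_def using add q_measurable[OF t] by (subst nn_integral_add[symmetric]) (auto simp:distrib_left)
 have "(\<integral>\<^sup>+x. g x * NQ t (%x. v x + u x) x \<partial>mu)=(\<integral>\<^sup>+x. g x * NQ t v x \<partial>mu)+(\<integral>\<^sup>+x. g x * NQ t u x \<partial>mu)"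
  using add NQ_measurable[OF t, of u] NQ_measurable[OF t, of v] g by (subst nn_integral_add[symmetric]) (auto simp:distrib_left e)
 also have "...=(\<integral>\<^sup>+x. v x * NQ t g x \<partial>mu)+(\<integral>\<^sup>+x. u x * NQ t g x \<partial>mu)" using add by simp
 also have "...=(\<integral>\<^sup>+x. (v x + u x) * NQ t g x \<partial>mu)"
  using add NQ_measurable[OF t g] by (subst nn_integral_add[symmetric]) (auto simp:distrib_right)
 finally show ?case .
next
 case (seq U)
 have "(\<integral>\<^sup>+x. g x * NQ t (SUP i. U i) x \<partial>mu)=(\<integral>\<^sup>+x. (SUP i. g x * NQ t (U i) x) \<partial>mu)"
  using seq by (intro nn_integral_cong) (simp add:NQ_sup[OF t] SUP_mult_left_ennreal)
 also have "...=(SUP i. \<integral>\<^sup>+x. g x * NQ t (U i) x \<partial>mu)"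
 proof (rule nn_integral_monotone_convergence_SUP)
  show "incseq (%i x. g x * NQ t (U i) x)" using seq by (auto simp:incseq_def le_fun_def NQ_def intro!: mult_left_mono nn_integral_mono)
 qed (use seq NQ_measurable[OF t, of "U _"] g in auto)
 also have "...=(SUP i. \<integral>\<^sup>+x. U i x * NQ t g x \<partial>mu)" using seq by simp
 also have "...=(\<integral>\<^sup>+x. (SUP i. U i x * NQ t g x) \<partial>mu)" using seq NQ_measurable[OF t g]
  by (intro nn_integral_monotone_convergence_SUP[symmetric]) (auto simp:incseq_def le_fun_def mult_right_mono)
 also have "...=(\<integral>\<^sup>+x. (SUP i. U i) x * NQ t g x \<partial>mu)"
  by (intro nn_integral_cong) (simp add:SUP_mult_right_ennreal image_comp)
 finally show ?case .
qed

lemma integrable_mult_bdd: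
 assumes "integrable mu f" "g:bdf" shows "integrable mu (%x. f x * g x)"
proof -
 obtain C where C:"C>=0" "!!x. \<bar>g x\<bar><=C" using bdd_funE[OF assms(2)] by metis
 show ?thesis
 proof (rule Bochner_Integration.integrable_bound[of _ "%x. C * f x"])
  show "AE x in mu. norm (f x * g x)<=norm (C * f x)"
  proof (rule AE_I2)
   fix x
   have "\<bar>f x\<bar> * \<bar>g x\<bar><=\<bar>f x\<bar> * C" using C(2) by (intro mult_left_mono) auto
   then show "norm (f x * g x)<=norm (C * f x)" using C(1) by (simp add:abs_mult mult.commute)
  qed
 qed (use assms bdf_measurable[OF assms(2)] in auto)
qed

lemma Q_integrable_sym_nonneg:
 assumes t:"t>0" and f:"f:bdf" "integrable mu f" "!!x. f x>=0"
  and g:"g:bdf" "!!x. g x>=0"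
 shows "integrable mu (%x. Q t f x * g x)" "(\<integral>x. Q t f x * g x \<partial>mu)=(\<integral>x. f x * Q t g x \<partial>mu)"
proof -
 have L:"(\<integral>\<^sup>+x. ennreal (g x) * NQ t (%y. ennreal (f y)) x \<partial>mu)=(\<integral>\<^sup>+x. ennreal (Q t f x * g x) \<partial>mu)"
  using NQ_eq_Q[OF t f(1,3)] Q_nonneg[OF t f(3)] g(2) by (intro nn_integral_cong) (simp add:ennreal_mult mult.commute)
 have R:"(\<integral>\<^sup>+x. ennreal (f x) * NQ t (%y. ennreal (g y)) x \<partial>mu)=(\<integral>\<^sup>+x. ennreal (f x * Q t g x) \<partial>mu)"
  using NQ_eq_Q[OF t g(1,2)] Q_nonneg[OF t g(2)] f(3) by (intro nn_integral_cong) (simp add:ennreal_mult mult.commute)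
 have eq:"(\<integral>\<^sup>+x. ennreal (Q t f x * g x) \<partial>mu)=(\<integral>\<^sup>+x. ennreal (f x * Q t g x) \<partial>mu)"
  using NQ_sym[OF t, of "%y. ennreal (f y)" "%y. ennreal (g y)"] bdf_measurable[OF f(1)] bdf_measurable[OF g(1)] by (simp add:L R)
 have iR:"integrable mu (%x. f x * Q t g x)" by (rule integrable_mult_bdd[OF f(2) Q_bdd[OF t g(1)]])
 have nR:"(\<integral>\<^sup>+x. ennreal (f x * Q t g x) \<partial>mu)=ennreal (\<integral>x. f x * Q t g x \<partial>mu)"
  using iR f(3) Q_nonneg[OF t g(2)] by (intro nn_integral_eq_integral) auto
 have m:"(%x. Q t f x * g x):borel_measurable mu" using bdf_measurable[OF Q_bdd[OF t f(1)]] bdf_measurable[OF g(1)] by measurable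
 have nn:"AE x in mu. 0<=Q t f x * g x" using Q_nonneg[OF t f(3)] g(2) by auto
 show i:"integrable mu (%x. Q t f x * g x)" using eq nR nn m by (intro integrableI_nonneg) auto
 show "(\<integral>x. Q t f x * g x \<partial>mu)=(\<integral>x. f x * Q t g x \<partial>mu)"
  using eq nR nn_integral_eq_integral[OF i nn] f(3) Q_nonneg[OF t g(2)] Q_nonneg[OF t f(3)] g(2) by (simp add:Bochner_Integration.integral_nonneg)
qed

text \<open>Here \<open>g\<close> is only bounded, so symmetry on \<open>L2\<close> does not apply
  directly. The case \<open>g = 1\<close> turns the integral of \<open>Q h (f^2)\<close> into that
  of \<open>f^2 * Q h 1\<close>, which keeps track of the mass lost by the kernel.\<close>

lemma Q_integrable_sym:
 assumes t:"t>0" and f:"f:bdf" "integrable mu f" and g:"g:bdf"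
 shows "integrable mu (%x. Q t f x * g x)" "(\<integral>x. Q t f x * g x \<partial>mu)=(\<integral>x. f x * Q t g x \<partial>mu)"
proof -
 define pos neg where "pos=(%f x::'a. max (f x) 0 :: real)" and "neg=(%f x::'a. max (- f x) 0 :: real)"
 have bp:"pos k:bdf" "neg k:bdf" if k:"k:bdf" for k
 proof -
  obtain C where C:"C>=0" "!!x. \<bar>k x\<bar><=C" using bdd_funE[OF k] by metis
  have km:"k:borel_measurable mu" by (rule bdf_measurable[OF k])
  have b:"\<bar>max (k x) 0\<bar><=C" "\<bar>max (- k x) 0\<bar><=C" for x using C(1) C(2)[of x] by auto
  show "pos k:bdf" unfolding pos_def by (rule bdd_funI[of _ C]) (use km b in auto)
  show "neg k:bdf" unfolding neg_def by (rule bdd_funI[of _ C]) (use km b in auto)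
 qed
 have dec:"k=(%x. 1 * pos k x+(- 1) * neg k x)" for k by (auto simp:pos_def neg_def max_def)
 have nn:"pos k x>=0" "neg k x>=0" for k x by (auto simp:pos_def neg_def)
 have fi:"integrable mu (pos f)" "integrable mu (neg f)" using f(2) by (auto simp:pos_def neg_def)
 note S1 = Q_integrable_sym_nonneg[OF t bp(1)[OF f(1)] fi(1) nn(1) bp(1)[OF g] nn(1)]
 note S2 = Q_integrable_sym_nonneg[OF t bp(1)[OF f(1)] fi(1) nn(1) bp(2)[OF g] nn(2)]
 note S3 = Q_integrable_sym_nonneg[OF t bp(2)[OF f(1)] fi(2) nn(2) bp(1)[OF g] nn(1)]
 note S4 = Q_integrable_sym_nonneg[OF t bp(2)[OF f(1)] fi(2) nn(2) bp(2)[OF g] nn(2)]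
 have Qf:"Q t f x=Q t (pos f) x - Q t (neg f) x" for x using Q_lin[OF t bp(1)[OF f(1)] bp(2)[OF f(1)], of 1 "-1" x] dec[of f] by simp
 have Qg:"Q t g x=Q t (pos g) x - Q t (neg g) x" for x using Q_lin[OF t bp(1)[OF g] bp(2)[OF g], of 1 "-1" x] dec[of g] by simp
 have fx:"f x=pos f x - neg f x" and gx:"g x=pos g x - neg g x" for x using fun_cong[OF dec[of f], of x] fun_cong[OF dec[of g], of x] by simp_all
 have e1:"(%x. Q t f x * g x)=(%x. Q t (pos f) x * pos g x - Q t (pos f) x * neg g x
   - (Q t (neg f) x * pos g x - Q t (neg f) x * neg g x))"
  by (rule ext) (simp add:Qf gx algebra_simps)
 have e2:"(%x. f x * Q t g x)=(%x. pos f x * Q t (pos g) x - pos f x * Q t (neg g) x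
   - (neg f x * Q t (pos g) x - neg f x * Q t (neg g) x))"
  by (rule ext) (simp add:Qg fx algebra_simps)
 have i:"integrable mu (%x. h x * Q t k x)" if "integrable mu h" "k:bdf" for h k using that by (intro integrable_mult_bdd Q_bdd t)
 show "integrable mu (%x. Q t f x * g x)" unfolding e1 by (intro Bochner_Integration.integrable_diff S1 S2 S3 S4)
 show "(\<integral>x. Q t f x * g x \<partial>mu)=(\<integral>x. f x * Q t g x \<partial>mu)"
  unfolding e1 e2 using S1 S2 S3 S4 i[OF fi(1) bp(1)[OF g]] i[OF fi(1) bp(2)[OF g]] i[OF fi(2) bp(1)[OF g]] i[OF fi(2) bp(2)[OF g]] by simp
qed

end

context kernel_form
begin

subsection \<open>The approximating energy densities\<close>

lemma bdd_L2_mult:"f:L2 mu==>g:bdf==>(%x. f x * g x):L2 mu" by (rule bdd_funE) (auto intro!: L2_mult_bounded bdf_measurable)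

lemma bdd_L2_power2:"f:L2 mu==>f:bdf==>(%x. (f x)^2):L2 mu" using bdd_L2_mult[of f f] by (simp add:power2_eq_square)

text \<open>For \<open>f \<in> F\<close> bounded, the measures with density \<open>edens h f\<close> converge vaguely to the energy
 measure of \<open>f\<close> as \<open>h\<close> tends to 0.\<close>

definition edens :: "real=>('a=>real) => 'a=>real" where
 "edens h f x=((f x)^2-2 * f x * Q h f x + Q h (%y. (f y)^2) x)/(2 * h)"

lemma Q_square_diff:
 assumes h:"h>0" and f:"f:bdf"
 shows "Q h (%y. (c - f y)^2) x=c^2 * Q h (%y. 1) x-2 * c * Q h f x + Q h (%y. (f y)^2) x"
proof -
 have "(%y. (c - f y)^2)=(%y. 1*(c^2*1+(- 2 * c) * f y)+1*(f y)^2)" by (rule ext) (simp add:power2_eq_square algebra_simps)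
 moreover have "Q h (%y. 1*(c^2*1+(- 2 * c) * f y)+1*(f y)^2) x
   = 1 * Q h (%y. c^2*1+(- 2 * c) * f y) x+1 * Q h (%y. (f y)^2) x"
  by (intro Q_lin h bdf_lin bdf_const f bdf_power2)
 moreover have "Q h (%y. c^2*1+(- 2 * c) * f y) x=c^2 * Q h (%y. 1) x+(- 2 * c) * Q h f x" by (intro Q_lin h bdf_const f)
 ultimately show ?thesis by simp
qed

text \<open>A jump part and a killing part, both visibly nonnegative because
  \<open>Q h 1 <= 1\<close>.\<close>

lemma edens_eq:
 assumes "h>0" "f:bdf"
 shows "edens h f x=(Q h (%y. (f x - f y)^2) x+(f x)^2*(1 - Q h (%y. 1) x))/(2 * h)"
 unfolding Q_square_diff[OF assms] edens_def by (simp add:algebra_simps)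

lemma edens_nonneg:"h>0==>f:bdf==>edens h f x>=0" unfolding edens_eq using Q_one[of h x]
 by (intro divide_nonneg_nonneg add_nonneg_nonneg Q_nonneg mult_nonneg_nonneg) auto

lemma Q_square_le_edens:
 assumes "h>0" "f:bdf"
 shows "Q h (%y. (f x - f y)^2) x<=2 * h * edens h f x"
 using assms(1) Q_one[OF assms(1), of x] unfolding edens_eq[OF assms] by (simp add:mult_nonneg_nonneg)

lemma edens_bdd:"h>0==>f:bdf==>edens h f:bdf"
proof -
 assume h:"h>0" and f:"f:bdf"
 have e:"edens h f=(%x. 1/(2 * h)*(1*(1*(f x)^2+(- 2)*(f x * Q h f x))+1 * Q h (%y. (f y)^2) x))" by (rule ext) (simp add:edens_def)
 show ?thesis unfolding e by (intro bdf_cmult bdf_lin bdf_power2 bdf_mult Q_bdd f h)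
qed

lemma Q_square_integrable:
 assumes h:"h>0" and f:"f:bdf" "f:L2 mu"
 shows "integrable mu (Q h (%y. (f y)^2))"
  "(\<integral>x. Q h (%y. (f y)^2) x \<partial>mu)=(\<integral>x. (f x)^2 * Q h (%y. 1) x \<partial>mu)"
 using Q_integrable_sym[OF h bdf_power2[OF f(1)] L2_integrable_square[OF f(2)] bdf_const[of 1]] by simp_all

text \<open>Symmetry replaces the integral of \<open>Q h (f^2)\<close> by that of
  \<open>f^2 * Q h 1\<close>. The mass falls short of the form because the killing part enters it
  with half the weight.\<close>

lemma edens_mass:
 assumes h:"h>0" and f:"f:bdf" "f:L2 mu"
 shows "integrable mu (edens h f)" "(\<integral>x. edens h f x \<partial>mu)<=sform h f f/h"
proof -
 have e:"edens h f=(%x. ((f x)^2-2*(Q h f x * f x) + Q h (%y. (f y)^2) x)/(2 * h))" by (rule ext) (simp add:edens_def)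
 have i1:"integrable mu (%x. (f x)^2)" by (rule L2_integrable_square[OF f(2)])
 have i2:"integrable mu (%x. Q h f x * f x)" by (intro L2_integrable_mult Q_L2 h f)
 note i3 = Q_square_integrable[OF h f]
 show "integrable mu (edens h f)" unfolding e using i1 i2 i3(1) by simp
 have i4:"integrable mu (%x. (f x)^2 * Q h (%y. 1) x)" by (intro integrable_mult_bdd i1 Q_bdd h bdf_const)
 have "(\<integral>x. (f x)^2 * Q h (%y. 1) x \<partial>mu)<=(\<integral>x. (f x)^2 \<partial>mu)"
  using Q_one[OF h] by (intro integral_mono i4 i1) (simp add:mult_left_le)
 then have "(\<integral>x. edens h f x \<partial>mu)<=(2*(\<integral>x. (f x)^2 \<partial>mu)-2*(\<integral>x. Q h f x * f x \<partial>mu))/(2 * h)"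
  unfolding e using i1 i2 i3 h by (simp add:divide_right_mono)
 also have "...=sform h f f/h"
 proof -
  have "(\<integral>x. Q h f x * f x \<partial>mu)=ip (P h f) f" using Q_P_bdd_inner[OF h f(2,2)] by (simp add:L2_inner_def)
  moreover have "(\<integral>x. (f x)^2 \<partial>mu)=ip f f" by (simp add:L2_inner_def power2_eq_square)
  ultimately show ?thesis using h by (simp add:sform_def divide_simps)
 qed
 finally show "(\<integral>x. edens h f x \<partial>mu)<=sform h f f/h" .
qed

text \<open>The finite-difference counterpart of the identity that defines the energy measure, with
  \<open>sform h\<close> divided by \<open>h\<close> in place of \<open>E\<close>.\<close>

lemma edens_formula:
 assumes h:"h>0" and f:"f:bdf" "f:L2 mu" and ph:"ph:bdf" "ph:L2 mu"
 shows "(\<integral>x. ph x * edens h f x \<partial>mu)=(sform h f (%x. f x * ph x)-1/2 * sform h (%x. (f x)^2) ph)/h"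
proof -
 have fph:"(%x. f x * ph x):L2 mu" by (rule bdd_L2_mult[OF f(2) ph(1)])
 have f2:"(%x. (f x)^2):L2 mu" by (rule bdd_L2_power2[OF f(2,1)])
 have i1:"integrable mu (%x. f x * (f x * ph x))" by (rule L2_integrable_mult[OF f(2) fph])
 have i2:"integrable mu (%x. Q h f x * (f x * ph x))" by (intro L2_integrable_mult Q_L2 h f fph)
 have i3:"integrable mu (%x. Q h (%y. (f y)^2) x * ph x)" by (intro L2_integrable_mult Q_L2 h f2 ph)
 have "(\<integral>x. ph x * edens h f x \<partial>mu)
   = (\<integral>x. (f x * (f x * ph x)-2*(Q h f x * (f x * ph x)) + Q h (%y. (f y)^2) x * ph x)/(2 * h) \<partial>mu)"
  by (rule Bochner_Integration.integral_cong)
   (auto simp:edens_def power2_eq_square algebra_simps add_divide_distrib diff_divide_distrib)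
 also have "...=(ip f (%x. f x * ph x)-2 * ip (Q h f) (%x. f x * ph x) + ip (Q h (%y. (f y)^2)) ph)/(2 * h)"
  using i1 i2 i3 by (simp add:L2_inner_def)
 also have "ip (Q h f) (%x. f x * ph x)=ip (P h f) (%x. f x * ph x)" by (rule Q_P_bdd_inner[OF h f(2) fph])
 also have "ip (Q h (%y. (f y)^2)) ph=ip (P h (%y. (f y)^2)) ph" by (rule Q_P_bdd_inner[OF h f2 ph(2)])
 also have "ip f (%x. f x * ph x)=ip (%x. (f x)^2) ph" by (simp add:L2_inner_def power2_eq_square mult.assoc)
 finally show ?thesis using h by (simp add:sform_def L2_inner_def power2_eq_square mult.assoc divide_simps)
qed

text \<open>The Beurling-Deny representation by jumps and killing, which reduces inequalities
  between values of \<open>sform\<close> to pointwise ones.\<close>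

lemma sform_Dirichlet:
 assumes h:"h>0" and f:"f:bdf" "f:L2 mu"
 defines "G==%x. Q h (%y. (f x - f y)^2) x/2+(f x)^2*(1 - Q h (%y. 1) x)"
 shows "integrable mu G" "sform h f f=(\<integral>x. G x \<partial>mu)"
proof -
 have e:"G=(%x. (f x)^2-(f x)\<^sup>2 * Q h (%y. 1) x/2 - Q h f x * f x + Q h (%y. (f y)^2) x/2)"
  unfolding G_def Q_square_diff[OF h f(1)] by (rule ext) (simp add:field_simps)
 have i1:"integrable mu (%x. (f x)^2)" by (rule L2_integrable_square[OF f(2)])
 have i2:"integrable mu (%x. Q h f x * f x)" by (intro L2_integrable_mult Q_L2 h f)
 note i3 = Q_square_integrable[OF h f]
 have i4:"integrable mu (%x. (f x)^2 * Q h (%y. 1) x)" by (intro integrable_mult_bdd i1 Q_bdd h bdf_const)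
 show "integrable mu G" unfolding e using i1 i2 i3(1) i4 by simp
 have "(\<integral>x. Q h f x * f x \<partial>mu)=ip (P h f) f" using Q_P_bdd_inner[OF h f(2,2)] by (simp add:L2_inner_def)
 moreover have "(\<integral>x. (f x)^2 \<partial>mu)=ip f f" by (simp add:L2_inner_def power2_eq_square)
 ultimately show "sform h f f=(\<integral>x. G x \<partial>mu)" unfolding e using i1 i2 i3 i4 by (simp add:sform_def)
qed

text \<open>Both summands of \<open>sform_Dirichlet\<close> are monotone in the squared differences
  and squared values. Products and truncations are instances.\<close>

lemma sform_compare:
 assumes h:"h>0" and f:"f:bdf" "f:L2 mu" and g:"g:bdf" "g:L2 mu"
  and k:"k:bdf" "k:L2 mu"
  and diff:"!!x y. (k x - k y)^2<=a * (f x - f y)^2 + b * (g x - g y)^2"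
  and val:"!!x. (k x)^2<=a * (f x)^2 + b * (g x)^2"
 shows "sform h k k<=a * sform h f f + b * sform h g g"
proof -
 note F = sform_Dirichlet[OF h f] and G = sform_Dirichlet[OF h g] and K = sform_Dirichlet[OF h k]
 have sq:"(%y. (c - u y)^2):bdf" if "u:bdf" for c u using that by (intro bdf_power2 bdf_diff bdf_const)
 let ?G = "%f x. Q h (%y. (f x - f y)^2) x/2+(f x)^2*(1 - Q h (%y. 1) x)"
 have "sform h k k<=(\<integral>x. a * ?G f x + b * ?G g x \<partial>mu)" unfolding K(2)
 proof (rule integral_mono[OF K(1)])
  show "integrable mu (%x. a * ?G f x + b * ?G g x)" using F(1) G(1) by simp
  fix x
  have "Q h (%y. (k x - k y)^2) x<=Q h (%y. a * (f x - f y)^2 + b * (g x - g y)^2) x" by (intro Q_mono h sq k bdf_lin f g diff)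
  also have "...=a * Q h (%y. (f x - f y)^2) x + b * Q h (%y. (g x - g y)^2) x" by (intro Q_lin h sq f g)
  finally have 1:"Q h (%y. (k x - k y)^2) x<=a * Q h (%y. (f x - f y)^2) x + b * Q h (%y. (g x - g y)^2) x" .
  have 2:"(k x)^2*(1 - Q h (%y. 1) x)<=(a * (f x)^2 + b * (g x)^2)*(1 - Q h (%y. 1) x)" using Q_one[OF h, of x] by (intro mult_right_mono val) auto
  have "A/2 + B<=a * (C/2 + c * m) + b * (D/2 + d * m)"
   if "A<=a * C + b * D" "B<=(a * c + b * d) * m" for A B C D c d m
   using that by (simp add:algebra_simps)
  from this[OF 1 2] show "?G k x<=a * ?G f x + b * ?G g x" .
 qed
 also have "...=a * sform h f f + b * sform h g g" unfolding F(2) G(2) using F(1) G(1) by simp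
 finally show ?thesis .
qed

text \<open>The Leibniz splitting \<open>f g - f' g' = g (f - f') + f' (g - g')\<close> and
  \<open>(a + b)^2 <= 2 a^2 + 2 b^2\<close> bound the approximating forms uniformly in
  \<open>h\<close>; \<open>sform_membership\<close> then puts the product into
  \<open>F\<close>.\<close>

lemma F_bdd_mult:
 assumes f:"f:F" "f:bdf" and g:"g:F" "g:bdf"
 shows "(%x. f x * g x):F"
proof -
 obtain C where C:"C>=0" "!!x. \<bar>f x\<bar><=C" using bdd_funE[OF f(2)] by metis
 obtain D where D:"D>=0" "!!x. \<bar>g x\<bar><=D" using bdd_funE[OF g(2)] by metis
 have L:"(%x. f x * g x):L2 mu" by (rule bdd_L2_mult[OF F_L2[OF f(1)] g(2)])
 have fC:"(f x)^2<=C^2" and gD:"(g x)^2<=D^2" for x using C D by (simp_all add: abs_le_square_iff[symmetric])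
 have "sform h (%x. f x * g x) (%x. f x * g x)/h<=2 * D^2 * E f f+2 * C^2 * E g g" if h:"h>0" for h
 proof -
  have "sform h (%x. f x * g x) (%x. f x * g x)<=(2 * D^2) * sform h f f+(2 * C^2) * sform h g g"
  proof (rule sform_compare[OF h f(2) F_L2[OF f(1)] g(2) F_L2[OF g(1)] bdf_mult[OF f(2) g(2)] L])
   fix x y
   have "(f x * g x - f y * g y)^2=(g x * (f x - f y) + f y * (g x - g y))^2" by (simp add:algebra_simps)
   also have "...<=2*(g x * (f x - f y))^2+2*(f y * (g x - g y))^2"
   using zero_le_power2[of "g x * (f x - f y) - f y * (g x - g y)"] by (simp add:power2_eq_square algebra_simps)
   also have "...<=2 * D^2*(f x - f y)^2+2 * C^2*(g x - g y)^2"
   using fC[of y] gD[of x] by (auto simp:power_mult_distrib intro!: add_mono mult_right_mono)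
   finally show "(f x * g x - f y * g y)^2<=2 * D^2*(f x - f y)^2+2 * C^2*(g x - g y)^2" .
  next
   fix x
   have "(f x * g x)^2<=(f x)^2 * D^2" using gD[of x] by (simp add:power_mult_distrib mult_left_mono)
   also have "...<=2 * D^2*(f x)^2+2 * C^2*(g x)^2"
   using mult_nonneg_nonneg[of "D^2" "(f x)^2"] mult_nonneg_nonneg[of "C^2" "(g x)^2"] by (simp add:algebra_simps)
   finally show "(f x * g x)^2<=2 * D^2*(f x)^2+2 * C^2*(g x)^2" .
  qed
  then have "sform h (%x. f x * g x) (%x. f x * g x)/h<=(2 * D^2 * sform h f f+2 * C^2 * sform h g g)/h" using h by (intro divide_right_mono) auto
  also have "...=2 * D^2*(sform h f f/h)+2 * C^2*(sform h g g/h)" by (simp add:add_divide_distrib)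
  also have "...<=2 * D^2 * E f f+2 * C^2 * E g g" by (intro add_mono mult_left_mono sform_div_le h f g) auto
  finally show ?thesis .
 qed
 from sform_membership(1)[OF L this] show ?thesis .
qed

lemma F_bdd_power2:"f:F==>f:bdf==>(%x. (f x)^2):F" using F_bdd_mult[of f f] by (simp add:power2_eq_square)

lemma edens_limit:
 assumes f:"f:F" "f:bdf" and ph:"ph:F" "ph:bdf"
 shows "((%h. \<integral>x. ph x * edens h f x \<partial>mu) \<longlongrightarrow> E f (%x. f x * ph x)-1/2 * E (%x. (f x)^2) ph) (at_right 0)"
proof (rule Lim_transform_eventually)
 show "((%h. sform h f (%x. f x * ph x)/h-1/2*(sform h (%x. (f x)^2) ph/h))
   \<longlongrightarrow> E f (%x. f x * ph x)-1/2 * E (%x. (f x)^2) ph) (at_right 0)"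
  by (intro tendsto_intros sform_limit_polar f F_bdd_mult F_bdd_power2 ph)
 show "\<forall>\<^sub>F h in at_right 0. sform h f (%x. f x * ph x)/h-1/2*(sform h (%x. (f x)^2) ph/h)
   = (\<integral>x. ph x * edens h f x \<partial>mu)"
  using eventually_at_right_less[of 0] by eventually_elim (use f ph in \<open>simp add:edens_formula F_L2 diff_divide_distrib\<close>)
qed

subsection \<open>Truncation\<close>

lemma truncate_abs:"\<bar>truncate k f x\<bar><=real k" "\<bar>truncate k f x\<bar><=\<bar>f x\<bar>" by (auto simp:truncate_def)

lemma truncate_measurable:"f:borel_measurable mu==>truncate k f:borel_measurable mu"
 unfolding truncate_def by (intro borel_measurable_max borel_measurable_min) auto

lemma truncate_bdd:"f:borel_measurable mu==>truncate k f:bdf" by (rule bdd_funI[OF truncate_measurable truncate_abs(1)])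

lemma truncate_L2:"f:L2 mu==>truncate k f:L2 mu" by (rule L2_bound[OF truncate_measurable[OF L2_measurable]]) (auto simp:truncate_abs)

lemma truncate_L2_limit:
 assumes f:"f:L2 mu" shows "(%k. nrm (%x. truncate k f x - f x)) ----> 0"
proof -
 have "(%k. \<integral>x. (truncate k f x - f x)^2 \<partial>mu) ----> (\<integral>x. 0 \<partial>mu)"
 proof (rule integral_dominated_convergence[where w = "%x. (f x)^2"])
  show "integrable mu (%x. (f x)^2)" by (rule L2_integrable_square[OF f])
  show "AE x in mu. (%k. (truncate k f x - f x)^2) ----> 0"
  proof (rule AE_I2)
   fix x
   obtain N :: nat where N:"\<bar>f x\<bar><=real N" using real_arch_simple by blast
   have "truncate k f x=f x" if "k>=N" for k
   proof -
   have "\<bar>f x\<bar><=real k" using N that by linarith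
   then show ?thesis by (auto simp:truncate_def)
   qed
   then have "\<forall>\<^sub>F k in sequentially. (truncate k f x - f x)^2=0" unfolding eventually_sequentially by auto
   then show "(%k. (truncate k f x - f x)^2) ----> 0" by (rule tendsto_eventually)
  qed
  show "AE x in mu. norm ((truncate k f x - f x)^2)<=(f x)^2" for k
  proof (rule AE_I2)
   fix x
   have "\<bar>truncate k f x - f x\<bar><=\<bar>f x\<bar>" by (auto simp:truncate_def)
   then show "norm ((truncate k f x - f x)^2)<=(f x)^2" by (simp add:abs_le_square_iff)
  qed
 qed (use L2_measurable[OF f] truncate_measurable[OF L2_measurable[OF f]] in auto)
 from tendsto_real_sqrt[OF this] show ?thesis by (simp add:L2_norm_def L2_inner_def power2_eq_square)
qed

text \<open>\<open>sform_compare\<close> speaks of bounded functions, so \<open>truncate k f\<close>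
  is compared with \<open>truncate m f\<close> for \<open>m >= k\<close>, and then \<open>m\<close>
  tends to infinity in \<open>L2\<close>.\<close>

lemma sform_truncate_le:
 assumes h:"h>0" and f:"f:L2 mu"
 shows "sform h (truncate k f) (truncate k f)<=sform h f f"
proof (rule tendsto_lowerbound)
 show "(%m. sform h (truncate m f) (truncate m f)) ----> sform h f f" by (intro sform_L2_limit h truncate_L2 f truncate_L2_limit)
 show "\<forall>\<^sub>F m in sequentially. sform h (truncate k f) (truncate k f)<=sform h (truncate m f) (truncate m f)"
  using eventually_ge_at_top[of k]
 proof eventually_elim
  case (elim m)
  have km:"real k<=real m" using elim by simp
  have fm:"f:borel_measurable mu" by (rule L2_measurable[OF f])
  have "sform h (truncate k f) (truncate k f)<=1 * sform h (truncate m f) (truncate m f)+0 * sform h (truncate m f) (truncate m f)"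
  proof (intro sform_compare h truncate_L2 truncate_bdd f fm)
   fix x y
   have "\<bar>truncate k f x - truncate k f y\<bar><=\<bar>truncate m f x - truncate m f y\<bar>" using km unfolding truncate_def by linarith
   then show "(truncate k f x - truncate k f y)^2<=1*(truncate m f x - truncate m f y)^2+0*(truncate m f x - truncate m f y)^2"
   by (simp add:abs_le_square_iff)
   have "\<bar>truncate k f x\<bar><=\<bar>truncate m f x\<bar>" using km unfolding truncate_def by linarith
   then show "(truncate k f x)^2<=1*(truncate m f x)^2+0*(truncate m f x)^2" by (simp add:abs_le_square_iff)
  qed
  then show ?case by simp
 qed
qed simp

lemma truncate_F:
 assumes f:"f:F"
 shows "truncate k f:F" "E (truncate k f) (truncate k f)<=E f f"
proof -
 have "sform h (truncate k f) (truncate k f)/h<=E f f" if h:"h>0" for h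
 proof -
  have "sform h (truncate k f) (truncate k f)/h<=sform h f f/h" using h by (intro divide_right_mono sform_truncate_le F_L2 f) auto
  then show ?thesis using sform_div_le[OF h f] by linarith
 qed
 from sform_membership[OF truncate_L2[OF F_L2[OF f]] this]
 show "truncate k f:F" "E (truncate k f) (truncate k f)<=E f f" by auto
qed

lemma truncate_E_limit:
 assumes f:"f:F"
 shows "(%k. E (%x. truncate k f x - f x) (%x. truncate k f x - f x)) ----> 0" by (intro E_strong_limit truncate_F f truncate_L2_limit F_L2)

section \<open>The kernel operators on the form domain\<close>

lemma Q_F: assumes "t>0" "f:F" shows "Q t f:F" "E (Q t f) (Q t f)<=E f f"
proof -
 have ae:"AE x in mu. P t f x=Q t f x" using Q_P[OF assms(1) F_L2[OF assms(2)]] by eventually_elim simp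
 have PF:"P t f:F" by (rule P_E_le(1)[OF assms])
 show QF:"Q t f:F" by (rule domain_AE[OF PF _ ae]) (intro Q_measurable assms L2_measurable F_L2)
 have "E (Q t f) (Q t f)=E (P t f) (P t f)" using form_AE[OF PF QF PF ae] form_AE[OF PF QF QF ae] form_sym[OF PF QF] by simp
 then show "E (Q t f) (Q t f)<=E f f" using P_E_le(2)[OF assms] by simp
qed

lemma Q_generator_bound:
 assumes h:"h>0" and t:"t>=4 * h" and f:"f:L2 mu"
 shows "nrm (%x. Q t f x - Q h (Q t f) x)<=8 * h/t * nrm f"
proof -
 have t0:"t>0" using h t by linarith
 have ae:"AE x in mu. P h (Q t f) x=P h (P t f) x" by (intro P_cong_AE Q_P h t0 f Q_L2 P_L2)
 have "nrm (%x. Q t f x - Q h (Q t f) x)<=nrm (%x. P t f x - P h (P t f) x)"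
 proof (rule L2_norm_mono)
  show "AE x in mu. \<bar>Q t f x - Q h (Q t f) x\<bar><=\<bar>P t f x - P h (P t f) x\<bar>"
   using ae Q_P[OF t0 f] Q_P[OF h Q_L2[OF t0 f]] by eventually_elim simp
 qed (auto intro!: L2_measurable L2_diff P_L2 Q_L2 h t0 f)
 then show ?thesis using generator_bound[OF h t f] by linarith
qed

lemma Q_E_limit:
 assumes f:"f:F"
 shows "(%n. E (%x. Q (1/real (Suc n)) f x - f x) (%x. Q (1/real (Suc n)) f x - f x)) ----> 0"
proof (rule E_strong_limit[OF Q_F(1)[OF _ f] f _ Q_F(2)[OF _ f]])
 have "filterlim (%n. 1/real (Suc n)) (at_right 0) sequentially" by real_asymp
 from filterlim_compose[OF P_strongly_continuous[OF F_L2[OF f]] this]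
 have lim:"(%n. nrm (%x. P (1/real (Suc n)) f x - f x)) ----> 0" .
 show "(%n. nrm (%x. Q (1/real (Suc n)) f x - f x)) ----> 0"
 proof (rule Lim_null_comparison[OF always_eventually lim], rule allI)
  fix n
  have t:"1/real (Suc n)>0" by simp
  have "nrm (%x. Q (1/real (Suc n)) f x - f x)<=nrm (%x. P (1/real (Suc n)) f x - f x)"
  proof (rule L2_norm_mono)
   show "AE x in mu. \<bar>Q (1/real (Suc n)) f x - f x\<bar><=\<bar>P (1/real (Suc n)) f x - f x\<bar>"
   using Q_P[OF t F_L2[OF f]] by eventually_elim simp
  qed (use f t in \<open>auto intro!: L2_measurable L2_diff P_L2 Q_L2 intro: F_L2\<close>)
  then show "norm (nrm (%x. Q (1/real (Suc n)) f x - f x))<=nrm (%x. P (1/real (Suc n)) f x - f x)" by (simp add:L2_norm_nonneg)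
 qed
qed auto

end

section \<open>Positive functionals on compactly supported functions\<close>

locale proper_metric =
 fixes metric_type :: "'a::metric_space itself"
 assumes compact_cball:"compact (cball (x::'a) r)"
begin

lemma CcI:
 fixes f :: "'a=>real"
 assumes "continuous_on UNIV f" "!!y. f y~=0==>y:cball x r"
 shows "f:Cc"
proof -
 have "closure {y. f y~=0} \<subseteq> cball x r" using assms(2) by (intro closure_minimal) auto
 then have "compact (closure {y. f y~=0})"
  using compact_Int_closed[OF compact_cball[of x r] closed_closure, of "{y. f y~=0}"] by (simp add:Int_absorb1)
 then show ?thesis using assms(1) by (simp add:Cc_def)
qed

end

lemma Cc_continuous:"f:Cc==>continuous_on UNIV f" by (simp add:Cc_def)

lemma Cc_measurable:"f:Cc==>f:borel_measurable borel" by (intro borel_measurable_continuous_onI Cc_continuous)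

lemma Cc_dominated:
 fixes f g :: "'a::topological_space=>real"
 assumes "f:Cc" "continuous_on UNIV g" "!!x. f x=0==>g x=0"
 shows "g:Cc"
proof -
 have "closure {y. g y~=0} \<subseteq> closure {y. f y~=0}" using assms(3) by (intro closure_mono) auto
 then have "closure {y. f y~=0} Int closure {y. g y~=0}=closure {y. g y~=0}" by auto
 moreover have "compact (closure {y. f y~=0} Int closure {y. g y~=0})" using assms(1) by (intro compact_Int_closed) (auto simp:Cc_def)
 ultimately show ?thesis using assms(2) by (simp add:Cc_def)
qed

lemma Cc_lin:
 fixes f g :: "'a::t2_space=>real"
 assumes "f:Cc" "g:Cc"
 shows "(%x. a * f x + b * g x):Cc"
proof -
 have "closure {x. a * f x + b * g x~=0} \<subseteq> closure ({x. f x~=0} Un {x. g x~=0})" by (rule closure_mono) auto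
 then have "closure {x. a * f x + b * g x~=0} \<subseteq> closure {x. f x~=0} Un closure {x. g x~=0}" by (simp add:closure_Un)
 moreover have "compact (closure {x. f x~=0} Un closure {x. g x~=0})" using assms by (auto simp:Cc_def intro: compact_Un)
 ultimately have "compact (closure {x. a * f x + b * g x~=0})"
  using compact_Int_closed[of "closure {x. f x~=0} Un closure {x. g x~=0}" "closure {x. a * f x + b * g x~=0}"] by (simp add:inf.absorb2)
 then show ?thesis using assms by (auto simp:Cc_def intro!: continuous_intros)
qed

lemma
 fixes f g :: "'a::t2_space=>real"
 shows Cc_add:"f:Cc==>g:Cc==>(%x. f x + g x):Cc"
  and Cc_diff:"f:Cc==>g:Cc==>(%x. f x - g x):Cc"
  and Cc_cmult:"f:Cc==>(%x. c * f x):Cc"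
 using Cc_lin[of f g 1 1] Cc_lin[of f g 1 "-1"] Cc_lin[of f f c 0] by simp_all

lemma Cc_zero:"(%x. 0):Cc" by (simp add:Cc_def)

lemma Cc_bounded:
 fixes f :: "'a::topological_space=>real"
 assumes f:"f:Cc" obtains C where "C>0" "!!x. \<bar>f x\<bar><=C"
proof -
 let ?K = "closure {x. f x~=0}"
 have "compact (f ` ?K)" using f by (intro compact_continuous_image) (auto simp:Cc_def intro: continuous_on_subset)
 then have "bounded (f ` ?K)" by (rule compact_imp_bounded)
 then obtain B where B:"!!x. x:?K==>\<bar>f x\<bar><=B" unfolding bounded_real by auto
 have "\<bar>f x\<bar><=max B 1" for x
 proof (cases "f x=0")
  case False
  then have "x:?K" using closure_subset by force
  then show ?thesis using B[of x] by linarith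
 qed auto
 then show thesis using that[of "max B 1"] by auto
qed

lemma Cc_integrable:
 fixes f :: "'a::topological_space=>real"
 assumes f:"f:Cc" and m:"finite_measure m" "sets m=sets borel"
 shows "integrable m f"
proof -
 obtain C where C:"!!x. \<bar>f x\<bar><=C" using Cc_bounded[OF f] by metis
 have "f:borel_measurable m" using Cc_measurable[OF f] m(2) measurable_cong_sets[OF m(2) refl] by blast
 then show ?thesis using C m(1) by (intro finite_measure.integrable_const_bound[of m f C]) auto
qed

context proper_metric
begin

lemma bump_exists:
 assumes K:"compact (K::'a set)" and e:"e>0"
 obtains ph where "ph:Cc" "!!x. 0<=ph x&ph x<=(1::real)" "!!x. x:K==>ph x=1"
  "!!x. (ALL y:K. dist x y>=e)==>ph x=0"
proof (cases "K={}")
 case True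
 then show thesis using that[of "%x. 0"] Cc_zero by auto
next
 case False
 then obtain k where k:"k:K" by auto
 obtain B where B:"!!y. y:K==>dist k y<=B" using compact_imp_bounded[OF K] bounded_any_center[of K k] by auto
 let ?ph = "%x. max 0 (1 - infdist x K/e)"
 have z:"?ph x=0" if "ALL y:K. dist x y>=e" for x
 proof -
  have "infdist x K>=e" unfolding infdist_notempty[OF False] using that False by (intro cINF_greatest) auto
  then show ?thesis using e by simp
 qed
 have "?ph:Cc"
 proof (rule CcI)
  show "continuous_on UNIV ?ph" using e by (intro continuous_intros) auto
  fix y assume "?ph y~=0"
  then obtain u where u:"u:K" "dist y u<e" using z[of y] by (meson not_le)
  show "y:cball k (B + e)" using B[OF u(1)] u(2) dist_triangle[of k y u] by (simp add:dist_commute)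
 qed
 moreover have "0<=?ph x&?ph x<=1" for x using e infdist_nonneg[of x K] by (simp add:divide_nonneg_pos)
 moreover have "?ph x=1" if "x:K" for x using that by simp
 ultimately show thesis using that[of ?ph] z by blast
qed

lemma sigma_sets_compact:"sigma_sets UNIV {K::'a set. compact K}=sets borel"
proof (rule antisym)
 have "{K::'a set. compact K} \<subseteq> sets borel" by (auto intro: borel_compact)
 then show "sigma_sets UNIV {K::'a set. compact K} \<subseteq> sets borel" by (metis sets.sigma_sets_subset space_borel)
 have "sigma_sets UNIV {S::'a set. closed S} \<subseteq> sigma_sets UNIV {K::'a set. compact K}"
 proof (rule sigma_sets_mono, rule subsetI)
  fix S :: "'a set" assume "S:{S. closed S}"
  then have S:"closed S" by simp
  have eq:"S=(\<Union>n::nat. S Int cball undefined (real n))" using real_arch_simple by (auto simp:mem_cball)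
  have "(\<Union>n::nat. S Int cball undefined (real n)):sigma_sets UNIV {K::'a set. compact K}"
   using S compact_cball by (intro sigma_sets.Union sigma_sets.Basic) (auto intro: closed_Int_compact)
  then show "S:sigma_sets UNIV {K::'a set. compact K}" using eq by simp
 qed
 moreover have "sets (borel::'a measure)=sigma_sets UNIV {S. closed S}" unfolding borel_eq_closed by simp
 ultimately show "sets borel \<subseteq> sigma_sets UNIV {K::'a set. compact K}" by simp
qed

text \<open>A list of weighted finite measures plays the role of a signed measure. Bump functions
  shrinking to a compact set give the claim there, exhaustion by closed balls gives it for the whole
  space, and the compact sets form an intersection-stable generator.\<close>

lemma signed_measure_zero:
 fixes ms :: "(real \<times> 'a measure) list"
 assumes fin:"!!c m. (c,m):set ms==>finite_measure m&sets m=sets borel"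
  and zero:"!!ph. ph:Cc==>(\<Sum>(c,m)\<leftarrow>ms. c * (\<integral>x. ph x \<partial>m))=0"
  and A:"A:sets borel"
 shows "(\<Sum>(c,m)\<leftarrow>ms. c * measure m A)=0"
proof -
 have lim_list:"(%n. \<Sum>(c,m)\<leftarrow>ms'. c * g n m) ----> (\<Sum>(c,m)\<leftarrow>ms'. c * l m)"
  if "!!c m. (c,m):set ms'==>(%n. g n m) ----> l m" for ms' :: "(real \<times> 'a measure) list" and g :: "nat=>_=>real" and l
  using that
 proof (induction ms')
  case (Cons a ms')
  then show ?case by (cases a) (auto intro!: tendsto_intros)
 qed simp
 have comp:"(\<Sum>(c,m)\<leftarrow>ms. c * measure m K)=0" if K:"compact K" for K
 proof -
  have "EX ph:Cc. (ALL x. 0<=ph x&ph x<=(1::real))&(ALL x:K. ph x=1)&(ALL x. (ALL y:K. dist x y>=1/real (Suc n))-->ph x=0)" for n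
  proof -
   have pos:"1/real (Suc n)>0" by simp
   show ?thesis by (rule bump_exists[OF K pos], rule bexI[rotated]) auto
  qed
  then obtain ph where ph:"!!n. ph n:Cc" "!!n x. 0<=ph n x&ph n x<=(1::real)" "!!n x. x:K==>ph n x=1"
   "!!n x. (ALL y:K. dist x y>=1/real (Suc n))==>ph n x=0" by metis
  have pt:"(%n. ph n x) ----> ind K x" for x
  proof (cases "x:K")
   case False
   then obtain e where e:"e>0" "!!y. y:K==>dist x y>=e"
   proof (cases "K={}")
   case False
   then show thesis using that infdist_pos_not_in_closed[OF compact_imp_closed[OF K] False \<open>x \<notin> K\<close>] infdist_le by metis
   qed (use that[of 1] in auto)
   obtain N where N:"1/real (Suc N)<e" using nat_approx_posE[OF e(1)] by blast
   have "\<forall>\<^sub>F n in sequentially. ph n x=0" using eventually_ge_at_top[of N]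
   proof eventually_elim
   case (elim n)
   have "1/real (Suc n)<=1/real (Suc N)" using elim by (intro divide_left_mono) auto
   then show ?case using N e(2) by (intro ph(4)) force
   qed
   then show ?thesis using False by (simp add:tendsto_eventually)
  qed (simp add:ph(3))
  have "(%n. \<Sum>(c,m)\<leftarrow>ms. c * (\<integral>x. ph n x \<partial>m)) ----> (\<Sum>(c,m)\<leftarrow>ms. c * measure m K)"
  proof (rule lim_list)
   fix c m assume cm:"(c,m):set ms"
   have [simp]:"sets m=sets borel" and fm:"finite_measure m" using fin[OF cm] by auto
   have sp:"space m=UNIV" using sets_eq_imp_space_eq[of m borel] by simp
   have "(%n. \<integral>x. ph n x \<partial>m) ----> (\<integral>x. ind K x \<partial>m)"
   proof (rule integral_dominated_convergence[where w = "%x. 1"])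
   show "integrable m (%x. 1)" using fm by (simp add:finite_measure.integrable_const)
   show "ph n:borel_measurable m" for n using Cc_measurable[OF ph(1)] measurable_cong_sets[of m borel borel borel] by auto
   show "ind K:borel_measurable m" by (intro borel_measurable_indicator) (simp add:borel_compact[OF K])
   qed (use ph(2) pt in \<open>auto simp:abs_le_iff intro: order_trans[of _ 0]\<close>)
   then show "(%n. \<integral>x. ph n x \<partial>m) ----> measure m K" by (simp add:sp)
  qed
  then show ?thesis using zero[OF ph(1)] by (simp add:LIMSEQ_const_iff)
 qed
 have univ:"(\<Sum>(c,m)\<leftarrow>ms. c * measure m UNIV)=0"
 proof -
  have "(%n. \<Sum>(c,m)\<leftarrow>ms. c * measure m (cball undefined (real n))) ----> (\<Sum>(c,m)\<leftarrow>ms. c * measure m UNIV)"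
  proof (rule lim_list)
   fix c m assume cm:"(c,m):set ms"
   have [simp]:"sets m=sets borel" and fm:"finite_measure m" using fin[OF cm] by auto
   have "(%n. measure m (cball undefined (real n))) ----> measure m (\<Union>n. cball undefined (real n))"
   by (rule finite_measure.finite_Lim_measure_incseq[OF fm]) (auto simp:incseq_def)
   moreover have "(\<Union>n. cball (undefined::'a) (real n))=UNIV" using real_arch_simple by (auto simp:mem_cball)
   ultimately show "(%n. measure m (cball undefined (real n))) ----> measure m UNIV" by simp
  qed
  then show ?thesis using comp[OF compact_cball] by (simp add:LIMSEQ_const_iff)
 qed
 have i3:"A:sigma_sets UNIV {K::'a set. compact K}" using A by (simp add:sigma_sets_compact)
 have i1:"Int_stable {K::'a set. compact K}" by (auto simp:Int_stable_def intro: compact_Int)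
 have i2:"{K::'a set. compact K} \<subseteq> Pow UNIV" by simp
 from i1 i2 i3 show ?thesis
 proof (induction rule: sigma_sets_induct_disjoint)
  case (basic A)
  then show ?case by (simp add:comp)
 next
  case empty
  show ?case by (simp add:case_prod_beta)
 next
  case (compl A)
  have "(\<Sum>(c,m)\<leftarrow>ms. c * measure m (UNIV - A))=(\<Sum>(c,m)\<leftarrow>ms. c * measure m UNIV - c * measure m A)"
  proof (rule arg_cong[where f = sum_list], rule map_cong[OF refl])
   fix cm assume cm:"cm:set ms"
   obtain c m where [simp]:"cm=(c,m)" by (cases cm)
   have [simp]:"sets m=sets borel" and fm:"finite_measure m" using fin cm by auto
   have sp:"space m=UNIV" using sets_eq_imp_space_eq[of m borel] by simp
   have "A:sets m" using compl by (simp add:sigma_sets_compact)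
   then have "measure m (UNIV - A)=measure m UNIV - measure m A" using finite_measure.finite_measure_compl[OF fm] by (simp add:sp)
   then show "(case cm of (c,m)=>c * measure m (UNIV - A))=(case cm of (c,m)=>c * measure m UNIV - c * measure m A)" by (simp add:right_diff_distrib)
  qed
  also have "...=(\<Sum>(c,m)\<leftarrow>ms. c * measure m UNIV)-(\<Sum>(c,m)\<leftarrow>ms. c * measure m A)" by (induction ms) auto
  finally show ?case using univ compl by simp
 next
  case (union A)
  have "(%n. \<Sum>(c,m)\<leftarrow>ms. c * (\<Sum>i<n. measure m (A i))) ----> (\<Sum>(c,m)\<leftarrow>ms. c * measure m (\<Union>i. A i))"
  proof (rule lim_list)
   fix c m assume cm:"(c,m):set ms"
   have [simp]:"sets m=sets borel" and fm:"finite_measure m" using fin[OF cm] by auto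
   have "(%i. measure m (A i)) sums measure m (\<Union>i. A i)"
   using union by (intro finite_measure.finite_measure_UNION[OF fm]) (auto simp:sigma_sets_compact)
   then show "(%n. \<Sum>i<n. measure m (A i)) ----> measure m (\<Union>i. A i)" by (simp add:sums_def)
  qed
  moreover have "(\<Sum>(c,m)\<leftarrow>ms. c * (\<Sum>i<n. measure m (A i)))=0" for n
  proof (induction n)
   case (Suc n)
   have "(\<Sum>(c,m)\<leftarrow>ms. c * (\<Sum>i<Suc n. measure m (A i)))=(\<Sum>(c,m)\<leftarrow>ms. c * (\<Sum>i<n. measure m (A i)) + c * measure m (A n))"
   by (simp add:distrib_left)
   also have "...=(\<Sum>(c,m)\<leftarrow>ms. c * (\<Sum>i<n. measure m (A i)))+(\<Sum>(c,m)\<leftarrow>ms. c * measure m (A n))"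
   by (induction ms) auto
   finally show ?case using Suc union by simp
  qed (simp add:case_prod_beta)
  ultimately show ?case by (simp add:LIMSEQ_const_iff)
 qed
qed

end

text \<open>Boundedness on functions with values in the unit interval makes the representing measure
  finite, of mass at most \<open>M\<close>. For energy measures \<open>M\<close> is the
  energy.\<close>

locale bounded_functional = proper_metric metric_type for metric_type :: "'a::metric_space itself" +
 fixes I :: "('a=>real)=>real" and M :: real
 assumes I_lin:"f:Cc==>g:Cc==>I (%x. a * f x + b * g x)=a * I f + b * I g"
  and I_nonneg:"f:Cc==>(!!x. f x>=0)==>I f>=0"
  and I_bound:"f:Cc==>(!!x. 0<=f x&f x<=1)==>I f<=M"
begin

lemma I_zero:"I (%x. 0)=0" using I_lin[OF Cc_zero Cc_zero, of 0 0] by simp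

lemma I_add:"f:Cc==>g:Cc==>I (%x. f x + g x)=I f + I g"
 and I_diff:"f:Cc==>g:Cc==>I (%x. f x - g x)=I f - I g"
 and I_cmult:"f:Cc==>I (%x. c * f x)=c * I f"
 using I_lin[of f g 1 1] I_lin[of f g 1 "-1"] I_lin[of f f c 0] by simp_all

lemma I_mono: assumes "f:Cc" "g:Cc" "!!x. f x<=g x" shows "I f<=I g" using I_nonneg[OF Cc_diff[OF assms(2,1)]] assms I_diff[OF assms(2,1)] by simp

lemma M_nonneg:"M>=0" using I_bound[OF Cc_zero] I_zero by simp

text \<open>Vanishing outside \<open>U\<close> replaces having compact support inside
  \<open>U\<close>; \<open>adm_shrink\<close> restores the latter at a cost of
  \<open>e * M\<close>.\<close>

definition adm :: "'a set=>('a=>real) set" where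
 "adm U={ph\<in>Cc. (ALL x. 0<=ph x&ph x<=1)&(ALL x. x ~: U-->ph x=0)}"

definition icont :: "'a set=>real" where
 "icont U=(SUP ph\<in>adm U. I ph)"

lemma adm_zero:"(%x. 0):adm U" by (simp add:adm_def Cc_zero)

lemma adm_Cc:"ph:adm U==>ph:Cc" by (simp add:adm_def)

lemma bdd_adm:"bdd_above (I ` adm U)" by (auto simp:adm_def intro!: bdd_aboveI[of _ M] I_bound)

lemma icont_upper:"ph:adm U==>I ph<=icont U" unfolding icont_def by (intro cSUP_upper bdd_adm)

lemma icont_least:"(!!ph. ph:adm U==>I ph<=c)==>icont U<=c" unfolding icont_def using adm_zero by (intro cSUP_least) auto

lemma icont_nonneg:"icont U>=0" using icont_upper[OF adm_zero] I_zero by simp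

lemma icont_le:"icont U<=M" by (rule icont_least) (auto simp:adm_def intro: I_bound)

lemma icont_mono:"U \<subseteq> V==>icont U<=icont V" by (rule icont_least, rule icont_upper) (auto simp:adm_def)

text \<open>Subtracting \<open>e\<close> confines the function to a compact set inside
  \<open>U\<close>. What is lost is \<open>e\<close> times a function with values in the unit
  interval, hence at most \<open>e * M\<close> under \<open>I\<close>.\<close>

lemma adm_shrink:
 assumes ph:"ph:adm U" and e:"e>0"
 defines "ps==%x. max (ph x - e) 0"
 shows "ps:adm U" "compact {x. ph x>=e}" "{x. ph x>=e} \<subseteq> U" "!!x. \<not> ph x>=e==>ps x=0"
  "I ph<=I ps + e * M"
proof -
 have ph_C:"ph:Cc" and ph01:"!!x. 0<=ph x&ph x<=1" and ph_U:"!!x. x ~: U==>ph x=0" using ph by (auto simp:adm_def)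
 have cont:"continuous_on UNIV ph" by (rule Cc_continuous[OF ph_C])
 have ps_C:"ps:Cc" unfolding ps_def using cont e by (intro Cc_dominated[OF ph_C] continuous_intros) auto
 show "ps:adm U" using ps_C ph01 ph_U e unfolding adm_def ps_def
  by (auto simp:max_def) (meson diff_le_eq le_add_same_cancel1 less_imp_le order_trans)
 show "{x. ph x>=e} \<subseteq> U" using ph_U e by force
 show "!!x. \<not> ph x>=e==>ps x=0" by (simp add:ps_def)
 have "closed {x. ph x>=e}" using cont by (intro closed_Collect_le continuous_intros) auto
 moreover have "{x. ph x>=e} \<subseteq> closure {x. ph x~=0}" using e closure_subset by force
 ultimately show "compact {x. ph x>=e}" using compact_Int_closed[of "closure {x. ph x~=0}" "{x. ph x>=e}"] ph_C by (simp add:Cc_def inf.absorb2)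
 let ?r = "%x. min (ph x/e) 1"
 have rC:"?r:Cc" using cont e by (intro Cc_dominated[OF ph_C] continuous_intros) auto
 have "I ?r<=M" using ph01 e by (intro I_bound rC) auto
 moreover have "(%x. 1 * ps x + e * ?r x)=ph"
 proof
  fix x show "1 * ps x + e * ?r x=ph x"
   using e by (cases "ph x>=e") (auto simp:ps_def min_def max_def field_simps)
 qed
 then have "I ph=1 * I ps + e * I ?r" using I_lin[OF ps_C rC, of 1 e] by simp
 ultimately show "I ph<=I ps + e * M" using e by simp
qed

text \<open>A function admissible for the union is shrunk to a compact \<open>K\<close> and split
  into its minimum with \<open>dU U x / c\<close>, which is admissible for \<open>U\<close>, and the
  rest, which is admissible for \<open>V\<close>.\<close>

lemma icont_Un:
 assumes U:"open U" and V:"open V"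
 shows "icont (U Un V)<=icont U + icont V"
proof (rule icont_least)
 fix ph assume ph:"ph:adm (U Un V)"
 show "I ph<=icont U + icont V"
 proof (rule field_le_epsilon)
  fix d :: real assume d:"d>0"
  define e where "e=d/(M+1)"
  have e:"e>0" using d M_nonneg by (simp add:e_def)
  have eM:"e * M<=d"
  proof -
   have "e * M<=e * (M+1)" using e by simp
   also have "...=d" using M_nonneg by (simp add:e_def)
   finally show ?thesis .
  qed
  note S = adm_shrink[OF ph e]
  define ps where "ps=(%x. max (ph x - e) 0)"
  define K where "K={x. ph x>=e}"
  \<comment> \<open>The distance to the complement, with the positive default 1 when the complement
    is empty, where \<open>infdist\<close> would be 0.\<close>
  define dU where "dU W x=(if W=UNIV then 1 else infdist x (- W))" for W and x :: 'a
  have dc:"continuous_on UNIV (dU W)" for W unfolding dU_def by (cases "W=UNIV") (auto intro!: continuous_intros)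
  have d0:"dU W x>=0" for W x by (simp add:dU_def infdist_nonneg)
  have dz:"dU W x=0" if "x ~: W" for W x using that by (auto simp:dU_def)
  have dp:"dU W x>0" if "open W" "x:W" for W x using that infdist_pos_not_in_closed[of "- W" x] by (auto simp:dU_def)
  \<comment> \<open>Positive by compactness. On \<open>K\<close> outside \<open>V\<close> it forces
    \<open>dU U x >= c\<close>, so the second part of the splitting vanishes there.\<close>
  obtain c where c:"c>0" "!!x. x:K==>dU U x + dU V x>=c"
  proof (cases "K={}")
   case False
   have "continuous_on K (%x. dU U x + dU V x)" by (intro continuous_intros continuous_on_subset[OF dc]) auto
   from continuous_attains_inf[OF S(2)[folded K_def] False this]
   obtain x0 where x0:"x0:K" "!!x. x:K==>dU U x0 + dU V x0<=dU U x + dU V x" by auto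
   have "x0:U Un V" using S(3) x0(1) by (auto simp:K_def)
   then have "dU U x0 + dU V x0>0" using dp[OF U, of x0] dp[OF V, of x0] d0[of U x0] d0[of V x0] by (auto intro: add_pos_nonneg add_nonneg_pos)
   then show thesis using that x0(2) by blast
  qed (use that[of 1] in auto)
  let ?a = "%x. min (ps x) (dU U x/c)"
  have ps_C:"ps:Cc" using adm_Cc[OF S(1)] by (simp add:ps_def)
  have ps01:"0<=ps x&ps x<=1" for x using S(1) by (auto simp:adm_def ps_def)
  have aC:"?a:Cc" using Cc_continuous[OF ps_C] dc[of U] c d0 by (intro Cc_dominated[OF ps_C] continuous_intros) (auto simp:min_def intro!: antisym)
  have aU:"?a:adm U" using aC ps01 d0 c(1) dz by (auto simp:adm_def min_le_iff_disj divide_nonneg_pos)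
  have bC:"(%x. ps x - ?a x):Cc" by (rule Cc_diff[OF ps_C aC])
  have "(%x. ps x - ?a x):adm V"
  proof -
   have "ps x - ?a x=0" if "x ~: V" for x
   proof (cases "x:K")
   case True
   then have "dU U x>=c" using c(2)[OF True] dz[OF that] by simp
   then have "dU U x/c>=1" using c(1) by simp
   then show ?thesis using ps01[of x] by simp
   next
   case False
   then have "ps x=0" using S(4)[of x] by (simp add:K_def ps_def)
   then show ?thesis using d0[of U x] c(1) by simp
   qed
   moreover have "0<=ps x - ?a x&ps x - ?a x<=1" for x
   proof -
   have "dU U x/c>=0" using d0[of U x] c(1) by simp
   then show ?thesis using ps01[of x] by linarith
   qed
   ultimately show ?thesis using bC by (auto simp:adm_def)
  qed
  then have "I ?a + I (%x. ps x - ?a x)<=icont U + icont V" by (intro add_mono icont_upper aU)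
  moreover have "I ps=I ?a + I (%x. ps x - ?a x)" using I_diff[OF ps_C aC] by simp
  ultimately show "I ph<=icont U + icont V + d" using S(5) eM by (simp add:ps_def)
 qed
qed

lemma icont_finite_Union:
 assumes "!!i. open (U i)" shows "icont (\<Union>i<n. U i)<=(\<Sum>i<n::nat. icont (U i))"
proof (induction n)
 case 0
 have "icont {}<=0" by (rule icont_least) (auto simp:adm_def fun_eq_iff I_zero intro: order_trans[OF eq_refl[OF arg_cong[of _ "%x. 0" I]]])
 then show ?case by simp
next
 case (Suc n)
 have "(\<Union>i<Suc n. U i)=(\<Union>i<n. U i) Un U n" by (auto simp:less_Suc_eq)
 moreover have "open (\<Union>i<n. U i)" using assms by auto
 ultimately show ?case using icont_Un[of "\<Union>i<n. U i" "U n"] assms[of n] Suc by simp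
qed

definition outer :: "'a set=>real" where
 "outer A=(INF U\<in>{U. open U&A \<subseteq> U}. icont U)"

lemma bdd_outer:"bdd_below (icont ` {U. open U&A \<subseteq> U})" by (auto intro!: bdd_belowI[of _ 0] icont_nonneg)

lemma outer_lower:"open U==>A \<subseteq> U ==> outer A<=icont U" unfolding outer_def by (intro cINF_lower bdd_outer) auto

lemma outer_greatest:"(!!U. open U==>A \<subseteq> U==>c<=icont U)==>c <= outer A" unfolding outer_def by (intro cINF_greatest) auto

lemma outer_open:"open U ==> outer U=icont U" by (intro antisym outer_lower outer_greatest icont_mono) auto

lemma outer_nonneg:"outer A>=0" by (rule outer_greatest[OF icont_nonneg])

lemma outer_mono:"A \<subseteq> B ==> outer A <= outer B" by (rule outer_greatest, rule outer_lower) auto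

lemma outer_near: assumes "d>0" shows "EX U. open U&A \<subseteq> U&icont U < outer A + d"
proof -
 have "EX U:{U. open U&A \<subseteq> U}. icont U < outer A + d"
  using cINF_less_iff[OF _ bdd_outer, of A "outer A + d"] assms unfolding outer_def[symmetric] by auto
 then show ?thesis by auto
qed

text \<open>After \<open>adm_shrink\<close> the function lives on a compact set, which finitely many
  of the \<open>U i\<close> cover.\<close>

lemma icont_countable_Union:
 assumes U:"!!i::nat. open (U i)" and s:"summable (%i. icont (U i))"
 shows "icont (\<Union>i. U i)<=(\<Sum>i. icont (U i))"
proof (rule icont_least)
 fix ph assume ph:"ph:adm (\<Union>i. U i)"
 show "I ph<=(\<Sum>i. icont (U i))"
 proof (rule field_le_epsilon)
  fix d :: real assume d:"d>0"
  define e where "e=d/(M+1)"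
  have e:"e>0" using d M_nonneg by (simp add:e_def)
  have eM:"e * M<=d"
  proof -
   have "e * M<=e * (M+1)" using e by simp
   also have "...=d" using M_nonneg by (simp add:e_def)
   finally show ?thesis .
  qed
  note S = adm_shrink[OF ph e]
  obtain C where C:"C \<subseteq> range U" "finite C" "{x. ph x>=e} \<subseteq> \<Union>C" using compactE[OF S(2) S(3)] U by (metis image_iff)
  then obtain n where n:"C \<subseteq> U ` {..<n}"
  proof -
   obtain J where J:"finite J" "C=U ` J" using C finite_subset_image[of C U UNIV] by auto
   then obtain n where "J \<subseteq> {..<n}" using finite_nat_bounded by blast
   then show thesis using that J by auto
  qed
  have "(%x. max (ph x - e) 0):adm (\<Union>i<n. U i)"
  proof -
   have "max (ph x - e) 0=0" if "x ~: (\<Union>i<n. U i)" for x using that C(3) n by (intro S(4)) auto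
   then show ?thesis using S(1) by (simp add:adm_def)
  qed
  then have "I (%x. max (ph x - e) 0)<=(\<Sum>i<n. icont (U i))" using icont_upper icont_finite_Union[of U n, OF U] by (meson order_trans)
  also have "...<=(\<Sum>i. icont (U i))" by (intro sum_le_suminf s) (auto simp:icont_nonneg)
  finally show "I ph<=(\<Sum>i. icont (U i)) + d" using S(5) eM by linarith
 qed
qed

lemma outer_measure_outer:"outer_measure_space (Pow UNIV) (%A. ennreal (outer A))" unfolding outer_measure_space_def
proof (intro conjI)
 show "positive (Pow UNIV) (%A. ennreal (outer A))" using outer_open[of "{}"] icont_finite_Union[of "%i. {}" 0] icont_nonneg[of "{}"]
  by (auto simp:positive_def)
 show "increasing (Pow UNIV) (%A. ennreal (outer A))" by (auto simp:increasing_def intro!: ennreal_leI outer_mono)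
 show "countably_subadditive (Pow UNIV) (%A. ennreal (outer A))" unfolding countably_subadditive_def
 proof (intro allI impI)
  fix A :: "nat => 'a set"
  show "ennreal (outer (\<Union>i. A i))<=(\<Sum>i. ennreal (outer (A i)))"
  proof (cases "summable (%i. outer (A i))")
   case False
   have "(\<Sum>i. ennreal (outer (A i)))=\<infinity>"
   proof -
   show ?thesis
   proof (rule ccontr)
   assume "(\<Sum>i. ennreal (outer (A i)))~=\<infinity>"
   then have "summable (%i. outer (A i))" using summable_suminf_not_top[OF outer_nonneg] by (simp only: infinity_ennreal_def not_False_eq_True)
   then show False using False by contradiction
   qed
   qed
   then show ?thesis by simp
  next
   case True
   have "outer (\<Union>i. A i)<=(\<Sum>i. outer (A i)) + d" if d:"d>0" for d
   proof -
   have "EX U. open U&A i \<subseteq> U&icont U < outer (A i) + d * (1/2) ^ Suc i" for i using d by (intro outer_near) simp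
   then obtain U where U:"!!i. open (U i)" "!!i. A i \<subseteq> U i" "!!i. icont (U i) < outer (A i) + d * (1/2) ^ Suc i" by metis
   have sg:"(%i. d * (1/2) ^ Suc i) sums (d * 1)" by (intro sums_mult power_half_series)
   have s1:"summable (%i. outer (A i) + d * (1/2) ^ Suc i)" using True sg by (intro summable_add) (auto simp:sums_iff)
   have s2:"summable (%i. icont (U i))" using U(3) icont_nonneg by (intro summable_comparison_test'[OF s1, of 0]) (auto intro: less_imp_le)
   have "outer (\<Union>i. A i)<=icont (\<Union>i. U i)" using U by (intro outer_lower) auto
   also have "...<=(\<Sum>i. icont (U i))" by (rule icont_countable_Union[OF U(1) s2])
   also have "...<=(\<Sum>i. outer (A i) + d * (1/2) ^ Suc i)" using U(3) by (intro suminf_le s1 s2) (auto intro: less_imp_le)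
   also have "...=(\<Sum>i. outer (A i)) + d" using suminf_add[OF True, of "%i. d * (1/2) ^ Suc i"] sg by (simp add:sums_iff)
   finally show ?thesis .
   qed
   then have "outer (\<Union>i. A i)<=(\<Sum>i. outer (A i))" by (rule field_le_epsilon)
   then show ?thesis using True outer_nonneg by (simp add:suminf_ennreal2 ennreal_leI)
  qed
 qed
qed

text \<open>Half of Caratheodory's criterion for open sets. A function admissible for
  \<open>U Int V\<close> is shrunk to a compact set; the complement of that set in \<open>U\<close>
  is an open neighbourhood of \<open>A - V\<close>, and adding any function admissible for it stays
  admissible for \<open>U\<close>.\<close>

lemma outer_open_split:
 assumes V:"open V"
 shows "outer (A Int V) + outer (A - V) <= outer A"
proof (rule outer_greatest)
 fix U assume U:"open U" "A \<subseteq> U"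
 have "icont (U Int V) + outer (A - V)<=icont U"
 proof (rule field_le_epsilon)
  fix d :: real assume d:"d>0"
  define e where "e=d/(M+1)"
  have e:"e>0" using d M_nonneg by (simp add:e_def)
  have eM:"e * M<=d"
  proof -
   have "e * M<=e * (M+1)" using e by simp
   also have "...=d" using M_nonneg by (simp add:e_def)
   finally show ?thesis .
  qed
  have "icont (U Int V)<=icont U + d - outer (A - V)"
  proof (rule icont_least)
   fix ph assume ph:"ph:adm (U Int V)"
   note S = adm_shrink[OF ph e]
   define ps where "ps=(%x. max (ph x - e) 0)"
   let ?W = "U - {x. ph x>=e}"
   have W:"open ?W" "A - V \<subseteq> ?W" using U S(3) compact_imp_closed[OF S(2)] by auto
   have "icont ?W<=icont U - I ps"
   proof (rule icont_least)
   fix et assume et:"et:adm ?W"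
   have "(%x. ps x + et x):adm U"
   proof -
   have "0<=ps x + et x&ps x + et x<=1&(x ~: U-->ps x + et x=0)" for x
   proof (cases "ph x>=e")
   case True
   then have "et x=0" "x:U" using et S(3) by (auto simp:adm_def)
   moreover have "0<=ps x&ps x<=1" using S(1) by (auto simp:adm_def ps_def)
   ultimately show ?thesis by simp
   next
   case False
   then have "ps x=0" using S(4)[of x] by (simp add:ps_def)
   then show ?thesis using et by (auto simp:adm_def)
   qed
   then show ?thesis using Cc_add[OF adm_Cc[OF S(1)] adm_Cc[OF et]] by (auto simp:adm_def ps_def)
   qed
   from icont_upper[OF this] show "I et<=icont U - I ps" using I_add[OF adm_Cc[OF S(1)] adm_Cc[OF et]] by (simp add:ps_def)
   qed
   moreover have "outer (A - V)<=icont ?W" by (rule outer_lower[OF W])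
   ultimately show "I ph<=icont U + d - outer (A - V)" using S(5) eM by (simp add:ps_def)
  qed
  then show "icont (U Int V) + outer (A - V)<=icont U + d" by simp
 qed
 moreover have "outer (A Int V)<=icont (U Int V)" using U V by (intro outer_lower) auto
 ultimately show "outer (A Int V) + outer (A - V)<=icont U" by linarith
qed

definition rmeasure :: "'a measure" where
 "rmeasure=measure_of UNIV (sets borel) (%A. ennreal (outer A))"

lemma sets_rmeasure [simp]:"sets rmeasure=sets borel"
 and space_rmeasure [simp]:"space rmeasure=UNIV"
 using sets.sigma_sets_eq[of "borel::'a measure"] by (simp_all add: rmeasure_def)

lemma emeasure_rmeasure:"A:sets borel==>emeasure rmeasure A=ennreal (outer A)"
proof -
 assume A:"A:sets borel"
 let ?L = "lambda_system UNIV (Pow UNIV) (%A::'a set. ennreal (outer A))"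
 have ms:"measure_space UNIV ?L (%A. ennreal (outer A))" using sigma_algebra.caratheodory_lemma[OF sigma_algebra_Pow outer_measure_outer] by simp
 have sa:"sigma_algebra UNIV ?L" using ms by (simp add:measure_space_def)
 have "V:?L" if V:"open V" for V :: "'a set"
 proof -
  have "ennreal (outer (V Int A)) + ennreal (outer ((UNIV - V) Int A))=ennreal (outer A)" for A
  proof (rule antisym)
   have "outer (V Int A) + outer ((UNIV - V) Int A) <= outer A" using outer_open_split[OF V, of A] by (simp add:Int_commute Diff_eq)
   then show "ennreal (outer (V Int A)) + ennreal (outer ((UNIV - V) Int A))<=ennreal (outer A)"
   using outer_nonneg by (simp add:ennreal_plus[symmetric] ennreal_leI del: ennreal_plus)
   have "subadditive (Pow UNIV) (%A::'a set. ennreal (outer A))"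
   proof -
   have ring:"ring_of_sets UNIV (Pow (UNIV::'a set))" by (rule Sigma_Algebra.algebra.axioms(1)[OF sigma_algebra.axioms(1)[OF sigma_algebra_Pow]])
   show ?thesis using outer_measure_outer unfolding outer_measure_space_def by (intro ring_of_sets.countably_subadditive_subadditive[OF ring]) blast+
   qed
   then have "ennreal (outer ((V Int A) Un ((UNIV - V) Int A)))<=ennreal (outer (V Int A)) + ennreal (outer ((UNIV - V) Int A))"
   by (rule subadditiveD) auto
   moreover have "(V Int A) Un ((UNIV - V) Int A)=A" by auto
   ultimately show "ennreal (outer A)<=ennreal (outer (V Int A)) + ennreal (outer ((UNIV - V) Int A))" by simp
  qed
  then show ?thesis by (simp add:lambda_system_def)
 qed
 then have "sets borel \<subseteq> ?L" unfolding borel_def using sigma_algebra.sigma_sets_subset[OF sa, of "{S. open S}"] by auto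
 then have "countably_additive (sets borel) (%A. ennreal (outer A))"
  using ms unfolding measure_space_def countably_additive_def by (meson subset_eq subset_trans)
 moreover have "positive (sets borel) (%A. ennreal (outer A))" using outer_measure_outer by (auto simp:outer_measure_space_def positive_def)
 ultimately show ?thesis unfolding rmeasure_def
  using A by (intro emeasure_measure_of_sigma) (auto intro: sets.sigma_algebra_axioms[of "borel::'a measure", simplified])
qed

lemma rmeasure_mass:"emeasure rmeasure UNIV<=ennreal M" using icont_le[of UNIV] by (simp add:emeasure_rmeasure outer_open ennreal_leI)

lemma finite_rmeasure:"finite_measure rmeasure" by (rule finite_measureI) (use rmeasure_mass in \<open>auto simp:top_unique\<close>)

lemma measure_rmeasure:"open U==>measure rmeasure U=icont U" by (simp add:measure_def emeasure_rmeasure outer_open icont_nonneg)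

text \<open>Cuts \<open>ph\<close> into \<open>N\<close> horizontal slices. Slice \<open>j\<close>
  lies between the indicators of \<open>U (j+1)\<close> and of \<open>U j\<close>, both divided by
  \<open>N\<close>, so integral and functional are trapped between the same two sums, whose gap
  telescopes to at most \<open>M / N\<close>.\<close>

lemma integral_rmeasure_unit:
 assumes ph:"ph:Cc" "!!x. 0<=ph x&ph x<=1"
 shows "(\<integral>x. ph x \<partial>rmeasure)=I ph"
proof -
 have cont:"continuous_on UNIV ph" by (rule Cc_continuous[OF ph(1)])
 have key:"\<bar>(\<integral>x. ph x \<partial>rmeasure) - I ph\<bar><=M/real N" if N:"N>0" for N :: nat
 proof -
  define s where "s j x=min (max (ph x - real j/real N) 0) (1/real N)" for j :: nat and x
  define U where "U j={x. ph x>real j/real N}" for j :: nat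
  have sC:"s j:Cc" for j unfolding s_def using cont ph(2) N by (intro Cc_dominated[OF ph(1)] continuous_intros) auto
  have Uo:"open (U j)" for j unfolding U_def using cont by (intro open_Collect_less continuous_intros) auto
  have part:"(\<Sum>j<n. s j x)=min (ph x) (real n/real N)" for n x
  proof (induction n)
   case (Suc n)
   have "min (ph x) (real n/real N) + s n x=min (ph x) (real n/real N+1/real N)"
   proof -
   have "1/real N>0" using N by simp
   then show ?thesis unfolding s_def by linarith
   qed
   then show ?case using Suc by (simp add:add_divide_distrib)
  qed (use ph(2) in simp)
  have sum:"(\<Sum>j<N. s j x)=ph x" for x using part[where n = N and x = x] N ph(2)[of x] by simp
  have I_sum:"I (%x. \<Sum>j<n. s j x)=(\<Sum>j<n. I (s j))" for n
  proof -
   have "(%x. \<Sum>j<n. s j x):Cc&I (%x. \<Sum>j<n. s j x)=(\<Sum>j<n. I (s j))" by (induction n) (auto simp:I_zero Cc_zero I_add sC Cc_add)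
   then show ?thesis ..
  qed
  have iC:"integrable rmeasure (s j)" for j by (rule Cc_integrable[OF sC finite_rmeasure]) simp
  have iU:"integrable rmeasure (ind (U j))" for j
   using Uo finite_rmeasure by (intro finite_measure.integrable_const_bound[where B = 1]) (auto simp:indicator_le_1 intro!: borel_measurable_indicator)
  have mU:"(\<integral>x. ind (U j) x \<partial>rmeasure)=icont (U j)" for j using measure_rmeasure[OF Uo] by simp
  have lo1:"icont (U (Suc j))/real N<=I (s j)" for j
  proof -
   have "icont (U (Suc j))<=I (%x. real N * s j x)"
   proof (rule icont_least, rule I_mono)
   fix et x assume et:"et:adm (U (Suc j))"
   show "et x<=real N * s j x"
   proof (cases "x:U (Suc j)")
   case True
   then have "ph x - real j/real N>=1/real N" by (simp add:U_def add_divide_distrib)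
   moreover have "1/real N>0" using N by simp
   ultimately have "s j x=1/real N" unfolding s_def by linarith
   then show ?thesis using et N by (simp add:adm_def)
   next
   case False
   then show ?thesis using et N by (auto simp:adm_def s_def)
   qed
   qed (auto intro: adm_Cc Cc_cmult sC)
   then show ?thesis using N by (simp add:I_cmult[OF sC] field_simps)
  qed
  have hi1:"I (s j)<=icont (U j)/real N" for j
  proof -
   have "(%x. real N * s j x):adm (U j)" using Cc_cmult[OF sC] N by (auto simp:adm_def s_def U_def min_def max_def field_simps)
   from icont_upper[OF this] show ?thesis using N by (simp add:I_cmult[OF sC] field_simps)
  qed
  have lo2:"icont (U (Suc j))/real N<=(\<integral>x. s j x \<partial>rmeasure)" for j
  proof -
   have "(\<integral>x. ind (U (Suc j)) x/real N \<partial>rmeasure)<=(\<integral>x. s j x \<partial>rmeasure)"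
   proof (rule integral_mono)
   fix x show "ind (U (Suc j)) x/real N<=s j x"
   proof (cases "x:U (Suc j)")
   case True
   then have "ph x - real j/real N>=1/real N" by (simp add:U_def add_divide_distrib)
   moreover have "1/real N>0" using N by simp
   ultimately have "s j x=1/real N" unfolding s_def by linarith
   then show ?thesis using True by simp
   qed (simp add:s_def)
   qed (use iC iU in auto)
   then show ?thesis using measure_rmeasure[OF Uo] by simp
  qed
  have hi2:"(\<integral>x. s j x \<partial>rmeasure)<=icont (U j)/real N" for j
  proof -
   have "(\<integral>x. s j x \<partial>rmeasure)<=(\<integral>x. ind (U j) x/real N \<partial>rmeasure)"
   proof (rule integral_mono)
   fix x show "s j x<=ind (U j) x/real N"
   by (cases "x:U j") (auto simp:s_def U_def)
   qed (use iC iU in auto)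
   then show ?thesis using measure_rmeasure[OF Uo] by simp
  qed
  have "(\<integral>x. ph x \<partial>rmeasure)=(\<Sum>j<N. \<integral>x. s j x \<partial>rmeasure)"
   using iC by (subst Bochner_Integration.integral_sum[symmetric]) (auto simp:sum)
  moreover have "I ph=(\<Sum>j<N. I (s j))" using I_sum[of N] sum by simp
  ultimately have "\<bar>(\<integral>x. ph x \<partial>rmeasure) - I ph\<bar>=\<bar>\<Sum>j<N. (\<integral>x. s j x \<partial>rmeasure) - I (s j)\<bar>"
   by (simp add:sum_subtractf)
  also have "...<=(\<Sum>j<N. icont (U j)/real N - icont (U (Suc j))/real N)"
   by (intro order_trans[OF sum_abs] sum_mono) (smt (verit) lo1 lo2 hi1 hi2)
  also have "...=icont (U 0)/real N - icont (U N)/real N" by (rule sum_lessThan_telescope')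
  also have "...<=M/real N" using icont_le[of "U 0"] icont_nonneg[of "U N"] N by (smt (verit) divide_nonneg_nonneg divide_right_mono of_nat_0_le_iff)
  finally show ?thesis .
 qed
 have "\<bar>(\<integral>x. ph x \<partial>rmeasure) - I ph\<bar><=0"
 proof (rule LIMSEQ_le_const[of "%n. M/real (Suc n)"])
  show "(%n. M/real (Suc n)) ----> 0" by real_asymp
  show "EX N. ALL n>=N. \<bar>(\<integral>x. ph x \<partial>rmeasure) - I ph\<bar><=M/real (Suc n)" using key by blast
 qed
 then show ?thesis by simp
qed

theorem riesz_representation:
 "ph:Cc==>(\<integral>x. ph x \<partial>rmeasure)=I ph"
proof -
 assume ph:"ph:Cc"
 obtain C where C:"C>0" "!!x. \<bar>ph x\<bar><=C" using Cc_bounded[OF ph] by metis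
 let ?p = "%x. max (ph x) 0/C" and ?n = "%x. max (- ph x) 0/C"
 have cont:"continuous_on UNIV ph" by (rule Cc_continuous[OF ph])
 have pC:"?p:Cc" and nC:"?n:Cc" using cont C by (auto intro!: Cc_dominated[OF ph] continuous_intros)
 have p01:"0<=?p x&?p x<=1" and n01:"0<=?n x&?n x<=1" for x using C(1) C(2)[of x] by (auto simp:max_def abs_le_iff)
 have e:"ph=(%x. C * ?p x+(- C) * ?n x)" using C(1) by (auto simp:fun_eq_iff max_def)
 have "I ph=C * I ?p+(- C) * I ?n" using I_lin[OF pC nC, of C "- C"] e by simp
 also have "...=C * (\<integral>x. ?p x \<partial>rmeasure)+(- C)*(\<integral>x. ?n x \<partial>rmeasure)"
  using integral_rmeasure_unit[OF pC p01] integral_rmeasure_unit[OF nC n01] by simp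
 also have "...=(\<integral>x. C * ?p x+(- C) * ?n x \<partial>rmeasure)"
  using Cc_integrable[OF pC finite_rmeasure] Cc_integrable[OF nC finite_rmeasure]
  by (subst Bochner_Integration.integral_add[OF integrable_mult_right integrable_mult_right]) (simp_all del: times_divide_eq_right)
 finally show ?thesis using e by simp
qed

end

section \<open>Energy measures\<close>

locale hk_space = MMD_space mu E F + kernel_form mu E F P p + proper_metric "TYPE('a)"
 for mu :: "'a::polish_space measure" and E F P p
begin

lemma sets_mu:"sets mu=sets borel" using radon by (simp add:radon_measure_def)

lemma borel_measurable_mu:"f:borel_measurable mu \<longleftrightarrow> f:borel_measurable borel" using measurable_cong_sets[OF sets_mu refl] by blast

lemma Cc_bdf:"ph:Cc==>ph:bdf" using Cc_bounded[of ph] Cc_measurable[of ph] by (metis bdd_funI borel_measurable_mu)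

lemma edens_mass_E:
 assumes "h>0" "f:F" "f:bdf"
 shows "integrable mu (edens h f)" "(\<integral>x. edens h f x \<partial>mu)<=E f f"
 using edens_mass[OF assms(1,3) F_L2[OF assms(2)]] sform_div_le[OF assms(1,2)] by auto

lemma edens_integrable_mult:
 "h>0==>f:F==>f:bdf==>g:bdf==>integrable mu (%x. g x * edens h f x)"
 using integrable_mult_bdd[OF edens_mass_E(1), of h f g] by (simp add:mult.commute)

lemma edens_approx:
 assumes h:"h>0" and f:"f:F" "f:bdf" and g:"g:bdf" "k:bdf"
  and near:"!!x. \<bar>g x - k x\<bar><=e"
 shows "\<bar>(\<integral>x. g x * edens h f x \<partial>mu)-(\<integral>x. k x * edens h f x \<partial>mu)\<bar><=e * E f f"
proof -
 note i = edens_integrable_mult[OF h f]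
 have e0:"e>=0" using near[of undefined] by linarith
 have "(\<integral>x. g x * edens h f x \<partial>mu)-(\<integral>x. k x * edens h f x \<partial>mu)=(\<integral>x. (g x - k x) * edens h f x \<partial>mu)"
  using i[OF g(1)] i[OF g(2)] by (simp add:left_diff_distrib)
 also have "\<bar>...\<bar><=(\<integral>x. e * edens h f x \<partial>mu)"
 proof (rule order_trans[OF integral_abs_bound integral_mono])
  show "integrable mu (%x. \<bar>(g x - k x) * edens h f x\<bar>)" using i[OF bdf_diff[OF g]] by (rule integrable_abs)
  show "integrable mu (%x. e * edens h f x)" using edens_mass_E(1)[OF h f] by simp
  show "\<bar>(g x - k x) * edens h f x\<bar><=e * edens h f x" for x
   using near[of x] edens_nonneg[OF h f(2), of x] by (simp add:abs_mult mult_right_mono)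
 qed
 also have "...<=e * E f f" using edens_mass_E[OF h f] e0 by (simp add:mult_left_mono)
 finally show ?thesis .
qed

definition elim_fun :: "('a=>real)=>('a=>real)=>real" where
 "elim_fun f ph=Lim (at_right 0) (%h. \<integral>x. ph x * edens h f x \<partial>mu)"

lemma F_Cc_approx:
 assumes "ph:Cc" "e>0" obtains g where "g:F" "g:Cc" "!!x. \<bar>ph x - g x\<bar><e"
 using regular assms unfolding regular_form_def by blast

text \<open>\<open>edens_limit\<close> gives convergence for test functions in \<open>F\<close>.
  Regularity approximates any \<open>ph\<close> in \<open>Cc\<close> uniformly by these, and the
  densities have mass at most \<open>E f f\<close>, uniformly in \<open>h\<close>.\<close>

lemma elim_fun_limit:
 assumes f:"f:F" "f:bdf" and ph:"ph:Cc"
 shows "((%h. \<integral>x. ph x * edens h f x \<partial>mu) \<longlongrightarrow> elim_fun f ph) (at_right 0)"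
proof -
 define a where "a h=(\<integral>x. ph x * edens h f x \<partial>mu)" for h
 have "EX g. g:F&g:Cc&(ALL x. \<bar>ph x - g x\<bar><1/real (Suc n))" for n by (rule F_Cc_approx[OF ph, of "1/real (Suc n)"]) auto
 then obtain g where g:"!!n. g n:F" "!!n. g n:Cc" "!!n x. \<bar>ph x - g n x\<bar><1/real (Suc n)" by metis
 define b where "b n h=(\<integral>x. g n x * edens h f x \<partial>mu)" for n h
 define l where "l n=E f (%x. f x * g n x)-1/2 * E (%x. (f x)^2) (g n)" for n
 have bl:"(b n \<longlongrightarrow> l n) (at_right 0)" for n unfolding b_def l_def by (intro edens_limit f g Cc_bdf)
 have ab:"\<bar>a h - b n h\<bar><=E f f/real (Suc n)" if "h>0" for h n
  using edens_approx[OF that f Cc_bdf[OF ph] Cc_bdf[OF g(2)], of n "1/real (Suc n)"] g(3) unfolding a_def b_def by (simp add:less_imp_le)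
 have near:"\<bar>l m - l n\<bar><=E f f/real (Suc m) + E f f/real (Suc n)" for m n
 proof (rule tendsto_upperbound)
  show "((%h. \<bar>b m h - b n h\<bar>) \<longlongrightarrow> \<bar>l m - l n\<bar>) (at_right 0)" by (intro tendsto_intros bl)
  show "\<forall>\<^sub>F h in at_right 0. \<bar>b m h - b n h\<bar><=E f f/real (Suc m) + E f f/real (Suc n)" using eventually_at_right_less[of 0]
  proof eventually_elim
   case (elim h)
   show ?case using ab[OF elim, of m] ab[OF elim, of n] by linarith
  qed
 qed simp
 have E0:"E f f>=0" by (rule form_nonneg[OF f(1)])
 have small:"EX N. ALL n>=N. E f f/real (Suc n)<e" if "e>0" for e
 proof -
  have "(%n. a/real (Suc n)) ----> 0" for a by real_asymp
  from order_tendstoD(2)[OF this that] show ?thesis by (simp add:eventually_sequentially)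
 qed
 have "Cauchy l"
 proof (rule metric_CauchyI)
  fix e :: real assume "e>0"
  then obtain N where N:"!!n. n>=N==>E f f/real (Suc n)<e/2" using small[of "e/2"] by auto
  show "EX M. ALL m>=M. ALL n>=M. dist (l m) (l n)<e" using near N by (intro exI[of _ N]) (smt (verit) dist_real_def field_sum_of_halves)
 qed
 then obtain L where L:"l ----> L" by (auto simp:Cauchy_convergent_iff convergent_def)
 have "(a \<longlongrightarrow> L) (at_right 0)"
 proof (rule tendstoI)
  fix e :: real assume e:"e>0"
  obtain N where N:"!!n. n>=N==>E f f/real (Suc n)<e/3" using small[of "e/3"] e by auto
  have "\<forall>\<^sub>F n in sequentially. dist (l n) L<e/3" using L e by (intro tendstoD) auto
  then obtain N' where N': "!!n. n>=N'==>dist (l n) L<e/3" by (auto simp:eventually_sequentially)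
  define n where "n=max N N'"
  have "\<forall>\<^sub>F h in at_right 0. dist (b n h) (l n)<e/3" using bl e by (intro tendstoD) auto
  then show "\<forall>\<^sub>F h in at_right 0. dist (a h) L<e" using eventually_at_right_less[of 0]
  proof eventually_elim
   case (elim h)
   have "E f f/real (Suc n)<e/3" by (rule N) (simp add:n_def)
   moreover have "dist (l n) L<e/3" by (rule N') (simp add:n_def)
   ultimately show ?case using elim(1) ab[OF elim(2), of n] unfolding dist_real_def by linarith
  qed
 qed
 then show ?thesis unfolding elim_fun_def a_def[symmetric]
  using tendsto_Lim[OF _ \<open>(a \<longlongrightarrow> L) (at_right 0)\<close>] by (simp add:a_def[abs_def, symmetric])
qed

lemma elim_fun_functional:
 assumes f:"f:F" "f:bdf"
 shows "bounded_functional (elim_fun f) (E f f)"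
proof
 fix g k :: "'a=>real" and a b :: real
 assume g:"g:Cc" and k:"k:Cc"
 show "elim_fun f (%x. a * g x + b * k x)=a * elim_fun f g + b * elim_fun f k"
 proof (rule tendsto_unique)
  show "((%h. \<integral>x. (a * g x + b * k x) * edens h f x \<partial>mu) \<longlongrightarrow> elim_fun f (%x. a * g x + b * k x)) (at_right 0)"
   by (rule elim_fun_limit[OF f Cc_lin[OF g k]])
  have "((%h. a * (\<integral>x. g x * edens h f x \<partial>mu) + b * (\<integral>x. k x * edens h f x \<partial>mu)) \<longlongrightarrow> a * elim_fun f g + b * elim_fun f k) (at_right 0)"
   by (intro tendsto_intros elim_fun_limit f g k)
  moreover have "\<forall>\<^sub>F h in at_right 0. a * (\<integral>x. g x * edens h f x \<partial>mu) + b * (\<integral>x. k x * edens h f x \<partial>mu)=(\<integral>x. (a * g x + b * k x) * edens h f x \<partial>mu)"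
   using eventually_at_right_less[of 0]
  proof eventually_elim
   case (elim h)
   have "(%x. (a * g x + b * k x) * edens h f x)=(%x. a * (g x * edens h f x) + b * (k x * edens h f x))" by (rule ext) (simp add:algebra_simps)
   then show ?case using edens_integrable_mult[OF elim f Cc_bdf[OF g]] edens_integrable_mult[OF elim f Cc_bdf[OF k]] by simp
  qed
  ultimately show "((%h. \<integral>x. (a * g x + b * k x) * edens h f x \<partial>mu) \<longlongrightarrow> a * elim_fun f g + b * elim_fun f k) (at_right 0)"
   by (rule Lim_transform_eventually)
 qed simp
next
 fix g :: "'a=>real" assume g:"g:Cc" "!!x. g x>=0"
 show "elim_fun f g>=0"
 proof (rule tendsto_lowerbound[OF elim_fun_limit[OF f g(1)]])
  show "\<forall>\<^sub>F h in at_right 0. 0<=(\<integral>x. g x * edens h f x \<partial>mu)" using eventually_at_right_less[of 0]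
   by eventually_elim (use f g edens_nonneg in \<open>auto intro!: Bochner_Integration.integral_nonneg mult_nonneg_nonneg\<close>)
 qed simp
next
 fix g :: "'a=>real" assume g:"g:Cc" "!!x. 0<=g x&g x<=1"
 show "elim_fun f g<=E f f"
 proof (rule tendsto_upperbound[OF elim_fun_limit[OF f g(1)]])
  show "\<forall>\<^sub>F h in at_right 0. (\<integral>x. g x * edens h f x \<partial>mu)<=E f f" using eventually_at_right_less[of 0]
  proof eventually_elim
   case (elim h)
   have "(\<integral>x. g x * edens h f x \<partial>mu)<=(\<integral>x. edens h f x \<partial>mu)" using g(2) edens_nonneg[OF elim f(2)]
   by (intro integral_mono edens_integrable_mult elim f Cc_bdf g edens_mass_E) (auto intro: mult_left_le_one_le)
   then show ?case using edens_mass_E(2)[OF elim f] by linarith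
  qed
 qed simp
qed

lemma cutoff_F:
 assumes K:"compact K"
 obtains \<chi>' where "\<chi>':F" "\<chi>':Cc" "!!x. 0<=\<chi>' x&\<chi>' x<=(1::real)" "!!x. x:K==>\<chi>' x=1"
proof -
 obtain ph where ph:"ph:Cc" "!!x. x:K==>ph x=(1::real)" by (rule bump_exists[OF K, of 1]) auto
 \<comment> \<open>The factor 2 makes an approximation with error below 1 exceed 1 on
   \<open>K\<close>, so cutting at 1 leaves the value 1 there.\<close>
 obtain g where g:"g:F" "g:Cc" "!!x. \<bar>2 * ph x - g x\<bar><1" using F_Cc_approx[OF Cc_cmult[OF ph(1), of 2], of 1] by auto
 have "unit_cut g:F" by (rule unit_cut_F[OF g(1)])
 moreover have "unit_cut g:Cc" using Cc_continuous[OF g(2)] unfolding unit_cut_def[abs_def] by (intro Cc_dominated[OF g(2)] continuous_intros) auto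
 moreover have "unit_cut g x=1" if "x:K" for x using ph(2)[OF that] g(3)[of x] by (auto simp:unit_cut_def)
 ultimately show thesis using that[of "unit_cut g"] by (auto simp:unit_cut_def)
qed

text \<open>Existence is the Riesz measure of \<open>elim_fun f\<close>. For uniqueness, a candidate
  is only known to integrate \<open>F Int Cc\<close>: cutoffs in \<open>F\<close> bound its value on
  compact sets, hence its total mass, and regularity extends the agreement to all of
  \<open>Cc\<close>.\<close>

lemma energy_measure_bounded_eq:
 assumes f:"f:F" "f:bdf"
 shows "energy_measure_bounded E F f=bounded_functional.rmeasure (elim_fun f)"
proof -
 interpret B: bounded_functional "TYPE('a)" "elim_fun f" "E f f" by (rule elim_fun_functional[OF f])
 have val:"elim_fun f g=E f (%x. f x * g x)-1/2 * E (%x. (f x)^2) g" if "g:F Int Cc" for g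
  using that by (intro tendsto_unique[OF _ elim_fun_limit[OF f] edens_limit[OF f]]) (auto intro: Cc_bdf)
 show ?thesis unfolding energy_measure_bounded_def
 proof (rule the_equality)
  show "sets B.rmeasure=sets borel&(ALL g:F Int Cc. integrable B.rmeasure g \<and>
   (\<integral>x. g x \<partial>B.rmeasure)=E f (%x. f x * g x)-1/2 * E (%x. (f x)^2) g)"
   using B.riesz_representation val by (auto intro: Cc_integrable B.finite_rmeasure)
 next
  fix nu assume nu:"sets nu=sets borel&(ALL g:F Int Cc. integrable nu g \<and>
   (\<integral>x. g x \<partial>nu)=E f (%x. f x * g x)-1/2 * E (%x. (f x)^2) g)"
  then have setsnu:"sets nu=sets borel" and int:"!!g. g:F==>g:Cc==>integrable nu g"
   and eq:"!!g. g:F==>g:Cc==>(\<integral>x. g x \<partial>nu)=elim_fun f g"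
   using val by auto
  have spnu:"space nu=UNIV" using sets_eq_imp_space_eq[OF setsnu] by simp
  have cpt:"emeasure nu K<=ennreal (E f f)" if K:"compact K" for K
  proof -
   obtain c where c:"c:F" "c:Cc" "!!x. 0<=c x&c x<=(1::real)" "!!x. x:K==>c x=1" using cutoff_F[OF K] by metis
   have "emeasure nu K=(\<integral>\<^sup>+x. indicator K x \<partial>nu)" using borel_compact[OF K] by (simp add:setsnu)
   also have "...<=(\<integral>\<^sup>+x. ennreal (c x) \<partial>nu)" using c by (intro nn_integral_mono) (auto simp:indicator_def)
   also have "...=ennreal (\<integral>x. c x \<partial>nu)" using int[OF c(1,2)] c(3) by (intro nn_integral_eq_integral) auto
   also have "...=ennreal (elim_fun f c)" using eq[OF c(1,2)] by simp
   also have "...<=ennreal (E f f)" by (intro ennreal_leI B.I_bound c)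
   finally show ?thesis .
  qed
  have "emeasure nu UNIV=(SUP n. emeasure nu (cball undefined (real n)))"
  proof -
   have "(\<Union>n. cball (undefined::'a) (real n))=UNIV" using real_arch_simple by (auto simp:mem_cball)
   moreover have "(SUP n. emeasure nu (cball undefined (real n)))=emeasure nu (\<Union>n. cball undefined (real n))"
   by (rule SUP_emeasure_incseq) (auto simp:incseq_def setsnu)
   ultimately show ?thesis by simp
  qed
  also have "...<=ennreal (E f f)" by (intro SUP_least cpt compact_cball)
  finally have fin:"finite_measure nu" by (intro finite_measureI) (auto simp:spnu top_unique)
  have all:"(\<integral>x. ph x \<partial>nu)=elim_fun f ph" if ph:"ph:Cc" for ph
  proof -
   have "\<bar>(\<integral>x. ph x \<partial>nu) - elim_fun f ph\<bar><=e * (measure nu UNIV + E f f)" if e:"e>0" for e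
   proof -
   obtain g where g:"g:F" "g:Cc" "!!x. \<bar>ph x - g x\<bar><e" using F_Cc_approx[OF ph e] by metis
   have i:"integrable nu ph" "integrable nu g" by (auto intro!: Cc_integrable fin setsnu ph g)
   have "\<bar>(\<integral>x. ph x \<partial>nu)-(\<integral>x. g x \<partial>nu)\<bar>=\<bar>\<integral>x. ph x - g x \<partial>nu\<bar>" using i by simp
   also have "...<=(\<integral>x. e \<partial>nu)" using i g(3) fin by (intro order_trans[OF integral_abs_bound integral_mono])
   (auto intro: less_imp_le finite_measure.integrable_const)
   also have "...=e * measure nu UNIV" using fin by (simp add:spnu)
   finally have 1:"\<bar>(\<integral>x. ph x \<partial>nu) - elim_fun f g\<bar><=e * measure nu UNIV" using eq[OF g(1,2)] by simp
   have 2:"\<bar>elim_fun f g - elim_fun f ph\<bar><=e * E f f"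
   proof (rule tendsto_upperbound)
   show "((%h. \<bar>(\<integral>x. g x * edens h f x \<partial>mu)-(\<integral>x. ph x * edens h f x \<partial>mu)\<bar>) \<longlongrightarrow> \<bar>elim_fun f g - elim_fun f ph\<bar>) (at_right 0)"
   by (intro tendsto_intros elim_fun_limit f g ph)
   show "\<forall>\<^sub>F h in at_right 0. \<bar>(\<integral>x. g x * edens h f x \<partial>mu)-(\<integral>x. ph x * edens h f x \<partial>mu)\<bar><=e * E f f"
   using eventually_at_right_less[of 0]
   proof eventually_elim
   case (elim h)
   have "\<bar>g x - ph x\<bar><=e" for x using g(3)[of x] by linarith
   then show ?case by (intro edens_approx elim f Cc_bdf g ph)
   qed
   qed simp
   show ?thesis using 1 2 by (simp add:distrib_left)
   qed
   note key = this
   define c where "c=measure nu UNIV + E f f"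
   have "\<bar>(\<integral>x. ph x \<partial>nu) - elim_fun f ph\<bar><=0"
   proof (rule LIMSEQ_le_const[of "%n. 1/real (Suc n) * c"])
   show "(%n. 1/real (Suc n) * c) ----> 0" by real_asymp
   show "EX N. ALL n>=N. \<bar>(\<integral>x. ph x \<partial>nu) - elim_fun f ph\<bar><=1/real (Suc n) * c"
   by (intro exI allI impI key[folded c_def]) simp
   qed
   then show ?thesis by simp
  qed
  show "nu=B.rmeasure"
  proof (rule measure_eqI)
   show "sets nu=sets B.rmeasure" by (simp add:setsnu)
   fix A assume "A:sets nu"
   then have A:"A:sets borel" by (simp add:setsnu)
   have "(\<Sum>(c,m)\<leftarrow>[(1,nu),(- 1,B.rmeasure)]. c * measure m A)=0" using fin setsnu B.finite_rmeasure all B.riesz_representation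
   by (intro signed_measure_zero A) auto
   then have "measure nu A=measure B.rmeasure A" by simp
   then show "emeasure nu A=emeasure B.rmeasure A"
   using finite_measure.emeasure_eq_measure[OF fin] finite_measure.emeasure_eq_measure[OF B.finite_rmeasure] by simp
  qed
 qed
qed

lemma energy_bounded:
 assumes f:"f:F" "f:bdf"
 shows "sets (energy_measure_bounded E F f)=sets borel"
  "finite_measure (energy_measure_bounded E F f)"
  "measure (energy_measure_bounded E F f) UNIV<=E f f"
  "ph:Cc==>(\<integral>x. ph x \<partial>energy_measure_bounded E F f)=elim_fun f ph"
proof -
 interpret B: bounded_functional "TYPE('a)" "elim_fun f" "E f f" by (rule elim_fun_functional[OF f])
 note eq = energy_measure_bounded_eq[OF f]
 show "sets (energy_measure_bounded E F f)=sets borel" "finite_measure (energy_measure_bounded E F f)" using B.finite_rmeasure by (simp_all add: eq)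
 show "measure (energy_measure_bounded E F f) UNIV<=E f f"
  using B.rmeasure_mass form_nonneg[OF f(1)] finite_measure.emeasure_eq_measure[OF B.finite_rmeasure] by (simp add:eq)
 show "ph:Cc==>(\<integral>x. ph x \<partial>energy_measure_bounded E F f)=elim_fun f ph" using B.riesz_representation by (simp add:eq)
qed

text \<open>Every quadratic identity between the densities \<open>edens h\<close> passes to the energy measures.\<close>

lemma energy_identity:
 fixes us :: "(real \<times> ('a=>real)) list"
 assumes us:"!!c u. (c,u):set us==>u:F&u:bdf"
  and zero:"!!h x. h>0==>(\<Sum>(c,u)\<leftarrow>us. c * edens h u x)=0"
  and A:"A:sets borel"
 shows "(\<Sum>(c,u)\<leftarrow>us. c * measure (energy_measure_bounded E F u) A)=0"
proof -
 have "(\<Sum>(c,m)\<leftarrow>map (%(c,u). (c,energy_measure_bounded E F u)) us. c * measure m A)=0"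
 proof (rule signed_measure_zero[OF _ _ A])
  fix c m assume "(c,m):set (map (%(c,u). (c,energy_measure_bounded E F u)) us)"
  then show "finite_measure m&sets m=sets borel" using us energy_bounded(1,2) by auto
 next
  fix ph :: "'a=>real" assume ph:"ph:Cc"
  have lim:"((%h. \<integral>x. ph x * (\<Sum>(c,u)\<leftarrow>vs. c * edens h u x) \<partial>mu) \<longlongrightarrow> (\<Sum>(c,u)\<leftarrow>vs. c * elim_fun u ph)) (at_right 0)
   &(ALL h>0. integrable mu (%x. ph x * (\<Sum>(c,u)\<leftarrow>vs. c * edens h u x)))"
   if "!!c u. (c,u):set vs==>u:F&u:bdf" for vs :: "(real \<times> ('a=>real)) list"
   using that
  proof (induction vs)
   case (Cons v vs)
   obtain c u where v:"v=(c,u)" by (cases v)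
   have u:"u:F" "u:bdf" using Cons.prems[of c u] by (auto simp:v)
   have IH:"((%h. \<integral>x. ph x * (\<Sum>(c,u)\<leftarrow>vs. c * edens h u x) \<partial>mu) \<longlongrightarrow> (\<Sum>(c,u)\<leftarrow>vs. c * elim_fun u ph)) (at_right 0)"
   "!!h. h>0==>integrable mu (%x. ph x * (\<Sum>(c,u)\<leftarrow>vs. c * edens h u x))"
   using Cons by auto
   note iu = edens_integrable_mult[OF _ u Cc_bdf[OF ph]]
   have e:"(%x. ph x * (\<Sum>(c,u)\<leftarrow>v # vs. c * edens h u x))=(%x. c * (ph x * edens h u x) + ph x * (\<Sum>(c,u)\<leftarrow>vs. c * edens h u x))" for h
   by (rule ext) (simp add:v algebra_simps)
   have "((%h. c * (\<integral>x. ph x * edens h u x \<partial>mu)+(\<integral>x. ph x * (\<Sum>(c,u)\<leftarrow>vs. c * edens h u x) \<partial>mu)) \<longlongrightarrow> c * elim_fun u ph+(\<Sum>(c,u)\<leftarrow>vs. c * elim_fun u ph)) (at_right 0)"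
   by (intro tendsto_intros elim_fun_limit u ph IH)
   moreover have "\<forall>\<^sub>F h in at_right 0. c * (\<integral>x. ph x * edens h u x \<partial>mu)+(\<integral>x. ph x * (\<Sum>(c,u)\<leftarrow>vs. c * edens h u x) \<partial>mu)
   = (\<integral>x. ph x * (\<Sum>(c,u)\<leftarrow>v # vs. c * edens h u x) \<partial>mu)"
   using eventually_at_right_less[of 0]
   proof eventually_elim
   case (elim h)
   show ?case unfolding e using iu[OF elim] IH(2)[OF elim] by simp
   qed
   ultimately have "((%h. \<integral>x. ph x * (\<Sum>(c,u)\<leftarrow>v # vs. c * edens h u x) \<partial>mu) \<longlongrightarrow> c * elim_fun u ph+(\<Sum>(c,u)\<leftarrow>vs. c * elim_fun u ph)) (at_right 0)"
   by (rule Lim_transform_eventually)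
   moreover have "integrable mu (%x. ph x * (\<Sum>(c,u)\<leftarrow>v # vs. c * edens h u x))" if "h>0" for h
   unfolding e using iu[OF that] IH(2)[OF that] by simp
   ultimately show ?case by (simp add:v)
  qed simp
  have l1:"((%h. \<integral>x. ph x * (\<Sum>(c,u)\<leftarrow>us. c * edens h u x) \<partial>mu) \<longlongrightarrow> (\<Sum>(c,u)\<leftarrow>us. c * elim_fun u ph)) (at_right 0)"
   using lim[of us] us by blast
  have "((%h::real. 0::real) \<longlongrightarrow> (\<Sum>(c,u)\<leftarrow>us. c * elim_fun u ph)) (at_right 0)"
  proof (rule Lim_transform_eventually[OF l1])
   show "\<forall>\<^sub>F h in at_right 0. (\<integral>x. ph x * (\<Sum>(c,u)\<leftarrow>us. c * edens h u x) \<partial>mu)=0"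
   using eventually_at_right_less[of 0] by eventually_elim (simp add:zero)
  qed
  then have "(\<Sum>(c,u)\<leftarrow>us. c * elim_fun u ph)=0" by (simp add:tendsto_const_iff trivial_limit_at_right_real)
  moreover have "(\<Sum>(c,m)\<leftarrow>map (%(c,u). (c,energy_measure_bounded E F u)) us. c * (\<integral>x. ph x \<partial>m))=(\<Sum>(c,u)\<leftarrow>us. c * elim_fun u ph)"
   unfolding map_map using us energy_bounded(4)[OF _ _ ph] by (intro arg_cong[where f = sum_list] map_cong) auto
  ultimately show "(\<Sum>(c,m)\<leftarrow>map (%(c,u). (c,energy_measure_bounded E F u)) us. c * (\<integral>x. ph x \<partial>m))=0" by simp
 qed
 then have z:"sum_list (map (%(c,m). c * measure m A) (map (%(c,u). (c,energy_measure_bounded E F u)) us))=0" .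
 have "map (%(c,m). c * measure m A) (map (%(c,u). (c,energy_measure_bounded E F u)) us)
   = map (%(c,u). c * measure (energy_measure_bounded E F u) A) us"
  by (induction us) auto
 with z show ?thesis by (rule subst[rotated])
qed


section \<open>Bilinear calculus of the energy measures\<close>

definition edens2 :: "real=>('a=>real)=>('a=>real) => 'a=>real" where
 "edens2 h u v x=(u x * v x - u x * Q h v x - v x * Q h u x + Q h (%y. u y * v y) x)/(2 * h)"

lemma edens_expand:
 assumes h:"h>0" and u:"u:bdf" and v:"v:bdf"
 shows "edens h (%x. a * u x + b * v x) x=a^2 * edens h u x+2 * a * b * edens2 h u v x + b^2 * edens h v x"
proof -
 have e:"(%y. (a * u y + b * v y)^2)=(%y. 1*(a^2*(u y)^2+(2 * a * b)*(u y * v y)) + b^2*(v y)^2)"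
  by (rule ext) (simp add:power2_eq_square algebra_simps)
 have "Q h (%y. (a * u y + b * v y)^2) x=1 * Q h (%y. a^2*(u y)^2+(2 * a * b)*(u y * v y)) x + b^2 * Q h (%y. (v y)^2) x"
  unfolding e by (intro Q_lin h bdf_lin bdf_power2 bdf_mult u v)
 also have "Q h (%y. a^2*(u y)^2+(2 * a * b)*(u y * v y)) x=a^2 * Q h (%y. (u y)^2) x+(2 * a * b) * Q h (%y. u y * v y) x"
  by (intro Q_lin h bdf_power2 bdf_mult u v)
 finally have 1:"Q h (%y. (a * u y + b * v y)^2) x=a^2 * Q h (%y. (u y)^2) x+(2 * a * b) * Q h (%y. u y * v y) x + b^2 * Q h (%y. (v y)^2) x" by simp
 have 2:"Q h (%y. a * u y + b * v y) x=a * Q h u x + b * Q h v x" by (rule Q_lin[OF h u v])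
 have "(a * U + b * V)^2-2*(a * U + b * V)*(a * qu + b * qv)+(a^2 * quu+2 * a * b * quv + b^2 * qvv)
   = a^2*(U^2-2 * U * qu + quu)+2 * a * b * (U * V - U * qv - V * qu + quv) + b^2*(V^2-2 * V * qv + qvv)"
  for U V qu qv quu quv qvv by (simp add:power2_eq_square algebra_simps)
 note eq = this
 have gen:"(a^2 * X+2 * a * b * Y + b^2 * Z)/d=a^2*(X/d)+2 * a * b * (Y/d) + b^2*(Z/d)" for X Y Z d :: real by (simp add:add_divide_distrib)
 show ?thesis unfolding edens_def edens2_def 1 2 eq by (rule gen)
qed

lemma edens2_lin:
 assumes h:"h>0" and u:"u:bdf" and u': "u':bdf" and v:"v:bdf"
 shows "edens2 h (%x. a * u x + b * u' x) v x=a * edens2 h u v x + b * edens2 h u' v x"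
proof -
 have e:"(%y. (a * u y + b * u' y) * v y)=(%y. a * (u y * v y) + b * (u' y * v y))" by (rule ext) (simp add:algebra_simps)
 have 1:"Q h (%y. (a * u y + b * u' y) * v y) x=a * Q h (%y. u y * v y) x + b * Q h (%y. u' y * v y) x"
  unfolding e by (intro Q_lin h bdf_mult u u' v)
 have 2:"Q h (%y. a * u y + b * u' y) x=a * Q h u x + b * Q h u' x" by (rule Q_lin[OF h u u'])
 have "(a * U + b * U') * V-(a * U + b * U') * qv - V * (a * qu + b * qu')+(a * quv + b * quv')
   = a * (U * V - U * qv - V * qu + quv) + b * (U' * V - U' * qv - V * qu' + quv')"
  for U U' V qu qu' qv quv quv' by (simp add:algebra_simps)
 note eq = this
 have gen:"(a * X + b * Y)/d=a * (X/d) + b * (Y/d)" for X Y d :: real by (simp add:add_divide_distrib)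
 show ?thesis unfolding edens2_def 1 2 eq by (rule gen)
qed

definition en :: "('a=>real) => 'a set=>real" where
 "en f A=measure (energy_measure_bounded E F f) A"

definition enB :: "('a=>real)=>('a=>real) => 'a set=>real" where
 "enB f g A=(en (%x. f x + g x) A - en (%x. f x - g x) A)/4"

lemma Fb_lin:"f:F&f:bdf==>g:F&g:bdf==>(%x. a * f x + b * g x):F&(%x. a * f x + b * g x):bdf" by (simp add:F_lin bdf_lin)

lemma Fb_add:"f:F&f:bdf==>g:F&g:bdf==>(%x. f x + g x):F&(%x. f x + g x):bdf"
 and Fb_diff:"f:F&f:bdf==>g:F&g:bdf==>(%x. f x - g x):F&(%x. f x - g x):bdf"
 using Fb_lin[of f g 1 1] Fb_lin[of f g 1 "-1"] by simp_all

text \<open>The identity holds exactly for the densities \<open>edens h\<close>, and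
  \<open>energy_identity\<close> transfers it to measures; the five-term list is this identity with
  the mixed term written by polarization.\<close>

lemma en_expand:
 assumes f:"f:F&f:bdf" and g:"g:F&g:bdf" and A:"A:sets borel"
 shows "en (%x. a * f x + b * g x) A=a^2 * en f A+2 * a * b * enB f g A + b^2 * en g A"
proof -
 have "(\<Sum>(c,u)\<leftarrow>[(1,%x. a * f x + b * g x),(- a\<^sup>2,f),(- b\<^sup>2,g),(- a * b/2,%x. f x + g x),(a * b/2,%x. f x - g x)].
  c * measure (energy_measure_bounded E F u) A)=0"
 proof (rule energy_identity[OF _ _ A])
  fix c u assume "(c,u):set [(1,%x. a * f x + b * g x),(- a\<^sup>2,f),(- b\<^sup>2,g),(- a * b/2,%x. f x + g x),(a * b/2,%x. f x - g x)]"
  then show "u:F&u:bdf" using Fb_lin[OF f g, of a b] Fb_add[OF f g] Fb_diff[OF f g] f g by auto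
 next
  fix h :: real and x assume h:"h>0"
  have s:"edens h (%x. f x + g x) x=edens h f x+2 * edens2 h f g x + edens h g x" using edens_expand[OF h, of f g 1 1 x] f g by simp
  have d:"edens h (%x. f x - g x) x=edens h f x-2 * edens2 h f g x + edens h g x" using edens_expand[OF h, of f g 1 "-1" x] f g by simp
  have t:"edens h (%x. a * f x + b * g x) x=a^2 * edens h f x+2 * a * b * edens2 h f g x + b^2 * edens h g x"
   using edens_expand[OF h, of f g a b x] f g by simp
  show "(\<Sum>(c,u)\<leftarrow>[(1,%x. a * f x + b * g x),(- a\<^sup>2,f),(- b\<^sup>2,g),(- a * b/2,%x. f x + g x),(a * b/2,%x. f x - g x)].
   c * edens h u x)=0"
   by (simp add:s d t field_simps)
 qed
 then show ?thesis by (simp add:en_def enB_def field_simps)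
qed

lemma enB_lin:
 assumes f:"f:F&f:bdf" and f': "f':F&f':bdf" and g:"g:F&g:bdf" and A:"A:sets borel"
 shows "enB (%x. a * f x + b * f' x) g A=a * enB f g A + b * enB f' g A"
proof -
 let ?k = "%x. a * f x + b * f' x"
 let ?L = "[(1,%x. ?k x + g x),(- 1,%x. ?k x - g x),(- a,%x. f x + g x),(a,%x. f x - g x),(- b,%x. f' x + g x),(b,%x. f' x - g x)]"
 note k = Fb_lin[OF f f', of a b]
 have "(\<Sum>(c,u)\<leftarrow>?L. c * measure (energy_measure_bounded E F u) A)=0"
 proof (rule energy_identity[OF _ _ A])
  fix c u assume "(c,u):set ?L"
  then show "u:F&u:bdf" using Fb_add[OF k g] Fb_diff[OF k g] Fb_add[OF f g] Fb_diff[OF f g] Fb_add[OF f' g] Fb_diff[OF f' g] by auto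
 next
  fix h :: real and x assume h:"h>0"
  have s:"edens h (%x. u x + g x) x=edens h u x+2 * edens2 h u g x + edens h g x"
   and d:"edens h (%x. u x - g x) x=edens h u x-2 * edens2 h u g x + edens h g x" if "u:F&u:bdf" for u
   using edens_expand[OF h, of u g 1 1 x] edens_expand[OF h, of u g 1 "-1" x] that g by simp_all
  have e2:"edens2 h ?k g x=a * edens2 h f g x + b * edens2 h f' g x" using f f' g by (intro edens2_lin h) auto
  show "(\<Sum>(c,u)\<leftarrow>?L. c * edens h u x)=0" by (simp add:s[OF k] d[OF k] s[OF f] d[OF f] s[OF f'] d[OF f'] e2 ring_distribs)
 qed
 then show ?thesis by (simp add:en_def enB_def field_simps)
qed

lemma en_nonneg:"en f A>=0" by (simp add:en_def)

lemma en_le_E:"f:F&f:bdf==>en f A<=E f f" using energy_bounded(1,2,3)[of f] finite_measure.bounded_measure[of "energy_measure_bounded E F f" A]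
  sets_eq_imp_space_eq[of "energy_measure_bounded E F f" borel] unfolding en_def by fastforce

lemma enB_Cauchy_Schwarz:
 assumes f:"f:F&f:bdf" and g:"g:F&g:bdf" and A:"A:sets borel"
 shows "(enB f g A)^2<=en f A * en g A"
proof (rule quadratic_nonneg_discriminant)
 fix s
 show "0<=en f A+2 * enB f g A * s + en g A * s^2" using en_nonneg[of "%x. 1 * f x + s * g x" A] unfolding en_expand[OF f g A] by (simp add:mult_ac)
qed

lemma sqrt_quadratic_triangle:
 fixes a b c :: real
 assumes "b^2<=a * c" "a>=0" "c>=0"
 shows "sqrt (a+2 * b + c)<=sqrt a + sqrt c"
proof (rule real_le_lsqrt)
 have "b<=(abs b)" by simp
 also have "...=sqrt (b^2)" by simp
 also have "...<=sqrt (a * c)" by (rule real_sqrt_le_mono[OF assms(1)])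
 finally have "b<=sqrt a * sqrt c" by (simp add:real_sqrt_mult)
 then show "a+2 * b + c<=(sqrt a + sqrt c)^2" using assms by (simp add:power2_sum)
qed (use assms in simp)

text \<open>At each fixed \<open>A\<close> the square root of the energy is a seminorm below the
  energy norm. The estimate is uniform in \<open>A\<close>, and this uniformity later carries
  countable additivity over to unbounded functions.\<close>

lemma en_lipschitz:
 assumes f:"f:F&f:bdf" and g:"g:F&g:bdf" and A:"A:sets borel"
 shows "sqrt (en f A)<=sqrt (en g A) + sqrt (E (%x. f x - g x) (%x. f x - g x))"
proof -
 note d = Fb_diff[OF f g]
 have "en f A=en g A+2 * enB g (%x. f x - g x) A + en (%x. f x - g x) A" using en_expand[OF g d A, of 1 1] by simp
 then have "sqrt (en f A)<=sqrt (en g A) + sqrt (en (%x. f x - g x) A)"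
  using sqrt_quadratic_triangle[OF enB_Cauchy_Schwarz[OF g d A] en_nonneg en_nonneg] by simp
 also have "sqrt (en (%x. f x - g x) A)<=sqrt (E (%x. f x - g x) (%x. f x - g x))" by (intro real_sqrt_le_mono en_le_E d)
 finally show ?thesis by simp
qed

definition Enorm :: "('a=>real)=>real" where
 "Enorm f=sqrt (E f f)"

lemma Enorm_nonneg:"f:F==>Enorm f>=0" by (simp add:Enorm_def form_nonneg)

lemma Enorm_triangle:
 assumes f:"f:F" and g:"g:F"
 shows "Enorm (%x. f x + g x)<=Enorm f + Enorm g"
proof -
 have "(E f g)^2<=E f f * E g g"
 proof (rule quadratic_nonneg_discriminant)
  fix s
  show "0<=E f f+2 * E f g * s + E g g * s^2" using form_nonneg[OF F_lin[OF f g, of 1 s]] unfolding E_expand[OF f g] by (simp add:mult_ac)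
 qed
 from sqrt_quadratic_triangle[OF this form_nonneg[OF f] form_nonneg[OF g]] show ?thesis unfolding Enorm_def using E_expand[OF f g, of 1 1] by simp
qed

lemma Enorm_scale:"f:F==>Enorm (%x. a * f x)=(abs a) * Enorm f" using E_expand[of f f a 0] by (simp add:Enorm_def real_sqrt_mult)

lemma Enorm_diff_triangle:
 assumes "f:F" "g:F" "k:F"
 shows "Enorm (%x. f x - k x)<=Enorm (%x. f x - g x) + Enorm (%x. g x - k x)"
 using Enorm_triangle[OF F_diff[OF assms(1,2)] F_diff[OF assms(2,3)]] by simp

lemma Enorm_minus_commute:"f:F==>g:F==>Enorm (%x. f x - g x)=Enorm (%x. g x - f x)" using Enorm_scale[OF F_diff[of g f], of "-1"] by simp

lemma en_sqrt_diff:
 assumes f:"f:F&f:bdf" and g:"g:F&g:bdf" and A:"A:sets borel"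
 shows "\<bar>sqrt (en f A) - sqrt (en g A)\<bar><=Enorm (%x. f x - g x)"
 using en_lipschitz[OF f g A] en_lipschitz[OF g f A] Enorm_minus_commute[of f g] f g by (simp add:Enorm_def abs_le_iff)

section \<open>Energy measures of unbounded functions\<close>

definition eg :: "('a=>real) => 'a set=>real" where
 "eg f A=lim (%k. en (truncate k f) A)"

lemma truncate_Fb:"f:F==>truncate k f:F&truncate k f:bdf" by (simp add:truncate_F truncate_bdd L2_measurable F_L2)

lemma truncate_Enorm:"f:F==>(%k. Enorm (%x. truncate k f x - f x)) ----> 0" using tendsto_real_sqrt[OF truncate_E_limit] by (simp add:Enorm_def)

text \<open>The square roots of \<open>en (u k) A\<close> are Cauchy because they are Lipschitz in
  the energy norm. The limit does not depend on the approximating sequence, which frees later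
  identities from the particular truncations.\<close>

lemma en_approx:
 assumes f:"f:F" and u:"!!k. u k:F&u k:bdf"
  and lim:"(%k. Enorm (%x. u k x - f x)) ----> 0" and A:"A:sets borel"
 shows "(%k. en (u k) A) ----> eg f A" "eg f A>=0"
  "\<bar>sqrt (en (u k) A) - sqrt (eg f A)\<bar><=Enorm (%x. u k x - f x)"
proof -
 have main:"EX s>=0. (%k. sqrt (en (v k) A)) ----> s&(ALL k. \<bar>sqrt (en (v k) A) - s\<bar><=Enorm (%x. v k x - f x))"
  if v:"!!k. v k:F&v k:bdf" and vl:"(%k. Enorm (%x. v k x - f x)) ----> 0" for v
 proof -
  have d:"\<bar>sqrt (en (v k) A) - sqrt (en (v j) A)\<bar><=Enorm (%x. v k x - f x) + Enorm (%x. v j x - f x)" for j k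
   using en_sqrt_diff[OF v v A, of k j] Enorm_diff_triangle[of "v k" f "v j"] Enorm_minus_commute[of "v j" f] v f by fastforce
  have "Cauchy (%k. sqrt (en (v k) A))"
  proof (rule metric_CauchyI)
   fix e :: real assume "e>0"
   then have "\<forall>\<^sub>F k in sequentially. Enorm (%x. v k x - f x)<e/2" using vl by (intro order_tendstoD) auto
   then obtain N where N:"!!k. k>=N==>Enorm (%x. v k x - f x)<e/2" by (auto simp:eventually_sequentially)
   show "EX M. ALL m>=M. ALL n>=M. dist (sqrt (en (v m) A)) (sqrt (en (v n) A))<e"
   proof (intro exI allI impI)
   fix m n assume "m>=N" "n>=N"
   then show "dist (sqrt (en (v m) A)) (sqrt (en (v n) A))<e" using d[of m n] N[of m] N[of n] by (simp add:dist_real_def)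
   qed
  qed
  then obtain s where s:"(%k. sqrt (en (v k) A)) ----> s" by (auto simp:Cauchy_convergent_iff convergent_def)
  have "s>=0" by (rule LIMSEQ_le_const[OF s]) (auto simp:en_nonneg)
  moreover have "\<bar>sqrt (en (v k) A) - s\<bar><=Enorm (%x. v k x - f x)" for k
  proof (rule LIMSEQ_le)
   show "(%j. \<bar>sqrt (en (v k) A) - sqrt (en (v j) A)\<bar>) ----> \<bar>sqrt (en (v k) A) - s\<bar>" by (intro tendsto_intros s)
   show "(%j. Enorm (%x. v k x - f x) + Enorm (%x. v j x - f x)) ----> Enorm (%x. v k x - f x)" using tendsto_add[OF tendsto_const vl] by simp
  qed (use d in auto)
  ultimately show ?thesis using s by auto
 qed
 obtain s where s:"s>=0" "(%k. sqrt (en (truncate k f) A)) ----> s"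
  "!!k. \<bar>sqrt (en (truncate k f) A) - s\<bar><=Enorm (%x. truncate k f x - f x)"
  using main[OF truncate_Fb[OF f] truncate_Enorm[OF f]] by blast
 have "(%k. (sqrt (en (truncate k f) A))^2) ----> s\<^sup>2" by (intro tendsto_intros s)
 then have "(%k. en (truncate k f) A) ----> s\<^sup>2" by (simp add:en_nonneg)
 then have egs:"eg f A=s^2" unfolding eg_def by (rule limI)
 then show "eg f A>=0" by simp
 obtain r where r:"r>=0" "(%k. sqrt (en (u k) A)) ----> r"
  "!!k. \<bar>sqrt (en (u k) A) - r\<bar><=Enorm (%x. u k x - f x)"
  using main[OF u lim] by blast
 have "(%k. \<bar>sqrt (en (u k) A) - sqrt (en (truncate k f) A)\<bar>) ----> 0"
 proof (rule tendsto_sandwich[OF always_eventually always_eventually tendsto_const])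
  show "(%k. Enorm (%x. u k x - f x) + Enorm (%x. truncate k f x - f x)) ----> 0" using tendsto_add[OF lim truncate_Enorm[OF f]] by simp
  show "ALL k. \<bar>sqrt (en (u k) A) - sqrt (en (truncate k f) A)\<bar><=Enorm (%x. u k x - f x) + Enorm (%x. truncate k f x - f x)"
  proof
   fix k
   show "\<bar>sqrt (en (u k) A) - sqrt (en (truncate k f) A)\<bar><=Enorm (%x. u k x - f x) + Enorm (%x. truncate k f x - f x)"
   using en_sqrt_diff[OF u truncate_Fb[OF f] A, of k k] Enorm_diff_triangle[of "u k" f "truncate k f"]
   Enorm_minus_commute[of "truncate k f" f] u[of k] truncate_Fb[OF f, of k] f by fastforce
  qed
 qed auto
 moreover have "(%k. \<bar>sqrt (en (u k) A) - sqrt (en (truncate k f) A)\<bar>) ----> \<bar>r - s\<bar>" by (intro tendsto_intros r s)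
 ultimately have rs:"r=s" using LIMSEQ_unique by fastforce
 have "(%k. (sqrt (en (u k) A))^2) ----> r\<^sup>2" by (intro tendsto_intros r)
 then show "(%k. en (u k) A) ----> eg f A" by (simp add:en_nonneg egs rs)
 show "\<bar>sqrt (en (u k) A) - sqrt (eg f A)\<bar><=Enorm (%x. u k x - f x)" using r(1,3) by (simp add:egs rs)
qed

lemmas en_truncate = en_approx[OF _ truncate_Fb truncate_Enorm]

lemma eg_bounded:"f:F&f:bdf==>A:sets borel==>eg f A=en f A"
proof -
 assume f:"f:F&f:bdf" and A:"A:sets borel"
 have "Enorm (%x. f x - f x)=0" using Enorm_scale[of f 0] f by simp
 then have "(%k::nat. Enorm (%x. f x - f x)) ----> 0" by simp
 from en_approx(1)[OF conjunct1[OF f] f this A] show "eg f A=en f A" by (simp add:LIMSEQ_const_iff)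
qed

lemma eg_le_E: assumes f:"f:F" and A:"A:sets borel" shows "eg f A<=E f f"
proof (rule LIMSEQ_le_const2[OF en_truncate(1)[OF f f f A]])
 have "en (truncate k f) A<=E f f" for k using en_le_E[OF truncate_Fb[OF f]] truncate_F(2)[OF f] by (rule order_trans)
 then show "EX N. ALL n>=N. en (truncate n f) A<=E f f" by blast
qed

lemma eg_additive:
 assumes f:"f:F" and A:"A:sets borel" and B:"B:sets borel" and "A Int B={}"
 shows "eg f (A Un B)=eg f A + eg f B"
proof (rule LIMSEQ_unique[OF en_truncate(1)[OF f f f]])
 show "A Un B:sets borel" using A B by auto
 have "en (truncate k f) (A Un B)=en (truncate k f) A + en (truncate k f) B" for k
  unfolding en_def using energy_bounded(1,2)[of "truncate k f"] truncate_Fb[OF f, of k] assms by (intro finite_measure.finite_measure_Union) auto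
 then show "(%k. en (truncate k f) (A Un B)) ----> eg f A + eg f B"
  using tendsto_add[OF en_truncate(1)[OF f f f A] en_truncate(1)[OF f f f B]] by simp
qed

text \<open>Countable additivity survives the limit because \<open>en (truncate k f) B\<close>
  converges to \<open>eg f B\<close> uniformly in \<open>B\<close>.\<close>

lemma eg_sums:
 assumes f:"f:F" and A:"!!i::nat. A i:sets borel" and dis:"disjoint_family A"
 shows "(%i. eg f (A i)) sums eg f (\<Union>i. A i)"
proof -
 have fin:"eg f (\<Union>i<n. A i)=(\<Sum>i<n. eg f (A i))" for n
 proof (induction n)
  case 0
  have "en (truncate k f) {}=0" for k by (simp add:en_def)
  then show ?case using en_truncate(1)[OF f f f, of "{}"] by (simp add:LIMSEQ_const_iff)
 next
  case (Suc n)
  have "(\<Union>i<Suc n. A i)=(\<Union>i<n. A i) Un A n" by (auto simp:less_Suc_eq)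
  moreover have "A i Int A n={}" if "i<n" for i using that by (intro disjoint_family_onD[OF dis]) auto
  then have "(\<Union>i<n. A i) Int A n={}" by blast
  ultimately show ?case using eg_additive[OF f _ A[of n], of "\<Union>i<n. A i"] A Suc by auto
 qed
 let ?U = "\<Union>i. A i"
 have Ub:"?U:sets borel" using A by auto
 define S where "S=sqrt (E f f)"
 \<comment> \<open>Factorizes the difference of squares of the two square roots, each of which is at
   most \<open>S\<close>.\<close>
 have near:"\<bar>en (truncate k f) B - eg f B\<bar><=Enorm (%x. truncate k f x - f x)*(2 * S)" if B:"B:sets borel" for k B
 proof -
  let ?a = "sqrt (en (truncate k f) B)" and ?b = "sqrt (eg f B)"
  have "?a<=S" unfolding S_def using en_le_E[OF truncate_Fb[OF f], of k B] truncate_F(2)[OF f, of k] by (intro real_sqrt_le_mono) linarith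
  moreover have "?b<=S" unfolding S_def by (intro real_sqrt_le_mono eg_le_E f B)
  moreover have "0<=?a" "0<=?b" using en_nonneg en_truncate(2)[OF f f f B] by auto
  moreover have "\<bar>?a - ?b\<bar><=Enorm (%x. truncate k f x - f x)" by (rule en_truncate(3)[OF f f f B])
  ultimately have "\<bar>?a - ?b\<bar> * (?a + ?b)<=Enorm (%x. truncate k f x - f x)*(2 * S)" by (intro mult_mono) auto
  moreover have "en (truncate k f) B - eg f B=(?a - ?b)*(?a + ?b)"
   using en_nonneg[of "truncate k f" B] en_truncate(2)[OF f f f B] by (simp add:algebra_simps)
  ultimately show ?thesis using \<open>0 \<le> ?a\<close> \<open>0 \<le> ?b\<close> by (simp add:abs_mult)
 qed
 have "(%n. eg f (\<Union>i<n. A i)) ----> eg f ?U"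
 proof (rule tendstoI)
  fix e :: real assume e:"e>0"
  have "(%k. Enorm (%x. truncate k f x - f x)*(2 * S)) ----> 0*(2 * S)" by (intro tendsto_intros truncate_Enorm f)
  then have "\<forall>\<^sub>F k in sequentially. Enorm (%x. truncate k f x - f x)*(2 * S)<e/3" using e by (intro order_tendstoD) auto
  from eventually_happens'[OF sequentially_bot this]
  obtain k where k:"Enorm (%x. truncate k f x - f x)*(2 * S)<e/3" by blast
  have "(%n. en (truncate k f) (\<Union>i<n. A i)) ----> en (truncate k f) (\<Union>n. \<Union>i<n. A i)" unfolding en_def
  proof (rule finite_measure.finite_Lim_measure_incseq)
   show "incseq (%n. \<Union>i<n. A i)" by (intro incseq_SucI UN_mono) auto
  qed (use energy_bounded(1,2)[of "truncate k f"] truncate_Fb[OF f, of k] A in auto)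
  moreover have "(\<Union>n. \<Union>i<n. A i)=?U" by auto
  ultimately have "\<forall>\<^sub>F n in sequentially. dist (en (truncate k f) (\<Union>i<n. A i)) (en (truncate k f) ?U)<e/3"
   using e by (intro tendstoD) auto
  then show "\<forall>\<^sub>F n in sequentially. dist (eg f (\<Union>i<n. A i)) (eg f ?U)<e"
  proof eventually_elim
   case (elim n)
   have "(\<Union>i<n. A i):sets borel" using A by auto
   have arith:"\<bar>a - b\<bar><e" if "\<bar>c - a\<bar><=z" "\<bar>d - b\<bar><=z" "z<e/3" "\<bar>c - d\<bar><e/3" for a b c d z :: real
   using that by linarith
   show ?case unfolding dist_real_def
   by (rule arith[OF near[OF \<open>(\<Union>i<n. A i) \<in> sets borel\<close>, of k] near[OF Ub, of k] k elim[unfolded dist_real_def]])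
  qed
 qed
 then show ?thesis unfolding sums_def fin .
qed

text \<open>\<open>measure_of\<close> takes the prescribed values only once the set function is
  known to be positive and countably additive, which is what \<open>eg_sums\<close> is for.\<close>

lemma energy_measure_eq:
 assumes f:"f:F"
 shows "sets (energy_measure E F f)=sets borel" "finite_measure (energy_measure E F f)"
  "A:sets borel==>measure (energy_measure E F f) A=eg f A"
proof -
 let ?L = "%A. lim (%k. emeasure (energy_measure_bounded E F (truncate k f)) A)"
 have L:"?L A=ennreal (eg f A)" if A:"A:sets borel" for A
 proof (rule limI)
  have "emeasure (energy_measure_bounded E F (truncate k f)) A=ennreal (en (truncate k f) A)" for k
   unfolding en_def using energy_bounded(2)[of "truncate k f"] truncate_Fb[OF f, of k] by (intro finite_measure.emeasure_eq_measure) auto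
  then show "(%k. emeasure (energy_measure_bounded E F (truncate k f)) A) ----> ennreal (eg f A)"
   using tendsto_ennrealI[OF en_truncate(1)[OF f f f A]] by simp
 qed
 show s:"sets (energy_measure E F f)=sets borel" using sets.sigma_sets_eq[of "borel::'a measure"] by (simp add:energy_measure_def)
 have pos:"positive (sets borel) ?L" using L[of "{}"] by (simp add:positive_def)
 have add:"countably_additive (sets borel) ?L"
 proof (rule countably_additiveI)
  fix A :: "nat => 'a set" assume A:"range A \<subseteq> sets borel" "disjoint_family A" "(\<Union>i. A i):sets borel"
  then have Ai:"A i:sets borel" for i by auto
  have "(\<Sum>i. ?L (A i))=(\<Sum>i. ennreal (eg f (A i)))" using L[OF Ai] by simp
  also have "...=ennreal (\<Sum>i. eg f (A i))"
   using eg_sums[OF f Ai A(2)] en_truncate(2)[OF f f f Ai] by (intro suminf_ennreal2) (auto simp:sums_iff)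
  also have "...=?L (\<Union>i. A i)" using eg_sums[OF f Ai A(2)] L[OF A(3)] by (simp add:sums_iff)
  finally show "(\<Sum>i. ?L (A i))=?L (\<Union>i. A i)" .
 qed
 have em:"emeasure (energy_measure E F f) A=ennreal (eg f A)" if A:"A:sets borel" for A unfolding energy_measure_def L[OF A, symmetric]
  using sets.sigma_algebra_axioms[of "borel::'a measure"] by (intro emeasure_measure_of_sigma[OF _ pos add A]) simp
 have "space (energy_measure E F f)=UNIV" using sets_eq_imp_space_eq[OF s] by simp
 then show "finite_measure (energy_measure E F f)" using em[of UNIV] by (intro finite_measureI) simp
 show "A:sets borel==>measure (energy_measure E F f) A=eg f A" using em en_truncate(2)[OF f f f] by (simp add:measure_def)
qed

definition egB :: "('a=>real)=>('a=>real) => 'a set=>real" where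
 "egB f g A=(eg (%x. f x + g x) A - eg (%x. f x - g x) A)/4"

lemma mutual_energy_eq:"f:F==>g:F==>A:sets borel==>mutual_energy_measure E F f g A=egB f g A"
 by (simp add:mutual_energy_measure_def egB_def energy_measure_eq domain_add F_diff)

lemma Enorm_lin_limit:
 assumes f:"f:F" "!!k. u k:F" "(%k. Enorm (%x. u k x - f x)) ----> 0"
  and g:"g:F" "!!k. v k:F" "(%k. Enorm (%x. v k x - g x)) ----> 0"
 shows "(%k. Enorm (%x. (a * u k x + b * v k x)-(a * f x + b * g x))) ----> 0"
proof (rule tendsto_sandwich[OF always_eventually always_eventually tendsto_const])
 show "(%k. (abs a) * Enorm (%x. u k x - f x) + (abs b) * Enorm (%x. v k x - g x)) ----> 0"
  using tendsto_add[OF tendsto_mult_left[OF f(3), of "(abs a)"] tendsto_mult_left[OF g(3), of "(abs b)"]] by simp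
 have e:"(%x. (a * u k x + b * v k x)-(a * f x + b * g x))=(%x. a * (u k x - f x) + b * (v k x - g x))" for k by (rule ext) (simp add:algebra_simps)
 have D:"(%x. u k x - f x):F" "(%x. v k x - g x):F" for k using f g by (auto intro: F_diff)
 show "ALL k. Enorm (%x. (a * u k x + b * v k x)-(a * f x + b * g x))<=(abs a) * Enorm (%x. u k x - f x) + (abs b) * Enorm (%x. v k x - g x)"
  unfolding e using Enorm_triangle[OF domain_scale[OF D(1)] domain_scale[OF D(2)]] by (simp add:Enorm_scale D)
 show "ALL k. 0<=Enorm (%x. (a * u k x + b * v k x)-(a * f x + b * g x))" unfolding e using D by (auto intro!: Enorm_nonneg F_lin)
qed

lemma egB_limit:
 assumes f:"f:F" "!!k. u k:F&u k:bdf" "(%k. Enorm (%x. u k x - f x)) ----> 0"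
  and g:"g:F" "!!k. v k:F&v k:bdf" "(%k. Enorm (%x. v k x - g x)) ----> 0"
  and A:"A:sets borel"
 shows "(%k. enB (u k) (v k) A) ----> egB f g A"
proof -
 have uF:"!!k. u k:F" "!!k. v k:F" using f(2) g(2) by auto
 have "(%k. en (%x. 1 * u k x + b * v k x) A) ----> eg (%x. 1 * f x + b * g x) A" for b
  using en_approx(1)[OF F_lin[OF f(1) g(1)] Fb_lin[OF f(2) g(2)] Enorm_lin_limit[OF f(1) uF(1) f(3) g(1) uF(2) g(3)] A] .
 from this[of 1] this[of "-1"] show ?thesis unfolding enB_def egB_def by (intro tendsto_intros) auto
qed

lemma eg_expand:
 assumes f:"f:F" and g:"g:F" and A:"A:sets borel"
 shows "eg (%x. a * f x + b * g x) A=a^2 * eg f A+2 * a * b * egB f g A + b^2 * eg g A"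
proof (rule LIMSEQ_unique)
 note tf = truncate_Fb[OF f] truncate_Enorm[OF f] and tg = truncate_Fb[OF g] truncate_Enorm[OF g]
 show "(%k. en (%x. a * truncate k f x + b * truncate k g x) A) ----> eg (%x. a * f x + b * g x) A"
  by (rule en_approx(1)[OF F_lin[OF f g] Fb_lin[OF tf(1) tg(1)] Enorm_lin_limit[OF f _ tf(2) g _ tg(2)] A])
   (use tf tg in auto)
 show "(%k. en (%x. a * truncate k f x + b * truncate k g x) A) ----> a\<^sup>2 * eg f A+2 * a * b * egB f g A + b^2 * eg g A"
  unfolding en_expand[OF tf(1) tg(1) A] by (intro tendsto_intros en_approx(1)[OF f tf A] en_approx(1)[OF g tg A] egB_limit[OF f tf g tg A])
qed

lemma egB_lin_left:
 assumes f:"f:F" and f': "f':F" and g:"g:F" and A:"A:sets borel"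
 shows "egB (%x. a * f x + b * f' x) g A=a * egB f g A + b * egB f' g A"
proof (rule LIMSEQ_unique)
 note tf = truncate_Fb[OF f] truncate_Enorm[OF f] and tg = truncate_Fb[OF g] truncate_Enorm[OF g]
  and tf' = truncate_Fb[OF f'] truncate_Enorm[OF f']
 show "(%k. enB (%x. a * truncate k f x + b * truncate k f' x) (truncate k g) A) ----> egB (%x. a * f x + b * f' x) g A"
  by (rule egB_limit[OF F_lin[OF f f'] Fb_lin[OF tf(1) tf'(1)] Enorm_lin_limit[OF f _ tf(2) f' _ tf'(2)] g tg A])
   (use tf tf' in auto)
 show "(%k. enB (%x. a * truncate k f x + b * truncate k f' x) (truncate k g) A) ----> a * egB f g A + b * egB f' g A"
  unfolding enB_lin[OF tf(1) tf'(1) tg(1) A] by (intro tendsto_intros egB_limit[OF f tf g tg A] egB_limit[OF f' tf' g tg A])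
qed

lemma eg_nonneg:"f:F==>A:sets borel==>eg f A>=0" by (rule en_truncate(2)[where f = f])

lemma egB_sym:"f:F==>g:F==>A:sets borel==>egB f g A=egB g f A"
proof -
 assume f:"f:F" and g:"g:F" and A:"A:sets borel"
 have "eg (%x. (- 1)*(f x - g x)+0 * f x) A=eg (%x. f x - g x) A" using eg_expand[OF F_diff[OF f g] f A, of "-1" 0] by simp
 then show "egB f g A=egB g f A" by (simp add:egB_def add.commute)
qed

lemma egB_self:"f:F==>A:sets borel==>egB f f A=eg f A" using eg_expand[of f f A 2 0] eg_expand[of f f A 0 0] by (simp add:egB_def)

end

section \<open>A discrete Neumann semigroup\<close>

text \<open>\<open>N\<close> is the heat operator at time \<open>h\<close> restricted to \<open>B\<close>, with the lost mass put back as a holding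
 probability. It dominates the operator \<open>R\<close> killed outside \<open>B\<close>, and its form is local to \<open>B\<close>; this is
 how a lower bound for the killed iterates becomes a Poincare inequality on balls.\<close>

locale neumann = kernel_form mu E F P p for mu :: "'a measure" and E F P p +
 fixes B :: "'a set" and h :: real
 assumes B_sets:"B:sets mu" and B_finite:"emeasure mu B<\<infinity>" and h_pos:"h>0"
begin

abbreviation "indB==ind B"

definition R :: "('a=>real) => 'a=>real" where
 "R f x=indB x * Q h (%y. indB y * f y) x"

definition N :: "('a=>real) => 'a=>real" where
 "N f x=R f x+(indB x - R indB x) * f x"

lemma indB_bdd:"indB:bdf" by (rule bdf_indicator[OF B_sets])

lemma indB_mult_bdd:"f:bdf==>(%y. indB y * f y):bdf" by (rule bdf_mult[OF indB_bdd])

lemma indB_idem:"indB x * indB x=indB x" "indB x * (indB x * c)=indB x * c" by (auto simp:indicator_def)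

lemma supp_integrable:
 assumes f:"f:bdf" and z:"!!x. x ~: B==>f x=0"
 shows "integrable mu f"
proof -
 have "integrable mu indB" using B_sets B_finite by (intro integrable_real_indicator) auto
 from integrable_mult_bdd[OF this f] have "integrable mu (%x. indB x * f x)" .
 moreover have "(%x. indB x * f x)=f" using z by (auto simp:indicator_def fun_eq_iff)
 ultimately show ?thesis by simp
qed

lemma R_bdd:"f:bdf==>R f:bdf" unfolding R_def[abs_def] by (intro indB_mult_bdd Q_bdd h_pos)

lemma R_supp:"x ~: B==>R f x=0" by (simp add:R_def)

lemma R_lin:"f:bdf==>g:bdf==>R (%x. a * f x + b * g x) x=a * R f x + b * R g x"
proof -
 assume f:"f:bdf" and g:"g:bdf"
 have "(%y. indB y * (a * f y + b * g y))=(%y. a * (indB y * f y) + b * (indB y * g y))" by (rule ext) (simp add:algebra_simps)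
 then show ?thesis unfolding R_def using Q_lin[OF h_pos indB_mult_bdd[OF f] indB_mult_bdd[OF g], of a b x] by (simp add:algebra_simps)
qed

lemma R_nonneg:"(!!x. f x>=0)==>R f x>=0" unfolding R_def by (intro mult_nonneg_nonneg Q_nonneg h_pos) auto

lemma R_sym: assumes f:"f:bdf" and g:"g:bdf"
 shows "(\<integral>x. R f x * g x \<partial>mu)=(\<integral>x. f x * R g x \<partial>mu)"
proof -
 have i:"integrable mu (%y. indB y * f y)" by (rule supp_integrable[OF indB_mult_bdd[OF f]]) simp
 have "(\<integral>x. R f x * g x \<partial>mu)=(\<integral>x. Q h (%y. indB y * f y) x * (indB x * g x) \<partial>mu)" by (simp add:R_def mult_ac)
 also have "...=(\<integral>x. (indB x * f x) * Q h (%y. indB y * g y) x \<partial>mu)"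
  by (rule Q_integrable_sym(2)[OF h_pos indB_mult_bdd[OF f] i indB_mult_bdd[OF g]])
 finally show ?thesis by (simp add:R_def mult_ac)
qed

lemma R_one_le:"R indB x<=indB x"
proof -
 have "Q h (%y. indB y * indB y) x<=1" by (rule Q_le_const[OF h_pos indB_mult_bdd[OF indB_bdd]]) (auto simp:indicator_def)
 then show ?thesis unfolding R_def by (auto simp:indicator_def)
qed

lemma N_bdd:"f:bdf==>N f:bdf" unfolding N_def[abs_def] by (intro bdf_add R_bdd bdf_mult bdf_diff indB_bdd)

lemma N_supp:"x ~: B==>N f x=0" by (simp add:N_def R_supp)

lemma N_lin:"f:bdf==>g:bdf==>N (%x. a * f x + b * g x) x=a * N f x + b * N g x" unfolding N_def by (simp add:R_lin algebra_simps)

lemma N_nonneg:"(!!x. f x>=0)==>N f x>=0" unfolding N_def using R_one_le[of x] by (intro add_nonneg_nonneg R_nonneg mult_nonneg_nonneg) auto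

lemma R_le_N:"f x>=0==>R f x<=N f x" unfolding N_def using R_one_le[of x] by simp

lemma R_mono: assumes "f:bdf" "g:bdf" "!!x. f x<=g x" shows "R f x<=R g x"
 using R_nonneg[of "%x. 1 * g x+(- 1) * f x" x] R_lin[OF assms(2,1), of 1 "-1" x] assms(3) by simp

lemma N_one:"N indB=indB"
proof
 fix x show "N indB x=indB x"
  using R_supp[of x indB] by (cases "x:B") (auto simp:N_def)
qed

lemma bdd_supp_integrable2:
 assumes "f:bdf" "g:bdf" "!!x. x ~: B==>f x=0 | g x=0"
 shows "integrable mu (%x. f x * g x)" using assms by (intro supp_integrable bdf_mult) auto

lemma N_sym: assumes f:"f:bdf" and g:"g:bdf"
 shows "(\<integral>x. N f x * g x \<partial>mu)=(\<integral>x. f x * N g x \<partial>mu)"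
proof -
 let ?w = "%x. indB x - R indB x"
 have w:"?w:bdf" by (intro bdf_diff indB_bdd R_bdd)
 have wz:"?w x=0" if "x ~: B" for x using that by (simp add:R_supp)
 have i1:"integrable mu (%x. R f x * g x)" "integrable mu (%x. f x * R g x)" using f g by (auto intro!: bdd_supp_integrable2 R_bdd simp:R_supp)
 have i2:"integrable mu (%x. ?w x * (f x * g x))" by (intro bdd_supp_integrable2 w bdf_mult f g) (use wz in blast)
 have "(\<integral>x. N f x * g x \<partial>mu)=(\<integral>x. R f x * g x + ?w x * (f x * g x) \<partial>mu)" by (simp add:N_def algebra_simps)
 also have "...=(\<integral>x. f x * R g x \<partial>mu)+(\<integral>x. ?w x * (f x * g x) \<partial>mu)"
  using i1 i2 R_sym[OF f g] by (subst Bochner_Integration.integral_add) auto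
 also have "...=(\<integral>x. f x * R g x + ?w x * (f x * g x) \<partial>mu)" using i1 i2 by (subst Bochner_Integration.integral_add) auto
 also have "...=(\<integral>x. f x * N g x \<partial>mu)" by (simp add:N_def algebra_simps)
 finally show ?thesis .
qed

text \<open>A positive symmetric operator \<open>S\<close> satisfies \<open>S ((u - a)\<^sup>2) \<ge> 0\<close> for every constant \<open>a\<close>; putting
 \<open>a = u(x)\<close> at the point \<open>x\<close> and integrating gives the inequality.\<close>

lemma positive_symmetric_form:
 assumes S_bdd:"!!f. f:bdf==>S f:bdf" and S_supp:"!!f x. x ~: B==>S f x=0"
  and S_lin:"!!f g a b x. f:bdf==>g:bdf==>S (%x. a * f x + b * g x) x=a * S f x + b * S g x"
  and S_pos:"!!f. f:bdf==>(!!x. f x>=0)==>AE x in mu. S f x>=0"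
  and S_sym:"!!f g. f:bdf==>g:bdf==>(\<integral>x. S f x * g x \<partial>mu)=(\<integral>x. f x * S g x \<partial>mu)"
  and u:"u:bdf" "!!x. x ~: B==>u x=0"
 shows "(\<integral>x. S u x * u x \<partial>mu)<=(\<integral>x. (u x)^2 * S indB x \<partial>mu)"
proof -
 let ?u2 = "%x. (u x)^2"
 have u2:"?u2:bdf" by (rule bdf_power2[OF u(1)])
 \<comment> \<open>Positivity of \<open>S\<close> holds off a null set that depends on the constant,
   so countably many constants are treated at once; continuity in the constant then admits
   \<open>a = u x\<close>.\<close>
 have ae:"AE x in mu. ALL a::rat. 0<=S ?u2 x-2 * of_rat a * S u x+(of_rat a)^2 * S indB x"
 proof (subst AE_all_countable, rule allI)
  fix r :: rat
  define a :: real where "a = of_rat r"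
  let ?f = "%x. 1*((1::real) * ?u2 x+(- 2 * a) * u x) + a^2 * indB x"
  have l:"(%x. (1::real) * ?u2 x+(- 2 * a) * u x):bdf" by (intro bdf_lin u2 u)
  have fb:"?f:bdf" by (intro bdf_lin u2 u indB_bdd)
  have "?f x>=0" for x
  proof (cases "x:B")
   case True
   then have "?f x=(u x - a)^2" by (simp add:power2_eq_square algebra_simps)
   then show ?thesis by simp
  next
   case False
   then show ?thesis by (simp add:u(2))
  qed
  from S_pos[OF fb this]
  show "AE x in mu. 0<=S ?u2 x-2 * of_rat r * S u x+(of_rat r)^2 * S indB x"
  proof eventually_elim
   case (elim x)
   have "S ?f x=1*(1 * S ?u2 x+(- 2 * a) * S u x) + a^2 * S indB x"
   using S_lin[OF l indB_bdd, of 1 "a^2" x] S_lin[OF u2 u(1), of 1 "- 2 * a" x] by simp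
   then show ?case using elim by (simp add:a_def)
  qed
 qed
 have ae2:"AE x in mu. 0<=S ?u2 x-2 * u x * S u x+(u x)^2 * S indB x" using ae
 proof eventually_elim
  case (elim x)
  have "continuous_on UNIV (%a. S ?u2 x-2 * a * S u x + a^2 * S indB x)" by (intro continuous_intros)
  then have "closed {a. 0<=S ?u2 x-2 * a * S u x + a^2 * S indB x}" by (intro closed_Collect_le continuous_intros)
  moreover have "\<rat> \<subseteq> {a. 0<=S ?u2 x-2 * a * S u x + a^2 * S indB x}" using elim by (auto simp:Rats_def)
  ultimately have "closure \<rat> \<subseteq> {a. 0<=S ?u2 x-2 * a * S u x + a^2 * S indB x}" by (intro closure_minimal)
  then show ?case by (auto simp:Rats_closure_real)
 qed
 have i1:"integrable mu (S ?u2)" by (intro supp_integrable S_bdd u2 S_supp)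
 have i2:"integrable mu (%x. S u x * u x)" by (intro bdd_supp_integrable2 S_bdd u) (auto simp:S_supp)
 have i3:"integrable mu (%x. (u x)^2 * S indB x)" by (intro bdd_supp_integrable2 S_bdd u2 indB_bdd) (auto simp:S_supp)
 have "(\<integral>x. S ?u2 x \<partial>mu)=(\<integral>x. S ?u2 x * indB x \<partial>mu)"
  by (rule Bochner_Integration.integral_cong) (auto simp:S_supp indicator_def)
 also have "...=(\<integral>x. (u x)^2 * S indB x \<partial>mu)" by (rule S_sym[OF u2 indB_bdd])
 finally have e:"(\<integral>x. S ?u2 x \<partial>mu)=(\<integral>x. (u x)^2 * S indB x \<partial>mu)" .
 have "0<=(\<integral>x. S ?u2 x-2*(S u x * u x)+(u x)^2 * S indB x \<partial>mu)"
  by (rule integral_nonneg_AE) (use ae2 in \<open>eventually_elim; simp add:mult_ac\<close>)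
 also have "...=2*(\<integral>x. (u x)^2 * S indB x \<partial>mu)-2*(\<integral>x. S u x * u x \<partial>mu)" using i1 i2 i3 e by simp
 finally show ?thesis by simp
qed

abbreviation "Npow k==(N ^^ k)"
abbreviation "Rpow k==(R ^^ k)"

lemma Npow_bdd:"f:bdf==>Npow k f:bdf" by (induction k) (auto intro: N_bdd)

lemma Rpow_bdd:"f:bdf==>Rpow k f:bdf" by (induction k) (auto intro: R_bdd)

lemma Npow_nonneg:"(!!x. f x>=0)==>Npow k f x>=0" by (induction k arbitrary: x) (auto intro: N_nonneg)

lemma Npow_lin:"f:bdf==>g:bdf==>Npow k (%x. a * f x + b * g x)=(%x. a * Npow k f x + b * Npow k g x)"
proof (induction k)
 case (Suc k)
 then show ?case by (auto intro!: ext N_lin Npow_bdd)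
qed simp

lemma Npow_sym:"f:bdf==>g:bdf==>(\<integral>x. Npow k f x * g x \<partial>mu)=(\<integral>x. f x * Npow k g x \<partial>mu)"
proof (induction k arbitrary: f g)
 case (Suc k)
 have "(\<integral>x. Npow (Suc k) f x * g x \<partial>mu)=(\<integral>x. Npow k f x * N g x \<partial>mu)"
  using N_sym[OF Npow_bdd[OF Suc.prems(1)] Suc.prems(2)] by simp
 also have "...=(\<integral>x. f x * Npow k (N g) x \<partial>mu)" by (rule Suc.IH[OF Suc.prems(1) N_bdd[OF Suc.prems(2)]])
 finally show ?case by (simp add:funpow_swap1)
qed simp

lemma Npow_one:"Npow k indB=indB" by (induction k) (auto simp:N_one)

lemma Rpow_le_Npow:"f:bdf==>(!!x. f x>=0)==>Rpow k f x<=Npow k f x"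
proof (induction k arbitrary: x)
 case (Suc k)
 have "R (Rpow k f) x<=R (Npow k f) x" using Suc by (intro R_mono Rpow_bdd Npow_bdd) auto
 also have "...<=N (Npow k f) x" by (rule R_le_N) (rule Npow_nonneg[OF Suc.prems(2)])
 finally show ?case by simp
qed simp

lemma Npow_mono:"f:bdf==>g:bdf==>(!!x. f x<=g x)==>Npow k f x<=Npow k g x"
 using Npow_nonneg[of "%x. 1 * g x+(- 1) * f x" k x] Npow_lin[of g f k 1 "-1"] by (simp add:fun_eq_iff)

lemma Npow_abs_le: assumes f:"f:bdf" and C:"!!x. \<bar>f x\<bar><=C * indB x" shows "\<bar>Npow k f x\<bar><=C * indB x"
proof -
 have c:"(%x. C * indB x):bdf" by (intro bdf_cmult indB_bdd)
 have e:"Npow k (%x. C * indB x) x=C * indB x" for x using Npow_lin[OF indB_bdd indB_bdd, of k C 0] by (simp add:fun_eq_iff Npow_one)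
 have "Npow k f x<=C * indB x" using Npow_mono[OF f c, of k x] C by (simp add:e abs_le_iff)
 moreover have "Npow k (%x. - 1 * f x+0 * f x) x<=C * indB x" using Npow_mono[OF bdf_lin[OF f f] c, of "-1" 0 k x] C by (simp add:e abs_le_iff)
 then have "- Npow k f x<=C * indB x" using Npow_lin[OF f f, of k "-1" 0] by (simp add:fun_eq_iff)
 ultimately show ?thesis by (simp add:abs_le_iff)
qed

text \<open>The Dirichlet form of a single step of \<open>N\<close>.\<close>

definition nform :: "('a=>real)=>('a=>real)=>real" where
 "nform f g=(\<integral>x. f x * g x \<partial>mu)-(\<integral>x. N f x * g x \<partial>mu)"

abbreviation "onB f==f:bdf&(ALL x. x ~: B-->f x=0)"

lemma onB_lin:"onB f ==> onB g ==> onB (%x. a * f x + b * g x)" by (auto intro: bdf_lin)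

lemma Npow_onB:"onB f ==> onB (Npow k f)" by (cases k) (auto intro: Npow_bdd N_bdd simp:N_supp)

lemma nform_nonneg: assumes f:"onB f" shows "nform f f>=0"
proof -
 have "(\<integral>x. N f x * f x \<partial>mu)<=(\<integral>x. (f x)^2 * N indB x \<partial>mu)"
  by (rule positive_symmetric_form) (use f in \<open>auto intro: N_bdd N_supp N_lin N_sym N_nonneg\<close>)
 also have "...=(\<integral>x. f x * f x \<partial>mu)"
  using f by (intro Bochner_Integration.integral_cong) (auto simp:N_one indicator_def power2_eq_square)
 finally show ?thesis by (simp add:nform_def)
qed

lemma nform_expand:
 assumes f:"onB f" and g:"onB g"
 shows "nform (%x. f x + s * g x) (%x. f x + s * g x)=nform f f+2 * nform f g * s + nform g g * s^2"
proof -
 have i:"integrable mu (%x. k x * l x)" if "k:bdf" "onB l" for k l using that by (intro bdd_supp_integrable2) auto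
 have Nf:"N f:bdf" "N g:bdf" using f g by (auto intro: N_bdd)
 note I = i[OF conjunct1[OF f] f] i[OF conjunct1[OF f] g] i[OF conjunct1[OF g] g] i[OF Nf(1) f] i[OF Nf(1) g] i[OF Nf(2) f] i[OF Nf(2) g]
 have e1:"(%x. (f x + s * g x)*(f x + s * g x))=(%x. f x * f x+(2 * s)*(f x * g x) + s^2*(g x * g x))"
  by (rule ext) (simp add:power2_eq_square algebra_simps)
 have N1:"N (%x. f x + s * g x) x=N f x + s * N g x" for x using N_lin[of f g 1 s x] f g by simp
 have e2:"(%x. N (%x. f x + s * g x) x * (f x + s * g x))=(%x. N f x * f x + s * (N f x * g x) + s * (N g x * f x) + s^2*(N g x * g x))"
  by (rule ext) (simp add:N1 power2_eq_square algebra_simps)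
 have "(\<integral>x. N g x * f x \<partial>mu)=(\<integral>x. N f x * g x \<partial>mu)" using N_sym[of g f] f g by (simp add:mult.commute)
 note sym = this
 have "(\<integral>x. f x * f x+(2 * s)*(f x * g x) + s^2*(g x * g x) \<partial>mu)
   = (\<integral>x. f x * f x \<partial>mu)+(2 * s)*(\<integral>x. f x * g x \<partial>mu) + s^2*(\<integral>x. g x * g x \<partial>mu)"
  using I by simp
 moreover have "(\<integral>x. N f x * f x + s * (N f x * g x) + s * (N g x * f x) + s^2*(N g x * g x) \<partial>mu)
   = (\<integral>x. N f x * f x \<partial>mu) + s * (\<integral>x. N f x * g x \<partial>mu) + s * (\<integral>x. N g x * f x \<partial>mu) + s^2*(\<integral>x. N g x * g x \<partial>mu)"
  using I by simp
 ultimately show ?thesis unfolding nform_def e1 e2 sym by (simp only:) (simp add:algebra_simps)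
qed

lemma nform_Cauchy_Schwarz:
 assumes f:"onB f" and g:"onB g"
 shows "(nform f g)^2<=nform f f * nform g g"
proof (rule quadratic_nonneg_discriminant)
 fix s
 have "onB (%x. f x + s * g x)" using onB_lin[OF f g, of 1 s] by simp
 from nform_nonneg[OF this] show "0<=nform f f+2 * nform f g * s + nform g g * s^2" unfolding nform_expand[OF f g] .
qed

lemma nform_Npow_sym:
 assumes f:"onB f" and g:"onB g"
 shows "nform (Npow k f) g=nform f (Npow k g)"
proof -
 have b:"f:bdf" "g:bdf" using f g by auto
 have "(\<integral>x. N (Npow k f) x * g x \<partial>mu)=(\<integral>x. N f x * Npow k g x \<partial>mu)"
  using Npow_sym[OF N_bdd[OF b(1)] b(2), of k] by (simp add:funpow_swap1)
 then show ?thesis using Npow_sym[OF b, of k] by (simp add:nform_def)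
qed

text \<open>The same log-convexity as in \<open>sform_P_le\<close>, with powers of \<open>N\<close>
  in place of the semigroup.\<close>

lemma nform_contract:
 assumes u:"onB u" shows "nform (Npow k u) (Npow k u)<=nform u u"
proof -
 obtain C where C:"C>=0" "!!x. \<bar>u x\<bar><=C" using bdd_funE[of u] u by metis
 have C1:"\<bar>u x\<bar><=C * indB x" for x using C u by (auto simp:indicator_def)
 define b where "b k=nform (Npow k u) (Npow k u)" for k
 have b2:"b k=nform u (Npow (2 * k) u)" for k unfolding b_def using nform_Npow_sym[OF u Npow_onB[OF u], of k k] by (simp add:funpow_add mult_2)
 have "b k<=b 0"
 proof (rule log_convex_bounded)
  fix k
  show "b k>=0" unfolding b_def by (rule nform_nonneg[OF Npow_onB[OF u]])
  show "(b k)^2<=b 0 * b (2 * k)" unfolding b2[of k] using nform_Cauchy_Schwarz[OF u Npow_onB[OF u], of "2 * k"] by (simp add:b_def)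
  let ?v = "Npow k u"
  have i:"integrable mu (%x. C^2 * indB x)" using supp_integrable[OF bdf_cmult[OF indB_bdd]] by simp
  have v:"\<bar>?v x\<bar><=C * indB x" "\<bar>N ?v x\<bar><=C * indB x" for x
   using Npow_abs_le[OF _ C1, of k x] Npow_abs_le[OF _ C1, of "Suc k" x] u by auto
  have m:"\<bar>f x * ?v x\<bar><=C^2 * indB x" if "!!x. \<bar>f x\<bar><=C * indB x" for f x
   using mult_mono[OF that[of x] v(1)[of x]] C(1) by (simp add:abs_mult power2_eq_square indB_idem mult_ac)
  have ov:"onB ?v" by (rule Npow_onB[OF u])
  have "(\<integral>x. ?v x * ?v x \<partial>mu)<=(\<integral>x. C^2 * indB x \<partial>mu)"
   using m[OF v(1)] ov by (intro integral_mono i bdd_supp_integrable2) (auto simp:abs_le_iff)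
  moreover have "(\<integral>x. - (N ?v x * ?v x) \<partial>mu)<=(\<integral>x. C^2 * indB x \<partial>mu)"
   using m[OF v(2)] ov by (intro integral_mono i integrable_minus bdd_supp_integrable2 N_bdd) (auto simp:abs_le_iff)
  ultimately show "b k<=2*(\<integral>x. C^2 * indB x \<partial>mu)" by (simp add:b_def nform_def)
 qed
 then show ?thesis by (simp add:b_def)
qed

text \<open>The left side telescopes into the sum of \<open>nform (Npow k u) u\<close> over
  \<open>k < n\<close>, each at most \<open>nform u u\<close> by Cauchy-Schwarz and
  \<open>nform_contract\<close>.\<close>

lemma nform_iterate:
 assumes u:"onB u"
 shows "(\<integral>x. u x * u x \<partial>mu)-(\<integral>x. Npow n u x * u x \<partial>mu)<=real n * nform u u"
proof (induction n)
 case (Suc n)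
 have v:"onB (Npow n u)" by (rule Npow_onB[OF u])
 have "(nform (Npow n u) u)^2<=nform (Npow n u) (Npow n u) * nform u u" by (rule nform_Cauchy_Schwarz[OF v u])
 also have "...<=(nform u u)^2" unfolding power2_eq_square by (intro mult_right_mono nform_contract nform_nonneg u)
 finally have "nform (Npow n u) u<=nform u u" using nform_nonneg[OF u] by (rule power2_le_imp_le)
 then show ?case using Suc by (simp add:nform_def algebra_simps)
qed simp

text \<open>Since lost mass is put back at the point it came from, twice the form of
  \<open>N\<close> is the integral of \<open>(u x - u y)^2\<close> against the kernel over pairs in
  \<open>B\<close>. Dropping the restriction on \<open>y\<close> gives the bound by
  \<open>edens\<close>.\<close>

lemma nform_le_edens:
 assumes u:"u:bdf"
 shows "nform (%x. indB x * u x) (%x. indB x * u x)<=h * (\<integral>x. indB x * edens h u x \<partial>mu)"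
proof -
 let ?v = "%x. indB x * u x" and ?v2 = "%x. indB x * (u x)^2"
 have v:"?v:bdf" and v2:"?v2:bdf" by (auto intro!: indB_mult_bdd u bdf_power2)
 have key:"indB x * ((u x)^2 * Q h indB x-2 * u x * Q h ?v x + Q h ?v2 x)<=2 * h * (indB x * edens h u x)" for x
 proof -
  have "Q h (%y. indB y * (u x - u y)^2) x<=Q h (%y. (u x - u y)^2) x"
   by (intro Q_mono h_pos indB_mult_bdd bdf_power2 bdf_diff bdf_const u) (auto simp:indicator_def)
  also have "...<=2 * h * edens h u x" by (rule Q_square_le_edens[OF h_pos u])
  also have "(%y. indB y * (u x - u y)^2)=(%y. 1*((u x)^2 * indB y+(- 2 * u x) * ?v y)+1 * ?v2 y)"
   by (rule ext) (simp add:power2_eq_square algebra_simps)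
  also have "Q h (%y. 1*((u x)^2 * indB y+(- 2 * u x) * ?v y)+1 * ?v2 y) x
   = 1 * Q h (%y. (u x)^2 * indB y+(- 2 * u x) * ?v y) x+1 * Q h ?v2 x"
   by (intro Q_lin h_pos bdf_lin indB_bdd v v2)
  also have "Q h (%y. (u x)^2 * indB y+(- 2 * u x) * ?v y) x=(u x)^2 * Q h indB x+(- 2 * u x) * Q h ?v x" by (intro Q_lin h_pos indB_bdd v)
  finally have "(u x)^2 * Q h indB x-2 * u x * Q h ?v x + Q h ?v2 x<=2 * h * edens h u x" by simp
  then show ?thesis by (auto simp:indicator_def)
 qed
 have sq:"indB x * (indB x * u x)^2=?v2 x" "indB x * (indB x * c)=indB x * c" for x c by (auto simp:indicator_def)
 have R1:"R indB x=indB x * Q h indB x" for x by (simp add:R_def indB_idem)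
 have Rv:"R ?v x=indB x * Q h ?v x" for x by (simp add:R_def indB_idem)
 have qb:"Q h indB:bdf" "Q h ?v:bdf" "Q h ?v2:bdf" by (auto intro!: Q_bdd h_pos indB_bdd v v2)
 have I1:"integrable mu (%x. ?v2 x * Q h indB x)" by (intro bdd_supp_integrable2 v2 qb) auto
 have I2:"integrable mu (%x. ?v x * Q h ?v x)" by (intro bdd_supp_integrable2 v qb) auto
 have I3:"integrable mu (%x. indB x * Q h ?v2 x)" by (intro bdd_supp_integrable2 indB_bdd qb) auto
 have I4:"integrable mu (%x. ?v x * ?v x)" by (intro bdd_supp_integrable2 v) auto
 have v2i:"integrable mu ?v2" by (rule supp_integrable[OF v2]) simp
 have sym:"(\<integral>x. indB x * Q h ?v2 x \<partial>mu)=(\<integral>x. ?v2 x * Q h indB x \<partial>mu)"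
  using Q_integrable_sym(2)[OF h_pos v2 v2i indB_bdd] by (simp add:mult.commute)
 have Nv:"N ?v x * ?v x=?v x * Q h ?v x + ?v x * ?v x - ?v2 x * Q h indB x" for x
  unfolding N_def Rv R1 by (auto simp:indicator_def power2_eq_square algebra_simps)
 have nf:"nform ?v ?v=(\<integral>x. ?v2 x * Q h indB x \<partial>mu)-(\<integral>x. ?v x * Q h ?v x \<partial>mu)"
  unfolding nform_def Nv using I1 I2 I4 by simp
 have "2 * nform ?v ?v=(\<integral>x. ?v2 x * Q h indB x-2*(?v x * Q h ?v x) + indB x * Q h ?v2 x \<partial>mu)"
  unfolding nf using I1 I2 I3 sym by simp
 also have "...<=(\<integral>x. 2 * h * (indB x * edens h u x) \<partial>mu)"
 proof (rule integral_mono)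
  show "integrable mu (%x. ?v2 x * Q h indB x-2*(?v x * Q h ?v x) + indB x * Q h ?v2 x)" using I1 I2 I3 by simp
  show "integrable mu (%x. 2 * h * (indB x * edens h u x))" using supp_integrable[OF indB_mult_bdd[OF edens_bdd[OF h_pos u]]] by simp
  show "?v2 x * Q h indB x-2*(?v x * Q h ?v x) + indB x * Q h ?v2 x<=2 * h * (indB x * edens h u x)" for x
   using key[of x] by (simp add:algebra_simps)
 qed
 finally show ?thesis by simp
qed

text \<open>The lower bound allows \<open>kp\<close> times averaging over \<open>B'\<close> to be
  subtracted from \<open>Npow n\<close> without losing positivity, so
  \<open>positive_symmetric_form\<close> applies to the difference \<open>S\<close>. The subtracted
  part yields the variance on \<open>B'\<close>; the part from \<open>Npow n\<close> is bounded by
  \<open>nform_iterate\<close> and \<open>nform_le_edens\<close>.\<close>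

lemma local_poincare:
 assumes u:"u:bdf" and B': "B':sets mu" "B' \<subseteq> B" and kp:"kp>=0"
  and lower:"!!g. g:bdf==>(!!x. g x>=0)==>(!!x. x ~: B'==>g x=0) ==>
   AE x in mu. x:B'-->Rpow n g x>=kp * (\<integral>y. g y \<partial>mu)"
 shows "kp * (measure mu B' * (\<integral>x. ind B' x * (u x)^2 \<partial>mu)-(\<integral>x. ind B' x * u x \<partial>mu)\<^sup>2)
  <= real n * h * (\<integral>x. indB x * edens h u x \<partial>mu)"
proof -
 let ?o = "ind B'"
 let ?v = "%x. indB x * u x"
 have o:"?o:bdf" by (rule bdf_indicator[OF B'(1)])
 have oz:"?o x=0" if "x ~: B" for x using that B'(2) by (auto simp:indicator_def)
 have om:"(%x. ?o x * f x):bdf" if "f:bdf" for f by (rule bdf_mult[OF o that])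
 have oi:"integrable mu (%x. ?o x * f x)" if "f:bdf" for f using om[OF that] by (rule supp_integrable) (simp add:oz)
 have v:"?v:bdf" by (rule indB_mult_bdd[OF u])
 have vB:"onB ?v" using v by auto
 define av where "av f=(\<integral>y. ?o y * f y \<partial>mu)" for f
 define S where "S f x=indB x * Npow n (%y. indB y * f y) x - kp * ?o x * av f" for f x
 have SN:"indB x * Npow n (%y. indB y * f y) x=Npow n (%y. indB y * f y) x" if "f:bdf" for f x
  using Npow_onB[of "%y. indB y * f y" n] indB_mult_bdd[OF that] by (cases "x:B") auto
 have av_lin:"av (%x. a * f x + b * g x)=a * av f + b * av g" if "f:bdf" "g:bdf" for a b f g
 proof -
  have "(%y. ?o y * (a * f y + b * g y))=(%y. a * (?o y * f y) + b * (?o y * g y))" by (rule ext) (simp add:algebra_simps)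
  then show ?thesis unfolding av_def using oi[OF that(1)] oi[OF that(2)] by simp
 qed
 have "(\<integral>x. S ?v x * ?v x \<partial>mu)<=(\<integral>x. (?v x)^2 * S indB x \<partial>mu)"
 proof (rule positive_symmetric_form[OF _ _ _ _ _ v])
  show "S f:bdf" if "f:bdf" for f
  proof -
   have eS:"S f=(%x. 1*(indB x * Npow n (%y. indB y * f y) x)+(- kp * av f) * ?o x)" by (rule ext) (simp add:S_def)
   show ?thesis unfolding eS by (intro bdf_lin indB_mult_bdd Npow_bdd o that)
  qed
  show "S f x=0" if "x ~: B" for f x using that oz[OF that] by (simp add:S_def)
  show "S (%x. a * f x + b * g x) x=a * S f x + b * S g x" if "f:bdf" "g:bdf" for f g a b x
  proof -
   have e:"(%y. indB y * (a * f y + b * g y))=(%y. a * (indB y * f y) + b * (indB y * g y))" by (rule ext) (simp add:algebra_simps)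
   show ?thesis unfolding S_def av_lin[OF that] e Npow_lin[OF indB_mult_bdd[OF that(1)] indB_mult_bdd[OF that(2)]] by (simp add:algebra_simps)
  qed
  show "AE x in mu. S f x>=0" if f:"f:bdf" "!!x. f x>=0" for f
  proof -
   have "AE x in mu. x:B'-->Rpow n (%x. ?o x * f x) x>=kp * (\<integral>y. ?o y * f y \<partial>mu)" using f by (intro lower om) auto
   then show ?thesis
   proof eventually_elim
   case (elim x)
   have n1:"Npow n (%y. indB y * f y) x>=0" using f by (intro Npow_nonneg) auto
   show ?case
   proof (cases "x:B'")
   case True
   have "kp * av f<=Rpow n (%x. ?o x * f x) x" using elim True by (simp add:av_def)
   also have "...<=Npow n (%x. ?o x * f x) x" using f by (intro Rpow_le_Npow om) auto
   also have "...<=Npow n (%x. indB x * f x) x" using f B'(2) by (intro Npow_mono om indB_mult_bdd) (auto simp:indicator_def)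
   finally show ?thesis using True B'(2) by (auto simp:S_def)
   next
   case False
   then show ?thesis using n1 SN[OF f(1)] by (simp add:S_def)
   qed
   qed
  qed
  show "(\<integral>x. S f x * g x \<partial>mu)=(\<integral>x. f x * S g x \<partial>mu)" if f:"f:bdf" and g:"g:bdf" for f g
  proof -
   have I:"integrable mu (%x. Npow n (%y. indB y * k y) x * (indB x * l x))" if "k:bdf" "l:bdf" for k l
   by (intro bdd_supp_integrable2 Npow_bdd indB_mult_bdd that) auto
   have side:"(\<integral>x. S k x * l x \<partial>mu)=(\<integral>x. Npow n (%y. indB y * k y) x * (indB x * l x) \<partial>mu) - kp * av k * av l"
   if "k:bdf" "l:bdf" for k l
   proof -
   have "(%x. S k x * l x)=(%x. Npow n (%y. indB y * k y) x * (indB x * l x)-(kp * av k)*(?o x * l x))" by (rule ext) (simp add:S_def algebra_simps)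
   then show ?thesis using I[OF that] oi[OF that(2)] by (simp add:av_def)
   qed
   have "(\<integral>x. f x * S g x \<partial>mu)=(\<integral>x. S g x * f x \<partial>mu)" by (simp add:mult.commute)
   then show ?thesis unfolding side[OF f g] side[OF g f] using Npow_sym[OF indB_mult_bdd[OF f] indB_mult_bdd[OF g], of n] by (simp add:mult_ac)
  qed
 qed auto
 moreover have "(\<integral>x. S ?v x * ?v x \<partial>mu)=(\<integral>x. Npow n ?v x * ?v x \<partial>mu) - kp * (\<integral>x. ?o x * u x \<partial>mu)^2"
 proof -
  have ov:"?o x * ?v x=?o x * u x" for x using B'(2) by (auto simp:indicator_def)
  have avv:"av ?v=(\<integral>x. ?o x * u x \<partial>mu)" by (simp add:av_def ov)
  have e:"(%x. S ?v x * ?v x)=(%x. Npow n ?v x * ?v x-(kp * av ?v)*(?o x * u x))"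
  proof (rule ext)
   fix x
   have eq1:"(%y. indB y * (indB y * u y))=?v" by (rule ext) (simp add:indB_idem)
   show "S ?v x * ?v x=Npow n ?v x * ?v x-(kp * av ?v)*(?o x * u x)"
   proof (cases "x:B")
   case True
   then show ?thesis by (simp add:S_def eq1 left_diff_distrib)
   next
   case False
   then show ?thesis by (simp add:oz)
   qed
  qed
  have "integrable mu (%x. Npow n ?v x * ?v x)" by (intro bdd_supp_integrable2 Npow_bdd v) auto
  then have "(\<integral>x. Npow n ?v x * ?v x-(kp * av ?v)*(?o x * u x) \<partial>mu)
   = (\<integral>x. Npow n ?v x * ?v x \<partial>mu)-(kp * av ?v)*(\<integral>x. ?o x * u x \<partial>mu)"
   using oi[OF u] by (subst Bochner_Integration.integral_diff) auto
  then show ?thesis unfolding e by (simp only: avv power2_eq_square mult.assoc)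
 qed
 moreover have "(\<integral>x. (?v x)^2 * S indB x \<partial>mu)=(\<integral>x. ?v x * ?v x \<partial>mu) - kp * measure mu B' * (\<integral>x. ?o x * (u x)^2 \<partial>mu)"
 proof -
  have "(%y. indB y * indB y)=indB" by (rule ext) (simp add:indB_idem)
  moreover have "av indB=measure mu B'"
  proof -
   have "(%y. ?o y * indB y)=?o" using B'(2) by (auto simp:indicator_def fun_eq_iff)
   then show ?thesis using B'(1) by (simp add:av_def space_UNIV)
  qed
  ultimately have S1:"S indB x=indB x - kp * measure mu B' * ?o x" for x by (simp add:S_def Npow_one indB_idem)
  have e:"(%x. (?v x)^2 * S indB x)=(%x. ?v x * ?v x-(kp * measure mu B')*(?o x * (u x)^2))"
   using B'(2) by (auto simp:S1 fun_eq_iff indicator_def power2_eq_square algebra_simps)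
  have "integrable mu (%x. ?v x * ?v x)" by (intro bdd_supp_integrable2 v) auto
  then show ?thesis unfolding e using oi[OF bdf_power2[OF u]] by simp
 qed
 ultimately have "kp * (measure mu B' * (\<integral>x. ?o x * (u x)^2 \<partial>mu)-(\<integral>x. ?o x * u x \<partial>mu)\<^sup>2)
   <= (\<integral>x. ?v x * ?v x \<partial>mu)-(\<integral>x. Npow n ?v x * ?v x \<partial>mu)"
  by (simp add:right_diff_distrib mult.assoc)
 also have "...<=real n * nform ?v ?v" by (rule nform_iterate[OF vB])
 also have "...<=real n * (h * (\<integral>x. indB x * edens h u x \<partial>mu))" by (intro mult_left_mono nform_le_edens u) auto
 finally show ?thesis by (simp add:mult.assoc)
qed

text \<open>Killing outside \<open>B\<close> costs at most \<open>be\<close>. Off \<open>B\<close>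
  the flow is below \<open>be\<close> at every intermediate time and the killed iterate is 0, so
  \<open>Q t g <= Rpow k g + be\<close> holds on the whole space; applying \<open>Q h\<close>, which
  does not increase constants, gives the next step without accumulating errors.\<close>

lemma Rpow_lower:
 assumes g:"g:bdf" "!!x. g x>=0" "!!x. x ~: B==>g x=0" and be:"be>=0"
  and tail:"!!k. 0<k==>k<n==>AE x in mu. x ~: B-->Q (real k * h) g x<=be"
  and n:"n>0"
 shows "AE x in mu. x:B-->Q (real n * h) g x<=Rpow n g x + be"
proof -
 have gi:"integrable mu g" by (rule supp_integrable[OF g(1,3)])
 have gL:"g:L2 mu" using bdd_supp_integrable2[OF g(1,1)] g(3) bdf_measurable[OF g(1)] by (auto simp:L2_def power2_eq_square)
 have "AE x in mu. x:B-->Q (real (Suc k) * h) g x<=Rpow (Suc k) g x + be" if "Suc k<=n" for k using that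
 proof (induction k)
  case 0
  have "(%y. indB y * g y)=g" using g(3) by (auto simp:indicator_def fun_eq_iff)
  then show ?case using be by (auto simp:R_def)
 next
  case (Suc k)
  let ?t = "real (Suc k) * h"
  have t:"?t>0" using h_pos by simp
  have Qb:"Q ?t g:bdf" by (rule Q_bdd[OF t g(1)])
  have rb:"Rpow (Suc k) g:bdf" by (rule Rpow_bdd[OF g(1)])
  have a:"AE x in mu. x:B-->Q ?t g x<=Rpow (Suc k) g x + be" using Suc by simp
  have b:"AE x in mu. x ~: B-->Q ?t g x<=be" using tail[of "Suc k"] Suc.prems by simp
  have c:"AE x in mu. Q ?t g x<=1 * Rpow (Suc k) g x + be * 1" using a b
  proof eventually_elim
   case (elim x)
   then show ?case by (cases "x:B") (auto simp:R_supp)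
  qed
  have d:"AE x in mu. Q (h + ?t) g x=Q h (Q ?t g) x" by (rule Q_semigroup_AE[OF h_pos t gL g(1)])
  show ?case using d
  proof eventually_elim
   case (elim x)
   show ?case
   proof
   assume xB:"x:B"
   have "Q h (Q ?t g) x<=Q h (%y. 1 * Rpow (Suc k) g y + be * 1) x" by (rule Q_mono_AE[OF h_pos Qb bdf_lin[OF rb bdf_const] c])
   also have "...=1 * Q h (Rpow (Suc k) g) x + be * Q h (%y. 1) x" by (rule Q_lin[OF h_pos rb bdf_const])
   also have "...<=Q h (Rpow (Suc k) g) x + be" using Q_one[OF h_pos, of x] be by (simp add:mult_left_le)
   also have "Q h (Rpow (Suc k) g) x=Rpow (Suc (Suc k)) g x"
   proof -
   have "(%y. indB y * Rpow (Suc k) g y)=Rpow (Suc k) g" by (auto simp:R_def indB_idem fun_eq_iff)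
   then show ?thesis using xB by (simp add:R_def[of "R (Rpow k g)"])
   qed
   finally have "Q h (Q ?t g) x<=Rpow (Suc (Suc k)) g x + be" .
   moreover have "h + ?t=real (Suc (Suc k)) * h" by (simp add:algebra_simps)
   ultimately show "Q (real (Suc (Suc k)) * h) g x<=Rpow (Suc (Suc k)) g x + be" using elim by metis
   qed
  qed
 qed
 from this[of "n-1"] n show ?thesis by simp
qed

end

section \<open>Doubling spaces\<close>

text \<open>\<open>dq\<close> is an exponent of volume growth; the factor 2 in
  \<open>ball_growth\<close> absorbs the rounding of radii to dyadic multiples.\<close>

locale doubling_space =
 fixes mu :: "'a::polish_space measure" and dq :: nat
 assumes sets_borel:"sets mu=sets borel"
  and ball_finite:"emeasure mu (ball x r)<\<infinity>"
  and ball_pos:"r>0==>measure mu (ball x r)>0"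
  and ball_growth:"0<r==>r<=R==>measure mu (ball x R)<=(2 * R/r) ^ dq * measure mu (ball x r)"
begin

abbreviation "V x r==measure mu (ball x r)"

lemma V_mono: assumes "dist x y + r<=R" shows "V x r<=V y R"
proof -
 have "ball x r \<subseteq> ball y R"
 proof
  fix z assume "z:ball x r"
  then show "z:ball y R" using assms dist_triangle[of y z x] by (simp add:dist_commute)
 qed
 then have "emeasure mu (ball x r)<=emeasure mu (ball y R)" by (intro emeasure_mono) (auto simp:sets_borel)
 then show ?thesis unfolding measure_def using ball_finite by (intro enn2real_mono) auto
qed

definition separated :: "real => 'a set=>bool" where
 "separated rh Z \<longleftrightarrow> (ALL y:Z. ALL z:Z. y~=z-->dist y z>=rh)"

text \<open>The balls of radius \<open>rh / 2\<close> are disjoint inside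
  \<open>ball x (2 R)\<close> and each carries a fixed fraction of its measure; 16 arises as
  \<open>2 * 4 R\<close> over \<open>rh / 2\<close>.\<close>

lemma packing:
 assumes Z:"finite Z" "Z \<subseteq> ball x R" "separated rh Z" and rh:"0<rh" "rh<=R"
 shows "real (card Z)<=(16 * R/rh) ^ dq"
proof -
 have R:"R>0" using rh by simp
 have each:"V x (2 * R)<=(16 * R/rh) ^ dq * V z (rh/2)" if z:"z:Z" for z
 proof -
  have "dist x z<R" using Z(2) z by auto
  then have "dist x z+2 * R<=4 * R" using R by argo
  then have "V x (2 * R)<=V z (4 * R)" by (rule V_mono)
  also have "...<=(2*(4 * R)/(rh/2)) ^ dq * V z (rh/2)" using rh R by (intro ball_growth) auto
  finally show ?thesis by simp
 qed
 have dis:"disjoint_family_on (%z. ball z (rh/2)) Z" unfolding disjoint_family_on_def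
 proof (intro ballI impI)
  fix y z assume yz:"y:Z" "z:Z" "y~=z"
  show "ball y (rh/2) Int ball z (rh/2)={}"
  proof (rule ccontr)
   assume "\<not> ?thesis"
   then obtain w where "dist y w<rh/2" "dist z w<rh/2" by auto
   then have "dist y z<rh" using dist_triangle2[of y z w] by simp
   moreover have "rh<=dist y z" by (rule Z(3)[unfolded separated_def, rule_format, OF yz])
   ultimately show False by simp
  qed
 qed
 have "real (card Z) * V x (2 * R)=(SUM z:Z. V x (2 * R))" by simp
 also have "...<=(SUM z:Z. (16 * R/rh) ^ dq * V z (rh/2))" by (intro sum_mono each)
 also have "...=(16 * R/rh) ^ dq * (SUM z:Z. V z (rh/2))" by (simp add:sum_distrib_left)
 also have "(SUM z:Z. V z (rh/2))=measure mu (\<Union>z\<in>Z. ball z (rh/2))" using dis ball_finite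
  by (intro measure_finite_Union[symmetric] Z) (auto simp:sets_borel less_top[symmetric])
 also have "...<=V x (2 * R)"
 proof -
  have "(\<Union>z\<in>Z. ball z (rh/2)) \<subseteq> ball x (2 * R)"
  proof
   fix w assume "w:(\<Union>z\<in>Z. ball z (rh/2))"
   then obtain z where z:"z:Z" "dist z w<rh/2" by auto
   then have "dist x w<R + rh/2" using Z(2) dist_triangle[of x w z] by auto
   then show "w:ball x (2 * R)" using rh by simp
  qed
  then have "emeasure mu (\<Union>z\<in>Z. ball z (rh/2))<=emeasure mu (ball x (2 * R))" by (intro emeasure_mono) (auto simp:sets_borel)
  then show ?thesis unfolding measure_def using ball_finite by (intro enn2real_mono) auto
 qed
 finally have "real (card Z) * V x (2 * R)<=(16 * R/rh) ^ dq * V x (2 * R)" using rh R by (simp add:mult_left_mono)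
 then show ?thesis using ball_pos[of "2 * R" x] R by simp
qed

text \<open>Separated subsets have bounded cardinality by \<open>packing\<close>, so one of maximal
  cardinality exists, and maximality makes it a net.\<close>

lemma net_exists:
 assumes S:"S \<subseteq> ball x R" and rh:"0<rh" "rh<=R"
 obtains Z where "finite Z" "Z \<subseteq> S" "separated rh Z" "S \<subseteq> (\<Union>z\<in>Z. ball z rh)"
proof -
 define P where "P Z \<longleftrightarrow> finite Z&Z \<subseteq> S&separated rh Z" for Z
 obtain b :: nat where b:"(16 * R/rh) ^ dq<=real b" using real_arch_simple by blast
 have bound:"P Z==>card Z<Suc b" for Z using packing[of Z x R rh] S rh b unfolding P_def by fastforce
 have "P {}" by (simp add:P_def separated_def)
 from ex_has_greatest_nat[of P "{}" card "Suc b", OF this] bound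
 obtain Z where Z:"P Z" "!!Y. P Y==>card Y<=card Z" by blast
 have "S \<subseteq> (\<Union>z\<in>Z. ball z rh)"
 proof (rule ccontr)
  assume "\<not> ?thesis"
  then obtain s where s:"s:S" "!!z. z:Z==>dist z s>=rh" by force
  have "s ~: Z" using s(2)[of s] rh by auto
  moreover have "P (insert s Z)" using Z(1) s by (auto simp:P_def separated_def dist_commute)
  ultimately show False using Z(2)[of "insert s Z"] Z(1) by (auto simp:P_def)
 qed
 then show thesis using that Z(1) by (auto simp:P_def)
qed

text \<open>Nets of every fineness give total boundedness; completeness of the space does the
  rest.\<close>

lemma compact_cball_doubling:"compact (cball (x::'a) r)"
proof -
 have "EX k. finite k&cball x r \<subseteq> (\<Union>y\<in>k. ball y e)" if e:"e>0" for e
 proof -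
  have "cball x r \<subseteq> ball x ((abs r) + e)" using e by auto
  from net_exists[OF this e] show ?thesis by (metis abs_ge_zero le_add_same_cancel2)
 qed
 then show ?thesis by (simp add:compact_eq_totally_bounded complete_eq_closed)
qed

lemma overlap:
 assumes Z:"finite Z" "separated rh Z" and rh:"0<rh" "rh<=R"
 shows "(SUM z:Z. ind (ball z R) y)<=(16 * R/rh) ^ dq"
proof -
 have "(SUM z:Z. ind (ball z R) y)=real (card {z\<in>Z. y:ball z R})" using Z(1) by (simp add:indicator_def sum.If_cases Int_def)
 also have "...<=(16 * R/rh) ^ dq" using Z by (intro packing[OF _ _ _ rh, where x = y]) (auto simp:separated_def dist_commute)
 finally show ?thesis .
qed

end

section \<open>Consequences of the heat kernel estimates\<close>

text \<open>The form in which the heat kernel estimates are used: stated at times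
  \<open>Ps r\<close>, with the plain decay \<open>exp (- (a * dist x y / r))\<close>.
  \<open>Psi_quasi\<close> replaces monotonicity of \<open>Ps\<close>, \<open>Psi_small\<close>
  records at least linear decay towards small scales, and \<open>Psi_growth\<close> polynomial
  growth.\<close>

locale hke_space = hk_space mu E F P p + doubling_space mu dq
 for mu :: "'a::polish_space measure" and E F P p and dq :: nat +
 fixes Ps :: "real=>real" and Cs A a c dl C0 :: real and m :: nat
 assumes Psi_pos:"r>0==>Ps r>0"
  and Psi_surj:"ta>0==>\<exists>\<sigma>>0. Ps \<sigma>=ta"
  and Psi_quasi:"0<\<sigma>==>0<r==>Ps \<sigma><=Ps r==>\<sigma><=C0 * r"
  and Psi_small:"0<kp==>kp<=1==>0<r==>Ps (kp * r)<=Cs * kp * Ps r"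
  and Psi_growth:"1<=kp==>0<r==>Ps (kp * r)<=Cs * kp ^ m * Ps r"
  and C0:"C0>=1" and Cs:"Cs>=1" and A:"A>0" and a:"a>0" and c:"c>0" and dl:"0<dl" "dl<=1"
  and p_upper:"r>0==>AE x in mu. AE y in mu. p (Ps r) x y<=A/V x r * exp (- (a * dist x y/r))"
  and p_lower:"r>0==>AE x in mu. AE y in mu. dist x y<=dl * r-->p (Ps r) x y>=c/V x r"
begin

definition tc :: real where "tc=A * ((16 * C0/a) ^ dq * fact dq)"
definition tb :: real where "tb=a/(4 * C0)"

lemma tc_pos:"tc>0" using A C0 a by (simp add:tc_def)

lemma tb_pos:"tb>0" using C0 a by (simp add:tb_def)

lemma ball_sets:"ball x r:sets mu" by (simp add:sets_borel)

lemma supp_ball_integrable: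
 assumes f:"f:bdf" and z:"!!x. x ~: ball x0 r==>f x=0"
 shows "integrable mu f"
proof -
 have "integrable mu (ind (ball x0 r))" using ball_finite by (intro integrable_real_indicator ball_sets) auto
 from integrable_mult_bdd[OF this f] have "integrable mu (%x. ind (ball x0 r) x * f x)" .
 moreover have "(%x. ind (ball x0 r) x * f x)=f" using z by (auto simp:indicator_def fun_eq_iff)
 ultimately show ?thesis by simp
qed

text \<open>A single term of the exponential series.\<close>

lemma power_exp_bound:
 fixes X y :: real
 assumes "X>=0" "y>0"
 shows "X ^ n * exp (- (y * X))<=fact n/y ^ n"
proof -
 have "(y * X) ^ n/fact n<=exp (y * X)"
 proof -
  have s:"summable (%i. (y * X) ^ i/fact i)"
   using summable_exp_generic[of "y * X", unfolded real_scaleR_def] by (simp add:divide_inverse mult.commute)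
  have "(SUM i:{n}. (y * X) ^ i/fact i)<=(\<Sum>i. (y * X) ^ i/fact i)" by (rule sum_le_suminf[OF s]) (use assms in auto)
  also have "...=exp (y * X)" unfolding exp_def real_scaleR_def by (simp add:divide_inverse mult.commute)
  finally show ?thesis by simp
 qed
 then have "(y * X) ^ n<=fact n * exp (y * X)" by (simp add:divide_le_eq mult.commute)
 then have "(y ^ n * X ^ n) * exp (- (y * X))<=fact n * exp (y * X) * exp (- (y * X))" by (intro mult_right_mono) (auto simp:power_mult_distrib)
 also have "...=fact n" by (simp add:mult.assoc exp_add[symmetric])
 finally show ?thesis using assms by (simp add:field_simps)
qed

text \<open>Valid for all times up to \<open>Ps r\<close>, as both the killed iterates and the
  cutoffs require. With \<open>ta = Ps \<sigma>\<close>, half of the available exponent absorbs the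
  volume ratio \<open>(d / \<sigma>) ^ dq\<close>; the other half, by
  \<open>\<sigma> <= C0 * r\<close>, is the stated decay.\<close>

lemma tail_bound:
 assumes r:"r>0" and ta:"0<ta" "ta<=Ps r" and rh:"rh>=r"
  and g:"g:bdf" "!!x. g x>=0" "!!x. x ~: ball x0 rh==>g x=0"
 shows "AE z in mu. dist z x0>=2 * rh-->Q ta g z<=tc/V x0 rh * exp (- (tb * dist z x0/r))*(\<integral>y. g y \<partial>mu)"
proof -
 obtain \<sigma> where \<sigma>: "\<sigma>>0" "Ps \<sigma>=ta" using Psi_surj[OF ta(1)] by auto
 have \<sigma>r:"\<sigma><=C0 * r" using Psi_quasi[OF \<sigma>(1) r] \<sigma>(2) ta(2) by simp
 have gi:"integrable mu g" by (rule supp_ball_integrable[OF g(1,3)])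
 show ?thesis using p_upper[OF \<sigma>(1)]
 proof eventually_elim
  case (elim z)
  show ?case
  proof
   assume dz:"dist z x0>=2 * rh"
   define d where "d=dist z x0"
   have d:"d>=2 * rh" "d>0" using dz rh r by (auto simp:d_def)
   have V0:"V x0 rh>0" "V z \<sigma>>0" using rh r \<sigma> by (auto intro: ball_pos)
   have C0r:"C0 * r<=C0 * d" using d rh r C0 by (intro mult_left_mono) auto
   have "d<=C0 * d" using d C0 by simp
   then have "2 * d<=2*(C0 * d)" by (rule mult_left_mono) simp
   moreover have "d + rh<=2 * d" using d rh r by argo
   ultimately have "d + rh<=2 * C0 * d" by (simp only: mult.assoc)
   then have "V x0 rh<=V z (2 * C0 * d)" by (intro V_mono) (simp add:d_def dist_commute)
   also have "...<=(2*(2 * C0 * d)/\<sigma>) ^ dq * V z \<sigma>"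
   proof (rule ball_growth[OF \<sigma>(1)])
   have "0<=C0 * d" using C0 d by simp
   then have "\<sigma><=2*(C0 * d)" using \<sigma>r C0r by linarith
   then show "\<sigma><=2 * C0 * d" by (simp only: mult.assoc)
   qed
   finally have V1:"V x0 rh<=(4 * C0 * d/\<sigma>) ^ dq * V z \<sigma>" by (simp add:mult.assoc)
   have gen:"1/v<=k/w" if "w<=k * v" "w>0" "v>0" for v w k :: real using that by (simp add:field_simps)
   have V2:"1/V z \<sigma><=(4 * C0 * d/\<sigma>) ^ dq/V x0 rh" by (rule gen[OF V1 V0])
   \<comment> \<open>Points of the ball around \<open>x0\<close> are at distance at least
     \<open>d / 2\<close> from \<open>z\<close>, which leaves this exponent.\<close>
   define e where "e=exp (- (a * d/(2 * \<sigma>)))"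
   have esplit:"e=exp (- ((a/4)*(d/\<sigma>))) * exp (- (a * d/(4 * \<sigma>)))" by (simp add:e_def exp_add[symmetric])
   have "1/V z \<sigma> * e<=(4 * C0 * d/\<sigma>) ^ dq/V x0 rh * e" by (rule mult_right_mono) (use V2 in \<open>auto simp:e_def\<close>)
   also have "...=(4 * C0 * d/\<sigma>) ^ dq/V x0 rh * (exp (- ((a/4)*(d/\<sigma>))) * exp (- (a * d/(4 * \<sigma>))))" unfolding esplit ..
   also have "(4 * C0 * d/\<sigma>) ^ dq/V x0 rh * (exp (- ((a/4)*(d/\<sigma>))) * exp (- (a * d/(4 * \<sigma>))))
   = (4 * C0) ^ dq * ((d/\<sigma>) ^ dq * exp (- ((a/4)*(d/\<sigma>))))/V x0 rh * exp (- (a * d/(4 * \<sigma>)))"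
   by (simp add:power_mult_distrib power_divide)
   also have "...<=(4 * C0) ^ dq * (fact dq/(a/4) ^ dq)/V x0 rh * exp (- (tb * d/r))"
   proof (intro mult_mono divide_right_mono mult_left_mono power_exp_bound)
   have "a * d/(4*(C0 * r))<=a * d/(4 * \<sigma>)" using \<sigma>(1) \<sigma>r a d r C0 by (intro divide_left_mono mult_left_mono mult_pos_pos) auto
   moreover have "a * d/(4*(C0 * r))=tb * d/r" by (simp add:tb_def)
   ultimately show "exp (- (a * d/(4 * \<sigma>)))<=exp (- (tb * d/r))" by simp
   qed (use \<sigma> d a C0 V0 in auto)
   also have "(4 * C0) ^ dq * (fact dq/(a/4) ^ dq)=(16 * C0/a) ^ dq * fact dq"
   proof -
   have "16 * C0/a=(4 * C0)*(4/a)" by simp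
   then have e1:"(16 * C0/a) ^ dq=(4 * C0) ^ dq * (4/a) ^ dq" by (simp only: power_mult_distrib)
   have e2:"fact dq/(a/4) ^ dq=fact dq * (4/a) ^ dq" using a by (simp add:power_divide)
   show ?thesis unfolding e1 e2 by (simp only: mult_ac)
   qed
   finally have "1/V z \<sigma> * e<=(16 * C0/a) ^ dq * fact dq/V x0 rh * exp (- (tb * d/r))" .
   then have "A * (1/V z \<sigma> * e)<=A * ((16 * C0/a) ^ dq * fact dq/V x0 rh * exp (- (tb * d/r)))" using A by (intro mult_left_mono) auto
   then have "A * (1/V z \<sigma> * exp (- (a * d/(2 * \<sigma>))))<=A * ((16 * C0/a) ^ dq * fact dq/V x0 rh * exp (- (tb * d/r)))" unfolding e_def .
   then have key:"A/V z \<sigma> * exp (- (a * d/(2 * \<sigma>)))<=tc/V x0 rh * exp (- (tb * d/r))" by (simp add:tc_def)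
   have "Q ta g z<=(\<integral>y. tc/V x0 rh * exp (- (tb * d/r)) * g y \<partial>mu)" unfolding Q_def
   proof (rule integral_mono_AE)
   show "integrable mu (%y. q ta z y * g y)" by (rule q_integrable[OF ta(1) g(1)])
   show "integrable mu (%y. tc/V x0 rh * exp (- (tb * d/r)) * g y)" using gi by simp
   show "AE y in mu. q ta z y * g y<=tc/V x0 rh * exp (- (tb * d/r)) * g y" using elim
   proof eventually_elim
   case (elim y)
   show ?case
   proof (cases "y:ball x0 rh")
   case True
   have "d<=dist z y + dist y x0" by (simp add:d_def dist_triangle)
   then have "dist z y>=d/2" using True d by (simp add:dist_commute)
   then have "a * (d/2)/\<sigma><=a * dist z y/\<sigma>" using a \<sigma>(1) by (intro divide_right_mono mult_left_mono) auto
   then have "exp (- (a * dist z y/\<sigma>))<=exp (- (a * d/(2 * \<sigma>)))" by simp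
   then have "A/V z \<sigma> * exp (- (a * dist z y/\<sigma>))<=A/V z \<sigma> * exp (- (a * d/(2 * \<sigma>)))"
   using A V0 by (intro mult_left_mono) auto
   then have "p ta z y<=tc/V x0 rh * exp (- (tb * d/r))" using elim key \<sigma>(2) by simp
   moreover have "q ta z y<=p ta z y" using p_nonneg[OF ta(1)] by (simp add:q_def)
   ultimately have "q ta z y<=tc/V x0 rh * exp (- (tb * d/r))" by linarith
   then show ?thesis using g(2) by (rule mult_right_mono)
   qed (simp add:g(3))
   qed
   qed
   then show "Q ta g z<=tc/V x0 rh * exp (- (tb * dist z x0/r))*(\<integral>y. g y \<partial>mu)" using gi by (simp add:d_def)
  qed
 qed
qed

lemma near_bound:
 assumes r:"r>0" and g:"g:bdf" "!!x. g x>=0" and gi:"integrable mu g"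
 shows "AE x in mu. (ALL y. g y~=0-->dist x y<=dl * r)-->Q (Ps r) g x>=c/V x r * (\<integral>y. g y \<partial>mu)"
 using p_lower[OF r] kmass_le_one[OF Psi_pos[OF r]]
proof eventually_elim
 case (elim x)
 show ?case
 proof
  assume near:"ALL y. g y~=0-->dist x y<=dl * r"
  have "(\<integral>y. c/V x r * g y \<partial>mu)<=Q (Ps r) g x" unfolding Q_def
  proof (rule integral_mono_AE)
   show "integrable mu (%y. q (Ps r) x y * g y)" by (rule q_integrable[OF Psi_pos[OF r] g(1)])
   show "integrable mu (%y. c/V x r * g y)" using gi by simp
   show "AE y in mu. c/V x r * g y<=q (Ps r) x y * g y" using elim(1)
   proof eventually_elim
   case (elim y)
   show ?case
   proof (cases "g y=0")
   case False
   then have "c/V x r<=p (Ps r) x y" using near elim by blast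
   from mult_right_mono[OF this g(2)[of y]] show ?thesis using \<open>kmass (Ps r) x \<le> 1\<close> by (simp add:q_def)
   qed simp
   qed
  qed
  then show "Q (Ps r) g x>=c/V x r * (\<integral>y. g y \<partial>mu)" using gi by simp
 qed
qed

text \<open>The densities converge only against continuous functions, so \<open>B\<close> is
  enlarged to \<open>B'\<close> with a bump function in between. The filter allows \<open>h\<close>
  to run through a sequence tending to 0.\<close>

lemma Fb_edens_limit_le:
 assumes u:"u:F" "u:bdf" and B:"bounded B" "B:sets borel" and e:"e>0"
  and near:"!!x y. x:B==>dist x y<e==>y:B'" and B': "B':sets borel"
  and le:"\<forall>\<^sub>F h in F'. h>0&w<=K * (\<integral>x. ind B x * edens h u x \<partial>mu)"
  and F': "filterlim (%h. h) (at_right 0) F'" "F'~=bot" and K:"K>=0"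
 shows "w<=K * en u B'"
proof -
 have "compact (closure B)"
  using B(1) compact_cball by (metis bounded_subset_cball closed_cball closed_closure closure_minimal compact_Int_closed inf.absorb_iff2)
 then obtain ph where ph:"ph:Cc" "!!x. 0<=ph x&ph x<=(1::real)" "!!x. x:closure B==>ph x=1"
  "!!x. (ALL y:closure B. dist x y>=e)==>ph x=0"
  by (rule bump_exists[OF _ e]) blast
 have ph_B': "ph x<=ind B' x" for x
 proof (cases "x:B'")
  case False
  have "dist x y>=e" if y:"y:closure B" for y
  proof (rule ccontr)
   assume "\<not> dist x y>=e"
   then have "e - dist x y>0" by simp
   from y[unfolded closure_approachable, rule_format, OF this]
   obtain b where b:"b:B" "dist b y<e - dist x y" by blast
   then have "dist b x<e" using dist_triangle[of b x y] by (simp add:dist_commute)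
   then show False using near[OF b(1)] False by blast
  qed
  then show ?thesis using ph(4)[of x] by simp
 qed (use ph(2) in auto)
 have "w<=K * elim_fun u ph"
 proof (rule tendsto_lowerbound)
  show "((%h. K * (\<integral>x. ph x * edens h u x \<partial>mu)) \<longlongrightarrow> K * elim_fun u ph) F'"
   by (intro tendsto_intros filterlim_compose[OF elim_fun_limit[OF u ph(1)] F'(1)])
  show "\<forall>\<^sub>F h in F'. w<=K * (\<integral>x. ph x * edens h u x \<partial>mu)" using le
  proof eventually_elim
   case (elim h)
   have h:"h>0" using elim by simp
   have "(\<integral>x. ind B x * edens h u x \<partial>mu)<=(\<integral>x. ph x * edens h u x \<partial>mu)"
   proof (rule integral_mono)
   show "integrable mu (%x. ind B x * edens h u x)" using B by (intro edens_integrable_mult h u bdf_indicator) (simp add:sets_mu)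
   show "integrable mu (%x. ph x * edens h u x)" by (intro edens_integrable_mult h u Cc_bdf ph)
   show "ind B x * edens h u x<=ph x * edens h u x" for x
   proof (rule mult_right_mono[OF _ edens_nonneg[OF h u(2)]])
   show "ind B x<=ph x" using ph(2)[of x] ph(3)[of x] closure_subset[of B] by (auto simp:indicator_def)
   qed
   qed
   then have "K * (\<integral>x. ind B x * edens h u x \<partial>mu)<=K * (\<integral>x. ph x * edens h u x \<partial>mu)" using K by (rule mult_left_mono)
   then show ?case using elim by linarith
  qed
 qed (rule F'(2))
 also have "elim_fun u ph=(\<integral>x. ph x \<partial>energy_measure_bounded E F u)" using energy_bounded(4)[OF u ph(1)] by simp
 also have "...<=(\<integral>x. ind B' x \<partial>energy_measure_bounded E F u)"
 proof (rule integral_mono)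
  show "integrable (energy_measure_bounded E F u) ph" by (intro Cc_integrable ph energy_bounded[OF u])
  show "integrable (energy_measure_bounded E F u) (ind B')"
   using energy_bounded(1,2)[OF u] B' finite_measure.emeasure_finite[OF energy_bounded(2)[OF u], of B']
   by (intro integrable_real_indicator) (auto simp:less_top[symmetric])
 qed (rule ph_B')
 also have "...=en u B'" using sets_eq_imp_space_eq[OF energy_bounded(1)[OF u]] by (simp add:en_def)
 finally show ?thesis using K by (simp add:mult_left_mono)
qed

text \<open>Applies \<open>local_poincare\<close> with \<open>n+1\<close> steps of length
  \<open>Ps r / (n+1)\<close>, so that the total time is \<open>Ps r\<close>, and lets
  \<open>n\<close> tend to infinity. Near the diagonal the kernel gives \<open>2 * kp\<close> times
  the mass of \<open>g\<close>; what leaves the ball of radius \<open>L0 * r\<close> costs at most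
  \<open>kp\<close> times that mass.\<close>

lemma poincare:
 obtains L K where "L>=1" "K>0"
  "!!x0 s u. s>0==>u:F==>u:bdf ==>
   V x0 s * (\<integral>x. ind (ball x0 s) x * (u x)^2 \<partial>mu)-(\<integral>x. ind (ball x0 s) x * u x \<partial>mu)\<^sup>2
   <= K * Ps s * V x0 s * en u (ball x0 (L * s))"
proof -
 \<comment> \<open>\<open>4 ^ dq\<close> pays for moving the centre of the ball to
   \<open>x0\<close>; the 2 leaves half of the lower bound after the tail is subtracted.\<close>
 define c1 where "c1=c/(2*4 ^ dq)"
 have c1:"c1>0" using c by (simp add:c1_def)
 obtain L0 where L0:"L0>=2" "tc * exp (- (tb * L0))<=c1"
 proof -
  have "((%L. tc * exp (- (tb * L))) \<longlongrightarrow> 0) at_top" using tb_pos by real_asymp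
  then have "\<forall>\<^sub>F L in at_top. tc * exp (- (tb * L))<c1" using c1 by (intro order_tendstoD)
  then have "\<forall>\<^sub>F L in at_top. tc * exp (- (tb * L))<c1&L>=2" using eventually_ge_at_top[of 2] by eventually_elim auto
  from eventually_happens'[OF _ this] show thesis using that less_imp_le by auto
 qed
 define K where "K=Cs * (2/dl) ^ m/c1*(4/dl) ^ dq"
 have K:"K>0" using Cs dl c1 by (simp add:K_def)
 show thesis
 proof (rule that[of "2 * L0*(2/dl)" K])
  have "2/dl>=1" using dl by (simp add:field_simps)
  then show "2 * L0*(2/dl)>=1" using L0(1) mult_mono[of 1 "2 * L0" 1 "2/dl"] by simp
  show "K>0" by (rule K)
  fix x0 :: 'a and s :: real and u assume s:"s>0" and u:"u:F" "u:bdf"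
  \<comment> \<open>Any two points of \<open>ball x0 s\<close> are then within
    \<open>dl * r\<close>, the range of the near-diagonal lower bound.\<close>
  define r where "r=s * (2/dl)"
  have r:"r>0" and rs:"s=dl * r/2" using s dl by (auto simp:r_def)
  have sr:"s<=r/2" using dl r by (simp add:rs)
  define B where "B=ball x0 (L0 * r)"
  define B' where "B'=ball x0 s"
  have L0r:"L0 * r>=2 * r" using L0(1) r by simp
  have sub:"B' \<subseteq> B" unfolding B_def B'_def using L0r sr r by (intro subset_ball) linarith
  define kp where "kp=c1/V x0 r"
  have kp:"kp>0" using c1 ball_pos[OF r] by (simp add:kp_def)
  define w where "w=V x0 s * (\<integral>x. ind B' x * (u x)^2 \<partial>mu)-(\<integral>x. ind B' x * u x \<partial>mu)\<^sup>2"
  have main:"kp * w<=Ps r * (\<integral>x. ind B x * edens (Ps r/real (Suc n)) u x \<partial>mu)" for n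
  proof -
   define h where "h=Ps r/real (Suc n)"
   have h:"h>0" using Psi_pos[OF r] by (simp add:h_def)
   have nh:"real (Suc n) * h=Ps r" by (simp add:h_def)
   interpret Nm: neumann mu E F P p B h
   using h ball_finite by unfold_locales (auto simp:B_def sets_borel)
   have "kp * (measure mu B' * (\<integral>x. ind B' x * (u x)^2 \<partial>mu)-(\<integral>x. ind B' x * u x \<partial>mu)\<^sup>2)
   <= real (Suc n) * h * (\<integral>x. ind B x * edens h u x \<partial>mu)"
   proof (rule Nm.local_poincare[OF u(2) _ sub])
   show "B':sets mu" by (simp add:B'_def sets_borel)
   show "kp>=0" using kp by simp
   fix g assume g:"g:bdf" "!!x. g x>=0" "!!x. x ~: B'==>g x=0"
   have gi:"integrable mu g" by (rule supp_ball_integrable[OF g(1) g(3)[unfolded B'_def]])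
   define G where "G=(\<integral>y. g y \<partial>mu)"
   have G:"G>=0" using g(2) by (simp add:G_def)
   have V0:"V x0 r>0" by (rule ball_pos[OF r])
   define be where "be=kp * G"
   have tail:"AE x in mu. x ~: B-->Q (real k * h) g x<=be" if k:"0<k" "k<Suc n" for k
   proof -
   have kh:"0<real k * h" "real k * h<=Ps r" using k h nh mult_right_mono[of "real k" "real (Suc n)" h] by auto
   have "AE z in mu. dist z x0>=2 * r-->Q (real k * h) g z<=tc/V x0 r * exp (- (tb * dist z x0/r))*(\<integral>y. g y \<partial>mu)"
   proof (rule tail_bound[OF r kh order_refl g(1,2)])
   fix x assume "x ~: ball x0 r"
   moreover have "B' \<subseteq> ball x0 r" unfolding B'_def using sr r by (intro subset_ball) linarith
   ultimately show "g x=0" by (intro g(3)) auto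
   qed
   then show ?thesis
   proof eventually_elim
   case (elim x)
   show ?case
   proof
   assume "x ~: B"
   then have d:"dist x x0>=L0 * r" by (simp add:B_def dist_commute)
   then have "Q (real k * h) g x<=tc/V x0 r * exp (- (tb * dist x x0/r)) * G" using elim L0r by (simp add:G_def)
   also have "...<=tc/V x0 r * exp (- (tb * L0)) * G"
   proof -
   have "tb * L0<=tb * dist x x0/r" using d r tb_pos by (simp add:field_simps)
   then show ?thesis using tc_pos V0 G by (intro mult_right_mono mult_left_mono) auto
   qed
   also have "...<=be" using mult_right_mono[OF L0(2), of "G/V x0 r"] G V0 by (simp add:be_def kp_def)
   finally show "Q (real k * h) g x<=be" .
   qed
   qed
   qed
   have up:"AE x in mu. x:B-->Q (real (Suc n) * h) g x<=Nm.Rpow (Suc n) g x + be"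
   proof (rule Nm.Rpow_lower[OF g(1,2)])
   show "g x=0" if "x ~: B" for x using that sub by (intro g(3)) auto
   show "be>=0" using kp G by (simp add:be_def)
   qed (use tail in auto)
   show "AE x in mu. x:B'-->Nm.Rpow (Suc n) g x>=kp * (\<integral>y. g y \<partial>mu)" using up near_bound[OF r g(1,2) gi]
   proof eventually_elim
   case (elim x)
   show ?case
   proof
   assume x:"x:B'"
   have "dist x y<=dl * r" if "g y~=0" for y
   proof -
   have "y:B'" using g(3) that by blast
   then have "dist x y<s + s" using x dist_triangle2[of x y x0] by (simp add:B'_def dist_commute)
   then show ?thesis by (simp add:rs)
   qed
   then have lo:"c/V x r * G<=Q (Ps r) g x" using elim(2) by (simp add:G_def)
   have "V x r<=V x0 (2 * r)" using x sr r by (intro V_mono) (auto simp:B'_def dist_commute)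
   also have "...<=4 ^ dq * V x0 r" using ball_growth[of r "2 * r" x0] r by simp
   finally have "V x r<=4 ^ dq * V x0 r" .
   then have "c/(4 ^ dq * V x0 r)<=c/V x r" using c ball_pos[OF r] by (intro divide_left_mono mult_pos_pos) auto
   moreover have "2 * kp=c/(4 ^ dq * V x0 r)" by (simp add:kp_def c1_def)
   ultimately have "2 * kp * G<=c/V x r * G" using G by (intro mult_right_mono) auto
   then have "2 * kp * G<=Nm.Rpow (Suc n) g x + be" using lo elim(1) x sub nh by auto
   then show "Nm.Rpow (Suc n) g x>=kp * (\<integral>y. g y \<partial>mu)" by (simp add:be_def G_def)
   qed
   qed
   qed
   then show ?thesis unfolding nh by (simp add:w_def B'_def h_def)
  qed
  have "kp * w<=Ps r * en u (ball x0 (2 * L0 * r))"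
  proof (rule Fb_edens_limit_le[OF u])
   show "bounded B" "B:sets borel" "ball x0 (2 * L0 * r):sets borel" by (auto simp:B_def)
   show "L0 * r>0" using L0r r by linarith
   show "!!x y. x:B==>dist x y<L0 * r==>y:ball x0 (2 * L0 * r)"
   proof -
   fix x y assume "x:B" "dist x y<L0 * r"
   then have "dist x0 y<L0 * r + L0 * r" using dist_triangle[of x0 y x] by (simp add:B_def)
   then show "y:ball x0 (2 * L0 * r)" by simp
   qed
   have "(%n. Ps r/real (Suc n)) ----> 0" for r :: real by real_asymp
   then have "filterlim (%n. Ps r/real (Suc n)) (at_right 0) sequentially" using Psi_pos[OF r] by (intro tendsto_imp_filterlim_at_right) auto
   then show "filterlim (%h. h) (at_right 0) (filtermap (%n. Ps r/real (Suc n)) sequentially)" by (simp add:filterlim_def)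
   show "filtermap (%n. Ps r/real (Suc n)) sequentially~=bot" by (simp add:filtermap_bot_iff)
   show "\<forall>\<^sub>F h in filtermap (%n. Ps r/real (Suc n)) sequentially. h>0&kp * w<=Ps r * (\<integral>x. ind B x * edens h u x \<partial>mu)"
   unfolding eventually_filtermap using main Psi_pos[OF r] by (intro always_eventually) auto
   show "Ps r>=0" using Psi_pos[OF r] by simp
  qed
  then have "w<=Ps r * V x0 r/c1 * en u (ball x0 (2 * L0 * r))" using c1 ball_pos[OF r, of x0] by (simp add:kp_def field_simps)
  also have "...<=K * Ps s * V x0 s * en u (ball x0 (2 * L0 * r))"
  proof (rule mult_right_mono[OF _ en_nonneg])
   have "Ps r<=Cs * (2/dl) ^ m * Ps s" using Psi_growth[of "2/dl" s] dl s by (simp add:r_def mult.commute)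
   moreover have "V x0 r<=(4/dl) ^ dq * V x0 s" using ball_growth[of s r x0] s sr r dl by (simp add:rs)
   ultimately have "Ps r * V x0 r<=(Cs * (2/dl) ^ m * Ps s)*((4/dl) ^ dq * V x0 s)" using Psi_pos[OF r] Psi_pos[OF s] Cs dl by (intro mult_mono) auto
   then have "Ps r * V x0 r/c1<=(Cs * (2/dl) ^ m * Ps s)*((4/dl) ^ dq * V x0 s)/c1" using c1 by (intro divide_right_mono) auto
   then show "Ps r * V x0 r/c1<=K * Ps s * V x0 s" by (simp add:K_def mult_ac)
  qed
  also have "2 * L0 * r=2 * L0*(2/dl) * s" by (simp add:r_def)
  finally show "V x0 s * (\<integral>x. ind (ball x0 s) x * (u x)^2 \<partial>mu)-(\<integral>x. ind (ball x0 s) x * u x \<partial>mu)\<^sup>2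
   <= K * Ps s * V x0 s * en u (ball x0 (2 * L0*(2/dl) * s))"
   by (simp add:w_def B'_def)
 qed
qed

end

context hke_space
begin

section \<open>A Caccioppoli inequality\<close>

text \<open>With this factor \<open>ball x (dl * \<sigma>)\<close> stays inside
  \<open>ball z (K1 * r)\<close> for \<open>x\<close> in \<open>ball z r\<close> and every
  \<open>\<sigma> <= C0 * r\<close>.\<close>

definition K1 :: real where "K1=1 + C0"
definition c2 :: real where "c2=min 1 (c * (dl/2) ^ dq)"
text \<open>The second entry makes the weight at least 1 on the ball of radius
  \<open>2 * K1 * r\<close>, where \<open>tail_bound\<close> says nothing.\<close>

definition ce :: real where "ce=max tc (exp (2 * K1 * tb))"

lemma K1_ge:"K1>=2" using C0 by (simp add:K1_def)

lemma c2_pos:"c2>0" using c dl by (simp add:c2_def)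

lemma ce_pos:"ce>0" using tc_pos by (simp add:ce_def)

definition wt :: "'a=>real => 'a=>real" where
 "wt z r x=ce * exp (- (tb * dist x z/r))"

lemma wt_measurable:"wt z r:borel_measurable mu" unfolding wt_def[abs_def] borel_measurable_mu by measurable

lemma wt_bdd:"r>0==>wt z r:bdf"
proof (rule bdd_funI[OF wt_measurable])
 fix x assume "r>0"
 then have "exp (- (tb * dist x z/r))<=1" using tb_pos by simp
 then show "\<bar>wt z r x\<bar><=ce" using ce_pos by (simp add:wt_def abs_mult mult_left_le)
qed

lemma wt_nonneg:"wt z r x>=0" using ce_pos by (simp add:wt_def)

lemma wt_ge_one: assumes "r>0" "dist x z<=2*(K1 * r)" shows "wt z r x>=1"
proof -
 have "tb * dist x z/r<=tb * (2*(K1 * r))/r" using assms tb_pos by (intro divide_right_mono mult_left_mono) auto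
 also have "...=2 * K1 * tb" using assms(1) by simp
 finally have "exp (- (2 * K1 * tb))<=exp (- (tb * dist x z/r))" by simp
 then have "exp (2 * K1 * tb) * exp (- (2 * K1 * tb))<=wt z r x" unfolding wt_def ce_def by (intro mult_mono) (auto simp:le_max_iff_disj)
 then show ?thesis by (simp add:exp_minus)
qed

abbreviation ib :: "'a=>real => 'a=>real" where
 "ib z r==ind (ball z r)"

lemma ib_bdd:"ib z r:bdf" by (rule bdf_indicator[OF ball_sets])

lemma ib_L2:"ib z r:L2 mu"
proof -
 have "(%x. (ib z r x)^2)=ib z r" by (auto simp:indicator_def fun_eq_iff)
 moreover have "integrable mu (ib z r)" by (rule supp_ball_integrable[where ?x0.0=z and r=r, OF ib_bdd]) simp
 ultimately show ?thesis using bdf_measurable[OF ib_bdd] by (simp add:L2_def)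
qed

lemma heat_upper:
 assumes r:"r>0" and ta:"0<ta" "ta<=Ps r"
 shows "AE x in mu. Q ta (ib z (K1 * r)) x<=wt z r x"
proof -
 let ?R = "K1 * r"
 have R:"?R>=r" using K1_ge r by simp
 have V0:"V z ?R>0" using R r by (intro ball_pos) linarith
 have I:"(\<integral>y. ib z ?R y \<partial>mu)=V z ?R" by (simp add:space_UNIV)
 have "AE x in mu. dist x z>=2 * ?R-->Q ta (ib z ?R) x<=tc/V z ?R * exp (- (tb * dist x z/r))*(\<integral>y. ib z ?R y \<partial>mu)"
  by (rule tail_bound[OF r ta R ib_bdd]) auto
 then show ?thesis
 proof eventually_elim
  case (elim x)
  show ?case
  proof (cases "dist x z>=2 * ?R")
   case True
   then have "Q ta (ib z ?R) x<=tc * exp (- (tb * dist x z/r))" using elim V0 unfolding I by simp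
   also have "...<=wt z r x" unfolding wt_def ce_def by (intro mult_right_mono) auto
   finally show ?thesis .
  next
   case False
   have "Q ta (ib z ?R) x<=1" by (rule Q_le_const[OF ta(1) ib_bdd]) (auto simp:indicator_def)
   also have "1<=wt z r x" using False by (intro wt_ge_one r) auto
   finally show ?thesis .
  qed
 qed
qed

text \<open>With \<open>ta = Ps \<sigma>\<close>, only the kernel mass in
  \<open>ball x (dl * \<sigma>)\<close> is counted; doubling bounds it below independently of
  \<open>\<sigma>\<close>.\<close>

lemma heat_lower:
 assumes r:"r>0" and ta:"0<ta" "ta<=Ps r"
 shows "AE x in mu. x:ball z r-->c2<=Q ta (ib z (K1 * r)) x"
proof -
 obtain \<sigma> where \<sigma>: "\<sigma>>0" "Ps \<sigma>=ta" using Psi_surj[OF ta(1)] by auto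
 have \<sigma>r:"\<sigma><=C0 * r" using Psi_quasi[OF \<sigma>(1) r] \<sigma>(2) ta(2) by simp
 show ?thesis using p_lower[OF \<sigma>(1)] kmass_le_one[OF ta(1)]
 proof eventually_elim
  case (elim x)
  show ?case
  proof
   assume x:"x:ball z r"
   have dl\<sigma>: "dl * \<sigma><=\<sigma>" "dl * \<sigma>>0" using dl \<sigma> by auto
   have sub:"ball x (dl * \<sigma>) \<subseteq> ball z (K1 * r)"
   proof
   fix y assume "y:ball x (dl * \<sigma>)"
   then have "dist z y<r + C0 * r" using x dl\<sigma>(1) \<sigma>r dist_triangle[of z y x] by simp
   then show "y:ball z (K1 * r)" by (simp add:K1_def distrib_right)
   qed
   have V0:"V x \<sigma>>0" by (rule ball_pos[OF \<sigma>(1)])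
   have "V x \<sigma><=(2 * \<sigma>/(dl * \<sigma>)) ^ dq * V x (dl * \<sigma>)" by (rule ball_growth[OF dl\<sigma>(2,1)])
   also have "2 * \<sigma>/(dl * \<sigma>)=2/dl" using \<sigma> by simp
   finally have "(dl/2) ^ dq * V x \<sigma><=(dl/2) ^ dq * ((2/dl) ^ dq * V x (dl * \<sigma>))" using dl by (intro mult_left_mono) auto
   also have "...=V x (dl * \<sigma>)"
   proof -
   have "(dl/2) ^ dq * (2/dl) ^ dq=(dl/2*(2/dl)) ^ dq" by (rule power_mult_distrib[symmetric])
   also have "dl/2*(2/dl)=1" using dl by simp
   finally show ?thesis by (simp add:mult.assoc[symmetric])
   qed
   finally have V1:"(dl/2) ^ dq * V x \<sigma><=V x (dl * \<sigma>)" .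
   have "c2<=c * (dl/2) ^ dq" by (simp add:c2_def)
   also have "...=c/V x \<sigma> * ((dl/2) ^ dq * V x \<sigma>)" using V0 by simp
   also have "...<=c/V x \<sigma> * V x (dl * \<sigma>)" using c V0 by (intro mult_left_mono V1) auto
   also have "...=(\<integral>y. c/V x \<sigma> * ib x (dl * \<sigma>) y \<partial>mu)" by (simp add:space_UNIV)
   also have "...<=Q ta (ib z (K1 * r)) x" unfolding Q_def
   proof (rule integral_mono_AE)
   have "integrable mu (ib x (dl * \<sigma>))" by (rule supp_ball_integrable[where ?x0.0=x and r="dl * \<sigma>", OF ib_bdd]) simp
   then show "integrable mu (%y. c/V x \<sigma> * ib x (dl * \<sigma>) y)" by simp
   show "integrable mu (%y. q ta x y * ib z (K1 * r) y)" by (rule q_integrable[OF ta(1) ib_bdd])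
   show "AE y in mu. c/V x \<sigma> * ib x (dl * \<sigma>) y<=q ta x y * ib z (K1 * r) y" using elim(1)
   proof eventually_elim
   case (elim y)
   show ?case
   proof (cases "y:ball x (dl * \<sigma>)")
   case True
   then have "c/V x \<sigma><=p ta x y" using elim \<sigma>(2) by simp
   then show ?thesis using True sub \<open>kmass ta x \<le> 1\<close> by (auto simp:q_def)
   next
   case False
   then show ?thesis using q_nonneg[OF ta(1)] by simp
   qed
   qed
   qed
   finally show "c2<=Q ta (ib z (K1 * r)) x" .
  qed
 qed
qed

section \<open>Cutoff functions from time averages of the heat flow\<close>

definition hstep :: "'a=>real=>real=>nat => 'a=>real" where
 "hstep z r h k=(if k=0 then ib z (K1 * r) else Q (real k * h) (ib z (K1 * r)))"

text \<open>The time average of the heat flow started from the indicator of a ball serves as a cutoff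
 function: by telescoping, the heat operator changes it by a multiple of \<open>1 / Ps r\<close> only.\<close>

definition cutoff :: "'a=>real=>nat => 'a=>real" where
 "cutoff z r n x=(SUM k<=n. hstep z r (Ps r/real (Suc n)) k x)/real (Suc n)"

lemma bdf_sum:"finite I==>(!!i. i:I==>f i:bdf)==>(%x. SUM i:I. f i x):bdf" by (induction I rule: finite_induct) (auto intro: bdf_const bdf_add)

lemma Q_sum:
 assumes t:"t>0" and I:"finite I" and f:"!!i. i:I==>f i:bdf"
 shows "Q t (%x. SUM i:I. f i x) x=(SUM i:I. Q t (f i) x)" using I f
proof (induction I rule: finite_induct)
 case empty
 then show ?case by (simp add:Q_def)
next
 case (insert i I)
 then have "Q t (%x. f i x+(SUM i:I. f i x)) x=Q t (f i) x + Q t (%x. SUM i:I. f i x) x" by (intro Q_add t bdf_sum) auto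
 then show ?case using insert by simp
qed

lemma L2_sum:"finite I==>(!!i. i:I==>f i:L2 mu)==>(%x. SUM i:I. f i x):L2 mu"
proof (induction I rule: finite_induct)
 case empty
 then show ?case by (simp add:L2_def)
next
 case (insert i I)
 then have "(%x. f i x+(SUM i:I. f i x)):L2 mu" by (intro L2_add) auto
 then show ?case using insert by simp
qed

lemma hstep_bdd:"h>0==>hstep z r h k:bdf" unfolding hstep_def by (auto intro: ib_bdd Q_bdd)

lemma hstep_L2:"h>0==>hstep z r h k:L2 mu" unfolding hstep_def by (auto intro: ib_L2 Q_L2)

lemma hstep_nonneg:"h>0==>hstep z r h k x>=0" unfolding hstep_def by (auto intro: Q_nonneg)

lemma hstep_Suc:"h>0==>AE x in mu. Q h (hstep z r h k) x=hstep z r h (Suc k) x"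
proof (cases "k=0")
 case False
 assume h:"h>0"
 have "AE x in mu. Q (h + real k * h) (ib z (K1 * r)) x=Q h (Q (real k * h) (ib z (K1 * r))) x"
  using h False by (intro Q_semigroup_AE ib_L2 ib_bdd) auto
 moreover have "h + real k * h=real (Suc k) * h" by (simp add:algebra_simps)
 ultimately show ?thesis using False by (auto simp:hstep_def)
qed (simp add:hstep_def)

lemma hstep_upper:
 assumes r:"r>0" and n:"k<=Suc n" and h:"h=Ps r/real (Suc n)"
 shows "AE x in mu. hstep z r h k x<=wt z r x"
proof (cases "k=0")
 case True
 have "ib z (K1 * r) x<=wt z r x" for x
 proof (cases "x:ball z (K1 * r)")
  case True
  have "0<=K1 * r" using K1_ge r by simp
  then have "dist x z<=2*(K1 * r)" using True by (simp add:dist_commute)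
  then show ?thesis using wt_ge_one[OF r] wt_nonneg[of z r x] by (auto simp:indicator_def)
 qed (simp add:wt_nonneg)
 then show ?thesis by (simp add:True hstep_def)
next
 case False
 have "real k * h<=Ps r" using mult_right_mono[of "real k" "real (Suc n)" h] n Psi_pos[OF r] by (simp add:h)
 moreover have "0<real k * h" using False Psi_pos[OF r] by (simp add:h)
 ultimately show ?thesis using heat_upper[OF r] False by (simp add:hstep_def)
qed

lemma hstep_lower:
 assumes r:"r>0" and n:"k<=Suc n" and h:"h=Ps r/real (Suc n)"
 shows "AE x in mu. x:ball z r-->c2<=hstep z r h k x"
proof (cases "k=0")
 case True
 have "r<=K1 * r" using K1_ge r by simp
 then have "ball z r \<subseteq> ball z (K1 * r)" by (rule subset_ball)
 moreover have "c2<=1" by (simp add:c2_def)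
 ultimately have "x:ball z r==>c2<=ib z (K1 * r) x" for x by (auto simp:indicator_def)
 then show ?thesis by (simp add:True hstep_def del: mem_ball)
next
 case False
 have "real k * h<=Ps r" using mult_right_mono[of "real k" "real (Suc n)" h] n Psi_pos[OF r] by (simp add:h)
 moreover have "0<real k * h" using False Psi_pos[OF r] by (simp add:h)
 ultimately show ?thesis using heat_lower[OF r] False by (simp add:hstep_def)
qed

text \<open>All averaged steps are at times at most \<open>Ps r\<close>, where
  \<open>heat_upper\<close> and \<open>heat_lower\<close> hold.\<close>

lemma cutoff_props:
 assumes r:"r>0"
 shows "cutoff z r n:bdf" "cutoff z r n:L2 mu" "cutoff z r n x>=0"
  "AE x in mu. cutoff z r n x<=wt z r x"
  "AE x in mu. x:ball z r-->c2<=cutoff z r n x"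
proof -
 define h where "h=Ps r/real (Suc n)"
 have h:"h>0" using Psi_pos[OF r] by (simp add:h_def)
 have e:"cutoff z r n=(%x. 1/real (Suc n)*(SUM k<=n. hstep z r h k x))" by (rule ext) (simp add:cutoff_def h_def)
 show "cutoff z r n:bdf" unfolding e by (intro bdf_cmult bdf_sum hstep_bdd h) auto
 show "cutoff z r n:L2 mu" unfolding e by (intro L2_cmult L2_sum hstep_L2 h) auto
 show "cutoff z r n x>=0" unfolding e by (intro mult_nonneg_nonneg sum_nonneg hstep_nonneg h) auto
 have "AE x in mu. ALL k:{..n}. hstep z r h k x<=wt z r x" using hstep_upper[OF r _ h_def] by (intro AE_finite_allI) auto
 then show "AE x in mu. cutoff z r n x<=wt z r x"
 proof eventually_elim
  case (elim x)
  have "(SUM k<=n. hstep z r h k x)<=(SUM k<=n. wt z r x)" using elim by (intro sum_mono) auto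
  also have "...=real (Suc n) * wt z r x" by simp
  finally show ?case unfolding e by (simp add:divide_le_eq mult.commute)
 qed
 have "AE x in mu. ALL k:{..n}. x:ball z r-->c2<=hstep z r h k x" using hstep_lower[OF r _ h_def] by (intro AE_finite_allI) auto
 then show "AE x in mu. x:ball z r-->c2<=cutoff z r n x"
 proof eventually_elim
  case (elim x)
  show ?case
  proof
   assume "x:ball z r"
   then have "(SUM k<=n. c2)<=(SUM k<=n. hstep z r h k x)" using elim by (intro sum_mono) auto
   moreover have "(SUM k<=n. c2)=real (Suc n) * c2" by simp
   ultimately show "c2<=cutoff z r n x" unfolding e by (simp add:le_divide_eq mult.commute)
  qed
 qed
qed

text \<open>The heat flow does not increase constants, so the overlap bound for the balls passes to
  the cutoffs in spite of their unbounded supports.\<close>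

lemma cutoff_sum_le:
 assumes r:"r>0" and Z:"finite Z" and M:"!!y. (SUM z:Z. ib z (K1 * r) y)<=M"
 shows "(SUM z:Z. cutoff z r n x)<=M"
proof -
 define h where "h=Ps r/real (Suc n)"
 have h:"h>0" using Psi_pos[OF r] by (simp add:h_def)
 have M0:"M>=0" using M[of undefined] sum_nonneg[of Z "%z. ib z (K1 * r) undefined"] by simp
 have step:"(SUM z:Z. hstep z r h k x)<=M" for k
 proof (cases "k=0")
  case False
  have "(SUM z:Z. Q (real k * h) (ib z (K1 * r)) x)=Q (real k * h) (%y. SUM z:Z. ib z (K1 * r) y) x"
   using False h by (intro Q_sum[symmetric] Z ib_bdd) auto
  also have "...<=M" using False h M M0 by (intro Q_le_const bdf_sum Z ib_bdd) auto
  finally show ?thesis using False by (simp add:hstep_def)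
 qed (use M in \<open>simp add:hstep_def\<close>)
 have "(SUM z:Z. cutoff z r n x)=(SUM k<=n. SUM z:Z. hstep z r h k x)/real (Suc n)"
  unfolding cutoff_def h_def by (subst sum.swap) (simp add:sum_divide_distrib)
 also have "...<=(SUM k<=n. M)/real (Suc n)" by (intro divide_right_mono sum_mono step) auto
 also have "...=M" by simp
 finally show ?thesis .
qed

text \<open>\<open>edens_formula\<close> with the cutoff as test function. The first form pairs
  \<open>u * cutoff\<close> with the difference quotient \<open>(u - Q h u) / h\<close> and is split
  by Young's inequality. In the second, \<open>Q h\<close> changes the cutoff by the last minus the
  first step, divided by \<open>n+1\<close>; dividing by \<open>h\<close> leaves the factor
  \<open>1 / Ps r\<close>.\<close>

lemma cacc_single:
 fixes n :: nat
 assumes r:"r>0" and u:"u:F" "u:bdf"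
 defines "h==Ps r/real (Suc n)"
 shows "c2*(\<integral>x. ib z r x * edens h u x \<partial>mu)
  <= Ps r/2*(\<integral>x. ((u x - Q h u x)/h)^2 * cutoff z r n x \<partial>mu)+1/Ps r * (\<integral>x. (u x)^2 * wt z r x \<partial>mu)"
proof -
 have t:"Ps r>0" by (rule Psi_pos[OF r])
 have h:"h>0" using t by (simp add:h_def)
 have hn:"real (Suc n) * h=Ps r" by (simp add:h_def)
 note cp = cutoff_props[OF r, of z n]
 let ?ph = "cutoff z r n"
 have uL:"u:L2 mu" by (rule F_L2[OF u(1)])
 let ?u2 = "%x. (u x)^2"
 have u2L:"?u2:L2 mu" and u2b:"?u2:bdf" and u2i:"integrable mu ?u2"
  using bdd_L2_power2[OF uL u(2)] bdf_power2[OF u(2)] L2_integrable_square[OF uL] by auto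
 have uph:"(%x. u x * ?ph x):L2 mu" by (rule bdd_L2_mult[OF uL cp(1)])
 let ?w = "%x. (u x - Q h u x)/h"
 have QuL:"Q h u:L2 mu" by (rule Q_L2[OF h uL])
 have wL:"?w:L2 mu" using L2_cmult[OF L2_diff[OF uL QuL], of "1/h"] by simp
 have S:"hstep z r h k:bdf" "hstep z r h k:L2 mu" for k using h by (auto intro: hstep_bdd hstep_L2)
 have Qph:"AE x in mu. Q h ?ph x=?ph x+(hstep z r h (Suc n) x - hstep z r h 0 x)/real (Suc n)"
 proof -
  have "AE x in mu. ALL k:{..n}. Q h (hstep z r h k) x=hstep z r h (Suc k) x" using hstep_Suc[OF h] by (intro AE_finite_allI) auto
  then show ?thesis
  proof eventually_elim
   case (elim x)
   have "?ph=(%x. 1/real (Suc n)*(SUM k<=n. hstep z r h k x))" by (rule ext) (simp add:cutoff_def h_def)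
   then have "Q h ?ph x=1/real (Suc n) * Q h (%x. SUM k<=n. hstep z r h k x) x" by (simp only: Q_cmult)
   also have "Q h (%x. SUM k<=n. hstep z r h k x) x=(SUM k<=n. hstep z r h (Suc k) x)" using Q_sum[OF h, of "{..n}" "hstep z r h" x] S elim by simp
   also have "...=(SUM k<=n. hstep z r h k x) + hstep z r h (Suc n) x - hstep z r h 0 x"
   using sum.atMost_Suc_shift[of "%k. hstep z r h k x" n] by simp
   finally have "Q h ?ph x=1/real (Suc n)*((SUM k<=n. hstep z r h k x) + hstep z r h (Suc n) x - hstep z r h 0 x)" .
   moreover have "?ph x=(SUM k<=n. hstep z r h k x)/real (Suc n)" by (simp only: cutoff_def h_def)
   moreover have "1/N * (S + b - d)=S/N+(b - d)/N" for N S b d :: real by (simp add:add_divide_distrib diff_divide_distrib)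
   ultimately show ?case by (simp only:)
  qed
 qed
 have f1:"sform h u (%x. u x * ?ph x)/h=(\<integral>x. ?w x * u x * ?ph x \<partial>mu)"
 proof -
  have "sform h u (%x. u x * ?ph x)=ip u (%x. u x * ?ph x) - ip (Q h u) (%x. u x * ?ph x)" by (simp add:sform_def Q_P_bdd_inner[OF h uL uph])
  also have "...=ip (%x. u x - Q h u x) (%x. u x * ?ph x)" by (simp add:L2_inner_diff_left uL QuL uph)
  finally have "sform h u (%x. u x * ?ph x)/h=1/h * ip (%x. u x - Q h u x) (%x. u x * ?ph x)" by simp
  also have "...=ip (%x. 1/h * (u x - Q h u x)) (%x. u x * ?ph x)" by (rule L2_inner_cmult_left[symmetric])
  finally show ?thesis by (simp add:L2_inner_def mult.assoc)
 qed
 have f2:"- (1/2 * sform h ?u2 ?ph)/h<=1/(2 * Ps r)*(\<integral>x. (u x)^2 * wt z r x \<partial>mu)"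
 proof -
  have "sform h ?u2 ?ph=ip ?ph ?u2 - ip (Q h ?ph) ?u2" using sform_sym[OF h u2L cp(2)] by (simp add:sform_def Q_P_bdd_inner[OF h cp(2) u2L])
  also have "ip (Q h ?ph) ?u2=ip (%x. ?ph x+(hstep z r h (Suc n) x - hstep z r h 0 x)/real (Suc n)) ?u2"
  proof (rule L2_inner_cong_AE[OF Qph])
   have "(%x. ?ph x+1/real (Suc n)*(hstep z r h (Suc n) x - hstep z r h 0 x)):L2 mu" by (intro L2_add L2_cmult L2_diff cp S)
   then have "(%x. ?ph x+1/real (Suc n)*(hstep z r h (Suc n) x - hstep z r h 0 x)):borel_measurable mu" by (rule L2_measurable)
   then show "(%x. ?ph x+(hstep z r h (Suc n) x - hstep z r h 0 x)/real (Suc n)):borel_measurable mu" by simp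
  qed (simp_all add: L2_measurable[OF Q_L2[OF h cp(2)]] L2_measurable[OF u2L])
  also have "...=ip (%x. 1 * ?ph x+1/real (Suc n)*(hstep z r h (Suc n) x - hstep z r h 0 x)) ?u2" by simp
  also have "...=1 * ip ?ph ?u2+1/real (Suc n) * ip (%x. hstep z r h (Suc n) x - hstep z r h 0 x) ?u2" by (intro L2_inner_lin_left cp L2_diff S u2L)
  also have "ip (%x. hstep z r h (Suc n) x - hstep z r h 0 x) ?u2=ip (hstep z r h (Suc n)) ?u2 - ip (hstep z r h 0) ?u2"
   by (intro L2_inner_diff_left S u2L)
  finally have sf:"sform h ?u2 ?ph=ip ?ph ?u2-(1 * ip ?ph ?u2+1/real (Suc n)*(ip (hstep z r h (Suc n)) ?u2 - ip (hstep z r h 0) ?u2))" .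
  have "- (1/2*(X-(1 * X+1/N * D)))/h=1/(2*(N * h)) * D" if "N>0" for X N D :: real using h that by (simp add:field_simps)
  then have "- (1/2 * sform h ?u2 ?ph)/h=1/(2*(real (Suc n) * h))*(ip (hstep z r h (Suc n)) ?u2 - ip (hstep z r h 0) ?u2)" unfolding sf by simp
  also have "...<=1/(2 * Ps r)*(\<integral>x. (u x)^2 * wt z r x \<partial>mu)" unfolding hn
  proof (rule mult_left_mono)
   \<comment> \<open>The initial step enters with the favourable sign and is dropped.\<close>
   have "ip (hstep z r h 0) ?u2>=0" unfolding L2_inner_def using hstep_nonneg[OF h] by (intro Bochner_Integration.integral_nonneg) simp
   moreover have "ip (hstep z r h (Suc n)) ?u2<=(\<integral>x. (u x)^2 * wt z r x \<partial>mu)" unfolding L2_inner_def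
   proof (rule integral_mono_AE)
   show "integrable mu (%x. hstep z r h (Suc n) x * (u x)^2)" by (intro L2_integrable_mult S u2L)
   show "integrable mu (%x. (u x)^2 * wt z r x)" by (intro integrable_mult_bdd u2i wt_bdd r)
   show "AE x in mu. hstep z r h (Suc n) x * (u x)^2<=(u x)^2 * wt z r x" using hstep_upper[where z=z, OF r order_refl h_def[THEN meta_eq_to_obj_eq]]
   by eventually_elim (simp add:mult.commute mult_left_mono)
   qed
   ultimately show "ip (hstep z r h (Suc n)) ?u2 - ip (hstep z r h 0) ?u2<=(\<integral>x. (u x)^2 * wt z r x \<partial>mu)" by simp
  qed (use t in simp)
  finally show ?thesis .
 qed
 \<comment> \<open>Young's inequality weighted by \<open>Ps r\<close>, the time scale of the
   ball.\<close>
 have f3:"(\<integral>x. ?w x * u x * ?ph x \<partial>mu)<=Ps r/2*(\<integral>x. (?w x)^2 * ?ph x \<partial>mu)+1/(2 * Ps r)*(\<integral>x. (u x)^2 * wt z r x \<partial>mu)"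
 proof -
  have w2i:"integrable mu (%x. (?w x)^2 * ?ph x)" by (intro integrable_mult_bdd L2_integrable_square wL cp)
  have uwi:"integrable mu (%x. (u x)^2 * wt z r x)" by (intro integrable_mult_bdd u2i wt_bdd r)
  have "(\<integral>x. ?w x * u x * ?ph x \<partial>mu)<=(\<integral>x. Ps r/2*((?w x)^2 * ?ph x)+1/(2 * Ps r)*((u x)^2 * wt z r x) \<partial>mu)"
  proof (rule integral_mono_AE)
   show "integrable mu (%x. ?w x * u x * ?ph x)" by (intro integrable_mult_bdd L2_integrable_mult wL uL cp)
   show "integrable mu (%x. Ps r/2*((?w x)^2 * ?ph x)+1/(2 * Ps r)*((u x)^2 * wt z r x))" using w2i uwi by simp
   show "AE x in mu. ?w x * u x * ?ph x<=Ps r/2*((?w x)^2 * ?ph x)+1/(2 * Ps r)*((u x)^2 * wt z r x)" using cp(4)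
   proof eventually_elim
   case (elim x)
   have yg:"a * b<=s/2 * a^2+1/(2 * s) * b^2" if s:"s>0" for a b s :: real
   proof -
   have "0<=(s * a - b)^2/(2 * s)" using s by simp
   also have "(s * a - b)^2/(2 * s)=s/2 * a^2+1/(2 * s) * b^2 - a * b" using s by (simp add:power2_eq_square field_simps)
   finally show ?thesis by simp
   qed
   have "?w x * u x * ?ph x<=(Ps r/2*(?w x)^2+1/(2 * Ps r)*(u x)^2) * ?ph x" by (intro mult_right_mono yg t cutoff_props(3)[OF r])
   also have "...=Ps r/2*((?w x)^2 * ?ph x)+1/(2 * Ps r)*((u x)^2 * ?ph x)" by (simp add:distrib_right mult.assoc)
   also have "...<=Ps r/2*((?w x)^2 * ?ph x)+1/(2 * Ps r)*((u x)^2 * wt z r x)" using t elim by (intro add_left_mono mult_left_mono) auto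
   finally show ?case .
   qed
  qed
  also have "...=Ps r/2*(\<integral>x. (?w x)^2 * ?ph x \<partial>mu)+1/(2 * Ps r)*(\<integral>x. (u x)^2 * wt z r x \<partial>mu)"
  proof -
   have "(\<integral>x. al * f x + be * g x \<partial>mu)=al * (\<integral>x. f x \<partial>mu) + be * (\<integral>x. g x \<partial>mu)"
   if "integrable mu f" "integrable mu g" for al be f and g :: "'a=>real" using that by simp
   from this[OF w2i uwi] show ?thesis .
  qed
  finally show ?thesis .
 qed
 have "c2*(\<integral>x. ib z r x * edens h u x \<partial>mu)=(\<integral>x. c2 * ib z r x * edens h u x \<partial>mu)" by (simp add:mult.assoc)
 also have "...<=(\<integral>x. ?ph x * edens h u x \<partial>mu)"
 proof (rule integral_mono_AE)
  show "integrable mu (%x. c2 * ib z r x * edens h u x)" by (intro edens_integrable_mult h u bdf_cmult ib_bdd)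
  show "integrable mu (%x. ?ph x * edens h u x)" by (intro edens_integrable_mult h u cp)
  show "AE x in mu. c2 * ib z r x * edens h u x<=?ph x * edens h u x" using cp(5)
  proof eventually_elim
   case (elim x)
   have "c2 * ib z r x<=?ph x" using elim cutoff_props(3)[OF r] by (auto simp:indicator_def)
   then show ?case by (rule mult_right_mono[OF _ edens_nonneg[OF h u(2)]])
  qed
 qed
 also have "...=sform h u (%x. u x * ?ph x)/h+(- (1/2 * sform h ?u2 ?ph)/h)"
  unfolding edens_formula[OF h u(2) uL cp(1,2)] by (simp add:diff_divide_distrib)
 also have "...<=(Ps r/2*(\<integral>x. (?w x)^2 * ?ph x \<partial>mu)+1/(2 * Ps r)*(\<integral>x. (u x)^2 * wt z r x \<partial>mu))
   + 1/(2 * Ps r)*(\<integral>x. (u x)^2 * wt z r x \<partial>mu)"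
  unfolding f1 by (intro add_mono f3 f2)
 also have "...=Ps r/2*(\<integral>x. (?w x)^2 * ?ph x \<partial>mu)+1/Ps r * (\<integral>x. (u x)^2 * wt z r x \<partial>mu)"
 proof -
  have "a+1/(2 * s) * b+1/(2 * s) * b=a+1/s * b" for a b s :: real by (simp add:field_simps)
  then show ?thesis .
 qed
 finally show ?thesis .
qed

text \<open>The functions \<open>u z\<close> may differ from ball to ball. A common majorant
  \<open>W h\<close> of their squared difference quotients lets the cutoffs be summed first, so the
  generator term is counted \<open>M\<close> times in total rather than once per ball.\<close>

lemma cacc_sum:
 assumes r:"r>0" and Z:"finite Z" "Z~={}" and M:"!!y. (SUM z:Z. ib z (K1 * r) y)<=M"
  and u:"!!z. z:Z==>u z:F&u z:bdf"
  and W:"!!h. 0<h==>h<h0==>W h:borel_measurable mu&integrable mu (W h)&(\<integral>x. W h x \<partial>mu)<=Om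
   &(ALL z:Z. ALL x. ((u z x - Q h (u z) x)/h)^2<=W h x)" and h0:"h0>0"
 shows "c2*(SUM z:Z. en (u z) (ball z (r/2)))<=Ps r/2*(M * Om)+1/Ps r * (SUM z:Z. \<integral>x. (u z x)^2 * wt z r x \<partial>mu)"
proof -
 have t:"Ps r>0" by (rule Psi_pos[OF r])
 have M0:"M>=0" using M[of undefined] sum_nonneg[of Z "%z. ib z (K1 * r) undefined"] by simp
 have "EX ph:Cc. (ALL x. ib z (r/2) x<=ph x&ph x<=ib z r x)" for z :: 'a
 proof -
  obtain ph where ph:"ph:Cc" "!!x. 0<=ph x&ph x<=(1::real)" "!!x. x:cball z (r/2)==>ph x=1"
   "!!x. (ALL y:cball z (r/2). dist x y>=r/2)==>ph x=0"
   by (rule bump_exists[OF compact_cball, of "r/2" z "r/2"]) (use r in auto)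
  have z0:"ph x=0" if "x ~: ball z r" for x
  proof (rule ph(4), rule ballI)
   fix y assume "y:cball z (r/2)"
   then show "dist x y>=r/2" using that dist_triangle[of z x y] by (simp add:dist_commute)
  qed
  have "ib z (r/2) x<=ph x" for x using ph(2)[of x] ph(3)[of x] by (auto simp:indicator_def)
  moreover have "ph x<=ib z r x" for x using ph(2)[of x] z0[of x] by (auto simp:indicator_def)
  ultimately show ?thesis using ph(1) by blast
 qed
 then obtain ph where ph:"!!z. ph z:Cc" "!!z x. ib z (r/2) x<=ph z x" "!!z x. ph z x<=ib z r x" by metis
 \<comment> \<open>The cutoff with parameter \<open>n\<close> belongs to this step length, so the
   limit is taken along the sequence.\<close>
 define h where "h n=Ps r/real (Suc n)" for n
 have h:"h n>0" for n using t by (simp add:h_def)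
 have hlim:"filterlim h (at_right 0) sequentially"
 proof (rule tendsto_imp_filterlim_at_right)
  have "(%n. b/real (Suc n)) ----> 0" for b :: real by real_asymp
  then show "h ----> 0" by (simp add:h_def[abs_def])
 qed (use h in auto)
 have en:"en (u z) (ball z (r/2))<=elim_fun (u z) (ph z)" if z:"z:Z" for z
 proof -
  have uz:"u z:F" "u z:bdf" using u[OF z] by auto
  note eb = energy_bounded[OF uz]
  have "en (u z) (ball z (r/2))=(\<integral>x. ib z (r/2) x \<partial>energy_measure_bounded E F (u z))"
   using sets_eq_imp_space_eq[OF eb(1)] by (simp add:en_def)
  also have "...<=(\<integral>x. ph z x \<partial>energy_measure_bounded E F (u z))"
  proof (rule integral_mono)
   show "integrable (energy_measure_bounded E F (u z)) (ib z (r/2))" using eb(1,2) finite_measure.emeasure_finite[OF eb(2), of "ball z (r/2)"]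
   by (intro integrable_real_indicator) (auto simp:less_top[symmetric])
   show "integrable (energy_measure_bounded E F (u z)) (ph z)" by (intro Cc_integrable ph eb(1,2))
  qed (rule ph(2))
  finally show ?thesis using eb(4)[OF ph(1)] by simp
 qed
 have "c2*(SUM z:Z. en (u z) (ball z (r/2)))<=c2*(SUM z:Z. elim_fun (u z) (ph z))" using c2_pos by (intro mult_left_mono sum_mono en) auto
 also have "...<=Ps r/2*(M * Om)+1/Ps r * (SUM z:Z. \<integral>x. (u z x)^2 * wt z r x \<partial>mu)"
 proof (rule tendsto_upperbound)
  show "(%n. c2*(SUM z:Z. \<integral>x. ph z x * edens (h n) (u z) x \<partial>mu)) ----> c2*(SUM z:Z. elim_fun (u z) (ph z))"
   using u by (intro tendsto_intros filterlim_compose[OF elim_fun_limit[OF _ _ ph(1)] hlim]) auto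
  have "\<forall>\<^sub>F n in sequentially. h n<h0"
  proof -
   have "h ----> 0" using hlim by (simp add:filterlim_at)
   from order_tendstoD(2)[OF this h0] show ?thesis .
  qed
  then show "\<forall>\<^sub>F n in sequentially. c2*(SUM z:Z. \<integral>x. ph z x * edens (h n) (u z) x \<partial>mu)
   <= Ps r/2*(M * Om)+1/Ps r * (SUM z:Z. \<integral>x. (u z x)^2 * wt z r x \<partial>mu)"
  proof eventually_elim
   case (elim n)
   have Wn:"W (h n):borel_measurable mu" "integrable mu (W (h n))" "(\<integral>x. W (h n) x \<partial>mu)<=Om"
   "!!z x. z:Z==>((u z x - Q (h n) (u z) x)/h n)\<^sup>2<=W (h n) x"
   using W[OF h elim] by auto
   let ?I = "%z. \<integral>x. ((u z x - Q (h n) (u z) x)/h n)^2 * cutoff z r n x \<partial>mu"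
   have "c2*(SUM z:Z. \<integral>x. ph z x * edens (h n) (u z) x \<partial>mu)=(SUM z:Z. c2*(\<integral>x. ph z x * edens (h n) (u z) x \<partial>mu))"
   by (simp add:sum_distrib_left)
   also have "...<=(SUM z:Z. c2*(\<integral>x. ib z r x * edens (h n) (u z) x \<partial>mu))"
   proof (intro sum_mono mult_left_mono integral_mono)
   fix z assume z:"z:Z"
   have uz:"u z:F" "u z:bdf" using u[OF z] by auto
   show "integrable mu (%x. ph z x * edens (h n) (u z) x)" by (intro edens_integrable_mult h uz Cc_bdf ph)
   show "integrable mu (%x. ib z r x * edens (h n) (u z) x)" by (intro edens_integrable_mult h uz ib_bdd)
   show "ph z x * edens (h n) (u z) x<=ib z r x * edens (h n) (u z) x" for x by (intro mult_right_mono ph edens_nonneg h uz)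
   qed (use c2_pos in auto)
   also have "...<=(SUM z:Z. Ps r/2 * ?I z+1/Ps r * (\<integral>x. (u z x)^2 * wt z r x \<partial>mu))"
   unfolding h_def using u by (intro sum_mono cacc_single r) auto
   also have "...=Ps r/2*(SUM z:Z. ?I z)+1/Ps r * (SUM z:Z. \<integral>x. (u z x)^2 * wt z r x \<partial>mu)"
   by (simp add:sum.distrib sum_distrib_left)
   also have "(SUM z:Z. ?I z)<=M * Om"
   proof -
   have "(SUM z:Z. ?I z)<=(SUM z:Z. \<integral>x. W (h n) x * cutoff z r n x \<partial>mu)"
   proof (intro sum_mono integral_mono)
   fix z assume z:"z:Z"
   have uz:"u z:L2 mu" using u[OF z] by (auto intro: F_L2)
   have "(%x. 1/h n * (u z x - Q (h n) (u z) x)):L2 mu" by (intro L2_cmult L2_diff Q_L2 uz h)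
   then have "(%x. (u z x - Q (h n) (u z) x)/h n):L2 mu" by simp
   then show "integrable mu (%x. ((u z x - Q (h n) (u z) x)/h n)^2 * cutoff z r n x)"
   by (intro integrable_mult_bdd L2_integrable_square cutoff_props[OF r])
   show "integrable mu (%x. W (h n) x * cutoff z r n x)" by (intro integrable_mult_bdd Wn cutoff_props[OF r])
   show "((u z x - Q (h n) (u z) x)/h n)^2 * cutoff z r n x<=W (h n) x * cutoff z r n x" for x
   by (intro mult_right_mono Wn(4)[OF z] cutoff_props[OF r])
   qed
   also have "...=(\<integral>x. (SUM z:Z. W (h n) x * cutoff z r n x) \<partial>mu)"
   by (intro Bochner_Integration.integral_sum[symmetric] integrable_mult_bdd Wn cutoff_props[OF r])
   also have "...<=(\<integral>x. W (h n) x * M \<partial>mu)"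
   proof (rule integral_mono)
   show "integrable mu (%x. SUM z:Z. W (h n) x * cutoff z r n x)"
   by (intro Bochner_Integration.integrable_sum integrable_mult_bdd Wn cutoff_props[OF r])
   show "integrable mu (%x. W (h n) x * M)" using Wn by simp
   show "(SUM z:Z. W (h n) x * cutoff z r n x)<=W (h n) x * M" for x
   proof -
   obtain z where "z:Z" using Z(2) by auto
   then have "W (h n) x>=0" using Wn(4)[of z x] zero_le_power2[of "(u z x - Q (h n) (u z) x)/h n"] by linarith
   then show ?thesis unfolding sum_distrib_left[symmetric] by (intro mult_left_mono cutoff_sum_le[OF r Z(1) M])
   qed
   qed
   also have "...=M * (\<integral>x. W (h n) x \<partial>mu)" using Wn by simp
   also have "...<=M * Om" using Wn M0 by (intro mult_left_mono)
   finally show ?thesis .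
   qed
   finally show ?case using t by (simp add:mult_left_mono)
  qed
 qed simp
 finally show ?thesis .
qed

end

section \<open>Functions of small energy on balls\<close>

lemma measure_overlap:
 assumes m:"finite_measure m" "sets m=sets borel" and Y:"finite Y"
  and S:"!!y. y:Y==>S y:sets borel" "!!y. y:Y==>S y \<subseteq> U" and U:"U:sets borel"
  and N:"!!x. (SUM y:Y. ind (S y) x)<=N"
 shows "(SUM y:Y. measure m (S y))<=N * measure m (U :: 'a::topological_space set)"
proof -
 interpret finite_measure m by (rule m)
 have sp:"space m=UNIV" using sets_eq_imp_space_eq[OF m(2)] by simp
 have i:"integrable m (ind B)" if "B:sets borel" for B using that m(2) by (intro integrable_real_indicator) (auto simp:emeasure_eq_measure)
 have "(SUM y:Y. measure m (S y))=(\<integral>x. (SUM y:Y. ind (S y) x) \<partial>m)"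
  using S(1) i by (subst Bochner_Integration.integral_sum) (auto simp:sp)
 also have "...<=(\<integral>x. N * ind U x \<partial>m)"
 proof (rule integral_mono)
  show "integrable m (%x. SUM y:Y. ind (S y) x)" using S(1) by (intro Bochner_Integration.integrable_sum i)
  show "integrable m (%x. N * ind U x)" using i[OF U] by simp
  show "(SUM y:Y. ind (S y) x)<=N * ind U x" for x
  proof (cases "x:U")
   case False
   then have "(SUM y:Y. ind (S y) x)=0" using S(2) by (intro sum.neutral) (auto simp:indicator_def)
   then show ?thesis using False by simp
  qed (use N in simp)
 qed
 also have "...=N * measure m U" by (simp add:sp)
 finally show ?thesis .
qed

context hke_space
begin

definition zero_mean :: "('a=>real) => 'a=>real=>bool" where
 "zero_mean u x s \<longleftrightarrow> (\<integral>y. ib x s y * u y \<partial>mu)=0"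

lemma ball_int:"u:bdf==>integrable mu (%y. ib x s y * u y)" by (rule supp_ball_integrable[where ?x0.0=x and r=s]) (auto intro: bdf_mult ib_bdd)

context
 fixes L K :: real
 assumes L:"L>=1" and K:"K>0"
  and PI:"!!x0 s u. s>0==>u:F==>u:bdf ==>
   V x0 s * (\<integral>x. ib x0 s x * (u x)^2 \<partial>mu)-(\<integral>x. ib x0 s x * u x \<partial>mu)\<^sup>2<=K * Ps s * V x0 s * en u (ball x0 (L * s))"
begin

text \<open>On the large ball the Poincare inequality controls \<open>u - s\<close>, with
  \<open>s\<close> the mean there. On the small ball \<open>u\<close> has mean zero, so
  \<open>s^2 * V z r\<close> is at most the integral of \<open>(u - s)^2\<close>; volume growth then
  bounds \<open>s^2 * V z R\<close>.\<close>

lemma zero_mean_growth: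
 assumes r:"0<r" "r<=R" and u:"u:F" "u:bdf" and z:"zero_mean u z r"
 shows "(\<integral>x. ib z R x * (u x)^2 \<partial>mu)<=2*(2 * R/r) ^ dq * (K * Ps R * en u (ball z (L * R)))"
proof -
 define D where "D=K * Ps R * en u (ball z (L * R))"
 define I where "I=(\<integral>x. ib z R x * (u x)^2 \<partial>mu)"
 define J where "J=(\<integral>x. ib z R x * u x \<partial>mu)"
 define s where "s=J/V z R"
 have R:"R>0" using r by simp
 have VR:"V z R>0" and Vr:"V z r>0" using ball_pos R r by auto
 have u2:"(%x. (u x)^2):bdf" by (rule bdf_power2[OF u(2)])
 have i1:"integrable mu (ib x t)" for x t using ball_int[OF bdf_const[of 1], of x t] by simp
 have sq:"(\<integral>x. ib x0 t x * (u x - s)^2 \<partial>mu)=(\<integral>x. ib x0 t x * (u x)^2 \<partial>mu)-2 * s * (\<integral>x. ib x0 t x * u x \<partial>mu) + s^2 * V x0 t" for x0 t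
 proof -
  have "(\<integral>x. ib x0 t x * (u x - s)^2 \<partial>mu)=(\<integral>x. ib x0 t x * (u x)^2-2 * s * (ib x0 t x * u x) + s^2 * ib x0 t x \<partial>mu)"
   by (intro Bochner_Integration.integral_cong) (auto simp:power2_eq_square algebra_simps)
  also have "...=(\<integral>x. ib x0 t x * (u x)^2 \<partial>mu)-2 * s * (\<integral>x. ib x0 t x * u x \<partial>mu) + s^2 * V x0 t"
   using ball_int[OF u2, of x0 t] ball_int[OF u(2), of x0 t] i1[of x0 t] by (simp add:space_UNIV)
  finally show ?thesis .
 qed
 have us:"(%x. (u x - s)^2):bdf" by (intro bdf_power2 bdf_diff bdf_const u)
 have "V z R * I - J\<^sup>2<=V z R * D" using PI[OF R u, of z] by (simp add:D_def I_def J_def mult.assoc mult.left_commute)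
 then have "(V z R * I - J\<^sup>2)/V z R<=D" using VR by (simp add:divide_le_eq mult.commute)
 moreover have "(V z R * I - J\<^sup>2)/V z R=I-2 * s * J + s^2 * V z R" using VR by (simp add:s_def power2_eq_square field_simps)
 ultimately have D1:"I-2 * s * J + s^2 * V z R<=D" by simp
 have D2:"I - s\<^sup>2 * V z R<=D"
 proof -
  have "s * J=s^2 * V z R" using VR by (simp add:s_def power2_eq_square)
  then show ?thesis using D1 by (simp add:mult.assoc)
 qed
 have "s^2 * V z r<=(\<integral>x. ib z r x * (u x - s)^2 \<partial>mu)" unfolding sq using z by (simp add:zero_mean_def)
 also have "...<=(\<integral>x. ib z R x * (u x - s)^2 \<partial>mu)"
  by (intro integral_mono ball_int us mult_right_mono) (use r in \<open>auto simp:indicator_def\<close>)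
 also have "...<=D" unfolding sq using D1 by (simp add:I_def J_def)
 finally have D3:"s^2 * V z r<=D" .
 have D0:"D>=0" using K Psi_pos[OF R] en_nonneg by (simp add:D_def)
 have g1:"(2 * R/r) ^ dq>=1" using r by (intro one_le_power) (simp add:le_divide_eq)
 have "s^2 * V z R<=s^2*((2 * R/r) ^ dq * V z r)" by (intro mult_left_mono ball_growth r) auto
 also have "...=(2 * R/r) ^ dq * (s^2 * V z r)" by simp
 also have "...<=(2 * R/r) ^ dq * D" using g1 by (intro mult_left_mono D3) auto
 finally have "I<=D+(2 * R/r) ^ dq * D" using D2 by simp
 moreover have "D<=(2 * R/r) ^ dq * D" using mult_right_mono[OF g1 D0] by simp
 ultimately have "I<=2*((2 * R/r) ^ dq * D)" by simp
 then show ?thesis by (simp only: I_def D_def mult.assoc)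
qed

text \<open>The Poincare inequality at radius \<open>ep * r\<close> brings
  \<open>Ps (ep * r) <= Cs * ep * Ps r\<close>: this is where a small \<open>ep\<close> gains
  against the factor \<open>1 / Ps r\<close> of the Caccioppoli inequality.\<close>

lemma zero_mean_inner:
 assumes r:"0<r" and eps:"0<ep" "ep<=1" and La:"La>=1"
  and Y:"finite Y" "Y \<subseteq> ball z (La * r)" "separated (ep * r) Y" "ball z (La * r) \<subseteq> (\<Union>y\<in>Y. ball y (ep * r))"
  and u:"u:F" "u:bdf" and zm:"!!y. y:Y==>zero_mean u y (ep * r)"
 shows "(\<integral>x. ib z (La * r) x * (u x)^2 \<partial>mu)
  <= 2*2 ^ dq * K * (Cs * ep)*(16 * L) ^ dq * Ps r * en u (ball z (2 * L * La * r))"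
proof -
 have er:"ep * r>0" using eps r by simp
 have u2:"(%x. (u x)^2):bdf" by (rule bdf_power2[OF u(2)])
 note eb = energy_bounded[OF u]
 have "(\<integral>x. ib z (La * r) x * (u x)^2 \<partial>mu)<=(\<integral>x. (SUM y:Y. ib y (ep * r) x * (u x)^2) \<partial>mu)"
 proof (rule integral_mono)
  show "integrable mu (%x. SUM y:Y. ib y (ep * r) x * (u x)^2)" by (intro Bochner_Integration.integrable_sum ball_int u2)
  show "ib z (La * r) x * (u x)^2<=(SUM y:Y. ib y (ep * r) x * (u x)^2)" for x
  proof (cases "x:ball z (La * r)")
   case True
   then obtain y where y:"y:Y" "x:ball y (ep * r)" using Y(4) by blast
   have "ib y (ep * r) x * (u x)^2<=(SUM y:Y. ib y (ep * r) x * (u x)^2)" by (rule member_le_sum[OF y(1) _ Y(1)]) simp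
   then show ?thesis using y(2) True by (simp del: mem_ball)
  next
   case False
   then show ?thesis by (simp add:sum_nonneg)
  qed
 qed (intro ball_int u2)
 also have "...=(SUM y:Y. \<integral>x. ib y (ep * r) x * (u x)^2 \<partial>mu)" by (intro Bochner_Integration.integral_sum ball_int u2)
 also have "...<=(SUM y:Y. 2*2 ^ dq * (K * Ps (ep * r)) * en u (ball y (L * (ep * r))))"
 proof (rule sum_mono)
  fix y assume "y:Y"
  from zero_mean_growth[OF er order_refl u zm[OF this]] er
  show "(\<integral>x. ib y (ep * r) x * (u x)^2 \<partial>mu)<=2*2 ^ dq * (K * Ps (ep * r)) * en u (ball y (L * (ep * r)))"
   using eps r by (simp add:mult.assoc)
 qed
 also have "...=2*2 ^ dq * (K * Ps (ep * r))*(SUM y:Y. en u (ball y (L * (ep * r))))" by (simp add:sum_distrib_left)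
 also have "...<=2*2 ^ dq * (K * (Cs * ep * Ps r))*((16 * L) ^ dq * en u (ball z (2 * L * La * r)))"
 proof (intro mult_mono mult_left_mono)
  show "Ps (ep * r)<=Cs * ep * Ps r" by (rule Psi_small[OF eps r])
  show "(SUM y:Y. en u (ball y (L * (ep * r))))<=(16 * L) ^ dq * en u (ball z (2 * L * La * r))" unfolding en_def
  proof (rule measure_overlap[OF eb(2,1) Y(1)])
   have "ep * r<=L * (ep * r)" using mult_right_mono[OF L less_imp_le[OF er]] by simp
   from overlap[OF Y(1,3) er this]
   have *: "(SUM y:Y. ib y (L * (ep * r)) x)<=(16*(L * (ep * r))/(ep * r)) ^ dq" for x .
   have "16*(L * (ep * r))/(ep * r)=16 * L" using eps r by simp
   with * show "(SUM y:Y. ib y (L * (ep * r)) x)<=(16 * L) ^ dq" for x by simp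
   fix y assume y:"y:Y"
   show "ball y (L * (ep * r)) \<subseteq> ball z (2 * L * La * r)"
   proof
   fix x assume "x:ball y (L * (ep * r))"
   moreover have "dist z y<La * r" using y Y(2) by auto
   ultimately have "dist z x<La * r + L * (ep * r)" using dist_triangle[of z x y] by simp
   moreover have "L * (ep * r)<=L * (La * r)" using L eps La r by (intro mult_left_mono mult_right_mono) auto
   moreover have "La * r<=L * (La * r)" using mult_right_mono[of 1 L "La * r"] L La r by simp
   ultimately have "dist z x<2*(L * (La * r))" by simp
   then show "x:ball z (2 * L * La * r)" by (simp only: mem_ball mult.assoc)
   qed
  qed auto
 qed (use K Cs eps r Psi_pos L en_nonneg in \<open>auto intro!: sum_nonneg mult_nonneg_nonneg simp:less_imp_le\<close>)
 finally show ?thesis by (simp add:mult_ac)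
qed

text \<open>Peels off one dyadic annulus at a time; outside \<open>ball z (2 ^ k * r)\<close> the
  weight is at most \<open>ce * exp (- (tb * 2 ^ k))\<close>.\<close>

lemma weight_split:
 assumes r:"r>0" and j:"k0<=j"
 shows "wt z r x<=ce * ib z (2 ^ k0 * r) x+(\<Sum>k=k0..<j. ce * exp (- (tb * 2 ^ k)) * ib z (2^(k+1) * r) x)
   + ce * exp (- (tb * 2 ^ j))"
 using j
proof (induction j rule: dec_induct)
 case base
 show ?case
 proof (cases "x:ball z (2 ^ k0 * r)")
  case True
  have "wt z r x<=ce" using ce_pos tb_pos r by (simp add:wt_def mult_left_le)
  also have "...=ce * ib z (2 ^ k0 * r) x" using True by simp
  finally have "wt z r x<=ce * ib z (2 ^ k0 * r) x" .
  moreover have "ce * exp (- (tb * 2 ^ k0))>=0" using ce_pos by simp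
  ultimately show ?thesis by simp
 next
  case False
  then have "2 ^ k0<=dist x z/r" using r by (simp add:le_divide_eq dist_commute)
  then have "wt z r x<=ce * exp (- (tb * 2 ^ k0))" using ce_pos tb_pos mult_left_mono[of "2 ^ k0" "dist x z/r" tb] by (simp add:wt_def)
  moreover have "ce * ib z (2 ^ k0 * r) x>=0" using ce_pos by simp
  ultimately show ?thesis by simp
 qed
next
 case (step j)
 let ?S = "ce * ib z (2 ^ k0 * r) x+(\<Sum>k=k0..<j. ce * exp (- (tb * 2 ^ k)) * ib z (2^(k+1) * r) x)"
 have S0:"?S>=0" using ce_pos by (auto intro!: add_nonneg_nonneg sum_nonneg)
 have e:"(\<Sum>k=k0..<Suc j. ce * exp (- (tb * 2 ^ k)) * ib z (2^(k+1) * r) x)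
   = (\<Sum>k=k0..<j. ce * exp (- (tb * 2 ^ k)) * ib z (2^(k+1) * r) x) + ce * exp (- (tb * 2 ^ j)) * ib z (2^(j+1) * r) x"
  using step(1) by simp
 show ?case
 proof (cases "x:ball z (2^(j+1) * r)")
  case True
  have "wt z r x<=?S + ce * exp (- (tb * 2 ^ j))" by (rule step(3))
  also have "...<=?S + ce * exp (- (tb * 2 ^ j)) * ib z (2^(j+1) * r) x + ce * exp (- (tb * 2 ^ Suc j))"
   using True ce_pos by (simp del: mem_ball power_Suc)
  finally show ?thesis unfolding e by (simp only: add.assoc)
 next
  case False
  then have "2 ^ Suc j<=dist x z/r" using r by (simp add:le_divide_eq dist_commute)
  then have "wt z r x<=ce * exp (- (tb * 2 ^ Suc j))" using ce_pos tb_pos mult_left_mono[of "2 ^ Suc j" "dist x z/r" tb] by (simp add:wt_def)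
  moreover have "ce * exp (- (tb * 2 ^ j)) * ib z (2^(j+1) * r) x>=0" using ce_pos by simp
  ultimately show ?thesis unfolding e using S0 by argo
 qed
qed

text \<open>The weight on the \<open>k\<close>-th annulus times the constant of
  \<open>zero_mean_growth\<close> at radius \<open>2^(k+1) * r\<close>, with
  \<open>Psi_growth\<close> reducing \<open>Ps\<close> there to \<open>Ps r\<close>.\<close>

definition tcoef :: "nat=>real" where
 "tcoef k=ce * exp (- (tb * 2 ^ k))*(2*(2*2^(k+1)) ^ dq * K * (Cs * (2^(k+1)) ^ m))"

text \<open>Three regimes: within \<open>2 ^ k0 * r\<close> the many mean-zero conditions give the
  gain \<open>ep\<close>; on the annuli up to \<open>2 ^ j * r\<close> the single condition on
  \<open>ball z r\<close> suffices because the weight decays; beyond, the global \<open>L2\<close>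
  norm is used.\<close>

lemma weighted_bound:
 assumes r:"0<r" and eps:"0<ep" "ep<=1" and j:"k0<=j"
  and Y:"finite Y" "Y \<subseteq> ball z (2 ^ k0 * r)" "separated (ep * r) Y" "ball z (2 ^ k0 * r) \<subseteq> (\<Union>y\<in>Y. ball y (ep * r))"
  and u:"u:F" "u:bdf" and zm:"!!y. y:Y==>zero_mean u y (ep * r)" and zz:"zero_mean u z r"
 shows "1/Ps r * (\<integral>x. (u x)^2 * wt z r x \<partial>mu)
  <= ce * (2*2 ^ dq * K * (Cs * ep)*(16 * L) ^ dq) * en u (ball z (2 * L * 2 ^ k0 * r))
   + (\<Sum>k=k0..<j. tcoef k * en u (ball z (L * (2^(k+1) * r))))
   + ce * exp (- (tb * 2 ^ j))*(1/Ps r * (\<integral>x. (u x)^2 \<partial>mu))"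
proof -
 have P0:"Ps r>0" by (rule Psi_pos[OF r])
 have u2:"(%x. (u x)^2):bdf" by (rule bdf_power2[OF u(2)])
 have u2i:"integrable mu (%x. (u x)^2)" by (rule L2_integrable_square[OF F_L2[OF u(1)]])
 let ?J = "%s. \<integral>x. ib z s x * (u x)^2 \<partial>mu"
 have "(\<integral>x. (u x)^2 * wt z r x \<partial>mu)<=(\<integral>x. ce * (ib z (2 ^ k0 * r) x * (u x)^2)
   + (\<Sum>k=k0..<j. ce * exp (- (tb * 2 ^ k))*(ib z (2^(k+1) * r) x * (u x)^2)) + ce * exp (- (tb * 2 ^ j))*(u x)^2 \<partial>mu)"
 proof (rule integral_mono)
  show "integrable mu (%x. (u x)^2 * wt z r x)" by (intro integrable_mult_bdd u2i wt_bdd r)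
  show "integrable mu (%x. ce * (ib z (2 ^ k0 * r) x * (u x)^2)
   + (\<Sum>k=k0..<j. ce * exp (- (tb * 2 ^ k))*(ib z (2^(k+1) * r) x * (u x)^2)) + ce * exp (- (tb * 2 ^ j))*(u x)^2)"
   by (intro Bochner_Integration.integrable_add Bochner_Integration.integrable_sum integrable_mult_right ball_int u2 u2i)
  show "(u x)^2 * wt z r x<=ce * (ib z (2 ^ k0 * r) x * (u x)^2)
   + (\<Sum>k=k0..<j. ce * exp (- (tb * 2 ^ k))*(ib z (2^(k+1) * r) x * (u x)^2)) + ce * exp (- (tb * 2 ^ j))*(u x)^2" for x
   using mult_left_mono[OF weight_split[OF r j, of z x] zero_le_power2[of "u x"]] by (simp add:distrib_left sum_distrib_left mult_ac)
 qed
 also have "...=ce * ?J (2 ^ k0 * r)+(\<Sum>k=k0..<j. ce * exp (- (tb * 2 ^ k)) * ?J (2^(k+1) * r)) + ce * exp (- (tb * 2 ^ j))*(\<integral>x. (u x)^2 \<partial>mu)"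
 proof -
  have lin:"(\<integral>x. b * f x+(SUM k:I. d k * g k x) + e * h x \<partial>mu)=b * (\<integral>x. f x \<partial>mu)+(SUM k:I. d k * (\<integral>x. g k x \<partial>mu)) + e * (\<integral>x. h x \<partial>mu)"
   if "integrable mu f" "!!k. integrable mu (g k)" "integrable mu h"
   for b e :: real and d :: "nat=>real" and I and f h :: "'a=>real" and g
   using that by (simp add:Bochner_Integration.integral_sum)
  show ?thesis by (rule lin[OF ball_int[OF u2] ball_int[OF u2] u2i])
 qed
 finally have main:"(\<integral>x. (u x)^2 * wt z r x \<partial>mu)<=..." .
 have "1/Ps r * (\<integral>x. (u x)^2 * wt z r x \<partial>mu)<=1/Ps r * (ce * ?J (2 ^ k0 * r)+(\<Sum>k=k0..<j. ce * exp (- (tb * 2 ^ k)) * ?J (2^(k+1) * r)) + ce * exp (- (tb * 2 ^ j))*(\<integral>x. (u x)^2 \<partial>mu))"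
  using P0 by (intro mult_left_mono main) auto
 also have "...=ce * (1/Ps r * ?J (2 ^ k0 * r))+(\<Sum>k=k0..<j. ce * exp (- (tb * 2 ^ k))*(1/Ps r * ?J (2^(k+1) * r)))
   + ce * exp (- (tb * 2 ^ j))*(1/Ps r * (\<integral>x. (u x)^2 \<partial>mu))"
  by (simp only: distrib_left sum_distrib_left mult.left_commute)
 also have "...<=ce * (2*2 ^ dq * K * (Cs * ep)*(16 * L) ^ dq * en u (ball z (2 * L * 2 ^ k0 * r)))
   + (\<Sum>k=k0..<j. tcoef k * en u (ball z (L * (2^(k+1) * r)))) + ce * exp (- (tb * 2 ^ j))*(1/Ps r * (\<integral>x. (u x)^2 \<partial>mu))"
 proof (intro add_mono mult_left_mono sum_mono order_refl)
  have "?J (2 ^ k0 * r)<=2*2 ^ dq * K * (Cs * ep)*(16 * L) ^ dq * Ps r * en u (ball z (2 * L * 2 ^ k0 * r))"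
   by (rule zero_mean_inner[OF r eps _ Y u zm]) auto
  then show "1/Ps r * ?J (2 ^ k0 * r)<=2*2 ^ dq * K * (Cs * ep)*(16 * L) ^ dq * en u (ball z (2 * L * 2 ^ k0 * r))"
   using P0 by (simp add:divide_le_eq mult_ac)
  fix k
  have pk:"(1::real)<=2^(k+1)" by (rule one_le_power) simp
  then have rk:"r<=2^(k+1) * r" using r by simp
  have "?J (2^(k+1) * r)<=2*(2*(2^(k+1) * r)/r) ^ dq * (K * Ps (2^(k+1) * r) * en u (ball z (L * (2^(k+1) * r))))"
   by (rule zero_mean_growth[OF r rk u zz])
  also have "2*(2^(k+1) * r)/r=2*2^(k+1)" using r by simp
  also have "2*(2*2^(k+1)) ^ dq * (K * Ps (2^(k+1) * r) * en u (ball z (L * (2^(k+1) * r))))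
   <= 2*(2*2^(k+1)) ^ dq * (K * (Cs * (2^(k+1)) ^ m * Ps r) * en u (ball z (L * (2^(k+1) * r))))"
   using K by (intro mult_left_mono mult_right_mono Psi_growth pk r en_nonneg) auto
  finally have J2:"?J (2^(k+1) * r)<=(2*(2*2^(k+1)) ^ dq * K * (Cs * (2^(k+1)) ^ m)) * en u (ball z (L * (2^(k+1) * r))) * Ps r"
   by (simp only: mult_ac)
  have "1/Ps r * ?J (2^(k+1) * r)<=(2*(2*2^(k+1)) ^ dq * K * (Cs * (2^(k+1)) ^ m)) * en u (ball z (L * (2^(k+1) * r)))"
  proof -
   have "1/P * J<=b" if "J<=b * P" "P>0" for P J b :: real using that by (simp add:divide_le_eq)
   from this[OF J2 P0] show ?thesis .
  qed
  from mult_left_mono[OF this, of "ce * exp (- (tb * 2 ^ k))"] ce_pos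
  show "ce * exp (- (tb * 2 ^ k))*(1/Ps r * ?J (2^(k+1) * r))<=tcoef k * en u (ball z (L * (2^(k+1) * r)))"
   unfolding tcoef_def by (simp only: mult.assoc) simp
 qed (use ce_pos P0 in auto)
 finally show ?thesis by (simp only: mult.assoc)
qed

text \<open>The exponential absorbs one more power of \<open>2 ^ k\<close> than stated, which leaves
  the geometric factor.\<close>

lemma pow2_exp_bound:
 "EX C. C>=0&(ALL k. (2 ^ k) ^ N * exp (- (tb * 2 ^ k))<=C * (1/2) ^ k)"
proof (intro exI conjI allI)
 show "fact (Suc N)/tb ^ Suc N>=0" using tb_pos by simp
 fix k
 have p:"(0::real)<2 ^ k" by simp
 have "(2 ^ k) ^ Suc N * exp (- (tb * 2 ^ k))<=fact (Suc N)/tb ^ Suc N" by (rule power_exp_bound[OF _ tb_pos]) simp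
 then have "2 ^ k * ((2 ^ k) ^ N * exp (- (tb * 2 ^ k)))<=fact (Suc N)/tb ^ Suc N" by (simp only: power_Suc mult.assoc)
 moreover have "y<=D * (1/2) ^ k" if "2 ^ k * y<=D" for y D :: real using that p by (simp add:power_one_over field_simps)
 ultimately show "(2 ^ k) ^ N * exp (- (tb * 2 ^ k))<=fact (Suc N)/tb ^ Suc N * (1/2) ^ k" by blast
qed

text \<open>The extra factor is the overlap of the balls of radius \<open>L * 2^(k+1) * r\<close>
  around an \<open>r/2\<close>-separated set.\<close>

lemma tcoef_summable:"summable (%k. tcoef k * (32 * L * 2^(k+1)) ^ dq)"
proof -
 define C1 where "C1=ce * (2*4 ^ dq * K * (Cs * 2 ^ m))*(64 * L) ^ dq"
 have C1:"C1>=0" using ce_pos K Cs L by (simp add:C1_def)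
 obtain C where C:"C>=0&(ALL k. (2 ^ k)^(2 * dq + m) * exp (- (tb * 2 ^ k))<=C * (1/2) ^ k)" using pow2_exp_bound[of "2 * dq + m"] ..
 note C = conjunct1[OF C] conjunct2[OF C, rule_format]
 have e:"tcoef k * (32 * L * 2^(k+1)) ^ dq=C1*((2 ^ k)^(2 * dq + m) * exp (- (tb * 2 ^ k)))" for k
 proof -
  have gen:"ce * e * (2*(2*(2 * X)) ^ dq * K * (Cs * (2 * X) ^ m))*(32 * L * (2 * X)) ^ dq=C1*(X^(2 * dq + m) * e)" for X e :: real
  proof -
   have "(2*(2 * X)) ^ dq=4 ^ dq * X ^ dq" "(2 * X) ^ m=2 ^ m * X ^ m" "(32 * L * (2 * X)) ^ dq=(64 * L) ^ dq * X ^ dq"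
   proof -
   have "2*(2 * X)=4 * X" "32 * L * (2 * X)=64 * L * X" by simp_all
   then show "(2*(2 * X)) ^ dq=4 ^ dq * X ^ dq" "(2 * X) ^ m=2 ^ m * X ^ m" "(32 * L * (2 * X)) ^ dq=(64 * L) ^ dq * X ^ dq"
   by (simp_all only: power_mult_distrib)
   qed
   moreover have "X^(2 * dq + m)=X ^ dq * X ^ dq * X ^ m" by (simp add:power_add mult_2)
   ultimately show ?thesis by (simp only: C1_def mult_ac)
  qed
  show ?thesis using gen[of "exp (- (tb * 2 ^ k))" "2 ^ k"] by (simp add:tcoef_def)
 qed
 show ?thesis
 proof (rule summable_comparison_test'[where N = 0])
  show "summable (%k. C1 * C * (1/2 :: real) ^ k)" by (intro summable_mult summable_geometric) simp
  fix k :: nat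
  have "C1*((2 ^ k)^(2 * dq + m) * exp (- (tb * 2 ^ k)))<=C1*(C * (1/2) ^ k)" by (intro mult_left_mono C C1)
  moreover have "C1*((2 ^ k)^(2 * dq + m) * exp (- (tb * 2 ^ k)))>=0" using C1 by simp
  ultimately show "norm (tcoef k * (32 * L * 2^(k+1)) ^ dq)<=C1 * C * (1/2) ^ k" unfolding e real_norm_def by (simp only: mult.assoc abs_of_nonneg)
 qed
qed

text \<open>Puts the weighted bounds into the Caccioppoli sum: the right side becomes
  \<open>et * mm U\<close> up to errors that vanish with \<open>r\<close>. Since \<open>v\<close>
  changes with \<open>z\<close>, a common majorant \<open>mm\<close> of the energies is used, of
  which only the overlap inequality and a sign are asked. \<open>Kd\<close> is fixed before the
  family, the sets and \<open>\<theta>\<close>.\<close>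

lemma small_energy_cover:
 assumes eta:"et>0"
 obtains Kd :: nat where
  "!!G mm W h0 Om Om2 A U rh0 \<theta>.
   (!!Y S N. finite Y==>(!!y. y:Y==>S y:sets borel)==>(!!y. y:Y==>S y \<subseteq> U) ==>
   (!!x. (SUM y:Y. ind (S y) x)<=N)==>(SUM y:(Y :: 'a set). mm (S y))<=N * mm U)==>mm U>=0==>G \<subseteq> F Int bdf ==>
   (!!v S. v:G==>S:sets borel==>en v S<=mm S) ==>
   (!!v. v:G==>(\<integral>x. (v x)^2 \<partial>mu)<=Om2)==>h0>0 ==>
   (!!h. 0<h==>h<h0==>W h:borel_measurable mu&integrable mu (W h)&(\<integral>x. W h x \<partial>mu)<=Om
   &(ALL v:G. ALL x. ((v x - Q h v x)/h)^2<=W h x)) ==>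
   (!!C. finite C==>card C<=Kd==>EX v:G. \<forall>(y,s)\<in>C. zero_mean v y s) ==>
   compact A==>A~={}==>U:sets borel==>rh0>0==>(!!x. x:A==>ball x rh0 \<subseteq> U)==>\<theta>>0 ==>
   EX r>0. EX Z v. finite Z&A \<subseteq> (\<Union>z\<in>Z. ball z (r/2))&(ALL y. (SUM z:Z. ib z (r/2) y)<=16 ^ dq)
   &(ALL z:Z. v z:G)&(SUM z:Z. en (v z) (ball z (r/2)))<=et * mm U + \<theta>"
proof -
 have ceta:"c2 * et/2>0" using c2_pos eta by simp
 \<comment> \<open>Half of the budget \<open>c2 * et\<close> goes to the annuli here, the other half
   to the inner ball through the choice of \<open>ep\<close>.\<close>
 obtain k0 where k0:"!!j. (\<Sum>k=k0..<j. tcoef k * (32 * L * 2^(k+1)) ^ dq)<=c2 * et/2"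
 proof -
  from tcoef_summable[unfolded summable_Cauchy, rule_format, OF ceta]
  obtain k0 where "!!j. norm (\<Sum>k=k0..<j. tcoef k * (32 * L * 2^(k+1)) ^ dq)<c2 * et/2" by auto
  then have "(\<Sum>k=k0..<j. tcoef k * (32 * L * 2^(k+1)) ^ dq)<=c2 * et/2" for j
   using abs_ge_self[of "\<Sum>k=k0..<j. tcoef k * (32 * L * 2^(k+1)) ^ dq"] unfolding real_norm_def by (meson le_less_trans less_imp_le)
  then show ?thesis by (rule that)
 qed
 define Cin where "Cin=ce * (2*2 ^ dq * K * Cs * (16 * L) ^ dq)*(64 * L * 2 ^ k0) ^ dq"
 have Cin:"Cin>0" using ce_pos K Cs L by (simp add:Cin_def)
 define ep where "ep=min 1 (c2 * et/2/Cin)"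
 have eps:"0<ep" "ep<=1" using ceta Cin by (auto simp:ep_def)
 define cin where "cin=ce * (2*2 ^ dq * K * (Cs * ep)*(16 * L) ^ dq)"
 have cin0:"cin>=0" using ce_pos K Cs L eps by (simp add:cin_def)
 have cin:"cin * (64 * L * 2 ^ k0) ^ dq<=c2 * et/2"
 proof -
  have "cin * (64 * L * 2 ^ k0) ^ dq=ep * Cin" by (simp only: cin_def Cin_def mult_ac)
  also have "...<=c2 * et/2/Cin * Cin" using Cin by (intro mult_right_mono) (auto simp:ep_def)
  also have "...=c2 * et/2" using Cin by simp
  finally show ?thesis .
 qed
 \<comment> \<open>Counts a net of spacing \<open>ep * r\<close> in
   \<open>ball z (2 ^ k0 * r)\<close> and one more condition on \<open>ball z r\<close>. Only the
   ratio of the radii enters, so the count does not depend on \<open>r\<close>.\<close>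
 obtain Kd :: nat where Kd:"(16*2 ^ k0/ep) ^ dq+1<=real Kd" using real_arch_simple by blast
 show ?thesis
 proof (rule that[of Kd])
  fix G :: "('a=>real) set" and mm :: "'a set=>real" and W :: "real => 'a=>real" and h0 Om Om2 :: real and A U :: "'a set" and rh0 \<theta> :: real
  assume mm:"!!Y S N. finite Y==>(!!y. y:Y==>S y:sets borel)==>(!!y. y:Y==>S y \<subseteq> U) ==>
   (!!x. (SUM y:Y. ind (S y) x)<=N)==>(SUM y:(Y :: 'a set). mm (S y))<=N * mm U"
   and mmU:"mm U>=0"
   and G:"G \<subseteq> F Int bdf"
   and Gm:"!!v S. v:G==>S:sets borel==>en v S<=mm S"
   and G2:"!!v. v:G==>(\<integral>x. (v x)^2 \<partial>mu)<=Om2" and h0:"h0>0"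
   and W:"!!h. 0<h==>h<h0==>W h:borel_measurable mu&integrable mu (W h)&(\<integral>x. W h x \<partial>mu)<=Om
   &(ALL v:G. ALL x. ((v x - Q h v x)/h)^2<=W h x)"
   and Gz:"!!C. finite C==>card C<=Kd==>EX v:G. \<forall>(y,s)\<in>C. zero_mean v y s"
   and A:"compact A" "A~={}" and U:"U:sets borel" and rh0:"rh0>0" "!!x. x:A==>ball x rh0 \<subseteq> U" and \<theta>: "\<theta>>0"
  have GF:"v:F" "v:bdf" if "v:G" for v using G that by auto
  have Om2:"Om2>=0"
  proof -
   obtain v where "v:G" using Gz[of "{}"] by auto
   have "0<=(\<integral>x. (v x)^2 \<partial>mu)" by (rule Bochner_Integration.integral_nonneg) simp
   then show ?thesis using G2[OF \<open>v \<in> G\<close>] by (rule order_trans)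
  qed
  \<comment> \<open>The Poincare inequality enlarges radii by \<open>L\<close>, and
    \<open>L * R0 = rh0\<close> is the radius up to which balls around points of \<open>A\<close>
    stay in \<open>U\<close>.\<close>
  define R0 where "R0=rh0/L"
  have R0:"R0>0" using rh0 L by (simp add:R0_def)
  obtain x0 R1 where R1:"A \<subseteq> ball x0 R1" "R1>=R0"
  proof -
   obtain x e where "A \<subseteq> cball x e" using compact_imp_bounded[OF A(1)] by (auto simp:bounded_subset_cball)
   then have "A \<subseteq> ball x (max (e+1) R0)" by fastforce
   then show ?thesis by (rule that) simp
  qed
  \<comment> \<open>The overlap of the balls of radius \<open>K1 * r\<close> around an
    \<open>r/2\<close>-separated set, as \<open>cacc_sum\<close> asks for.\<close>
  define M where "M=(32 * K1) ^ dq"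
  obtain CE where CE:"CE>=0&(ALL k. (2 ^ k)^(dq + m) * exp (- (tb * 2 ^ k))<=CE * (1/2) ^ k)" using pow2_exp_bound[of "dq + m"] ..
  note CE = conjunct1[OF CE] conjunct2[OF CE, rule_format]
  \<comment> \<open>Collects two errors of order \<open>(1/2) ^ j\<close>: the generator term, by
    \<open>Ps r <= Cs * Ps R0 * (1/2) ^ j\<close>, and the far tail, where the exponential beats
    both the number of balls and \<open>1 / Ps r\<close>.\<close>
  define C5 where "C5=Cs * Ps R0/2*(M * (abs Om))+(32 * R1/R0) ^ dq * (ce * (Cs/Ps R0 * Om2)) * CE"
  obtain j where j:"k0+1<=j" "C5*(1/2) ^ j<=c2 * \<theta>"
  proof -
   have "(%j. C5*(1/2) ^ j) ----> C5*0" by (intro tendsto_intros LIMSEQ_realpow_zero) auto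
   then have "\<forall>\<^sub>F j in sequentially. C5*(1/2) ^ j<c2 * \<theta>" using c2_pos \<theta> by (intro order_tendstoD(2)) auto
   then have "\<forall>\<^sub>F j in sequentially. C5*(1/2) ^ j<c2 * \<theta>&k0+1<=j" using eventually_ge_at_top[of "k0+1"] by eventually_elim auto
   then show ?thesis using that by (metis (mono_tags, lifting) eventually_happens trivial_limit_sequentially less_imp_le)
  qed
  define r where "r=R0/2 ^ j"
  have r:"r>0" using R0 by (simp add:r_def)
  have rR0:"2 ^ j * r=R0" by (simp add:r_def)
  have P0:"Ps R0>0" "Ps r>0" using Psi_pos R0 r by auto
  have rle:"r<=R0" using R0 by (simp add:r_def divide_le_eq)
  have small:"Ps r<=Cs * Ps R0*(1/2) ^ j" using Psi_small[of "(1/2) ^ j" R0] R0 by (simp add:r_def power_one_over power_le_one mult_ac)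
  have large:"1/Ps r<=Cs/Ps R0*(2 ^ j) ^ m"
  proof -
   have "Ps (2 ^ j * r)<=Cs * (2 ^ j) ^ m * Ps r" by (rule Psi_growth[OF _ r]) simp
   then have "Ps R0<=(Cs * (2 ^ j) ^ m) * Ps r" by (simp only: rR0)
   moreover have "1/p<=Cs/q * X" if "q<=(Cs * X) * p" "p>0" "q>0" for p q X :: real using that by (simp add:field_simps)
   ultimately show ?thesis using P0 by blast
  qed
  have scale:"L * (2 ^ k * r)<=rh0" if "k<=j" for k
  proof -
   have "(2::real) ^ k<=2 ^ j" using that by (intro power_increasing) auto
   then have "L * (2 ^ k * r)<=L * (2 ^ j * r)" using L r by (intro mult_left_mono mult_right_mono) auto
   also have "...=rh0" using L by (simp only: rR0) (simp add:R0_def)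
   finally show ?thesis .
  qed
  have r2:"0<r/2" "r/2<=R1" using r rle R1(2) by auto
  obtain Z where Z:"finite Z" "Z \<subseteq> A" "separated (r/2) Z" "A \<subseteq> (\<Union>z\<in>Z. ball z (r/2))" by (rule net_exists[OF R1(1) r2])
  have Z0:"Z~={}" using Z(4) A(2) by auto
  have cardZ:"real (card Z)<=(32 * R1/R0) ^ dq * (2 ^ j) ^ dq"
  proof -
   have "real (card Z)<=(16 * R1/(r/2)) ^ dq" using Z R1 by (intro packing[OF _ _ _ r2]) auto
   also have "16 * R1/(r/2)=32 * R1/R0*2 ^ j" by (simp add:r_def)
   finally show ?thesis by (simp only: power_mult_distrib)
  qed
  define WB where "WB z w \<longleftrightarrow> 1/Ps r * (\<integral>x. (w x)^2 * wt z r x \<partial>mu)<=cin * en w (ball z (2 * L * 2 ^ k0 * r))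
   + (\<Sum>k=k0..<j. tcoef k * en w (ball z (L * (2^(k+1) * r)))) + ce * exp (- (tb * 2 ^ j))*(1/Ps r * (\<integral>x. (w x)^2 \<partial>mu))" for z w
  have "EX w. w:G&WB z w" for z
  proof -
   have er:"0<ep * r" "ep * r<=2 ^ k0 * r" using eps r order_trans[OF eps(2), of "2 ^ k0"] by (auto intro!: mult_right_mono)
   obtain Y where Y:"finite Y" "Y \<subseteq> ball z (2 ^ k0 * r)" "separated (ep * r) Y" "ball z (2 ^ k0 * r) \<subseteq> (\<Union>y\<in>Y. ball y (ep * r))"
   by (rule net_exists[OF order_refl er])
   have "real (card Y)<=(16*(2 ^ k0 * r)/(ep * r)) ^ dq" by (rule packing[OF Y(1-3) er])
   also have "16*(2 ^ k0 * r)/(ep * r)=16*2 ^ k0/ep" using r by simp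
   finally have cY:"real (card Y)<=(16*2 ^ k0/ep) ^ dq" .
   define C where "C=insert (z,r) ((%y. (y,ep * r)) ` Y)"
   have "card C<=card Y+1" using Y(1) card_image_le[OF Y(1), of "%y. (y,ep * r)"] by (auto simp:C_def card_insert_if le_SucI)
   then have "card C<=Kd" using cY Kd by linarith
   then obtain v where v:"v:G" "\<forall>(y,s)\<in>C. zero_mean v y s" using Gz[of C] Y(1) by (auto simp:C_def)
   have "1/Ps r * (\<integral>x. (v x)^2 * wt z r x \<partial>mu)<=cin * en v (ball z (2 * L * 2 ^ k0 * r))
   + (\<Sum>k=k0..<j. tcoef k * en v (ball z (L * (2^(k+1) * r)))) + ce * exp (- (tb * 2 ^ j))*(1/Ps r * (\<integral>x. (v x)^2 \<partial>mu))"
   unfolding cin_def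
   proof (rule weighted_bound[OF r eps _ Y GF[OF v(1)]])
   show "k0<=j" using j(1) by simp
   show "zero_mean v y (ep * r)" if "y:Y" for y using v(2) that by (auto simp:C_def)
   show "zero_mean v z r" using v(2) by (auto simp:C_def)
   qed
   with v(1) show ?thesis unfolding WB_def by blast
  qed
  then have "ALL z. EX w. w:G&WB z w" ..
  from choice[OF this] obtain v where vWB:"ALL z. v z:G&WB z (v z)" ..
  have vG:"v z:G" and v:"1/Ps r * (\<integral>x. (v z x)^2 * wt z r x \<partial>mu)<=cin * en (v z) (ball z (2 * L * 2 ^ k0 * r))
   + (\<Sum>k=k0..<j. tcoef k * en (v z) (ball z (L * (2^(k+1) * r)))) + ce * exp (- (tb * 2 ^ j))*(1/Ps r * (\<integral>x. (v z x)^2 \<partial>mu))" for z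
   using vWB[rule_format, of z] by (simp_all only: WB_def)
  have over:"(SUM z:Z. mm (ball z s))<=(32 * s/r) ^ dq * mm U" if s:"r/2<=s" "s<=rh0" for s
  proof (rule mm[OF Z(1)])
   show "ball z s \<subseteq> U" if "z:Z" for z using subset_ball[OF s(2), of z] rh0(2)[of z] that Z(2) by auto
   have "16 * s/(r/2)=32 * s/r" by simp
   then show "(SUM z:Z. ib z s y)<=(32 * s/r) ^ dq" for y using overlap[OF Z(1,3) r2(1) s(1), of y] by simp
  qed auto
  have enm:"en (v z) (ball z s)<=mm (ball z s)" for z s by (rule Gm[OF vG]) simp
  have t0:"tcoef k>=0" for k using ce_pos K Cs by (simp add:tcoef_def)
  let ?e = "exp (- (tb * 2 ^ j))"
  have "1/Ps r * (SUM z:Z. \<integral>x. (v z x)^2 * wt z r x \<partial>mu)=(SUM z:Z. 1/Ps r * (\<integral>x. (v z x)^2 * wt z r x \<partial>mu))"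
   by (rule sum_distrib_left)
  also have "...<=(SUM z:Z. cin * mm (ball z (2 * L * 2 ^ k0 * r))
   + (\<Sum>k=k0..<j. tcoef k * mm (ball z (L * (2^(k+1) * r)))) + ce * ?e * (1/Ps r * Om2))"
  proof (rule sum_mono)
   fix z
   have "cin * en (v z) (ball z (2 * L * 2 ^ k0 * r))
   + (\<Sum>k=k0..<j. tcoef k * en (v z) (ball z (L * (2^(k+1) * r)))) + ce * ?e * (1/Ps r * (\<integral>x. (v z x)^2 \<partial>mu))
   <= cin * mm (ball z (2 * L * 2 ^ k0 * r))
   + (\<Sum>k=k0..<j. tcoef k * mm (ball z (L * (2^(k+1) * r)))) + ce * ?e * (1/Ps r * Om2)"
   by (intro add_mono sum_mono mult_left_mono enm G2 vG cin0 t0) (use ce_pos P0 in auto)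
   with v[of z] show "1/Ps r * (\<integral>x. (v z x)^2 * wt z r x \<partial>mu)<=cin * mm (ball z (2 * L * 2 ^ k0 * r))
   + (\<Sum>k=k0..<j. tcoef k * mm (ball z (L * (2^(k+1) * r)))) + ce * ?e * (1/Ps r * Om2)"
   by (rule order_trans)
  qed
  also have "...=cin * (SUM z:Z. mm (ball z (2 * L * 2 ^ k0 * r)))
   + (\<Sum>k=k0..<j. tcoef k * (SUM z:Z. mm (ball z (L * (2^(k+1) * r))))) + real (card Z)*(ce * ?e * (1/Ps r * Om2))"
   by (simp only: sum.distrib sum_distrib_left sum.swap[of _ "{k0..<j}" Z] sum_constant)
  also have "...<=cin * ((64 * L * 2 ^ k0) ^ dq * mm U)
   + (\<Sum>k=k0..<j. tcoef k * ((32 * L * 2^(k+1)) ^ dq * mm U))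
   + ((32 * R1/R0) ^ dq * (2 ^ j) ^ dq)*(ce * ?e * ((Cs/Ps R0*(2 ^ j) ^ m) * Om2))"
  proof (intro add_mono mult_left_mono sum_mono cin0 t0)
   have half:"r/2<=L * (2 ^ k * r)" for k
   proof -
   have "r * 1<=L * (2 ^ k * r)" using L r one_le_power[of "2::real" k] mult_mono[of 1 L r "2 ^ k * r"] by simp
   then show ?thesis using r by simp
   qed
   have e1:"L * (2^(k0+1) * r)=2 * L * 2 ^ k0 * r" by simp
   have e2:"32*(2 * L * 2 ^ k0 * r)/r=64 * L * 2 ^ k0" using r by simp
   show "(SUM z:Z. mm (ball z (2 * L * 2 ^ k0 * r)))<=(64 * L * 2 ^ k0) ^ dq * mm U" using over[OF half scale[OF j(1)]] unfolding e1 e2 .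
   fix k assume "k:{k0..<j}"
   then have kj:"k+1<=j" by simp
   have e3:"32*(L * (2^(k+1) * r))/r=32 * L * 2^(k+1)" using r by simp
   show "(SUM z:Z. mm (ball z (L * (2^(k+1) * r))))<=(32 * L * 2^(k+1)) ^ dq * mm U" using over[OF half scale[OF kj]] unfolding e3 .
  next
   have nn:"0<=ce * ?e" using ce_pos by simp
   have "1/Ps r * Om2<=Cs/Ps R0*(2 ^ j) ^ m * Om2" by (intro mult_right_mono large Om2)
   then have "ce * ?e * (1/Ps r * Om2)<=ce * ?e * (Cs/Ps R0*(2 ^ j) ^ m * Om2)" by (intro mult_left_mono nn)
   moreover have "0<=ce * ?e * (1/Ps r * Om2)" using nn P0 Om2 by simp
   moreover have "0<=(32 * R1/R0) ^ dq * (2 ^ j) ^ dq" using cardZ by linarith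
   ultimately show "real (card Z)*(ce * ?e * (1/Ps r * Om2))<=((32 * R1/R0) ^ dq * (2 ^ j) ^ dq)*(ce * ?e * ((Cs/Ps R0*(2 ^ j) ^ m) * Om2))"
   by (intro mult_mono[OF cardZ])
  qed
  also have "...=(cin * (64 * L * 2 ^ k0) ^ dq) * mm U+(\<Sum>k=k0..<j. tcoef k * (32 * L * 2^(k+1)) ^ dq) * mm U
   + (32 * R1/R0) ^ dq * (ce * (Cs/Ps R0 * Om2))*((2 ^ j)^(dq + m) * ?e)"
  proof -
   have "(\<Sum>k=k0..<j. tcoef k * ((32 * L * 2^(k+1)) ^ dq * mm U))=(\<Sum>k=k0..<j. tcoef k * (32 * L * 2^(k+1)) ^ dq) * mm U"
   by (simp only: sum_distrib_right mult.assoc)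
   moreover have "a * (l * w) + S * w+(p * q)*(d * e * ((f * g) * h))=(a * l) * w + S * w + p * (d * (f * h))*((q * g) * e)"
   for a l w S p q d e f g h :: real by (simp only: mult_ac)
   ultimately show ?thesis by (simp only: power_add)
  qed
  also have "...<=(c2 * et/2) * mm U+(c2 * et/2) * mm U+(32 * R1/R0) ^ dq * (ce * (Cs/Ps R0 * Om2))*(CE * (1/2) ^ j)"
  proof (intro add_mono mult_right_mono cin k0 mult_left_mono CE mmU)
   have "32 * R1/R0>=0" using R0 R1(2) by simp
   then show "0<=(32 * R1/R0) ^ dq * (ce * (Cs/Ps R0 * Om2))" using ce_pos Cs P0 Om2 by simp
  qed
  finally have b1:"1/Ps r * (SUM z:Z. \<integral>x. (v z x)^2 * wt z r x \<partial>mu)<=..." .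
  have b2:"Ps r/2*(M * Om)<=Cs * Ps R0/2*(M * (abs Om))*(1/2) ^ j"
  proof -
   have M0:"M>=0" using K1_ge by (simp add:M_def)
   have "Ps r/2*(M * Om)<=Ps r/2*(M * (abs Om))" using P0 M0 by (intro mult_left_mono) auto
   also have "...<=Cs * Ps R0*(1/2) ^ j/2*(M * (abs Om))" using M0 by (intro mult_right_mono divide_right_mono small) auto
   also have "...=Cs * Ps R0/2*(M * (abs Om))*(1/2) ^ j" by simp
   finally show ?thesis .
  qed
  have "c2*(SUM z:Z. en (v z) (ball z (r/2)))<=Ps r/2*(M * Om)+1/Ps r * (SUM z:Z. \<integral>x. (v z x)^2 * wt z r x \<partial>mu)"
  proof (rule cacc_sum[OF r Z(1) Z0 _ _ _ h0])
   have "r/2<=K1 * r" using K1_ge r mult_right_mono[of 2 K1 r] by simp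
   moreover have "16*(K1 * r)/(r/2)=32 * K1" using r by simp
   ultimately show "(SUM z:Z. ib z (K1 * r) y)<=M" for y using overlap[OF Z(1,3) r2(1), of "K1 * r" y] by (simp add:M_def)
   show "v z:F&v z:bdf" for z using GF[OF vG] by simp
   show "W h:borel_measurable mu&integrable mu (W h)&(\<integral>x. W h x \<partial>mu)<=Om
   &(ALL z:Z. ALL x. ((v z x - Q h (v z) x)/h)^2<=W h x)" if "0<h" "h<h0" for h
   using W[OF that] vG by blast
  qed
  also have "...<=Cs * Ps R0/2*(M * (abs Om))*(1/2) ^ j+(c2 * et/2 * mm U + c2 * et/2 * mm U
   + (32 * R1/R0) ^ dq * (ce * (Cs/Ps R0 * Om2))*(CE * (1/2) ^ j))"
   by (intro add_mono b1 b2)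
  also have "...=c2 * et * mm U + C5*(1/2) ^ j"
  proof -
   have "a * x+(b/2 * u + b/2 * u + p * (e * x))=b * u+(a + p * e) * x" for a b x u p e :: real by (simp add:algebra_simps)
   then show ?thesis by (simp only: C5_def)
  qed
  also have "...<=c2*(et * mm U + \<theta>)" using j(2) by (simp add:distrib_left mult.assoc)
  finally have "(SUM z:Z. en (v z) (ball z (r/2)))<=et * mm U + \<theta>" using c2_pos by simp
  moreover have "(SUM z:Z. ib z (r/2) y)<=16 ^ dq" for y using overlap[OF Z(1,3) r2(1) order_refl, of y] r by simp
  ultimately show "EX r>0. EX Z v. finite Z&A \<subseteq> (\<Union>z\<in>Z. ball z (r/2))&(ALL y. (SUM z:Z. ib z (r/2) y)<=16 ^ dq)
   &(ALL z:Z. v z:G)&(SUM z:Z. en (v z) (ball z (r/2)))<=et * mm U + \<theta>"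
   using r Z vG by blast
 qed
qed

end

end

section \<open>The rank of a matrix\<close>

text \<open>Fewer equations than unknowns: one equation is solved for a pivot unknown and
  substituted into the others. It serves both the mean-zero conditions and the lower bound for
  ranks.\<close>

lemma kernel_exists:
 fixes d :: "'b => 'c=>real"
 assumes "finite Y" "finite I" "card Y<card I"
 shows "EX l. (EX i:I. l i~=0)&(ALL y:Y. (SUM i:I. l i * d y i)=0)" using assms
proof (induction Y arbitrary: I d rule: finite_induct)
 case empty
 then obtain i where "i:I" by fastforce
 then show ?case by (intro exI[of _ "%_. 1"]) auto
next
 case (insert y Y)
 show ?case
 proof (cases "EX k:I. d y k~=0")
  case False
  have "card Y<card I" using insert by simp
  from insert.IH[OF insert.prems(1) this, of d] obtain l where l:"EX i:I. l i~=0" "ALL y:Y. (SUM i:I. l i * d y i)=0" by auto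
  have "(SUM i:I. l i * d y i)=0" using False by (intro sum.neutral) auto
  then show ?thesis using l by (intro exI[of _ l]) auto
 next
  case True
  then obtain k where k:"k:I" "d y k~=0" by auto
  define J where "J=I - {k}"
  have J:"finite J" "k ~: J" "I=insert k J" using k insert.prems by (auto simp:J_def)
  have "card Y<card J" using insert.hyps insert.prems J by (simp add:card_insert_if)
  from insert.IH[OF J(1) this, of "%y' i. d y' i - d y i/d y k * d y' k"]
  obtain l where l:"EX i:J. l i~=0" "ALL y':Y. (SUM i:J. l i * (d y' i - d y i/d y k * d y' k))=0" by auto
  define s where "s=(SUM i:J. l i * d y i)/d y k"
  define l' where "l'=l(k := - s)"
  have sum:"(SUM i:I. l' i * d y' i)=(SUM i:J. l i * d y' i) - s * d y' k" for y'
  proof -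
   have "(SUM i:I. l' i * d y' i)=l' k * d y' k+(SUM i:J. l' i * d y' i)" using J by simp
   also have "(SUM i:J. l' i * d y' i)=(SUM i:J. l i * d y' i)" using J(2) by (intro sum.cong) (auto simp:l'_def)
   finally show ?thesis by (simp add:l'_def)
  qed
  have "(SUM i:I. l' i * d y' i)=0" if "y':insert y Y" for y'
  proof (cases "y'=y")
   case True
   then show ?thesis unfolding sum using k by (simp add:s_def)
  next
   case False
   then have "(SUM i:J. l i * (d y' i - d y i/d y k * d y' k))=0" using l(2) that by auto
   moreover have "(SUM i:J. l i * (d y' i - d y i/d y k * d y' k))=(SUM i:J. l i * d y' i) - s * d y' k"
   by (simp add:s_def right_diff_distrib sum_subtractf sum_distrib_right sum_divide_distrib mult.assoc)
   ultimately show ?thesis unfolding sum by simp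
  qed
  moreover obtain i where "i:J" "l i~=0" using l(1) by auto
  then have "EX i:I. l' i~=0" using J by (intro bexI[of _ i]) (auto simp:l'_def)
  ultimately show ?thesis by blast
 qed
qed

text \<open>Trades the column rank for an explicit sum of \<open>k\<close> products: forwards by
  expanding the columns in a maximal independent set of columns, backwards by subadditivity of the
  rank.\<close>

lemma rank_le_factor:
 fixes A :: "real mat"
 assumes A:"A:carrier_mat n n"
 shows "vec_space.rank n A<=k \<longleftrightarrow> (EX f g :: nat=>nat=>real. ALL i<n. ALL j<n. A $$ (i,j)=(\<Sum>a<k. f a i * g a j))"
proof -
 interpret vec_space "TYPE(real)" n .
 show ?thesis
 proof
  assume r:"rank A<=k"
  have "lin_indpt {}" unfolding lin_dep_def by auto
  then obtain S where S:"maximal S (%T. T \<subseteq> set (cols A)&lin_indpt T)" "finite S"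
   using maximal_exists_superset[of "set (cols A)" "%T. T \<subseteq> set (cols A)&lin_indpt T" "{}"] by auto
  have card:"card S<=k" using rank_card_indpt[OF A S(1)] r by simp
  have colsV:"set (cols A) \<subseteq> carrier_vec n" using cols_dim[of A] A by auto
  have SA:"S \<subseteq> set (cols A)" and Sli:"lin_indpt S" using S(1) by (auto simp:maximal_def)
  have SV:"S \<subseteq> carrier_vec n" using SA colsV by auto
  have span:"v:span S" if v:"v:set (cols A)" for v
  proof (cases "v:S")
   case True
   then show ?thesis using in_own_span[of S] SV by auto
  next
   case False
   have "lin_dep (S Un {v})"
   proof (rule ccontr)
   assume "\<not> lin_dep (S Un {v})"
   then have "S=S Un {v}" using S(1) SA v unfolding maximal_def by blast
   then show False using False by auto
   qed
   then show ?thesis using lin_dep_iff_in_span[of S v] SV Sli v colsV False by auto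
  qed
  have "EX d. ALL i<n. A $$ (i,j)=(SUM x:S. d x * x $ i)" if j:"j<n" for j
  proof -
   have "col A j:set (cols A)" using j A by (auto simp:cols_def)
   from finite_in_span[OF S(2) _ span[OF this]] SV obtain d where d:"lincomb d S=col A j" by auto
   have "A $$ (i,j)=(SUM x:S. d x * x $ i)" if "i<n" for i using lincomb_index[OF that SV, of d] that j A unfolding d by simp
   then show ?thesis by blast
  qed
  then obtain d where d:"!!i j. i<n==>j<n==>A $$ (i,j)=(SUM x:S. d j x * x $ i)" by metis
  obtain e where e:"bij_betw e {0..<card S} S" using ex_bij_betw_nat_finite[OF S(2)] by auto
  define f where "f a i=(if a<card S then e a $ i else 0)" for a i
  have "A $$ (i,j)=(\<Sum>a<k. f a i * d j (e a))" if "i<n" "j<n" for i j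
  proof -
   have "A $$ (i,j)=(SUM a:{0..<card S}. d j (e a) * e a $ i)" unfolding d[OF that] by (rule sum.reindex_bij_betw[OF e, symmetric])
   also have "...=(SUM a:{0..<card S}. f a i * d j (e a))" by (intro sum.cong) (auto simp:f_def)
   also have "...=(\<Sum>a<k. f a i * d j (e a))" using card by (intro sum.mono_neutral_left) (auto simp:f_def)
   finally show ?thesis .
  qed
  then show "EX f g :: nat=>nat=>real. ALL i<n. ALL j<n. A $$ (i,j)=(\<Sum>a<k. f a i * g a j)"
   by (intro exI[of _ f] exI[of _ "%a j. d j (e a)"]) auto
 next
  assume "EX f g :: nat=>nat=>real. ALL i<n. ALL j<n. A $$ (i,j)=(\<Sum>a<k. f a i * g a j)"
  then obtain f g :: "nat=>nat=>real" where fg:"!!i j. i<n==>j<n==>A $$ (i,j)=(\<Sum>a<k. f a i * g a j)" by blast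
  let ?M = "%k. Matrix.mat n n (%(i,j). \<Sum>a<k. f a i * g a j)"
  have rk:"rank (?M k)<=k" for k
  proof (induction k)
   case 0
   have e:"?M 0=0\<^sub>m n n" by (intro eq_matI) auto
   show ?case unfolding e rank_0I by simp
  next
   case (Suc k)
   let ?R = "Matrix.mat n n (%(i,j). f k i * g k j)"
   have "?M (Suc k)=?M k + ?R" by (intro eq_matI) auto
   moreover have "rank (?M k + ?R)<=rank (?M k) + rank ?R" by (rule rank_subadditive) auto
   moreover have "rank ?R<=1" by (rule rank_le_1_product_entries[where f="f k" and g="g k"]) auto
   ultimately show ?case using Suc by simp
  qed
  have eA:"A=?M k" using A fg by (intro eq_matI) auto
  show "rank A<=k" unfolding eA by (rule rk)
 qed
qed

section \<open>Bilinear forms and approximately orthonormal frames\<close>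

definition quad :: "nat=>(nat=>nat=>real)=>(nat=>real)=>(nat=>real)=>real" where
 "quad n H v w=(\<Sum>i<n. \<Sum>j<n. H i j * v i * w j)"

lemma quad_diff_left:"quad n H (%i. v i - v' i) w=quad n H v w - quad n H v' w" by (simp add:quad_def algebra_simps sum_subtractf)

lemma quad_add_left:"quad n H (%i. v i + v' i) w=quad n H v w + quad n H v' w" by (simp add:quad_def algebra_simps sum.distrib)

lemma quad_cmult_left:"quad n H (%i. a * v i) w=a * quad n H v w" by (simp add:quad_def algebra_simps sum_distrib_left)

lemma quad_sum_left:"finite I==>quad n H (%i. SUM a:I. c a * v a i) w=(SUM a:I. c a * quad n H (v a) w)"
proof (induction I rule: finite_induct)
 case empty
 then show ?case by (simp add:quad_def)
next
 case (insert x I)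
 then show ?case using quad_add_left[of n H "%i. c x * v x i" "%i. SUM a:I. c a * v a i" w] by (simp add:quad_cmult_left)
qed

lemma quad_sym:
 assumes "!!i j. i<n==>j<n==>H i j=H j i"
 shows "quad n H v w=quad n H w v" unfolding quad_def by (subst sum.swap) (auto intro!: sum.cong simp:assms mult_ac)

abbreviation mt :: "nat=>(nat=>nat=>real)=>real mat" where
 "mt n G==Matrix.mat n n (%(i,j). G i j)"

lemma rank_le_factor':
 "vec_space.rank n (mt n G)<=k \<longleftrightarrow> (EX f g :: nat=>nat=>real. ALL i<n. ALL j<n. G i j=(\<Sum>a<k. f a i * g a j))"
proof -
 have c:"mt n G:carrier_mat n n" by simp
 have e:"(ALL i<n. ALL j<n. mt n G $$ (i,j)=X i j) \<longleftrightarrow> (ALL i<n. ALL j<n. G i j=X i j)" for X :: "nat=>nat=>real" by auto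
 show ?thesis unfolding rank_le_factor[OF c] e ..
qed

text \<open>Gram--Schmidt: if it stops after \<open>m\<close> steps, then \<open>G\<close> is a sum of \<open>m\<close> matrices of rank one.\<close>

lemma orthonormal_exists:
 assumes sym:"!!i j. i<n==>j<n==>H i j=H j i" and psd:"!!v. quad n H v v>=0"
  and ker:"!!v i. quad n H v v=0==>i<n==>(\<Sum>j<n. G i j * v j)=0"
  and rank:"vec_space.rank n (mt n G)>k"
 shows "EX l. ALL a<=k. ALL b<=k. quad n H (l a) (l b)=(if a=b then 1 else 0)"
proof -
 have "m<=Suc k==>EX l. ALL a<m. ALL b<m. quad n H (l a) (l b)=(if a=b then 1 else 0)" for m
 proof (induction m)
  case (Suc m)
  then obtain l where l:"!!a b. a<m==>b<m==>quad n H (l a) (l b)=(if a=b then 1 else 0)" by auto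
  have "EX v. (ALL a<m. quad n H v (l a)=0)&quad n H v v~=0"
  proof (rule ccontr)
   assume neg:"\<not> ?thesis"
   define e :: "nat=>nat=>real" where "e j i=(if i=j then 1 else 0)" for j i
   have Geq:"G i j=(\<Sum>a<m. (\<Sum>j'<n. G i j' * l a j') * quad n H (e j) (l a))" if i:"i<n" and j:"j<n" for i j
   proof -
   \<comment> \<open>The component of the unit vector \<open>e j\<close> orthogonal to the frame. If
     no further step is possible its form vanishes, so \<open>ker\<close> annihilates it, and column
     \<open>j\<close> of \<open>G\<close> is a combination of the images of the
     \<open>l a\<close>.\<close>
   define v where "v=(%i. e j i-(\<Sum>a<m. quad n H (e j) (l a) * l a i))"
   have "quad n H v (l b)=0" if b:"b<m" for b
   proof -
   have "quad n H v (l b)=quad n H (e j) (l b)-(\<Sum>a<m. quad n H (e j) (l a) * quad n H (l a) (l b))"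
   unfolding v_def by (simp add:quad_diff_left quad_sum_left)
   also have "(\<Sum>a<m. quad n H (e j) (l a) * quad n H (l a) (l b))=(\<Sum>a<m. if a=b then quad n H (e j) (l b) else 0)"
   using l b by (intro sum.cong) auto
   also have "...=quad n H (e j) (l b)" using b by simp
   finally show ?thesis by simp
   qed
   then have "quad n H v v=0" using neg by blast
   from ker[OF this i] have "(\<Sum>j'<n. G i j' * v j')=0" .
   moreover have "(\<Sum>j'<n. G i j' * v j')=(\<Sum>j'<n. G i j' * e j j')-(\<Sum>j'<n. \<Sum>a<m. G i j' * (quad n H (e j) (l a) * l a j'))"
   by (simp add:v_def right_diff_distrib sum_subtractf sum_distrib_left)
   moreover have "(\<Sum>j'<n. G i j' * e j j')=G i j"
   proof -
   have "(\<Sum>j'<n. G i j' * e j j')=(\<Sum>j'<n. if j'=j then G i j' else 0)" by (intro sum.cong) (auto simp:e_def)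
   then show ?thesis using j by simp
   qed
   moreover have "(\<Sum>j'<n. \<Sum>a<m. G i j' * (quad n H (e j) (l a) * l a j'))=(\<Sum>a<m. (\<Sum>j'<n. G i j' * l a j') * quad n H (e j) (l a))"
   by (subst sum.swap) (simp add:sum_distrib_left sum_distrib_right mult_ac)
   ultimately show ?thesis by simp
   qed
   have "vec_space.rank n (mt n G)<=m" unfolding rank_le_factor'
   by (rule exI[of _ "%a i. \<Sum>j'<n. G i j' * l a j'"], rule exI[of _ "%a j. quad n H (e j) (l a)"], intro allI impI, rule Geq)
   then show False using rank Suc.prems by simp
  qed
  then obtain v where v:"!!a. a<m==>quad n H v (l a)=0" "quad n H v v~=0" by blast
  define s where "s=sqrt (quad n H v v)"
  have vv:"quad n H v v>0" using psd[of v] v(2) by simp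
  have s:"s>0" "s * s=quad n H v v" using vv by (auto simp:s_def)
  define w where "w=(%i. 1/s * v i)"
  have wl:"quad n H w x=1/s * quad n H v x" for x unfolding w_def by (rule quad_cmult_left)
  have ww:"quad n H w w=1"
  proof -
   have "quad n H v w=1/s * quad n H v v" using quad_sym[OF sym, where v=v and w=w] wl[of v] by simp
   then have "quad n H w w=1/s * (1/s * (s * s))" using s(2) wl[of w] by (simp only:)
   then show ?thesis using s(1) by simp
  qed
  have wa:"quad n H w (l a)=0&quad n H (l a) w=0" if "a<m" for a using wl[of "l a"] v(1)[OF that] quad_sym[OF sym, where v=w and w="l a"] by simp
  show ?case using l ww wa by (intro exI[of _ "l(m := w)"]) (auto simp:less_Suc_eq)
 qed simp
 from this[of "Suc k"] show ?thesis by (auto simp:less_Suc_eq_le)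
qed

text \<open>The transpose of \<open>G\<close> times \<open>G\<close>: positive semidefinite with the
  same kernel as \<open>G\<close>, so the rank of an arbitrary matrix can be read off from a
  form.\<close>

definition gram :: "nat=>(nat=>nat=>real)=>nat=>nat=>real" where
 "gram n G i j=(\<Sum>s<n. G s i * G s j)"

lemma quad_gram:"quad n (gram n G) v w=(\<Sum>s<n. (\<Sum>i<n. G s i * v i)*(\<Sum>j<n. G s j * w j))"
proof -
 have "quad n (gram n G) v w=(\<Sum>i<n. \<Sum>j<n. \<Sum>s<n. (G s i * v i)*(G s j * w j))"
  unfolding quad_def gram_def sum_distrib_right by (intro sum.cong refl) (simp add:mult_ac)
 also have "...=(\<Sum>i<n. \<Sum>s<n. \<Sum>j<n. (G s i * v i)*(G s j * w j))" by (intro sum.cong refl sum.swap)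
 also have "...=(\<Sum>s<n. \<Sum>i<n. \<Sum>j<n. (G s i * v i)*(G s j * w j))" by (rule sum.swap)
 finally show ?thesis by (simp add:sum_product)
qed

text \<open>If the rank were at most \<open>k\<close>, \<open>G\<close> would kill a combination of
  the \<open>k+1\<close> vectors with some nonzero coefficient. At the largest coefficient this is
  impossible: \<open>k+1\<close> matrix entries, each off by less than \<open>1/(2 (k+1))\<close>,
  compensate at most half of it.\<close>

lemma near_orthonormal_rank:
 assumes near:"!!a b. a<=k==>b<=k==>\<bar>quad n (gram n G) (l a) (l b)-(if a=b then 1 else 0)\<bar><1/(2*(real k+1))"
 shows "vec_space.rank n (mt n G)>k"
proof (rule ccontr)
 assume "\<not> ?thesis"
 then have "vec_space.rank n (mt n G)<=k" by simp
 then obtain f g :: "nat=>nat=>real" where fg:"!!i j. i<n==>j<n==>G i j=(\<Sum>a<k. f a i * g a j)" unfolding rank_le_factor' by blast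
 obtain c where c:"EX b:{..k}. c b~=0" "ALL a:{..<k}. (SUM b:{..k}. c b * (\<Sum>j<n. g a j * l b j))=0"
  using kernel_exists[of "{..<k}" "{..k}" "%a b. \<Sum>j<n. g a j * l b j"] by auto
 define v where "v=(%i. SUM b:{..k}. c b * l b i)"
 have Gv:"(\<Sum>i<n. G s i * v i)=0" if s:"s<n" for s
 proof -
  have "(\<Sum>i<n. G s i * v i)=(\<Sum>i<n. \<Sum>a<k. SUM b<=k. (f a s * g a i)*(c b * l b i))"
   using s by (intro sum.cong) (auto simp:fg v_def sum_product)
  also have "...=(\<Sum>a<k. \<Sum>i<n. SUM b<=k. (f a s * g a i)*(c b * l b i))" by (rule sum.swap)
  also have "...=(\<Sum>a<k. SUM b<=k. \<Sum>i<n. (f a s * g a i)*(c b * l b i))" by (intro sum.cong refl sum.swap)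
  also have "...=(\<Sum>a<k. SUM b<=k. \<Sum>i<n. f a s * (c b * (g a i * l b i)))" by (intro sum.cong refl) (simp only: mult_ac)
  also have "...=(\<Sum>a<k. f a s * (SUM b<=k. c b * (\<Sum>i<n. g a i * l b i)))" by (simp add:sum_distrib_left)
  also have "...=0" using c(2) by (intro sum.neutral) auto
  finally show ?thesis .
 qed
 define B where "B a b=quad n (gram n G) (l a) (l b)" for a b
 have zero:"(SUM b<=k. c b * B b b0)=0" for b0
 proof -
  have "(SUM b<=k. c b * B b b0)=quad n (gram n G) v (l b0)" unfolding v_def B_def by (simp add:quad_sum_left)
  also have "...=0" unfolding quad_gram using Gv by (intro sum.neutral) auto
  finally show ?thesis .
 qed
 obtain b0 where b0:"b0<=k" "!!b. b<=k==>\<bar>c b\<bar><=\<bar>c b0\<bar>"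
 proof -
  have "Max ((%b. \<bar>c b\<bar>) ` {..k}):(%b. \<bar>c b\<bar>) ` {..k}" by (intro Max_in) auto
  then obtain b0 where b0:"Max ((%b. \<bar>c b\<bar>) ` {..k})=\<bar>c b0\<bar>" "b0:{..k}" by (rule imageE)
  have "\<bar>c b\<bar><=\<bar>c b0\<bar>" if "b<=k" for b unfolding b0(1)[symmetric] using that by (intro Max_ge) auto
  then show ?thesis using that[of b0] b0(2) by blast
 qed
 have pos:"\<bar>c b0\<bar>>0" using c(1) b0(2) by fastforce
 have "c b0=(SUM b<=k. c b * (if b=b0 then 1 else 0))" using b0(1) by (simp add:if_distrib[of "%x. _ * x"] cong: if_cong)
 also have "...=(SUM b<=k. c b * ((if b=b0 then 1 else 0) - B b b0))" using zero[of b0] by (simp add:right_diff_distrib sum_subtractf)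
 finally have eq:"c b0=(SUM b<=k. c b * ((if b=b0 then 1 else 0) - B b b0))" .
 have "\<bar>c b0\<bar><=(SUM b<=k. \<bar>c b * ((if b=b0 then 1 else 0) - B b b0)\<bar>)" by (subst eq) (rule sum_abs)
 also have "...<=(SUM b<=k. \<bar>c b0\<bar> * (1/(2*(real k+1))))"
 proof (rule sum_mono)
  fix b assume "b:{..k}"
  then have "\<bar>c b\<bar> * \<bar>(if b=b0 then 1 else 0) - B b b0\<bar><=\<bar>c b0\<bar> * (1/(2*(real k+1)))"
   using near[of b b0] b0 by (intro mult_mono) (auto simp:B_def abs_minus_commute)
  then show "\<bar>c b * ((if b=b0 then 1 else 0) - B b b0)\<bar><=\<bar>c b0\<bar> * (1/(2*(real k+1)))" by (simp add:abs_mult)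
 qed
 also have "...=\<bar>c b0\<bar>/2"
 proof -
  have "(K+1)*(x * (1/(2*(K+1))))=x/2" if "K>=0" for K x :: real using that by (simp add:field_simps)
  from this[of "real k" "\<bar>c b0\<bar>"] show ?thesis by (simp add:add.commute)
 qed
 finally show False using pos by simp
qed

text \<open>Extensional functions, so that the set of rational frames is countable.\<close>

definition rat_frames :: "nat=>nat=>(nat=>nat=>real) set" where
 "rat_frames k n=PiE {..k} (%_. PiE {..<n} (%_. \<rat>))"

lemma countable_rat_frames:"countable (rat_frames k n)" unfolding rat_frames_def by (intro countable_PiE) (auto simp:countable_rat)

text \<open>Entrywise rational approximation; the finitely many values of the form are continuous in
  the entries.\<close>

lemma rat_frames_approx:
 assumes e:"e>0"
 shows "EX l':rat_frames k n. ALL a<=k. ALL b<=k. \<bar>quad n H (l' a) (l' b) - quad n H (l a) (l b)\<bar><e"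
proof -
 have "EX q. (ALL m. q m:\<rat>)&q ----> x" for x :: real
 proof -
  have "EX y:\<rat>. x<y&y<x+1/real (Suc m)" for m by (intro Rats_dense_in_real) simp
  then obtain q where q:"!!m. q m:\<rat>" "!!m. x<q m" "!!m. q m<x+1/real (Suc m)" by metis
  have "q ----> x"
  proof (rule tendsto_sandwich[where f="%_. x" and h="%m. x+1/real (Suc m)"])
   show "(%m. x+1/real (Suc m)) ----> x" by real_asymp
  qed (use q in \<open>auto intro!: always_eventually simp:less_imp_le\<close>)
  with q(1) show ?thesis by blast
 qed
 then have "EX q. ALL x. (ALL m. q x m:\<rat>)&q x ----> (x::real)" by (intro choice allI)
 then obtain q where q:"!!x m. q x m:\<rat>" "!!x :: real. q x ----> x" by blast
 define l' where "l' m=(\<lambda>a\<in>{..k}. \<lambda>i\<in>{..<n}. q (l a i) m)" for m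
 have l'R:"l' m:rat_frames k n" for m using q(1) by (auto simp:l'_def rat_frames_def)
 have lim:"(%m. quad n H (l' m a) (l' m b)) ----> quad n H (l a) (l b)" if "a<=k" "b<=k" for a b
 proof -
  have "(%m. \<Sum>i<n. \<Sum>j<n. H i j * q (l a i) m * q (l b j) m) ----> (\<Sum>i<n. \<Sum>j<n. H i j * l a i * l b j)"
   by (intro tendsto_intros q(2))
  moreover have "quad n H (l' m a) (l' m b)=(\<Sum>i<n. \<Sum>j<n. H i j * q (l a i) m * q (l b j) m)" for m
   unfolding quad_def l'_def using that by (intro sum.cong refl) simp
  ultimately show ?thesis unfolding quad_def[of n H "l a" "l b"] by simp
 qed
 have "\<forall>\<^sub>F m in sequentially. ALL a:{..k}. ALL b:{..k}. \<bar>quad n H (l' m a) (l' m b) - quad n H (l a) (l b)\<bar><e"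
 proof (intro eventually_ball_finite ballI)
  fix a b assume "a:{..k}" "b:{..k}"
  from tendstoD[OF lim e, of a b] this show "\<forall>\<^sub>F m in sequentially. \<bar>quad n H (l' m a) (l' m b) - quad n H (l a) (l b)\<bar><e"
   by (simp add:dist_real_def)
 qed auto
 then obtain m where "ALL a:{..k}. ALL b:{..k}. \<bar>quad n H (l' m a) (l' m b) - quad n H (l a) (l b)\<bar><e"
  using eventually_happens[of _ sequentially] by fastforce
 with l'R[of m] show ?thesis by auto
qed

lemma rational_orthonormal:
 assumes "!!i j. i<n==>j<n==>H i j=H j i" "!!v. quad n H v v>=0"
  and "!!v i. quad n H v v=0==>i<n==>(\<Sum>j<n. G i j * v j)=0"
  and "vec_space.rank n (mt n G)>k" and e:"e>0"
 shows "EX l:rat_frames k n. ALL a<=k. ALL b<=k. \<bar>quad n H (l a) (l b)-(if a=b then 1 else 0)\<bar><e"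
proof -
 obtain l where l:"ALL a<=k. ALL b<=k. quad n H (l a) (l b)=(if a=b then 1 else 0)" using orthonormal_exists[OF assms(1-4)] by blast
 obtain l' where l': "l':rat_frames k n" "ALL a<=k. ALL b<=k. \<bar>quad n H (l' a) (l' b) - quad n H (l a) (l b)\<bar><e"
  using rat_frames_approx[OF e, of k n H l] by blast
 have "\<bar>quad n H (l' a) (l' b)-(if a=b then 1 else 0)\<bar><e" if "a<=k" "b<=k" for a b
 proof -
  have "quad n H (l a) (l b)=(if a=b then 1 else 0)" using l that by blast
  then show ?thesis using l'(2) that by metis
 qed
 with l'(1) show ?thesis by blast
qed

text \<open>Describes the rank by countably many strict inequalities between polynomials in the
  entries, from which its measurability follows.\<close>

lemma rank_gt_iff:
 "vec_space.rank n (mt n G)>k \<longleftrightarrow>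
  (EX l:rat_frames k n. ALL a<=k. ALL b<=k. \<bar>quad n (gram n G) (l a) (l b)-(if a=b then 1 else 0)\<bar><1/(2*(real k+1)))"
proof
 assume r:"vec_space.rank n (mt n G)>k"
 show "EX l:rat_frames k n. ALL a<=k. ALL b<=k. \<bar>quad n (gram n G) (l a) (l b)-(if a=b then 1 else 0)\<bar><1/(2*(real k+1))"
 proof (rule rational_orthonormal[OF _ _ _ r])
  show "gram n G i j=gram n G j i" for i j by (simp add:gram_def mult.commute)
  show "quad n (gram n G) v v>=0" for v unfolding quad_gram by (intro sum_nonneg) simp
  show "(\<Sum>j<n. G i j * v j)=0" if "quad n (gram n G) v v=0" "i<n" for v i
  proof -
   have "(\<Sum>s<n. (\<Sum>i<n. G s i * v i)*(\<Sum>j<n. G s j * v j))=0" using that(1) unfolding quad_gram .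
   then have "ALL s:{..<n}. (\<Sum>i<n. G s i * v i)*(\<Sum>j<n. G s j * v j)=0" by (subst (asm) sum_nonneg_eq_0_iff) auto
   then show ?thesis using that(2) by auto
  qed
 qed simp
qed (use near_orthonormal_rank in blast)

text \<open>With \<open>e\<close> the \<open>i\<close>-th unit vector, nonnegativity of the form at
  \<open>e + s v\<close> bounds an affine function of \<open>s\<close> below for all real
  \<open>s\<close>, so its slope, twice the claimed sum, vanishes.\<close>

lemma psd_kernel:
 assumes sym:"!!i j. i<n==>j<n==>H i j=H j i" and psd:"!!v. quad n H v v>=0"
  and v:"quad n H v v=0" and i:"i<n"
 shows "(\<Sum>j<n. H i j * v j)=0"
proof -
 define e :: "nat=>real" where "e j=(if j=i then 1 else 0)" for j
 have "quad n H e v=(\<Sum>i'<n. (if i'=i then \<Sum>j<n. H i j * v j else 0))" unfolding quad_def e_def by (intro sum.cong) auto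
 then have ev:"quad n H e v=(\<Sum>j<n. H i j * v j)" using i by simp
 have q:"0<=quad n H e e+2 * s * quad n H e v" for s
 proof -
  have sy:"quad n H x y=quad n H y x" for x y by (rule quad_sym[OF sym])
  define w where "w=(%i. e i + s * v i)"
  have lin:"quad n H w x=quad n H e x + s * quad n H v x" for x by (simp add:w_def quad_add_left quad_cmult_left)
  have ew:"quad n H e w=quad n H e e + s * quad n H e v"
  proof -
   have "quad n H e w=quad n H w e" by (rule sy)
   also have "...=quad n H e e + s * quad n H v e" by (rule lin)
   also have "quad n H v e=quad n H e v" by (rule sy)
   finally show ?thesis .
  qed
  have vw:"quad n H v w=quad n H e v + s * quad n H v v" using sy[of v w] lin[of v] by (rule trans)
  have "quad n H w w=(quad n H e e + s * quad n H e v) + s * (quad n H e v + s * quad n H v v)" using lin[of w] unfolding ew vw .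
  then show ?thesis using psd[of w] v by (simp add:mult.assoc)
 qed
 show ?thesis
 proof (rule ccontr)
  assume "\<not> ?thesis"
  then have ne:"quad n H e v~=0" by (simp add:ev)
  have "2*(- (quad n H e e+1)/(2 * x)) * x = - (quad n H e e+1)" if "x~=0" for x using that by simp
  from this[OF ne] q[of "- (quad n H e e+1)/(2 * quad n H e v)"] show False by simp
 qed
qed

lemma rank_measurable:
 assumes G:"!!i j. i<n==>j<n==>(%x. G x i j):borel_measurable M"
 shows "(%x. of_nat (vec_space.rank n (mt n (G x))) :: ennreal):borel_measurable M"
proof -
 have gt:"{x:space M. vec_space.rank n (mt n (G x))>k}:sets M" for k
 proof -
  have [measurable]:"(%x. quad n (gram n (G x)) v w):borel_measurable M" for v w unfolding quad_def gram_def
   by (intro borel_measurable_sum borel_measurable_times borel_measurable_const G) auto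
  have gen:"{x:space M. EX l:R. ALL a<=k. ALL b<=k. P l a b x}=(\<Union>l\<in>R. \<Inter>a\<in>{..k}. \<Inter>b\<in>{..k}. {x:space M. P l a b x})"
   for R :: "(nat=>nat=>real) set" and P
  proof (intro Set.set_eqI iffI)
   fix x assume "x:(\<Union>l\<in>R. \<Inter>a\<in>{..k}. \<Inter>b\<in>{..k}. {x:space M. P l a b x})"
   then obtain l where l:"l:R" "!!a b. a<=k==>b<=k==>x:space M&P l a b x" by auto
   then show "x:{x:space M. EX l:R. ALL a<=k. ALL b<=k. P l a b x}" using l(2)[of 0 0] by auto
  qed auto
  have "{x:space M. vec_space.rank n (mt n (G x))>k}=(\<Union>l\<in>rat_frames k n.
   \<Inter>a\<in>{..k}. \<Inter>b\<in>{..k}. {x:space M. \<bar>quad n (gram n (G x)) (l a) (l b)-(if a=b then 1 else 0)\<bar><1/(2*(real k+1))})"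
   unfolding rank_gt_iff by (rule gen)
  also have "...:sets M" by (intro sets.countable_UN' countable_rat_frames sets.finite_INT) auto
  finally show ?thesis .
 qed
 have "(%x. vec_space.rank n (mt n (G x))):measurable M (count_space UNIV)"
 proof (subst measurable_count_space_eq2_countable, safe)
  fix r
  have "(%x. vec_space.rank n (mt n (G x))) -` {r} Int space M = 
   (if r=0 then space M else {x:space M. vec_space.rank n (mt n (G x))>r-1}) - {x:space M. vec_space.rank n (mt n (G x))>r}"
   by auto
  also have "...:sets M" using gt by auto
  finally show "(%x. vec_space.rank n (mt n (G x))) -` {r} Int space M:sets M" .
 qed auto
 then show ?thesis by (rule measurable_compose) simp
qed

section \<open>Linear combinations with unit coefficient vectors\<close>

definition lcf :: "nat=>(nat=>real)=>(nat => 'a=>real) => 'a=>real" where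
 "lcf n c u=(%x. \<Sum>a<n. c a * u a x)"

definition unitc :: "nat=>(nat=>real)=>bool" where
 "unitc n c \<longleftrightarrow> (\<Sum>a<n. (c a)^2)=1"

context hk_space
begin

lemma lcf_Suc:"lcf (Suc n) c u=(%x. 1 * lcf n c u x + c n * u n x)" by (simp add:lcf_def)

lemma lcf_F:"(!!a. a<n==>u a:F)==>lcf n c u:F"
proof (induction n)
 case 0
 then show ?case using domain_zero by (simp add:lcf_def)
next
 case (Suc n)
 then show ?case unfolding lcf_Suc by (intro F_lin) auto
qed

lemma lcf_bdd:"(!!a. a<n==>u a:bdf)==>lcf n c u:bdf"
proof (induction n)
 case 0
 then show ?case using bdf_const[of 0] by (simp add:lcf_def)
next
 case (Suc n)
 then show ?case unfolding lcf_Suc by (intro bdf_lin) auto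
qed

lemma egB_Cauchy_Schwarz:
 assumes f:"f:F" and g:"g:F" and A:"A:sets borel"
 shows "(egB f g A)^2<=eg f A * eg g A"
proof (rule quadratic_nonneg_discriminant)
 fix s
 show "0<=eg f A+2 * egB f g A * s + eg g A * s^2" using eg_nonneg[OF F_lin[OF f g, of 1 s] A] unfolding eg_expand[OF f g A] by (simp add:mult_ac)
qed

lemma eg_scale:"f:F==>A:sets borel==>eg (%x. a * f x) A=a^2 * eg f A" using eg_expand[of f f A a 0] by simp

lemma eg_zero:"A:sets borel==>eg (%x. 0) A=0" using eg_scale[OF domain_zero, of A 0] by simp

lemma eg_sqrt_triangle:
 assumes f:"f:F" and g:"g:F" and A:"A:sets borel"
 shows "sqrt (eg (%x. a * f x + b * g x) A)<=(abs a) * sqrt (eg f A) + (abs b) * sqrt (eg g A)"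
proof -
 have "sqrt (a^2 * eg f A+2*(a * b * egB f g A) + b^2 * eg g A)<=sqrt (a^2 * eg f A) + sqrt (b^2 * eg g A)"
 proof (rule sqrt_quadratic_triangle)
  show "(a * b * egB f g A)^2<=a^2 * eg f A * (b^2 * eg g A)"
   using mult_left_mono[OF egB_Cauchy_Schwarz[OF f g A], of "a^2 * b^2"] by (simp add:power_mult_distrib mult_ac)
 qed (use eg_nonneg f g A in auto)
 then show ?thesis unfolding eg_expand[OF f g A] by (simp add:real_sqrt_mult mult.assoc)
qed

text \<open>The signs are put into the second factor so that Cauchy-Schwarz for sums applies with
  the vector \<open>c\<close> itself.\<close>

lemma eg_lincomb_sqrt:
 "(!!a. a<n==>u a:F)==>A:sets borel==>sqrt (eg (lcf n c u) A)<=(\<Sum>a<n. c a * (sgn (c a) * sqrt (eg (u a) A)))"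
proof (induction n)
 case 0
 then show ?case by (simp add:lcf_def eg_zero)
next
 case (Suc n)
 have "sqrt (eg (lcf (Suc n) c u) A)<=(abs 1) * sqrt (eg (lcf n c u) A) + \<bar>c n\<bar> * sqrt (eg (u n) A)"
  unfolding lcf_Suc using Suc.prems by (intro eg_sqrt_triangle lcf_F) auto
 moreover have "\<bar>c n\<bar> * sqrt (eg (u n) A)=c n * (sgn (c n) * sqrt (eg (u n) A))" by (simp add:abs_sgn mult.assoc)
 ultimately show ?case using Suc by simp
qed

lemma eg_lincomb_le:
 assumes u:"!!a. a<n==>u a:F" and A:"A:sets borel" and c:"unitc n c"
 shows "eg (lcf n c u) A<=(\<Sum>a<n. eg (u a) A)"
proof -
 have nn:"eg (lcf n c u) A>=0" by (intro eg_nonneg lcf_F u A)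
 have "eg (lcf n c u) A=(sqrt (eg (lcf n c u) A))^2" using nn by simp
 also have "...<=(\<Sum>a<n. c a * (sgn (c a) * sqrt (eg (u a) A)))^2" using nn by (intro power_mono eg_lincomb_sqrt u A) auto
 also have "...<=(\<Sum>a<n. (c a)^2)*(\<Sum>a<n. (sgn (c a) * sqrt (eg (u a) A))^2)" by (rule Cauchy_Schwarz_ineq_sum)
 also have "...=(\<Sum>a<n. (sgn (c a) * sqrt (eg (u a) A))^2)" using c by (simp add:unitc_def)
 also have "...<=(\<Sum>a<n. eg (u a) A)"
 proof (rule sum_mono)
  fix a assume "a:{..<n}"
  then have "eg (u a) A>=0" using eg_nonneg u A by auto
  then show "(sgn (c a) * sqrt (eg (u a) A))^2<=eg (u a) A" by (auto simp:power_mult_distrib sgn_if)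
 qed
 finally show ?thesis .
qed

lemma eg_add_le:
 assumes f:"f:F" and g:"g:F" and A:"A:sets borel" and ab:"(abs a)=1" "(abs b)=1"
 shows "eg (%x. a * f x + b * g x) A<=2 * eg f A+2 * eg g A"
proof -
 have nn:"eg (%x. a * f x + b * g x) A>=0" "eg f A>=0" "eg g A>=0" by (intro eg_nonneg F_lin f g A)+
 have "eg (%x. a * f x + b * g x) A=(sqrt (eg (%x. a * f x + b * g x) A))^2" using nn by simp
 also have "...<=(sqrt (eg f A) + sqrt (eg g A))^2" using eg_sqrt_triangle[OF f g A, of a b] ab nn by (intro power_mono) auto
 also have "...<=2*(sqrt (eg f A))^2+2*(sqrt (eg g A))^2"
  using sum_squares_ge_zero[of "sqrt (eg f A) - sqrt (eg g A)" 0] by (simp only: power2_eq_square) (simp add:algebra_simps)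
 finally show ?thesis using nn by simp
qed

lemma eg_mono:
 assumes "f:F" "A:sets borel" "B:sets borel" "A \<subseteq> B"
 shows "eg f A<=eg f B" using finite_measure.finite_measure_mono[OF energy_measure_eq(2)[OF assms(1)], of A B] assms by (simp add:energy_measure_eq)

lemma eg_overlap:
 assumes f:"f:F" and Y:"finite (Y :: 'a set)" and S:"!!y. y:Y==>S y:sets borel" "!!y. y:Y==>S y \<subseteq> U" and U:"U:sets borel"
  and T:"T:sets borel" and N:"!!x. (SUM y:Y. ind (S y) x)<=N"
 shows "(SUM y:Y. eg f (S y Int T))<=N * eg f (U Int T)"
proof -
 have "(SUM y:Y. measure (energy_measure E F f) (S y Int T))<=N * measure (energy_measure E F f) (U Int T)"
 proof (rule measure_overlap[OF energy_measure_eq(2,1)[OF f] Y])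
  show "(SUM y:Y. ind (S y Int T) x)<=N" for x by (rule order_trans[OF sum_mono N[of x]]) (auto simp:indicator_def)
 qed (use S U T in auto)
 then show ?thesis using S(1) U T by (simp add:energy_measure_eq[OF f])
qed

text \<open>The bound on the difference quotients expresses, without naming the generator, that
  \<open>u\<close> lies in its domain; \<open>e\<close> measures the distance to \<open>g\<close> in
  energy.\<close>

definition special :: "('a=>real)=>real=>('a=>real)=>real=>real=>bool" where
 "special g e u H h0 \<longleftrightarrow> u:F&u:bdf&h0>0&(ALL h. 0<h&h<h0-->(\<integral>x. ((u x - Q h u x)/h)^2 \<partial>mu)<=H)
  &Enorm (%x. u x - g x)<e"

text \<open>\<open>g\<close> is truncated and then smoothed by \<open>Q t\<close>;
  \<open>Q_generator_bound\<close> supplies the bound as long as \<open>4 h <= t\<close>.\<close>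

lemma special_exists:
 assumes g:"g:F" and e:"e>0"
 shows "EX u H h0. special g e u H h0"
proof -
 have "\<forall>\<^sub>F k in sequentially. Enorm (%x. truncate k g x - g x)<e/2" using truncate_Enorm[OF g] e by (intro order_tendstoD(2)) auto
 then obtain k where k:"Enorm (%x. truncate k g x - g x)<e/2" by (auto simp:eventually_sequentially)
 define f where "f=truncate k g"
 have f:"f:F" "f:bdf" using truncate_Fb[OF g, of k] by (auto simp:f_def)
 have "(%n. Enorm (%x. Q (1/real (Suc n)) f x - f x)) ----> sqrt 0" unfolding Enorm_def by (intro tendsto_real_sqrt Q_E_limit f)
 then have "\<forall>\<^sub>F n in sequentially. Enorm (%x. Q (1/real (Suc n)) f x - f x)<e/2" using e by (intro order_tendstoD(2)) auto
 then obtain n where n:"Enorm (%x. Q (1/real (Suc n)) f x - f x)<e/2" by (auto simp:eventually_sequentially)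
 define t where "t=1/real (Suc n)"
 have t:"t>0" by (simp add:t_def)
 define u where "u=Q t f"
 have u:"u:F" "u:bdf" unfolding u_def by (intro Q_F t f Q_bdd)+
 have "special g e u ((8/t * nrm f)^2) (t/4)" unfolding special_def
 proof (intro conjI u allI impI)
  show "Enorm (%x. u x - g x)<e"
  proof -
   have "Enorm (%x. u x - f x)<e/2" using n by (simp only: u_def t_def)
   moreover have "Enorm (%x. f x - g x)<e/2" using k by (simp only: f_def)
   ultimately show ?thesis using Enorm_diff_triangle[OF u(1) f(1) g] by linarith
  qed
  fix h assume h:"0<h&h<t/4"
  have "nrm (%x. u x - Q h u x)<=8 * h/t * nrm f" unfolding u_def using h by (intro Q_generator_bound F_L2 f) auto
  then have "(nrm (%x. u x - Q h u x))^2<=(8 * h/t * nrm f)^2" by (intro power_mono L2_norm_nonneg)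
  moreover have "(nrm (%x. u x - Q h u x))^2=(\<integral>x. (u x - Q h u x)^2 \<partial>mu)"
   by (simp add:L2_norm_def L2_inner_def power2_eq_square[symmetric])
  ultimately have le:"(\<integral>x. (u x - Q h u x)^2 \<partial>mu)/h^2<=(8 * h/t * nrm f)^2/h^2" by (intro divide_right_mono) auto
  have e3:"(\<integral>x. ((u x - Q h u x)/h)^2 \<partial>mu)=(\<integral>x. (u x - Q h u x)^2 \<partial>mu)/h^2" by (simp add:power_divide)
  have e4:"(8 * h/t * nrm f)^2/h^2=(8/t * nrm f)^2" using h by (simp add:power_divide power_mult_distrib)
  show "(\<integral>x. ((u x - Q h u x)/h)^2 \<partial>mu)<=(8/t * nrm f)^2" unfolding e3 using le unfolding e4 .
 qed (use t in auto)
 then show ?thesis by blast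
qed

lemma lincomb_Q:
 assumes h:"h>0" and u:"!!a. a<n==>u a:bdf"
 shows "Q h (lcf n c u) x=(\<Sum>a<n. c a * Q h (u a) x)" using u
proof (induction n)
 case 0
 then show ?case by (simp add:lcf_def Q_def)
next
 case (Suc n)
 then have "Q h (%y. 1 * lcf n c u y + c n * u n y) x=1 * Q h (lcf n c u) x + c n * Q h (u n) x" by (intro Q_lin h lcf_bdd) auto
 then show ?case unfolding lcf_Suc using Suc by simp
qed

lemma unit_square_le:"unitc n c==>(\<Sum>a<n. c a * w a)\<^sup>2<=(\<Sum>a<n. (w a)^2)"
 using Cauchy_Schwarz_ineq_sum[of c w "{..<n}"] by (simp add:unitc_def)

end

context hke_space
begin

text \<open>\<open>small_energy_cover\<close> provides on each ball a unit combination of small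
  energy, and comparability carries the smallness over to \<open>g 0\<close>. Summing over the cover
  bounds the energy \<open>al\<close> of \<open>g 0\<close> on a compact part of the set by a
  fraction of itself.\<close>

lemma energy_zero_of_comparable:
 obtains K0 :: nat where
  "!!n g A. n>K0==>(!!a. a<n==>g a:F)==>A:sets borel ==>
   (!!c c' S. unitc n c==>unitc n c'==>S:sets borel==>S \<subseteq> A ==>
   eg (lcf n c g) S<=3 * eg (lcf n c' g) S)==>eg (g 0) A=0"
proof -
 obtain L K where L:"L>=1" and K:"K>0" and PI:"!!x0 s u. s>0==>u:F==>u:bdf ==>
   V x0 s * (\<integral>x. ib x0 s x * (u x)^2 \<partial>mu)-(\<integral>x. ib x0 s x * u x \<partial>mu)\<^sup>2<=K * Ps s * V x0 s * en u (ball x0 (L * s))"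
  by (rule poincare) (rule that)
 \<comment> \<open>In the end \<open>al\<close> is at most
   \<open>6 (mm U / 144 + al / 48) + al / 8\<close>, where
   \<open>mm U <= 6 al + 2 be + 2 \<gamma>\<close>, \<open>be < al\<close> and
   \<open>\<gamma> <= al / 48\<close>; this is less than \<open>al\<close>.\<close>
 have eta:"(1/144 :: real)>0" by simp
 show ?thesis
 proof (rule small_energy_cover[OF L K PI eta])
 fix Kd :: nat
 assume cover:
  "!!G mm W h0 Om Om2 A U rh0 \<theta>.
   (!!Y S N. finite Y==>(!!y. y:Y==>S y:sets borel)==>(!!y. y:Y==>S y \<subseteq> U) ==>
   (!!x. (SUM y:Y. ind (S y) x)<=N)==>(SUM y:(Y :: 'a set). mm (S y))<=N * mm U)==>mm U>=0==>G \<subseteq> F Int bdf ==>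
   (!!v S. v:G==>S:sets borel==>en v S<=mm S) ==>
   (!!v. v:G==>(\<integral>x. (v x)^2 \<partial>mu)<=Om2)==>h0>0 ==>
   (!!h. 0<h==>h<h0==>W h:borel_measurable mu&integrable mu (W h)&(\<integral>x. W h x \<partial>mu)<=Om
   &(ALL v:G. ALL x. ((v x - Q h v x)/h)^2<=W h x)) ==>
   (!!C. finite C==>card C<=Kd==>EX v:G. \<forall>(y,s)\<in>C. zero_mean v y s) ==>
   compact A==>A~={}==>U:sets borel==>rh0>0==>(!!x. x:A==>ball x rh0 \<subseteq> U)==>\<theta>>0 ==>
   EX r>0. EX Z v. finite Z&A \<subseteq> (\<Union>z\<in>Z. ball z (r/2))&(ALL y. (SUM z:Z. ib z (r/2) y)<=16 ^ dq)
   &(ALL z:Z. v z:G)&(SUM z:Z. en (v z) (ball z (r/2)))<=1/144 * mm U + \<theta>"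
 show thesis
 proof (rule that[of Kd])
  fix n :: nat and g and A0 :: "'a set"
  assume n:"n>Kd" and g:"!!a. a<n==>g a:F" and A0:"A0:sets borel"
   and comp0:"!!c c' S. unitc n c==>unitc n c'==>S:sets borel==>S \<subseteq> A0 ==>
   eg (lcf n c g) S<=3 * eg (lcf n c' g) S"
  have n0:"0<n" using n by simp
  have g0:"lcf n (%a. if a=0 then 1 else 0) g=g 0" using n0 by (simp add:lcf_def if_distrib[of "%c. c * _"] cong: if_cong)
  have u0:"unitc n (%a. if a=0 then 1 else 0)" using n0 by (simp add:unitc_def if_distrib[of "%c. c^2"] cong: if_cong)
  show "eg (g 0) A0=0"
  proof (rule ccontr)
   assume ne:"eg (g 0) A0~=0"
   let ?M = "%a. energy_measure E F (g a)"
   have Ms:"sets (?M a)=sets borel" and Mf:"finite_measure (?M a)" and Me:"!!B. B:sets borel==>measure (?M a) B=eg (g a) B" if "a<n" for a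
   using energy_measure_eq[OF g[OF that]] by auto
   interpret M0: finite_measure "?M 0" by (rule Mf[OF n0])
   have "measure (?M 0) A0>0" using ne eg_nonneg[OF g[OF n0] A0] Me[OF n0 A0] by simp
   then have "emeasure (?M 0) A0>0" by (simp add:M0.emeasure_eq_measure)
   also have "emeasure (?M 0) A0=(SUP K\<in>{K. K \<subseteq> A0&compact K}. emeasure (?M 0) K)"
   by (rule inner_regular[OF Ms[OF n0] _ A0]) (simp add:M0.emeasure_eq_measure)
   finally obtain A where A:"A \<subseteq> A0" "compact A" "emeasure (?M 0) A>0" by (auto simp:less_SUP_iff)
   have Ab:"A:sets borel" using A(2) by (simp add:borel_closed compact_imp_closed)
   define al where "al=eg (g 0) A"
   have al:"al>0" using A(3) Me[OF n0 Ab] by (simp add:al_def M0.emeasure_eq_measure)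
   have Ane:"A~={}" using A(3) by auto
   have comp:"eg (lcf n c g) S<=3 * eg (lcf n c' g) S"
   if "unitc n c" "unitc n c'" "S:sets borel" "S \<subseteq> A" for c c' S
   using comp0 that A(1) by blast
   \<comment> \<open>Open neighbourhoods shrinking to \<open>A\<close>, so that the energies of all
     \<open>g a\<close> on \<open>U j - A\<close>, where comparability is unknown, add up to less
     than \<open>al\<close>.\<close>
   define U where "U j=(\<Union>x\<in>A. ball x (1/real (Suc j)))" for j
   have Uo:"U j:sets borel" for j unfolding U_def by (intro borel_open open_UN) auto
   have Uempty:"(\<Inter>j. U j - A)={}"
   proof -
   have "y:closure A" if yU:"!!j. y:U j" for y
   proof (rule closure_approachable[THEN iffD2], intro allI impI)
   fix e :: real assume "e>0"
   then obtain j where "1/real (Suc j)<e" using nat_approx_posE by blast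
   moreover obtain x where "x:A" "dist x y<1/real (Suc j)" using yU[of j] by (auto simp:U_def)
   ultimately show "EX x:A. dist x y<e" by force
   qed
   then show ?thesis using A(2) by (auto simp:closure_closed compact_imp_closed)
   qed
   have Udec:"decseq (%j. U j - A)"
   proof (rule decseq_SucI)
   fix j
   have "ball x (1/real (Suc (Suc j))) \<subseteq> ball x (1/real (Suc j))" for x :: 'a by (intro subset_ball) (simp add:frac_le)
   then show "U (Suc j) - A \<subseteq> U j - A" unfolding U_def by blast
   qed
   have "(%j. measure (?M a) (U j - A)) ----> 0" if "a<n" for a
   proof -
   have "range (%j. U j - A) \<subseteq> sets (?M a)" unfolding Ms[OF that] using Uo Ab by auto
   from finite_measure.finite_Lim_measure_decseq[OF Mf[OF that] this Udec] show ?thesis unfolding Uempty measure_empty .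
   qed
   then have "(%j. \<Sum>a<n. measure (?M a) (U j - A)) ----> (\<Sum>a<n. 0)" by (intro tendsto_sum) auto
   then have "\<forall>\<^sub>F j in sequentially. (\<Sum>a<n. measure (?M a) (U j - A))<al" using al by (intro order_tendstoD(2)) auto
   then obtain j where j:"(\<Sum>a<n. measure (?M a) (U j - A))<al" by (auto simp:eventually_sequentially)
   define be where "be=(\<Sum>a<n. eg (g a) (U j - A))"
   have be:"be<al" using j Me Uo Ab by (simp add:be_def)
   define \<gamma> where "\<gamma>=al/(48*16 ^ dq)"
   have \<gamma>: "\<gamma>>0" "16 ^ dq * \<gamma>=al/48" using al by (simp_all add: \<gamma>_def)
   have "1 * \<gamma><=16 ^ dq * \<gamma>" using \<gamma>(1) by (intro mult_right_mono) (auto simp:one_le_power)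
   then have \<gamma>2:"\<gamma><=al/48" unfolding \<gamma>(2) by simp
   \<comment> \<open>Makes the energies of the \<open>n\<close> differences \<open>u a - g a\<close>
     add up to at most \<open>\<gamma>\<close>.\<close>
   define e where "e=sqrt (\<gamma>/real n)"
   have e:"e>0" using \<gamma> n0 by (simp add:e_def)
   have "ALL a. EX T. a<n-->special (g a) e (fst T) (fst (snd T)) (snd (snd T))" using special_exists[OF g e] by (metis fst_conv snd_conv)
   from choice[OF this] obtain T where T:"!!a. a<n==>special (g a) e (fst (T a)) (fst (snd (T a))) (snd (snd (T a)))" by blast
   define u where "u a=fst (T a)" for a
   define H where "H a=fst (snd (T a))" for a
   define hh where "hh a=snd (snd (T a))" for a
   have u:"u a:F" "u a:bdf" "hh a>0" "Enorm (%x. u a x - g a x)<e"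
   "!!h. 0<h==>h<hh a==>(\<integral>x. ((u a x - Q h (u a) x)/h)^2 \<partial>mu)<=H a" if "a<n" for a
   using T[OF that] unfolding special_def u_def H_def hh_def by auto
   define d where "d a=(%x. u a x - g a x)" for a
   have d:"d a:F" if "a<n" for a unfolding d_def by (intro F_diff u g that)
   have Ed:"E (d a) (d a)<=\<gamma>/real n" if "a<n" for a
   proof -
   have "sqrt (E (d a) (d a))<sqrt (\<gamma>/real n)" using u(4)[OF that] by (simp add:Enorm_def d_def e_def)
   then show ?thesis by (simp add:real_sqrt_less_iff)
   qed
   have dsum:"(\<Sum>a<n. eg (d a) S)<=\<gamma>" if "S:sets borel" for S
   proof -
   have "(\<Sum>a<n. eg (d a) S)<=(\<Sum>a<n. \<gamma>/real n)" using eg_le_E[OF d that] Ed by (intro sum_mono) (auto intro: order_trans)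
   then show ?thesis using n0 by simp
   qed
   have lu:"lcf n c u:F" "lcf n c u:bdf" for c by (intro lcf_F lcf_bdd u; simp)+
   have lg:"lcf n c g:F" "lcf n c d:F" for c by (intro lcf_F g d; simp)+
   \<comment> \<open>Majorizes the energy of every unit combination of the \<open>u a\<close>: 6 is
     2, for splitting off \<open>d = u - g\<close>, times 3, for comparability with
     \<open>g 0\<close> on \<open>A\<close>. The intersection with \<open>UNIV\<close> matches the
     shape of \<open>eg_overlap\<close>.\<close>
   define mm where "mm S=6 * eg (g 0) (S Int A)+2*(\<Sum>a<n. eg (g a) (S Int (- A)))+2*(\<Sum>a<n. eg (d a) (S Int UNIV))" for S
   define G where "G={lcf n c u | c. unitc n c}"
   define h0 where "h0=Min (hh ` {..<n})"
   \<comment> \<open>By Cauchy-Schwarz this dominates the squared difference quotient of every unit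
     combination at once.\<close>
   define W where "W h x=(\<Sum>a<n. ((u a x - Q h (u a) x)/h)^2)" for h x
   have enlc:"en (lcf n c u) S<=mm S" if c:"unitc n c" and S:"S:sets borel" for c S
   proof -
   have "en (lcf n c u) S=eg (lcf n c u) S" using eg_bounded[OF _ S] lu by simp
   also have "eg (lcf n c u) S<=2 * eg (lcf n c g) S+2 * eg (lcf n c d) S"
   proof -
   have e:"lcf n c u=(%x. 1 * lcf n c g x+1 * lcf n c d x)" by (rule ext) (simp add:lcf_def d_def sum.distrib[symmetric] algebra_simps)
   show ?thesis unfolding e by (intro eg_add_le lg S) auto
   qed
   also have "eg (lcf n c g) S=eg (lcf n c g) ((S Int A) Un (S Int (- A)))" by (rule arg_cong[where f="eg _"]) blast
   also have "...=eg (lcf n c g) (S Int A) + eg (lcf n c g) (S Int (- A))" using S Ab by (intro eg_additive lg) auto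
   also have "2 * ... + 2 * eg (lcf n c d) S<=2*(3 * eg (g 0) (S Int A)+(\<Sum>a<n. eg (g a) (S Int (- A))))+2*(\<Sum>a<n. eg (d a) S)"
   using S Ab comp[OF c u0, of "S Int A"] by (intro add_mono mult_left_mono eg_lincomb_le g d c) (auto simp:g0)
   finally show ?thesis by (simp add:mm_def)
   qed
   have mmU:"mm (U j)<=6 * al+2 * be+2 * \<gamma>"
   proof -
   have "A \<subseteq> U j" by (auto simp:U_def)
   then have "U j Int A=A" by blast
   then show ?thesis using dsum[OF Uo[of j]] by (simp add:mm_def al_def be_def Diff_eq)
   qed
   have "EX r>0. EX Z v. finite Z&A \<subseteq> (\<Union>z\<in>Z. ball z (r/2))&(ALL y. (SUM z:Z. ib z (r/2) y)<=16 ^ dq)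
   &(ALL z:Z. v z:G)&(SUM z:Z. en (v z) (ball z (r/2)))<=1/144 * mm (U j) + al/48"
   proof (rule cover[where W=W and Om="\<Sum>a<n. H a" and ?Om2.0="\<Sum>a<n. \<integral>x. (u a x)^2 \<partial>mu" and ?h0.0=h0 and ?rh0.0="1/real (Suc j)"])
   show "(SUM y:Y. mm (S y))<=N * mm (U j)"
   if Y:"finite (Y :: 'a set)" and S:"!!y. y:Y==>S y:sets borel" "!!y. y:Y==>S y \<subseteq> U j" and N:"!!x. (SUM y:Y. ind (S y) x)<=N"
   for Y S N
   proof -
   note ov = eg_overlap[OF _ Y S Uo _ N]
   have "(SUM y:Y. mm (S y))=6*(SUM y:Y. eg (g 0) (S y Int A))+2*(\<Sum>a<n. SUM y:Y. eg (g a) (S y Int (- A)))+2*(\<Sum>a<n. SUM y:Y. eg (d a) (S y Int UNIV))"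
   unfolding mm_def by (simp only: sum.distrib sum_distrib_left[symmetric] sum.swap[of _ "{..<n}" Y])
   also have "...<=6*(N * eg (g 0) (U j Int A))+2*(\<Sum>a<n. N * eg (g a) (U j Int (- A)))+2*(\<Sum>a<n. N * eg (d a) (U j Int UNIV))"
   using Ab n0 by (intro add_mono mult_left_mono sum_mono ov g d) auto
   also have "...=N * mm (U j)" unfolding mm_def by (simp only: sum_distrib_left[symmetric] distrib_left mult.left_commute)
   finally show ?thesis .
   qed
   show "0<=mm (U j)" unfolding mm_def using Uo Ab n0 by (intro add_nonneg_nonneg mult_nonneg_nonneg sum_nonneg eg_nonneg g d) auto
   show "G \<subseteq> F Int bdf" using lu by (auto simp:G_def)
   show "en v S<=mm S" if "v:G" "S:sets borel" for v S using that enlc by (auto simp:G_def)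
   show "(\<integral>x. (v x)^2 \<partial>mu)<=(\<Sum>a<n. \<integral>x. (u a x)^2 \<partial>mu)" if vG:"v:G" for v
   proof -
   obtain c where c:"unitc n c" "v=lcf n c u" using vG by (auto simp:G_def)
   have ui:"integrable mu (%x. (u a x)^2)" if "a<n" for a by (intro L2_integrable_square F_L2 u that)
   have "(\<integral>x. (v x)^2 \<partial>mu)<=(\<integral>x. (\<Sum>a<n. (u a x)^2) \<partial>mu)" unfolding c(2)
   proof (rule integral_mono)
   show "integrable mu (%x. (lcf n c u x)^2)" by (intro L2_integrable_square F_L2 lu)
   show "(lcf n c u x)^2<=(\<Sum>a<n. (u a x)^2)" for x unfolding lcf_def by (rule unit_square_le[OF c(1)])
   qed (use ui in auto)
   also have "...=(\<Sum>a<n. \<integral>x. (u a x)^2 \<partial>mu)" using ui by (intro Bochner_Integration.integral_sum) auto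
   finally show ?thesis .
   qed
   show "0<h0" unfolding h0_def using u(3) n0 by (subst Min_gr_iff) auto
   show "W h:borel_measurable mu&integrable mu (W h)&(\<integral>x. W h x \<partial>mu)<=(\<Sum>a<n. H a)
   &(ALL v:G. ALL x. ((v x - Q h v x)/h)^2<=W h x)" if h:"0<h" "h<h0" for h
   proof -
   have ha:"h<hh a" if "a<n" for a
   proof -
   have "h0<=hh a" unfolding h0_def using that by (intro Min_le) auto
   then show ?thesis using h by simp
   qed
   have wi:"integrable mu (%x. ((u a x - Q h (u a) x)/h)^2)" if "a<n" for a
   proof -
   have uL:"u a:L2 mu" by (rule F_L2[OF u(1)[OF that]])
   have "(%x. 1/h * (u a x - Q h (u a) x)):L2 mu" by (intro L2_cmult L2_diff Q_L2 uL h)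
   then show ?thesis using L2_integrable_square by fastforce
   qed
   have Wi:"integrable mu (W h)" unfolding W_def[abs_def] using wi by auto
   have "(\<integral>x. W h x \<partial>mu)=(\<Sum>a<n. \<integral>x. ((u a x - Q h (u a) x)/h)^2 \<partial>mu)"
   unfolding W_def using wi by (intro Bochner_Integration.integral_sum) auto
   also have "...<=(\<Sum>a<n. H a)" using u(5) h ha by (intro sum_mono) auto
   finally have WH:"(\<integral>x. W h x \<partial>mu)<=(\<Sum>a<n. H a)" .
   have "((v x - Q h v x)/h)^2<=W h x" if vG:"v:G" for v x
   proof -
   obtain c where c:"unitc n c" "v=lcf n c u" using vG by (auto simp:G_def)
   have Qv:"Q h v x=(\<Sum>a<n. c a * Q h (u a) x)" unfolding c(2) by (intro lincomb_Q h u(2))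
   have "(v x - Q h v x)/h=(\<Sum>a<n. c a * ((u a x - Q h (u a) x)/h))"
   unfolding Qv by (simp add:c(2) lcf_def sum_subtractf[symmetric] sum_divide_distrib right_diff_distrib)
   then show ?thesis unfolding W_def using unit_square_le[OF c(1), of "%a. (u a x - Q h (u a) x)/h"] by simp
   qed
   then show ?thesis using Wi WH by auto
   qed
   show "EX v:G. \<forall>(y,s)\<in>C. zero_mean v y s" if C:"finite C" "card C<=Kd" for C
   proof -
   \<comment> \<open>At most \<open>Kd < n\<close> linear conditions on \<open>n\<close>
     coefficients; the solution is normalized below.\<close>
   obtain l where l:"EX a:{..<n}. l a~=0" "ALL y:C. (SUM a:{..<n}. l a * (\<integral>x. ib (fst y) (snd y) x * u a x \<partial>mu))=0"
   using kernel_exists[of C "{..<n}" "%y a. \<integral>x. ib (fst y) (snd y) x * u a x \<partial>mu"] C n by auto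
   define N where "N=sqrt (\<Sum>a<n. (l a)^2)"
   have N2:"(\<Sum>a<n. (l a)^2)>0"
   proof -
   obtain a where "a<n" "l a~=0" using l(1) by auto
   then show ?thesis by (intro sum_pos2[of _ a]) auto
   qed
   have N:"N>0" "N^2=(\<Sum>a<n. (l a)^2)" using N2 by (auto simp:N_def)
   define c where "c a=l a/N" for a
   have "unitc n c" using N N2 by (simp add:unitc_def c_def power_divide sum_divide_distrib[symmetric])
   then have "lcf n c u:G" by (auto simp:G_def)
   moreover have "zero_mean (lcf n c u) y s" if "(y,s):C" for y s
   proof -
   have "(\<integral>x. ib y s x * lcf n c u x \<partial>mu)=(\<integral>x. (\<Sum>a<n. c a * (ib y s x * u a x)) \<partial>mu)"
   by (simp add:lcf_def sum_distrib_left mult.left_commute)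
   also have "...=(\<Sum>a<n. c a * (\<integral>x. ib y s x * u a x \<partial>mu))"
   using ball_int[OF u(2)] by (subst Bochner_Integration.integral_sum) auto
   also have "...=(\<Sum>a<n. l a * (\<integral>x. ib y s x * u a x \<partial>mu))/N" by (simp add:c_def sum_divide_distrib)
   also have "...=0" using l(2) that by force
   finally show ?thesis by (simp add:zero_mean_def)
   qed
   ultimately show ?thesis by blast
   qed
   show "ball x (1/real (Suc j)) \<subseteq> U j" if "x:A" for x using that by (auto simp:U_def)
   qed (use A(2) Ane Uo al in auto)
   then obtain r Z v where r:"r>0" and Z:"finite Z" "A \<subseteq> (\<Union>z\<in>Z. ball z (r/2))" and ov:"!!y. (SUM z:Z. ib z (r/2) y)<=16 ^ dq"
   and vG:"!!z. z:Z==>v z:G" and small:"(SUM z:Z. en (v z) (ball z (r/2)))<=1/144 * mm (U j) + al/48"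
   by blast
   let ?B = "%z. ball z (r/2)"
   \<comment> \<open>Comparability in the other direction: \<open>g 0\<close> against the
     combination chosen for this ball, followed by the passage from \<open>g\<close> back to
     \<open>u\<close>.\<close>
   have single:"eg (g 0) (?B z Int A)<=6 * en (v z) (?B z)+6*(\<Sum>a<n. eg (d a) (?B z))" if z:"z:Z" for z
   proof -
   obtain c where c:"unitc n c" "v z=lcf n c u" using vG[OF z] by (auto simp:G_def)
   have BA:"?B z Int A:sets borel" using Ab by auto
   have "eg (g 0) (?B z Int A)<=3 * eg (lcf n c g) (?B z Int A)" using comp[OF u0 c(1) BA] by (simp add:g0)
   also have "eg (lcf n c g) (?B z Int A)<=eg (lcf n c g) (?B z)" using BA by (intro eg_mono lg) auto
   also have "lcf n c g=(%x. 1 * lcf n c u x+(- 1) * lcf n c d x)" by (rule ext) (simp add:lcf_def d_def sum_subtractf[symmetric] algebra_simps)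
   also have "eg ... (?B z)<=2 * eg (lcf n c u) (?B z)+2 * eg (lcf n c d) (?B z)" by (intro eg_add_le lg lu) auto
   also have "eg (lcf n c d) (?B z)<=(\<Sum>a<n. eg (d a) (?B z))" by (intro eg_lincomb_le d c) auto
   also have "eg (lcf n c u) (?B z)=en (v z) (?B z)" using eg_bounded lu c(2) by simp
   finally show ?thesis by simp
   qed
   have "al<=(SUM z:Z. eg (g 0) (?B z Int A))"
   proof -
   have e:"(\<Union>z\<in>Z. ?B z Int A)=A" using Z(2) by blast
   have "(%z. ?B z Int A) ` Z \<subseteq> sets (?M 0)" unfolding Ms[OF n0] using Ab by auto
   from M0.finite_measure_subadditive_finite[OF Z(1) this]
   have "measure (?M 0) A<=(SUM z:Z. measure (?M 0) (?B z Int A))" unfolding e .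
   then show ?thesis using Me[OF n0] Ab by (simp add:al_def)
   qed
   also have "...<=(SUM z:Z. 6 * en (v z) (?B z)+6*(\<Sum>a<n. eg (d a) (?B z)))" by (intro sum_mono single)
   also have "...=6*(SUM z:Z. en (v z) (?B z))+6*(\<Sum>a<n. SUM z:Z. eg (d a) (?B z))"
   by (simp only: sum.distrib sum_distrib_left[symmetric] sum.swap[of _ "{..<n}" Z])
   also have "(\<Sum>a<n. SUM z:Z. eg (d a) (?B z))<=(\<Sum>a<n. 16 ^ dq * eg (d a) UNIV)"
   proof (rule sum_mono)
   fix a assume "a:{..<n}"
   then have "d a:F" using d by simp
   from eg_overlap[OF this Z(1), of ?B UNIV UNIV "16 ^ dq"] ov
   show "(SUM z:Z. eg (d a) (?B z))<=16 ^ dq * eg (d a) UNIV" by simp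
   qed
   also have "...=16 ^ dq * (\<Sum>a<n. eg (d a) UNIV)" by (simp add:sum_distrib_left)
   also have "...<=16 ^ dq * \<gamma>" by (intro mult_left_mono dsum) auto
   finally have "al<=6*(SUM z:Z. en (v z) (?B z))+6*(16 ^ dq * \<gamma>)" by simp
   then show False using small mmU be \<gamma> \<gamma>2 al by simp
  qed
 qed
 qed
qed

end

section \<open>Consequences of the hypotheses\<close>

lemma RN_real:
 assumes nu:"sigma_finite_measure nu" and N:"finite_measure N" "absolutely_continuous nu N" "sets N=sets nu"
 shows "EX D. D:borel_measurable nu&integrable nu D&(ALL A:sets nu. measure N A=(\<integral>x. ind A x * D x \<partial>nu))"
proof -
 interpret sigma_finite_measure nu by (rule nu)
 interpret N: finite_measure N by (rule N(1))
 obtain D where D:"D:borel_measurable nu" "AE x in nu. RN_deriv nu N x=ennreal (D x)" "!!x. 0<=D x"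
  by (rule real_RN_deriv[OF N]) (rule that; (assumption | blast))
 have "N=density nu (RN_deriv nu N)" by (rule density_RN_deriv[OF N(2,3), symmetric])
 also have "...=density nu (%x. ennreal (D x))" using D by (intro density_cong) auto
 finally have e:"N=density nu (%x. ennreal (D x))" .
 have m:"emeasure N A=(\<integral>\<^sup>+x. ennreal (ind A x * D x) \<partial>nu)" if A:"A:sets nu" for A
  unfolding e using A D by (subst emeasure_density) (auto intro!: nn_integral_cong simp:indicator_def)
 have i:"integrable nu (%x. ind A x * D x)" if A:"A:sets nu" for A
 proof (rule integrableI_nonneg)
  show "(\<integral>\<^sup>+x. ennreal (ind A x * D x) \<partial>nu)<\<infinity>" unfolding m[OF A, symmetric] by (simp add:N.emeasure_eq_measure)
 qed (use A D in auto)
 have "measure N A=(\<integral>x. ind A x * D x \<partial>nu)" if A:"A:sets nu" for A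
  unfolding measure_def m[OF A] using D A by (intro integral_eq_nn_integral[symmetric]) auto
 moreover have "integrable nu D"
 proof -
  have "integrable nu (%x. ind (space nu) x * D x)" by (rule i) auto
  then show ?thesis by (rule Bochner_Integration.integrable_cong[THEN iffD1, rotated 2]) auto
 qed
 ultimately show ?thesis using D(1) by blast
qed

lemma AE_nonneg_of_integrals:
 fixes g :: "'a=>real"
 assumes g:"integrable M g" and nn:"!!A. A:sets M==>0<=(\<integral>x. ind A x * g x \<partial>M)"
 shows "AE x in M. 0<=g x"
proof -
 define A where "A={x:space M. g x<0}"
 have A:"A:sets M" unfolding A_def using g by measurable
 have i:"integrable M (%x. ind A x * g x)" using integrable_real_mult_indicator[OF A g] by (simp add:mult.commute)
 have "(\<integral>x. - (ind A x * g x) \<partial>M)=0 \<longleftrightarrow> (AE x in M. - (ind A x * g x)=0)"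
  using i by (intro integral_nonneg_eq_0_iff_AE) (auto simp:A_def indicator_def)
 moreover have "(\<integral>x. - (ind A x * g x) \<partial>M)=0"
 proof (rule antisym)
  show "(\<integral>x. - (ind A x * g x) \<partial>M)<=0" using nn[OF A] by simp
  show "0<=(\<integral>x. - (ind A x * g x) \<partial>M)" by (intro Bochner_Integration.integral_nonneg_AE) (auto simp:A_def indicator_def)
 qed
 ultimately have "AE x in M. - (ind A x * g x)=0" by simp
 then show ?thesis by (rule AE_mp) (auto intro!: AE_I2 simp:A_def indicator_def split: if_splits)
qed

lemma scale_function_facts:
 assumes "scale_function Ps"
 obtains C be1 be2 where "be1>1" "be2>1" "C>1"
  "!!r R. 0<r==>r<=R==>(R/r) powr be1<=C * (Ps R/Ps r)"
  "!!r R. 0<r==>r<=R==>Ps R/Ps r<=C * (R/r) powr be2"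
  "!!r. r>0==>Ps r>0" "!!t. t>0==>EX s>0. Ps s=t" "!!r. r>0==>scale_inv Ps (Ps r)=r"
proof -
 obtain Ps' where h:"homeomorphism {0..} {0..} Ps Ps'" using assms by (auto simp:scale_function_def)
 obtain be1 be2 C where b:"1<be1" "be1<be2" "1<C" and
  g:"!!r R. 0<r&r<=R==>inverse C * (R/r) powr be1<=Ps R/Ps r&Ps R/Ps r<=C * (R/r) powr be2"
  using assms unfolding scale_function_def by blast
 have img:"Ps ` {0..}={0..}" and inv:"!!r. r>=0==>Ps' (Ps r)=r" using h by (auto simp:homeomorphism_def)
 have inj:"inj_on Ps {0..}" by (rule inj_on_inverseI[where g=Ps']) (simp add:inv)
 have nn:"Ps r>=0" if "r>=0" for r using img that by (metis atLeast_iff imageI)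
 have pos:"Ps r>0" if "r>0" for r
 proof -
  \<comment> \<open>If \<open>Ps r\<close> were 0, the quotient would be 0 by the convention for
    division, hence below \<open>inverse C\<close>.\<close>
  have "inverse C<=Ps r/Ps r" using g[of r r] that by simp
  then have "Ps r~=0" using b(3) by auto
  then show ?thesis using nn[of r] that by simp
 qed
 have zero:"Ps 0=0"
 proof -
  obtain s where s:"s>=0" "Ps s=0" using img by (metis atLeast_iff image_iff order_refl)
  then have "s=0" using pos[of s] by fastforce
  then show ?thesis using s by simp
 qed
 show ?thesis
 proof (rule that[of be1 be2 C])
  show "1<be2" using b by simp
  show "(R/r) powr be1<=C * (Ps R/Ps r)" if "0<r" "r<=R" for r R
  proof -
   have "C * (inverse C * (R/r) powr be1)<=C * (Ps R/Ps r)" using g[of r R] that b(3) by (intro mult_left_mono) auto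
   moreover have "C * (inverse C * (R/r) powr be1)=(R/r) powr be1" using b(3) by (simp add:mult.assoc[symmetric])
   ultimately show ?thesis by simp
  qed
  show "Ps R/Ps r<=C * (R/r) powr be2" if "0<r" "r<=R" for r R using g[of r R] that by simp
  show "EX s>0. Ps s=t" if t:"t>0" for t
  proof -
   have "t:Ps ` {0..}" using img t by auto
   then obtain s where s:"s>=0" "Ps s=t" by auto
   then have "s~=0" using zero t by auto
   then show ?thesis using s by (intro exI[of _ s]) auto
  qed
  show "scale_inv Ps (Ps r)=r" if "r>0" for r using that by (intro inv_into_f_f inj) auto
 qed (use b pos in auto)
qed

text \<open>A real supremum is usable only for a bounded set. For small \<open>rh\<close> put
  \<open>X = 1 / rh\<close>: the subtracted term is at least \<open>X powr be1 / D\<close>, so the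
  difference is nonpositive unless \<open>X powr (be1 - 1) < s * D\<close>, which forces
  \<open>X <= b\<close>.\<close>

lemma scale_conjugate_ge:
 assumes s:"s>=0" and r:"r>0" and be1:"be1>1" and C:"C>1" and pos:"!!r. r>0==>Ps r>0"
  and g:"!!r R. 0<r==>r<=R==>(R/r) powr be1<=C * (Ps R/Ps r)"
 shows "s/r-1/Ps r<=scale_conjugate Ps s" unfolding scale_conjugate_def
proof (rule cSUP_upper)
 define D where "D=C * Ps 1"
 have D:"D>0" using C pos[of 1] by (simp add:D_def)
 define b where "b=(s * D) powr (1/(be1-1))"
 have b:"b>=0" by (simp add:b_def)
 show "bdd_above ((%r. s/r-1/Ps r) ` {0<..})"
 proof (rule bdd_aboveI2)
  fix rh :: real assume "rh:{0<..}"
  then have rh:"rh>0" by simp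
  have P:"1/Ps rh>0" using pos[OF rh] by simp
  show "s/rh-1/Ps rh<=s * (1 + b)"
  proof (cases "rh>=1")
   case True
   then have "s/rh<=s/1" using s by (intro divide_left_mono) auto
   moreover have "s<=s * (1 + b)" using s b by (simp add:distrib_left)
   ultimately show ?thesis using P by linarith
  next
   case False
   define X where "X=1/rh"
   have X:"X>1" using False rh by (simp add:X_def)
   have "X powr be1<=C * (Ps 1/Ps rh)" using g[of rh 1] False rh by (simp add:X_def)
   then have "X powr be1<=D * (1/Ps rh)" by (simp add:D_def)
   then have lower:"X powr be1/D<=1/Ps rh" using D by (simp add:divide_le_eq mult.commute)
   have split:"X powr be1=X * X powr (be1-1)" using X powr_add[of X 1 "be1-1"] by simp
   show ?thesis
   proof (cases "s * D<=X powr (be1-1)")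
   case True
   then have "s<=X powr (be1-1)/D" using D by (simp add:le_divide_eq)
   then have "X * s<=X * (X powr (be1-1)/D)" using X by (intro mult_left_mono) auto
   then have "X * s<=1/Ps rh" using lower split by simp
   moreover have "s/rh=X * s" by (simp add:X_def)
   moreover have "s * (1 + b)>=0" using s b by simp
   ultimately show ?thesis by linarith
   next
   case False
   then have "X powr (be1-1)<=s * D" by simp
   then have "(X powr (be1-1)) powr (1/(be1-1))<=b" unfolding b_def using be1 by (intro powr_mono2) auto
   moreover have "(X powr (be1-1)) powr (1/(be1-1))=X" using X be1 by (simp add:powr_powr)
   ultimately have "X<=1 + b" by simp
   then have "s * X<=s * (1 + b)" using s by (intro mult_left_mono) auto
   moreover have "s/rh=s * X" by (simp add:X_def)
   ultimately show ?thesis using P by linarith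
   qed
  qed
 qed
qed (use r in auto)

text \<open>Local compactness makes a small ball around each point finite, and doubling propagates
  this to all radii; a power of 2 above the doubling constant gives the exponent.\<close>

lemma doubling_space_exists:
 assumes MMD:"MMD_space mu E F" and doubling:"doubling_measure mu"
 shows "EX dq. doubling_space mu dq"
proof -
 interpret MMD_space mu E F by (rule MMD)
 obtain C where C:"C>1" "!!x r. r>0==>emeasure mu (ball x (2 * r))<=ennreal C * emeasure mu (ball x r)"
  using doubling by (auto simp:doubling_measure_def)
 have sb:"sets mu=sets borel" and cf:"!!K. compact K==>emeasure mu K<\<infinity>" using radon by (auto simp:radon_measure_def)
 have fin:"emeasure mu (ball x r)<\<infinity>" for x r
 proof -
  obtain U K where UK:"open U" "compact K" "x:U" "U \<subseteq> K"
  proof -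
   have "ALL x::'a. EX U. open U&(EX K. compact K&x:U&U \<subseteq> K)" using locally_compact unfolding locally_compact_space_def by auto
   from this[rule_format, of x] show ?thesis using that by auto
  qed
  obtain e where e:"e>0" "ball x e \<subseteq> U" using UK(1,3) open_contains_ball by blast
  have "K:sets mu" using UK(2) sb by (simp add:borel_closed compact_imp_closed)
  then have e0:"emeasure mu (ball x e)<\<infinity>" using emeasure_mono[of "ball x e" K mu] e(2) UK(4) cf[OF UK(2)] by (auto intro: le_less_trans)
  have "emeasure mu (ball x (2 ^ k * e))<\<infinity>" for k
  proof (induction k)
   case (Suc k)
   have "emeasure mu (ball x (2*(2 ^ k * e)))<=ennreal C * emeasure mu (ball x (2 ^ k * e))" using e by (intro C) auto
   also have "...<\<infinity>" using Suc by (simp add:ennreal_mult_less_top)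
   finally show ?case by (simp add:mult.assoc)
  qed (use e0 in simp)
  moreover obtain k :: nat where "r/e<2 ^ k" using real_arch_pow[of 2 "r/e"] by auto
  then have "r<=2 ^ k * e" using e by (simp add:divide_less_eq)
  then have "emeasure mu (ball x r)<=emeasure mu (ball x (2 ^ k * e))" using sb by (intro emeasure_mono subset_ball) auto
  ultimately show ?thesis by (auto intro: le_less_trans)
 qed
 have mfin:"emeasure mu (ball x r)=ennreal (measure mu (ball x r))" for x r using fin[of x r] by (intro emeasure_eq_ennreal_measure) auto
 have pos:"measure mu (ball x r)>0" if r:"r>0" for x r
 proof -
  have "emeasure mu (ball x r)>0" using full_support r by (auto simp:full_support_def)
  then show ?thesis unfolding mfin by simp
 qed
 obtain dq :: nat where dq:"C<=2 ^ dq" using real_arch_pow[of 2 C] by (auto intro: less_imp_le)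
 have step:"measure mu (ball x (2 * r))<=2 ^ dq * measure mu (ball x r)" if r:"r>0" for x r
 proof -
  have "ennreal (measure mu (ball x (2 * r)))<=ennreal C * ennreal (measure mu (ball x r))" using C(2)[OF r, of x] unfolding mfin .
  then have "measure mu (ball x (2 * r))<=C * measure mu (ball x r)" using C(1) by (simp add:ennreal_mult[symmetric] ennreal_le_iff)
  also have "...<=2 ^ dq * measure mu (ball x r)" using dq by (intro mult_right_mono) auto
  finally show ?thesis .
 qed
 have iter:"measure mu (ball x (2 ^ k * r))<=(2 ^ k) ^ dq * measure mu (ball x r)" if r:"r>0" for x r k
 proof (induction k)
  case (Suc k)
  have "measure mu (ball x (2*(2 ^ k * r)))<=2 ^ dq * measure mu (ball x (2 ^ k * r))" using r by (intro step) auto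
  also have "...<=2 ^ dq * ((2 ^ k) ^ dq * measure mu (ball x r))" by (intro mult_left_mono Suc) auto
  also have "...=(2 ^ Suc k) ^ dq * measure mu (ball x r)" by (simp add:power_mult_distrib)
  finally show ?case by (simp add:mult.assoc)
 qed simp
 have growth:"measure mu (ball x R)<=(2 * R/r) ^ dq * measure mu (ball x r)" if r:"0<r" "r<=R" for x r R
 proof -
  \<comment> \<open>The first dyadic multiple of \<open>r\<close> that reaches \<open>R\<close>;
    minimality gives \<open>2 ^ k <= 2 R / r\<close>, the origin of the factor 2 in
    \<open>ball_growth\<close>.\<close>
  define k where "k=(LEAST k. R<=2 ^ k * r)"
  have ex:"EX k. R<=2 ^ k * r"
  proof -
   obtain k :: nat where "R/r<2 ^ k" using real_arch_pow[of 2 "R/r"] by auto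
   then show ?thesis using r by (intro exI[of _ k]) (simp add:divide_less_eq)
  qed
  have k1:"R<=2 ^ k * r" unfolding k_def by (rule LeastI_ex[OF ex])
  have k2:"2 ^ k<=2 * R/r"
  proof (cases k)
   case 0
   have "r<=2 * R" using r by simp
   then show ?thesis using 0 r by (simp add:le_divide_eq)
  next
   case (Suc l)
   then have "\<not> R<=2 ^ l * r" unfolding k_def by (intro not_less_Least) simp
   then have "2 ^ l * r<=R" by simp
   then show ?thesis using Suc r by (simp add:le_divide_eq)
  qed
  have "measure mu (ball x R)<=measure mu (ball x (2 ^ k * r))"
   using k1 sb fin by (intro measure_mono_fmeasurable subset_ball) (auto simp:fmeasurable_def)
  also have "...<=(2 ^ k) ^ dq * measure mu (ball x r)" by (rule iter[OF r(1)])
  also have "...<=(2 * R/r) ^ dq * measure mu (ball x r)" using k2 by (intro mult_right_mono power_mono) auto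
  finally show ?thesis .
 qed
 have "doubling_space mu dq" by unfold_locales (use sb fin pos growth in auto)
 then show ?thesis ..
qed

lemma hke_space_exists:
 assumes MMD:"MMD_space mu E F" and doubling:"doubling_measure mu" and scale:"scale_function Ps" and HKE:"HKE mu E F Ps"
 shows "EX P p dq Cs A a c dl C0 m. hke_space mu E F P p dq Ps Cs A a c dl C0 m"
proof -
 interpret MMD_space mu E F by (rule MMD)
 obtain dq where dq:"doubling_space mu dq" using doubling_space_exists[OF MMD doubling] ..
 interpret D: doubling_space mu dq by (rule dq)
 obtain C be1 be2 where b:"be1>1" "be2>1" "C>1"
  and lo:"!!r R. 0<r==>r<=R==>(R/r) powr be1<=C * (Ps R/Ps r)"
  and up:"!!r R. 0<r==>r<=R==>Ps R/Ps r<=C * (R/r) powr be2"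
  and pos:"!!r. r>0==>Ps r>0" and surj:"!!t. t>0==>EX s>0. Ps s=t" and inv:"!!r. r>0==>scale_inv Ps (Ps r)=r"
  by (rule scale_function_facts[OF scale]) (rule that)
 obtain C1 c1 c2 c3 dl p where cs:"C1>0" "c1>0" "c2>0" "c3>0" "dl>0" and hk:"heat_kernel mu E F p"
  and both:"ALL t>0. (AE x in mu. AE y in mu. p t x y<=C1/measure mu (ball x (scale_inv Ps t))
   * exp (- c1 * t * scale_conjugate Ps (c2*(dist x y/t)))) \<and>
   (AE x in mu. AE y in mu. dist x y<=dl * scale_inv Ps t-->p t x y>=c3/measure mu (ball x (scale_inv Ps t)))"
  using HKE unfolding HKE_def by (elim exE conjE) (rule that; assumption)
 have upper:"AE x in mu. AE y in mu. p t x y<=C1/measure mu (ball x (scale_inv Ps t))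
   * exp (- c1 * t * scale_conjugate Ps (c2*(dist x y/t)))" if "t>0" for t
  by (rule both[THEN spec, THEN mp, OF that, THEN conjunct1])
 have lower:"AE x in mu. AE y in mu. dist x y<=dl * scale_inv Ps t-->p t x y>=c3/measure mu (ball x (scale_inv Ps t))"
  if "t>0" for t by (rule both[THEN spec, THEN mp, OF that, THEN conjunct2])
 obtain P where P:"associated_semigroup mu E F P"
  "!!t f. t>0==>f:L2 mu==>AE x in mu. integrable mu (%y. p t x y * f y)&P t f x=(\<integral>y. p t x y * f y \<partial>mu)"
  using hk unfolding heat_kernel_def by blast
 have pm:"!!t. t>0==>(%(x,y). p t x y):borel_measurable borel" and pn:"!!t x y. t>0==>p t x y>=0" using hk by (auto simp:heat_kernel_def)
 have sb:"sets mu=sets borel" by (rule D.sets_borel)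
 have sf:"sigma_finite_measure mu"
 proof (unfold sigma_finite_measure_def, intro exI[of _ "range (%n. ball (undefined :: 'a) (real n))"] conjI)
  show "\<Union> (range (%n. ball (undefined :: 'a) (real n)))=space mu"
   using sets_eq_imp_space_eq[OF sb] reals_Archimedean2 by (auto simp:dist_commute)
  show "ALL a:range (%n. ball (undefined :: 'a) (real n)). emeasure mu a~=\<infinity>" using D.ball_finite by (auto simp:less_top)
  show "range (%n. ball (undefined :: 'a) (real n)) \<subseteq> sets mu" unfolding sb by (intro image_subsetI borel_open open_ball)
 qed simp
 have kf:"kernel_form mu E F P p"
 proof (intro kernel_form.intro semigroup_form.intro semigroup_form_axioms.intro kernel_form_axioms.intro sf dirichlet_form_axioms P(1))
  show "space mu=UNIV" using sets_eq_imp_space_eq[OF sb] by simp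
  show "(%(x,y). p t x y):borel_measurable (mu \<Otimes>\<^sub>M mu)" if "t>0" for t
  proof -
   have "sets (mu \<Otimes>\<^sub>M mu)=sets (borel \<Otimes>\<^sub>M (borel :: 'a measure))" by (intro sets_pair_measure_cong sb)
   also have "...=sets (borel :: ('a \<times> 'a) measure)" by (simp only: borel_prod)
   finally have "borel_measurable (mu \<Otimes>\<^sub>M mu)=(borel_measurable borel :: ('a \<times> 'a=>real) set)" by (intro measurable_cong_sets) auto
   then show ?thesis using pm[OF that] by simp
  qed
 qed (use pn P(2) in auto)
 have pr:"proper_metric TYPE('a)" by (rule proper_metric.intro) (rule D.compact_cball_doubling)
 have hks:"hk_space mu E F P p" by (intro hk_space.intro MMD kf pr)
 define m where "m=nat \<lceil>be2\<rceil>"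
 have mb:"be2<=real m" unfolding m_def by linarith
 have "hke_space_axioms mu p Ps C (C1 * exp c1) (c1 * c2) c3 (min dl 1) C m"
 proof
  fix r :: real assume r:"r>0"
  show "Ps r>0" by (rule pos[OF r])
  \<comment> \<open>Inserting the radius \<open>r\<close> itself into the supremum that defines the
    conjugate, at time \<open>Ps r\<close>, gives decay linear in \<open>dist x y / r\<close> at the
    price of a factor \<open>exp c1\<close>.\<close>
  have d1:"- c1 * Ps r * scale_conjugate Ps (c2*(dist x y/Ps r))<=c1 - c1 * c2 * dist x y/r" for x y :: 'a
  proof -
   have "c2*(dist x y/Ps r)/r-1/Ps r<=scale_conjugate Ps (c2*(dist x y/Ps r))"
   using cs(3) pos[OF r] by (intro scale_conjugate_ge[OF _ r b(1,3) pos lo]) auto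
   then have "c1 * Ps r * (c2*(dist x y/Ps r)/r-1/Ps r)<=c1 * Ps r * scale_conjugate Ps (c2*(dist x y/Ps r))"
   using cs(2) pos[OF r] by (intro mult_left_mono) auto
   moreover have "c1 * Ps r * (c2*(dist x y/Ps r)/r-1/Ps r)=c1 * c2 * dist x y/r - c1" using pos[OF r] r by (simp add:field_simps)
   ultimately show ?thesis by simp
  qed
  show "AE x in mu. AE y in mu. p (Ps r) x y<=C1 * exp c1/measure mu (ball x r) * exp (- (c1 * c2 * dist x y/r))"
   using upper[OF pos[OF r]] unfolding inv[OF r]
  proof eventually_elim
   case (elim x)
   then show ?case
   proof eventually_elim
   case (elim y)
   have V0:"measure mu (ball x r)>0" by (rule D.ball_pos[OF r])
   have "p (Ps r) x y<=C1/measure mu (ball x r) * exp (c1 - c1 * c2 * dist x y/r)"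
   using elim mult_left_mono[OF exp_le_cancel_iff[THEN iffD2, OF d1[of x y]], of "C1/measure mu (ball x r)"] cs(1) V0 by simp
   also have "...=C1 * exp c1/measure mu (ball x r) * exp (- (c1 * c2 * dist x y/r))" by (simp add:exp_diff exp_minus field_simps)
   finally show ?case .
   qed
  qed
  show "AE x in mu. AE y in mu. dist x y<=min dl 1 * r-->c3/measure mu (ball x r)<=p (Ps r) x y" using lower[OF pos[OF r]] unfolding inv[OF r]
  proof eventually_elim
   case (elim x)
   then show ?case
   proof eventually_elim
   case (elim y)
   have "min dl 1 * r<=dl * r" using r by (intro mult_right_mono) auto
   then show ?case using elim by auto
   qed
  qed
 next
  fix \<sigma> r :: real assume s:"0<\<sigma>" "0<r" "Ps \<sigma><=Ps r"
  show "\<sigma><=C * r"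
  proof (cases "\<sigma><=r")
   case True
   have "r<=C * r" using b(3) s(2) mult_right_mono[of 1 C r] by simp
   then show ?thesis using True by simp
  next
   case False
   have "\<sigma>/r=(\<sigma>/r) powr 1" using s by simp
   also have "...<=(\<sigma>/r) powr be1" using False s b by (intro powr_mono) auto
   also have "...<=C * (Ps \<sigma>/Ps r)" using False s by (intro lo) auto
   also have "...<=C * 1" using b(3) s pos[OF s(2)] by (intro mult_left_mono) auto
   finally show ?thesis using s by (simp add:divide_le_eq)
  qed
 next
  fix kp r :: real assume k:"0<kp" "kp<=1" "0<r"
  have kr:"0<kp * r" "kp * r<=r" using k by (auto simp:mult_left_le_one_le)
  have "1/kp=(1/kp) powr 1" using k by simp
  also have "...<=(1/kp) powr be1" using k b by (intro powr_mono) auto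
  also have "1/kp=r/(kp * r)" using k by simp
  also have "(r/(kp * r)) powr be1<=C * (Ps r/Ps (kp * r))" by (rule lo[OF kr])
  finally have "1/kp<=C * (Ps r/Ps (kp * r))" using k by simp
  moreover have "x<=C * kp * y" if "1/kp<=C * (y/x)" "x>0" for x y :: real using that k by (simp add:field_simps)
  ultimately show "Ps (kp * r)<=C * kp * Ps r" using pos[OF kr(1)] by blast
 next
  fix kp r :: real assume k:"1<=kp" "0<r"
  have "Ps (kp * r)/Ps r<=C * (kp * r/r) powr be2" using k by (intro up) (auto simp:mult_le_cancel_right1)
  also have "kp * r/r=kp" using k by simp
  also have "C * kp powr be2<=C * kp powr real m" using k b mb by (intro mult_left_mono powr_mono) auto
  also have "kp powr real m=kp ^ m" using k by (intro powr_realpow) auto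
  finally show "Ps (kp * r)<=C * kp ^ m * Ps r" using pos[OF k(2)] by (simp add:divide_le_eq)
 next
  fix ta :: real assume "ta>0"
  then show "\<exists>\<sigma>>0. Ps \<sigma>=ta" by (rule surj)
 qed (use b cs in auto)
 then have "hke_space mu E F P p dq Ps C (C1 * exp c1) (c1 * c2) c3 (min dl 1) C m" by (intro hke_space.intro hks dq)
 then show ?thesis by blast
qed

section \<open>The rank of the energy matrix\<close>

lemma quad_add_right:"quad n H w (%i. v i + v' i)=quad n H w v + quad n H w v'" by (simp add:quad_def algebra_simps sum.distrib)

lemma quad_cmult_right:"quad n H w (%i. a * v i)=a * quad n H w v" by (simp add:quad_def algebra_simps sum_distrib_left)

lemma quad_sum_right:"finite I==>quad n H w (%i. SUM a:I. c a * v a i)=(SUM a:I. c a * quad n H w (v a))"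
proof (induction I rule: finite_induct)
 case empty
 then show ?case by (simp add:quad_def)
next
 case (insert x I)
 then show ?case using quad_add_right[of n H w "%i. c x * v x i" "%i. SUM a:I. c a * v a i"] by (simp add:quad_cmult_right)
qed

text \<open>The error is at most the square of the sum of the \<open>|c a|\<close> over
  \<open>2 (k+1)\<close>, hence at most 1/2 by Cauchy-Schwarz. The form therefore lies between 1/2
  and 3/2, the source of the comparability factor 3.\<close>

lemma near_orthonormal_quad:
 assumes near:"!!a b. a<=k==>b<=k==>\<bar>quad n H (l a) (l b)-(if a=b then 1 else 0)\<bar><1/(2*(real k+1))"
  and c:"unitc (Suc k) c"
 shows "\<bar>quad n H (%i. \<Sum>a<Suc k. c a * l a i) (%i. \<Sum>a<Suc k. c a * l a i)-1\<bar><=1/2"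
proof -
 define I where "I={..<Suc k}"
 define e where "e=1/(2*(real k+1))"
 define B where "B a b=quad n H (l a) (l b)" for a b
 have I:"finite I" by (simp add:I_def)
 have c2:"(SUM a:I. (c a)^2)=1" using c by (simp add:unitc_def I_def)
 have q:"quad n H (%i. SUM a:I. c a * l a i) (%i. SUM a:I. c a * l a i)=(SUM a:I. SUM b:I. c a * c b * B a b)"
  by (simp add:quad_sum_left[OF I] quad_sum_right[OF I] B_def sum_distrib_left mult.assoc)
 have one:"(SUM a:I. SUM b:I. c a * c b * (if a=b then 1 else 0))=1"
 proof -
  have "(SUM b:I. c a * c b * (if a=b then 1 else 0))=(c a)^2" if "a:I" for a
  proof -
   have "(SUM b:I. c a * c b * (if a=b then 1 else 0))=(SUM b:I. if b=a then (c a)\<^sup>2 else 0)" by (intro sum.cong) (auto simp:power2_eq_square)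
   then show ?thesis using that I by simp
  qed
  then show ?thesis using c2 by simp
 qed
 have "quad n H (%i. SUM a:I. c a * l a i) (%i. SUM a:I. c a * l a i)-1
  = (SUM a:I. SUM b:I. c a * c b * B a b)-(SUM a:I. SUM b:I. c a * c b * (if a=b then 1 else 0))"
  by (simp only: q one)
 also have "...=(SUM a:I. SUM b:I. c a * c b * (B a b-(if a=b then 1 else 0)))" by (simp only: right_diff_distrib sum_subtractf)
 finally have eq:"quad n H (%i. SUM a:I. c a * l a i) (%i. SUM a:I. c a * l a i)-1
  = (SUM a:I. SUM b:I. c a * c b * (B a b-(if a=b then 1 else 0)))" .
 have "\<bar>SUM a:I. SUM b:I. c a * c b * (B a b-(if a=b then 1 else 0))\<bar><=(SUM a:I. SUM b:I. \<bar>c a\<bar> * \<bar>c b\<bar> * e)"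
 proof (rule order_trans[OF sum_abs], intro sum_mono order_trans[OF sum_abs])
  fix a b assume "a:I" "b:I"
  then have "\<bar>B a b-(if a=b then 1 else 0)\<bar><=e" using near[of a b] by (auto simp:I_def B_def e_def less_Suc_eq_le intro: less_imp_le)
  then show "\<bar>c a * c b * (B a b-(if a=b then 1 else 0))\<bar><=\<bar>c a\<bar> * \<bar>c b\<bar> * e"
   unfolding abs_mult by (intro mult_left_mono) auto
 qed
 also have "...=e * (SUM a:I. \<bar>c a\<bar> * 1)^2" by (simp add:power2_eq_square sum_product sum_distrib_left mult_ac)
 also have "...<=e * ((SUM a:I. \<bar>c a\<bar>\<^sup>2)*(SUM a:I. 1^2))" by (intro mult_left_mono Cauchy_Schwarz_ineq_sum) (simp add:e_def)
 also have "...=1/2" using c2 by (simp add:e_def I_def)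
 finally show ?thesis unfolding eq[unfolded I_def] I_def .
qed

context hk_space
begin

lemma egB_lincomb_left:
 assumes u:"!!i. i<n==>u i:F" and g:"g:F" and A:"A:sets borel"
 shows "egB (lcf n c u) g A=(\<Sum>i<n. c i * egB (u i) g A)" using u
proof (induction n)
 case 0
 have "egB (%x. 0 * g x+0 * g x) g A=0 * egB g g A+0 * egB g g A" by (rule egB_lin_left[OF g g g A])
 then show ?case by (simp add:lcf_def)
next
 case (Suc n)
 have "egB (%x. 1 * lcf n c u x + c n * u n x) g A=1 * egB (lcf n c u) g A + c n * egB (u n) g A"
  using Suc.prems by (intro egB_lin_left lcf_F g A) auto
 then show ?case unfolding lcf_Suc using Suc by simp
qed

lemma eg_lincomb_quad:
 assumes u:"!!i. i<n==>u i:F" and A:"A:sets borel"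
 shows "eg (lcf n c u) A=quad n (%i j. egB (u i) (u j) A) c c"
proof -
 have L:"lcf n c u:F" by (rule lcf_F[OF u])
 have "eg (lcf n c u) A=(\<Sum>i<n. c i * egB (u i) (lcf n c u) A)" unfolding egB_self[OF L A, symmetric] by (rule egB_lincomb_left[OF u L A])
 also have "...=(\<Sum>i<n. c i * (\<Sum>j<n. c j * egB (u j) (u i) A))"
  using u by (intro sum.cong refl) (simp add:egB_sym[OF _ L A] egB_lincomb_left[OF u _ A])
 also have "...=quad n (%i j. egB (u i) (u j) A) c c"
  unfolding quad_def sum_distrib_left using u A by (intro sum.cong refl) (simp add:egB_sym[of "u _" "u _"] mult_ac)
 finally show ?thesis .
qed

text \<open>The density is chosen by \<open>SOME\<close>; a quarter of the difference of the two
  Radon-Nikodym densities in the polarization shows that there is something to choose.\<close>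

lemma energy_density_props:
 assumes f:"f:F" and g:"g:F" and dom:"energy_dominant E F nu"
 shows "energy_density E F nu f g:borel_measurable borel" "integrable nu (energy_density E F nu f g)"
  "A:sets borel==>egB f g A=(\<integral>x. ind A x * energy_density E F nu f g x \<partial>nu)"
proof -
 have nu:"sets nu=sets borel" "sigma_finite_measure nu" and ac:"!!f. f:F==>absolutely_continuous nu (energy_measure E F f)"
  using dom by (auto simp:energy_dominant_def)
 have mb:"borel_measurable nu=(borel_measurable borel :: ('a=>real) set)" by (intro measurable_cong_sets nu) simp
 have ex:"EX D. D:borel_measurable borel&integrable nu D&(ALL A:sets borel. eg f A=(\<integral>x. ind A x * D x \<partial>nu))" if f:"f:F" for f
 proof -
  have s:"sets (energy_measure E F f)=sets nu" using energy_measure_eq(1)[OF f] nu(1) by simp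
  from RN_real[OF nu(2) energy_measure_eq(2)[OF f] ac[OF f] s] show ?thesis by (simp add:mb nu(1) energy_measure_eq[OF f])
 qed
 have fg:"(%x. f x + g x):F" "(%x. f x - g x):F" using domain_add F_diff f g by auto
 obtain D1 where D1:"D1:borel_measurable borel" "integrable nu D1" "!!A. A:sets borel==>eg (%x. f x + g x) A=(\<integral>x. ind A x * D1 x \<partial>nu)"
  using ex[OF fg(1)] by auto
 obtain D2 where D2:"D2:borel_measurable borel" "integrable nu D2" "!!A. A:sets borel==>eg (%x. f x - g x) A=(\<integral>x. ind A x * D2 x \<partial>nu)"
  using ex[OF fg(2)] by auto
 define P where "P h \<longleftrightarrow> h:borel_measurable borel&integrable nu h \<and>
   (ALL A:sets borel. mutual_energy_measure E F f g A=(LINT x:A|nu. h x))" for h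
 have "P (%x. (D1 x - D2 x)/4)" unfolding P_def
 proof (intro conjI ballI)
  show "(%x. (D1 x - D2 x)/4):borel_measurable borel" using D1 D2 by measurable
  show "integrable nu (%x. (D1 x - D2 x)/4)" using D1 D2 by simp
  fix A :: "'a set" assume A:"A:sets borel"
  have i:"integrable nu (%x. ind A x * D x)" if "integrable nu D" for D :: "'a=>real"
   using integrable_real_mult_indicator[of A nu D] A that nu(1) by (simp add:mult.commute)
  have "mutual_energy_measure E F f g A=((\<integral>x. ind A x * D1 x \<partial>nu)-(\<integral>x. ind A x * D2 x \<partial>nu))/4"
   by (simp add:mutual_energy_eq[OF f g A] egB_def D1(3)[OF A] D2(3)[OF A])
  also have "...=(\<integral>x. (ind A x * D1 x - ind A x * D2 x)/4 \<partial>nu)" using i[OF D1(2)] i[OF D2(2)] by simp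
  finally show "mutual_energy_measure E F f g A=(LINT x:A|nu. (D1 x - D2 x)/4)" by (simp add:set_lebesgue_integral_def right_diff_distrib)
 qed
 then have "P (energy_density E F nu f g)" unfolding energy_density_def P_def[symmetric] by (rule someI[of P])
 then show "energy_density E F nu f g:borel_measurable borel" "integrable nu (energy_density E F nu f g)"
  "A:sets borel==>egB f g A=(\<integral>x. ind A x * energy_density E F nu f g x \<partial>nu)"
  by (simp_all add: P_def mutual_energy_eq[OF f g, symmetric] set_lebesgue_integral_def)
qed

end

context hke_space
begin

text \<open>For each rational frame, unit combinations have comparable energies on the Borel set
  where the frame is nearly orthonormal for the energy matrix, so this set is null. There are
  countably many frames, and a rank above \<open>K0\<close> would make one of them nearly
  orthonormal.\<close>

lemma martingale_dimension_finite:
 assumes dom:"energy_dominant E F nu"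
 shows "martingale_dimension E F nu<\<infinity>"
proof -
 have nu:"sets nu=sets borel" using dom by (simp add:energy_dominant_def)
 have mb:"borel_measurable nu=(borel_measurable borel :: ('a=>real) set)" by (intro measurable_cong_sets nu) simp
 show ?thesis
 proof (rule energy_zero_of_comparable)
  fix K0 :: nat
  assume key:"!!n g A. n>K0==>(!!a. a<n==>g a:F)==>A:sets borel ==>
   (!!c c' S. unitc n c==>unitc n c'==>S:sets borel==>S \<subseteq> A ==>
   eg (lcf n c g) S<=3 * eg (lcf n c' g) S)==>eg (g 0) A=0"
  have bound:"esssup nu (%x. of_nat (vec_space.rank n (energy_matrix E F nu n f x)) :: ennreal)<=ennreal_of_enat (enat K0)"
   if f:"ALL i<n. f i:F" for n and f :: "nat => 'a=>real"
  proof -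
   define H where "H x i j=energy_density E F nu (f i) (f j) x" for x i j
   have em:"energy_matrix E F nu n f x=mt n (H x)" for x by (simp add:energy_matrix_def H_def)
   have Hm:"(%x. H x i j):borel_measurable nu" and Hi:"integrable nu (%x. H x i j)"
   and HB:"!!A. A:sets borel==>egB (f i) (f j) A=(\<integral>x. ind A x * H x i j \<partial>nu)"
   if "i<n" "j<n" for i j
   using energy_density_props[of "f i" "f j" nu] dom f that by (simp_all add: H_def mb)
   have Hi': "integrable nu (%x. ind A x * H x i j)" if "i<n" "j<n" "A:sets borel" for i j A
   using integrable_real_mult_indicator[of A nu "%x. H x i j"] Hi[OF that(1,2)] that(3) nu by (simp add:mult.commute)
   have qi:"integrable nu (%x. quad n (H x) v w)" for v w
   unfolding quad_def using Hi by (intro Bochner_Integration.integrable_sum integrable_mult_left) auto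
   have qi': "integrable nu (%x. ind A x * quad n (H x) v w)" if "A:sets borel" for v w A
   using integrable_real_mult_indicator[of A nu "%x. quad n (H x) v w"] qi that nu by (simp add:mult.commute)
   have egq:"eg (lcf n v f) A=(\<integral>x. ind A x * quad n (H x) v v \<partial>nu)" if A:"A:sets borel" for v A
   proof -
   have "(\<integral>x. ind A x * quad n (H x) v v \<partial>nu)=(\<integral>x. (\<Sum>i<n. \<Sum>j<n. ind A x * H x i j * v i * v j) \<partial>nu)"
   by (simp add:quad_def sum_distrib_left mult.assoc)
   also have "...=(\<Sum>i<n. \<Sum>j<n. (\<integral>x. ind A x * H x i j * v i * v j \<partial>nu))"
   proof -
   have i:"integrable nu (%x. ind A x * H x i j * v i * v j)" if "i:{..<n}" "j:{..<n}" for i j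
   using that A by (intro integrable_mult_left Hi') auto
   have "(\<integral>x. (\<Sum>i<n. \<Sum>j<n. ind A x * H x i j * v i * v j) \<partial>nu)=(\<Sum>i<n. \<integral>x. (\<Sum>j<n. ind A x * H x i j * v i * v j) \<partial>nu)"
   by (intro Bochner_Integration.integral_sum Bochner_Integration.integrable_sum i)
   also have "...=(\<Sum>i<n. \<Sum>j<n. (\<integral>x. ind A x * H x i j * v i * v j \<partial>nu))"
   by (intro sum.cong refl Bochner_Integration.integral_sum i)
   finally show ?thesis .
   qed
   also have "...=quad n (%i j. egB (f i) (f j) A) v v" unfolding quad_def using HB A by (intro sum.cong refl) simp
   also have "...=eg (lcf n v f) A" using f A by (intro eg_lincomb_quad[symmetric]) auto
   finally show ?thesis by simp
   qed
   have psd:"AE x in nu. quad n (H x) v v>=0" for v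
   proof (rule AE_nonneg_of_integrals[OF qi])
   fix A assume "A:sets nu"
   then have A:"A:sets borel" using nu by simp
   have "eg (lcf n v f) A>=0" using f by (intro eg_nonneg lcf_F A) auto
   then show "0<=(\<integral>x. ind A x * quad n (H x) v v \<partial>nu)" by (simp only: egq[OF A])
   qed
   have sym1:"AE x in nu. H x j i<=H x i j" if ij:"i<n" "j<n" for i j
   proof -
   have "AE x in nu. 0<=H x i j - H x j i"
   proof (rule AE_nonneg_of_integrals)
   show "integrable nu (%x. H x i j - H x j i)" using Hi ij by simp
   fix A assume "A:sets nu"
   then have A:"A:sets borel" using nu by simp
   have "(\<integral>x. ind A x * (H x i j - H x j i) \<partial>nu)=(\<integral>x. ind A x * H x i j \<partial>nu)-(\<integral>x. ind A x * H x j i \<partial>nu)"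
   using Hi' ij A by (simp add:right_diff_distrib)
   also have "...=egB (f i) (f j) A - egB (f j) (f i) A" using HB ij A by simp
   also have "...=0" using egB_sym[of "f i" "f j" A] f ij A by simp
   finally show "0<=(\<integral>x. ind A x * (H x i j - H x j i) \<partial>nu)" by simp
   qed
   then show ?thesis by simp
   qed
   have "AE x in nu. ALL i:{..<n}. ALL j:{..<n}. H x j i<=H x i j" using sym1 by (intro AE_finite_allI) auto
   \<comment> \<open>Frames with a single vector serve as the rational vectors.\<close>
   moreover have "AE x in nu. ALL l:rat_frames 0 n. quad n (H x) (l 0) (l 0)>=0"
   using psd by (intro AE_ball_countable') (auto simp:countable_rat_frames)
   moreover have "AE x in nu. ALL l:rat_frames K0 n. \<not> (ALL a<=K0. ALL b<=K0. \<bar>quad n (H x) (l a) (l b)-(if a=b then 1 else 0)\<bar><1/(2*(real K0+1)))"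
   proof (rule AE_ball_countable'[OF _ countable_rat_frames])
   fix l assume "l:rat_frames K0 n"
   define Q where "Q x \<longleftrightarrow> (ALL a<=K0. ALL b<=K0. \<bar>quad n (H x) (l a) (l b)-(if a=b then 1 else 0)\<bar><1/(2*(real K0+1)))" for x
   define A where "A={x. Q x}"
   have A:"A:sets borel"
   proof -
   have [measurable]:"(%x. quad n (H x) v w):borel_measurable borel" for v w
   using qi[of v w] unfolding mb[symmetric] by (rule borel_measurable_integrable)
   have gen:"{x. ALL a<=k. ALL b<=k. R a b x}=(\<Inter>a\<in>{..k}. \<Inter>b\<in>{..k}. {x:space borel. R a b x})"
   for k :: nat and R :: "nat=>nat => 'a=>bool" by auto
   have "A=(\<Inter>a\<in>{..K0}. \<Inter>b\<in>{..K0}. {x:space borel. \<bar>quad n (H x) (l a) (l b)-(if a=b then 1 else 0)\<bar><1/(2*(real K0+1))})"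
   unfolding A_def Q_def by (rule gen)
   also have "...:sets borel" by (intro sets.finite_INT) auto
   finally show ?thesis .
   qed
   define g where "g a=lcf n (l a) f" for a
   have gF:"g a:F" for a unfolding g_def using f by (intro lcf_F) auto
   \<comment> \<open>The coefficients, in terms of the original \<open>f i\<close>, of a combination
     of the functions \<open>g a\<close>.\<close>
   define vc where "vc c=(%i. \<Sum>a<Suc K0. c a * l a i)" for c :: "nat=>real"
   have lg:"lcf (Suc K0) c g=lcf n (vc c) f" for c
   proof (rule ext)
   fix x
   have "lcf (Suc K0) c g x=(\<Sum>a<Suc K0. \<Sum>i<n. c a * (l a i * f i x))" by (simp only: lcf_def g_def sum_distrib_left)
   also have "...=(\<Sum>i<n. \<Sum>a<Suc K0. c a * (l a i * f i x))" by (rule sum.swap)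
   also have "...=lcf n (vc c) f x" by (simp only: lcf_def vc_def sum_distrib_right mult.assoc)
   finally show "lcf (Suc K0) c g x=lcf n (vc c) f x" .
   qed
   have near:"\<bar>quad n (H x) (vc c) (vc c)-1\<bar><=1/2" if "x:A" "unitc (Suc K0) c" for x c
   unfolding vc_def using that by (intro near_orthonormal_quad) (auto simp:A_def Q_def)
   have "eg (g 0) A=0"
   proof (rule key[of "Suc K0"])
   fix c c' S assume c:"unitc (Suc K0) c" "unitc (Suc K0) c'" and S:"S:sets borel" "S \<subseteq> A"
   have "(\<integral>x. ind S x * quad n (H x) (vc c) (vc c) \<partial>nu)<=(\<integral>x. 3*(ind S x * quad n (H x) (vc c') (vc c')) \<partial>nu)"
   proof (rule integral_mono)
   show "integrable nu (%x. ind S x * quad n (H x) (vc c) (vc c))" by (rule qi'[OF S(1)])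
   show "integrable nu (%x. 3*(ind S x * quad n (H x) (vc c') (vc c')))" by (intro integrable_mult_right qi' S)
   show "ind S x * quad n (H x) (vc c) (vc c)<=3*(ind S x * quad n (H x) (vc c') (vc c'))" for x
   proof (cases "x:S")
   case True
   then have x:"x:A" using S(2) by blast
   have "quad n (H x) (vc c) (vc c)<=3 * quad n (H x) (vc c') (vc c')" using near[OF x c(1)] near[OF x c(2)] by linarith
   then show ?thesis using True by simp
   qed simp
   qed
   then show "eg (lcf (Suc K0) c g) S<=3 * eg (lcf (Suc K0) c' g) S" unfolding lg egq[OF S(1)] by simp
   qed (use gF A in auto)
   moreover have "eg (g 0) A=(\<integral>x. ind A x * quad n (H x) (l 0) (l 0) \<partial>nu)" unfolding g_def by (rule egq[OF A])
   ultimately have z:"(\<integral>x. ind A x * quad n (H x) (l 0) (l 0) \<partial>nu)=0" by simp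
   have half:"quad n (H x) (l 0) (l 0)>0" if "x:A" for x
   proof -
   have "Q x" using that by (simp only: A_def mem_Collect_eq)
   then have "\<bar>quad n (H x) (l 0) (l 0)-(if (0::nat)=0 then 1 else 0)\<bar><1/(2*(real K0+1))" unfolding Q_def by blast
   then have "\<bar>quad n (H x) (l 0) (l 0)-1\<bar><1/(2*(real K0+1))" by (simp only: simp_thms if_True)
   moreover have "1/(2*(real K0+1))<=1" by simp
   ultimately show ?thesis by linarith
   qed
   \<comment> \<open>The integrand is positive on \<open>A\<close> by \<open>half\<close>, so its
     vanishing integral makes \<open>A\<close> null.\<close>
   have "AE x in nu. ind A x * quad n (H x) (l 0) (l 0)=0"
   proof (rule integral_nonneg_eq_0_iff_AE[THEN iffD1, OF qi'[OF A] _ z])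
   show "AE x in nu. 0<=ind A x * quad n (H x) (l 0) (l 0)" using half by (intro AE_I2) (auto simp:indicator_def less_imp_le)
   qed
   then have "AE x in nu. \<not> Q x"
   proof eventually_elim
   case (elim x)
   then show ?case using half[of x] by (auto simp:A_def indicator_def split: if_splits)
   qed
   then show "AE x in nu. \<not> (ALL a<=K0. ALL b<=K0. \<bar>quad n (H x) (l a) (l b)-(if a=b then 1 else 0)\<bar><1/(2*(real K0+1)))"
   unfolding Q_def .
   qed
   ultimately have "AE x in nu. vec_space.rank n (mt n (H x))<=K0"
   proof eventually_elim
   case (elim x)
   have sym:"H x i j=H x j i" if "i<n" "j<n" for i j using elim(1) that by (auto intro: antisym)
   \<comment> \<open>A negative value would persist at a nearby rational vector.\<close>
   have nn:"quad n (H x) v v>=0" for v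
   proof (rule ccontr)
   assume "\<not> ?thesis"
   then have "- quad n (H x) v v>0" by simp
   from rat_frames_approx[OF this, of 0 n "H x" "%_. v"] obtain l where
   l:"l:rat_frames 0 n" "\<bar>quad n (H x) (l 0) (l 0) - quad n (H x) v v\<bar> < - quad n (H x) v v" by auto
   then show False using elim(2) by auto
   qed
   show ?case
   proof (rule ccontr)
   assume "\<not> ?thesis"
   then have r:"vec_space.rank n (mt n (H x))>K0" by simp
   have "EX l:rat_frames K0 n. ALL a<=K0. ALL b<=K0. \<bar>quad n (H x) (l a) (l b)-(if a=b then 1 else 0)\<bar><1/(2*(real K0+1))"
   by (rule rational_orthonormal[OF sym nn psd_kernel[OF sym nn] r]) auto
   then show False using elim(3) by blast
   qed
   qed
   then have ae:"AE x in nu. of_nat (vec_space.rank n (mt n (H x)))<=(of_nat K0 :: ennreal)" by eventually_elim (simp only: of_nat_mono)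
   have "(%x. of_nat (vec_space.rank n (mt n (H x))) :: ennreal):borel_measurable nu" using Hm by (intro rank_measurable) auto
   from esssup_I[OF this ae] show ?thesis unfolding em by simp
  qed
  have "martingale_dimension E F nu<=enat K0" unfolding martingale_dimension_def by (rule Least_le) (use bound in blast)
  then show "martingale_dimension E F nu<\<infinity>" by (rule le_less_trans) simp
 qed
qed

end

theorem theorem5p7:
  fixes \<mu> :: "'a::polish_space measure"
   and E :: "('a \<Rightarrow> real) \<Rightarrow> ('a \<Rightarrow> real) \<Rightarrow> real"
   and F :: "('a \<Rightarrow> real) set"
   and \<Psi> :: "real \<Rightarrow> real"
   and \<nu> :: "'a measure"
  assumes "MMD_space \<mu> E F"
   and "doubling_measure \<mu>"
   and "scale_function \<Psi>"
   and "HKE \<mu> E F \<Psi>"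
   and "minimal_energy_dominant E F \<nu>"
  shows "martingale_dimension E F \<nu> < \<infinity>"
proof -
 from hke_space_exists[OF assms(1-4)]
 obtain P p dq Cs A a c \<delta> C0 m where hke:"hke_space \<mu> E F P p dq \<Psi> Cs A a c \<delta> C0 m" by (elim exE) (rule that)
 have "energy_dominant E F \<nu>" using assms(5) by (simp add:minimal_energy_dominant_def)
 then show ?thesis by (rule hke_space.martingale_dimension_finite[OF hke])
qed

end
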